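(* Let $d=2$, let $\omega\ge 0$, and let $L_\omega$ be the self-adjoint operator $\Delta_{S^2}+\omega^2r^2$ on $H=L^2(S^2,dV_{S^2};\mathbb R)$ defined in the context. (a) The ground state of $L_\omega$ is $(1+r^2)^{-\omega}$, with corresponding eigenvalue $\omega$. (b) The spectrum of $L_\omega$ consists of the eigenvalues $$\lambda_{m,n}=\Big(m+\tfrac12\big(n+1+\sqrt{n^2+4\omega^2}\big)\Big)^2-\omega^2-\tfrac14,\qquad m,n\in\{0,1,2,\dots\},$$ where the pair $(m,n)$ contributes multiplicity $\mathbf m(m,n)=1$ if $n=0$ and $\mathbf m(m,n)=2$ if $n>0$. (The values $\lambda_{m,n}$ need not be distinct; the multiplicity of a number $\lambda$ as an eigenvalue is the sum of $\mathbf m(m,n)$ over all pairs $(m,n)$ with $\lambda_{m,n}=\lambda$.) The eigenfunctions corresponding to the pair $(m,n)$ are, with $\lambda=\lambda_{m,n}$, of the form $$\frac{r^n}{(1+r^2)^{(\sqrt{4\omega^2+4\lambda+1}-1)/2}}\;F\big(-m-\sqrt{4\omega^2+n^2},\,-m,\,n+1,\,-r^2\big)\,f(\theta),$$ where $F(a,b,c,z)$ is the Gauss hypergeometric function ${}_2F_1(a,b;c;z)$ (here an even polynomial of degree $2m$ in $r$) and $f(\theta)$ is a linear combination of $\cos(n\theta)$ and $\sin(n\theta)$. (c) If $\omega=0$, then the spectrum is $\{N(N+1): N=0,1,2,\dots\}$, where $N(N+1)$ has multiplicity $2N+1$.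
   Context: Identify the sphere $S^2$ minus a point with $\mathbb R^2$ by stereographic projection $(x_1,x_2,y)\mapsto x=(x_1,x_2)/(1-y)$, and let $(r,\theta)$ be polar coordinates of $x$, so $r=|x|$. In these coordinates the round metric is $\frac{4}{(1+r^2)^2}$ times the Euclidean metric and the area form is $dV_{S^2}=\frac{4r}{(1+r^2)^2}\,dr\,d\theta$. Let $\Delta_{S^2}$ be the nonnegative Laplace–Beltrami operator of the round metric, which in these coordinates is $-\frac14(1+r^2)^2\big(\partial_r^2+\frac1r\partial_r+\frac1{r^2}\partial_\theta^2\big)$. The operator $L_\omega=\Delta_{S^2}+\omega^2r^2$ is realized as a self-adjoint operator as follows. Let $H=L^2(S^2,dV_{S^2};\mathbb R)$ and $$Q_\omega(f,g)=\int_{S^2}\big(df\wedge *dg+\omega^2r^2fg\,dV_{S^2}\big),$$ where $*$ is the Hodge star of the round metric, defined for $f,g$ in the dense subspace $E\subset H$ of functions $f$ on $S^2$ (with weak differential $df$) for which $Q_\omega(f,f)<\infty$. Then $D(L_\omega)$ is the set of $g\in E$ for which $f\mapsto Q_\omega(f,g)$ is continuous on $E$ in the norm of $H$, and $L_\omega g$ is determined by $Q_\omega(f,g)=\langle f,L_\omega g\rangle_H$ for all $f\in E$. The ground state is the eigenfunction (up to a scalar) for the smallest eigenvalue. *)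

theory Defs
  imports "HOL-Analysis.Analysis"
begin

subsection \<open>The sphere and its stereographic coordinates\<close>

type_synonym plane = "real \<times> real"

text \<open>A point \<open>(x, y) \<in> \<real>\<^sup>2 \<times> \<real>\<close> stands for \<open>(x\<^sub>1, x\<^sub>2, y)\<close>; the product norm is the Euclidean one.\<close>

type_synonym space3 = "plane \<times> real"

definition S2 :: "space3 set" where
  "S2 = sphere 0 1"

text \<open>At the pole \<open>y = 1\<close>, a null set for the area measure below, the quotient is \<open>0\<close> by the
  convention for division by zero.\<close>

definition stereo :: "space3 \<Rightarrow> plane" where
  "stereo p = fst p /\<^sub>R (1 - snd p)"

definition inv_stereo :: "plane \<Rightarrow> space3" where
  "inv_stereo x = ((2 / (1 + (norm x)\<^sup>2)) *\<^sub>R x, ((norm x)\<^sup>2 - 1) / (1 + (norm x)\<^sup>2))"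

text \<open>The inverse of stereographic projection from the opposite pole, \<open>(x, y) \<mapsto> x / (1 + y)\<close>.
  The ranges of the two parametrizations cover the sphere.\<close>

definition inv_stereo' :: "plane \<Rightarrow> space3" where
  "inv_stereo' x = ((2 / (1 + (norm x)\<^sup>2)) *\<^sub>R x, (1 - (norm x)\<^sup>2) / (1 + (norm x)\<^sup>2))"

lemma inv_stereo_in_S2: "inv_stereo x \<in> S2" "inv_stereo' x \<in> S2"
proof -
  have n: "1 + (norm x)\<^sup>2 > 0"
    by (simp add: add_pos_nonneg)
  have *: "(2 / (1 + t) * s)\<^sup>2 + (\<bar>t - 1\<bar> / (1 + t))\<^sup>2 = 1" if "t = s\<^sup>2" "1 + t > 0" for s t :: real
  proof -
    have "(2 / (1 + t) * s)\<^sup>2 + (\<bar>t - 1\<bar> / (1 + t))\<^sup>2 = (4 * t + (t - 1)\<^sup>2) / (1 + t)\<^sup>2"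
      by (simp add: that(1) power_mult_distrib power_divide add_divide_distrib)
    also have "4 * t + (t - 1)\<^sup>2 = (1 + t)\<^sup>2"
      by (simp add: power2_eq_square algebra_simps)
    finally show ?thesis using that(2) by simp
  qed
  show "inv_stereo x \<in> S2"
    using *[OF refl n] n by (simp add: S2_def inv_stereo_def norm_Pair)
  show "inv_stereo' x \<in> S2"
    using *[OF refl n] n by (simp add: S2_def inv_stereo'_def norm_Pair abs_minus_commute)
qed

definition rad :: "space3 \<Rightarrow> real" where
  "rad p = norm (stereo p)"

definition ang :: "space3 \<Rightarrow> real" where
  "ang p = Arg (Complex (fst (stereo p)) (snd (stereo p)))"

text \<open>The factor \<open>4 / (1 + r\<^sup>2)\<^sup>2\<close> by which the round metric differs from the Euclidean one;
  it is also the density of the area form with respect to \<open>dx\<^sub>1 dx\<^sub>2 = r dr d\<theta>\<close>.\<close>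

definition conf :: "plane \<Rightarrow> real" where
  "conf x = 4 / (1 + (norm x)\<^sup>2)\<^sup>2"

definition dV :: "space3 measure" where
  "dV = distr (density lborel (\<lambda>x. ennreal (conf x))) (restrict_space borel S2) inv_stereo"

lemma measurable_inv_stereo: "inv_stereo \<in> borel \<rightarrow>\<^sub>M restrict_space borel S2"
proof (rule measurable_restrict_space2)
  show "inv_stereo \<in> space borel \<rightarrow> S2"
    by (simp add: inv_stereo_in_S2)
  have "1 + (norm x)\<^sup>2 \<noteq> 0" for x :: plane
    by (metis add_pos_nonneg less_irrefl zero_le_power2 zero_less_one)
  then show "inv_stereo \<in> borel_measurable borel"
    unfolding inv_stereo_def
    by (intro borel_measurable_continuous_onI continuous_intros) auto
qed


subsection \<open>The real Hilbert space \<open>L\<^sup>2(S\<^sup>2)\<close>\<close>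

definition square_integrable :: "(space3 \<Rightarrow> real) \<Rightarrow> bool" where
  "square_integrable f \<longleftrightarrow> f \<in> borel_measurable dV \<and> integrable dV (\<lambda>p. (f p)\<^sup>2)"

lemma square_integrable_zero: "square_integrable (\<lambda>_. 0)"
  by (simp add: square_integrable_def)

lemma square_integrable_mult:
  assumes "square_integrable f" "square_integrable g"
  shows "integrable dV (\<lambda>p. f p * g p)"
proof (rule Bochner_Integration.integrable_bound)
  show "integrable dV (\<lambda>p. (f p)\<^sup>2 + (g p)\<^sup>2)"
    using assms by (simp add: square_integrable_def)
  show "(\<lambda>p. f p * g p) \<in> borel_measurable dV"
    using assms by (auto simp: square_integrable_def intro: borel_measurable_times)
  have "\<bar>f p * g p\<bar> \<le> (f p)\<^sup>2 + (g p)\<^sup>2" for p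
  proof -
    have "2 * (\<bar>f p\<bar> * \<bar>g p\<bar>) \<le> (f p)\<^sup>2 + (g p)\<^sup>2"
      using sum_squares_bound[of "\<bar>f p\<bar>" "\<bar>g p\<bar>"] by (simp add: mult.assoc)
    moreover have "0 \<le> \<bar>f p\<bar> * \<bar>g p\<bar>" by simp
    ultimately show ?thesis unfolding abs_mult by linarith
  qed
  then show "AE p in dV. norm (f p * g p) \<le> norm ((f p)\<^sup>2 + (g p)\<^sup>2)"
    by (intro AE_I2) simp
qed

lemma square_integrable_add:
  assumes "square_integrable f" "square_integrable g"
  shows "square_integrable (\<lambda>p. f p + g p)"
  using assms square_integrable_mult[OF assms]
  by (auto simp: square_integrable_def power2_sum mult.assoc intro: borel_measurable_add)

lemma square_integrable_scale:
  assumes "square_integrable f"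
  shows "square_integrable (\<lambda>p. c * f p)"
  using assms by (auto simp: square_integrable_def power_mult_distrib intro: borel_measurable_times)

definition l2_rel :: "(space3 \<Rightarrow> real) \<Rightarrow> (space3 \<Rightarrow> real) \<Rightarrow> bool" where
  "l2_rel f g \<longleftrightarrow> square_integrable f \<and> square_integrable g \<and> (AE p in dV. f p = g p)"

quotient_type L2S2 = "space3 \<Rightarrow> real" / partial: l2_rel
proof (rule part_equivpI)
  show "\<exists>f. l2_rel f f"
    using square_integrable_zero by (auto simp: l2_rel_def)
  show "symp l2_rel"
    by (auto simp: l2_rel_def symp_def elim: AE_mp)
  show "transp l2_rel"
    by (auto simp: l2_rel_def transp_def elim: AE_mp)
qed

text \<open>\<open>class_of f\<close> is the class of \<open>f\<close>, meaningful for square integrable \<open>f\<close> only, and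
  \<open>fun_of u\<close> is an arbitrary representative of the class \<open>u\<close>.\<close>

abbreviation class_of :: "(space3 \<Rightarrow> real) \<Rightarrow> L2S2" where
  "class_of \<equiv> abs_L2S2"

abbreviation fun_of :: "L2S2 \<Rightarrow> space3 \<Rightarrow> real" where
  "fun_of \<equiv> rep_L2S2"

instantiation L2S2 :: real_inner
begin

lift_definition zero_L2S2 :: L2S2 is "\<lambda>_. 0"
  by (simp add: l2_rel_def square_integrable_zero)

lift_definition plus_L2S2 :: "L2S2 \<Rightarrow> L2S2 \<Rightarrow> L2S2" is "\<lambda>f g p. f p + g p"
  by (auto simp: l2_rel_def square_integrable_add elim: AE_mp)

lift_definition scaleR_L2S2 :: "real \<Rightarrow> L2S2 \<Rightarrow> L2S2" is "\<lambda>c f p. c * f p"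
  by (auto simp: l2_rel_def square_integrable_scale elim: AE_mp)

lift_definition uminus_L2S2 :: "L2S2 \<Rightarrow> L2S2" is "\<lambda>f p. - f p"
  using square_integrable_scale[of _ "-1"] by (auto simp: l2_rel_def elim: AE_mp)

definition minus_L2S2 :: "L2S2 \<Rightarrow> L2S2 \<Rightarrow> L2S2" where
  "minus_L2S2 u v = u + - v"

lift_definition inner_L2S2 :: "L2S2 \<Rightarrow> L2S2 \<Rightarrow> real" is "\<lambda>f g. \<integral>p. f p * g p \<partial>dV"
  by (rule integral_cong_AE)
    (auto simp: l2_rel_def square_integrable_def elim: AE_mp)

definition norm_L2S2 :: "L2S2 \<Rightarrow> real" where
  "norm_L2S2 u = sqrt (inner u u)"

definition dist_L2S2 :: "L2S2 \<Rightarrow> L2S2 \<Rightarrow> real" where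
  "dist_L2S2 u v = norm (u - v)"

definition sgn_L2S2 :: "L2S2 \<Rightarrow> L2S2" where
  "sgn_L2S2 u = scaleR (inverse (norm u)) u"

definition uniformity_L2S2 :: "(L2S2 \<times> L2S2) filter" where
  "uniformity_L2S2 = (INF e\<in>{0<..}. principal {(u, v). dist u v < e})"

definition open_L2S2 :: "L2S2 set \<Rightarrow> bool" where
  "open_L2S2 U \<longleftrightarrow> (\<forall>u\<in>U. \<forall>\<^sub>F (u', v) in uniformity. u' = u \<longrightarrow> v \<in> U)"

instance
proof
  fix u v w :: L2S2 and a b :: real
  show "u + v + w = u + (v + w)"
    by transfer (auto simp: l2_rel_def square_integrable_add add.assoc)
  show "u + v = v + u"
    by transfer (auto simp: l2_rel_def square_integrable_add add.commute)
  show "0 + u = u"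
    by transfer (auto simp: l2_rel_def)
  show "- u + u = 0"
    by transfer (auto simp: l2_rel_def square_integrable_zero)
  show "u - v = u + - v"
    by (rule minus_L2S2_def)
  show "a *\<^sub>R (u + v) = a *\<^sub>R u + a *\<^sub>R v"
    by transfer (auto simp: l2_rel_def distrib_left intro!: square_integrable_add square_integrable_scale)
  show "(a + b) *\<^sub>R u = a *\<^sub>R u + b *\<^sub>R u"
    by transfer (auto simp: l2_rel_def distrib_right intro!: square_integrable_add square_integrable_scale)
  show "a *\<^sub>R b *\<^sub>R u = (a * b) *\<^sub>R u"
    by transfer (auto simp: l2_rel_def mult.assoc square_integrable_scale
        intro: square_integrable_scale[of "\<lambda>p. _ * _ p"])
  show "1 *\<^sub>R u = u"
    by transfer (auto simp: l2_rel_def)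
  show "dist u v = norm (u - v)"
    by (rule dist_L2S2_def)
  show "sgn u = scaleR (inverse (norm u)) u"
    by (rule sgn_L2S2_def)
  show "uniformity = (INF e\<in>{0<..}. principal {(u, v :: L2S2). dist u v < e})"
    by (rule uniformity_L2S2_def)
  show "open U = (\<forall>u\<in>U. \<forall>\<^sub>F (u', v) in uniformity. u' = u \<longrightarrow> v \<in> U)" for U :: "L2S2 set"
    by (rule open_L2S2_def)
  show "inner u v = inner v u"
    by transfer (simp add: mult.commute)
  show "inner (u + v) w = inner u w + inner v w"
    by transfer (simp add: l2_rel_def distrib_right square_integrable_mult)
  show "inner (a *\<^sub>R u) v = a * inner u v"
    by transfer (simp add: mult.assoc)
  show "0 \<le> inner u u"
    by transfer simp
  show "inner u u = 0 \<longleftrightarrow> u = 0"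
    by transfer
      (auto simp: l2_rel_def square_integrable_zero square_integrable_mult
        integral_nonneg_eq_0_iff_AE)
  show "norm u = sqrt (inner u u)"
    by (rule norm_L2S2_def)
qed

end


subsection \<open>Weak differentials\<close>

text \<open>The class \<open>C\<^sup>\<infinity>\<close>: differentiable everywhere, with all partial derivatives again of this class.\<close>

coinductive smooth :: "('a::euclidean_space \<Rightarrow> real) \<Rightarrow> bool" where
  "(\<And>x. \<phi> differentiable at x) \<Longrightarrow>
   (\<And>b. b \<in> Basis \<Longrightarrow> smooth (\<lambda>x. frechet_derivative \<phi> (at x) b)) \<Longrightarrow> smooth \<phi>"

definition test_function :: "('a::euclidean_space \<Rightarrow> real) \<Rightarrow> bool" where
  "test_function \<phi> \<longleftrightarrow> smooth \<phi> \<and> compact (closure {x. \<phi> x \<noteq> 0})"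

definition locally_integrable :: "('a::euclidean_space \<Rightarrow> 'b::euclidean_space) \<Rightarrow> bool" where
  "locally_integrable u \<longleftrightarrow> (\<forall>K. compact K \<longrightarrow> set_integrable lborel K u)"

definition has_weak_gradient ::
  "('a::euclidean_space \<Rightarrow> real) \<Rightarrow> ('a \<Rightarrow> 'a) \<Rightarrow> bool" where
  "has_weak_gradient u G \<longleftrightarrow> locally_integrable u \<and> locally_integrable G \<and>
     (\<forall>\<phi>. test_function \<phi> \<longrightarrow> (\<forall>b\<in>Basis.
        (\<integral>x. u x * frechet_derivative \<phi> (at x) b \<partial>lborel) = - (\<integral>x. (G x \<bullet> b) * \<phi> x \<partial>lborel)))"

text \<open>Weak differentiability on the whole sphere, the pole \<open>r = \<infinity>\<close> included, is weak
  differentiability in both charts of the atlas.\<close>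

definition weakly_differentiable :: "(space3 \<Rightarrow> real) \<Rightarrow> bool" where
  "weakly_differentiable f \<longleftrightarrow>
     (\<exists>G. has_weak_gradient (f \<circ> inv_stereo) G) \<and> (\<exists>G. has_weak_gradient (f \<circ> inv_stereo') G)"

text \<open>The components of \<open>df\<close> with respect to \<open>dx\<^sub>1, dx\<^sub>2\<close>; they are determined almost everywhere,
  and the chart of \<open>stereo\<close> omits a single point.\<close>

definition weak_differential :: "(space3 \<Rightarrow> real) \<Rightarrow> plane \<Rightarrow> plane" where
  "weak_differential f = (SOME G. has_weak_gradient (f \<circ> inv_stereo) G)"


subsection \<open>The form \<open>Q\<^sub>\<omega>\<close> and the operator \<open>L\<^sub>\<omega>\<close>\<close>

text \<open>\<open>\<alpha> \<and> *\<beta> = \<langle>\<alpha>, \<beta>\<rangle> dV\<close>, where \<open>\<langle>\<cdot>, \<cdot>\<rangle>\<close> is the inner product of covectors dual to the round metric,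
  hence the Euclidean one divided by \<open>conf\<close>.\<close>

definition Q_dens :: "real \<Rightarrow> L2S2 \<Rightarrow> L2S2 \<Rightarrow> space3 \<Rightarrow> real" where
  "Q_dens \<omega> f g p =
     (weak_differential (fun_of f) (stereo p) \<bullet> weak_differential (fun_of g) (stereo p))
       / conf (stereo p)
     + \<omega>\<^sup>2 * (rad p)\<^sup>2 * fun_of f p * fun_of g p"

definition Q_form :: "real \<Rightarrow> L2S2 \<Rightarrow> L2S2 \<Rightarrow> real" where
  "Q_form \<omega> f g = (\<integral>p. Q_dens \<omega> f g p \<partial>dV)"

definition E_form :: "real \<Rightarrow> L2S2 set" where
  "E_form \<omega> = {f. weakly_differentiable (fun_of f) \<and> integrable dV (Q_dens \<omega> f f)}"

definition L_dom :: "real \<Rightarrow> L2S2 set" where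
  "L_dom \<omega> = {g \<in> E_form \<omega>. continuous_on (E_form \<omega>) (\<lambda>f. Q_form \<omega> f g)}"

definition L_op :: "real \<Rightarrow> L2S2 \<Rightarrow> L2S2" where
  "L_op \<omega> g = (THE h. \<forall>f\<in>E_form \<omega>. Q_form \<omega> f g = f \<bullet> h)"


subsection \<open>Spectral notions for an operator \<open>A\<close> with domain \<open>D\<close>\<close>

definition resolvent_set :: "'h::real_inner set \<Rightarrow> ('h \<Rightarrow> 'h) \<Rightarrow> real set" where
  "resolvent_set D A = {\<mu>. \<exists>R. bounded_linear R \<and>
     (\<forall>u. R u \<in> D \<and> A (R u) - \<mu> *\<^sub>R R u = u) \<and> (\<forall>u\<in>D. R (A u - \<mu> *\<^sub>R u) = u)}"

definition spectrum :: "'h::real_inner set \<Rightarrow> ('h \<Rightarrow> 'h) \<Rightarrow> real set" where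
  "spectrum D A = - resolvent_set D A"

definition eigenspace :: "'h::real_inner set \<Rightarrow> ('h \<Rightarrow> 'h) \<Rightarrow> real \<Rightarrow> 'h set" where
  "eigenspace D A \<mu> = {u \<in> D. A u = \<mu> *\<^sub>R u}"

definition eigenvalue :: "'h::real_inner set \<Rightarrow> ('h \<Rightarrow> 'h) \<Rightarrow> real \<Rightarrow> bool" where
  "eigenvalue D A \<mu> \<longleftrightarrow> (\<exists>u\<in>eigenspace D A \<mu>. u \<noteq> 0)"

text \<open>For an eigenvalue \<open>\<mu>\<close>, \<open>dim (eigenspace D A \<mu>) = k\<close> with \<open>k > 0\<close> includes finite-dimensionality.\<close>

definition ground_state :: "'h::real_inner set \<Rightarrow> ('h \<Rightarrow> 'h) \<Rightarrow> real \<Rightarrow> 'h \<Rightarrow> bool" where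
  "ground_state D A \<mu> u \<longleftrightarrow> eigenvalue D A \<mu> \<and> (\<forall>\<nu>. eigenvalue D A \<nu> \<longrightarrow> \<mu> \<le> \<nu>) \<and>
     eigenspace D A \<mu> = span {u}"


subsection \<open>Eigenvalues, multiplicities and eigenfunctions\<close>

definition gauss_F :: "real \<Rightarrow> real \<Rightarrow> real \<Rightarrow> real \<Rightarrow> real" where
  "gauss_F a b c z = eval_fps (fps_hypergeo [a, b] [c] 1) z"

definition lam :: "real \<Rightarrow> nat \<Rightarrow> nat \<Rightarrow> real" where
  "lam \<omega> m n = (real m + (real n + 1 + sqrt ((real n)\<^sup>2 + 4 * \<omega>\<^sup>2)) / 2)\<^sup>2 - \<omega>\<^sup>2 - 1 / 4"

definition pair_mult :: "nat \<Rightarrow> nat" where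
  "pair_mult n = (if n = 0 then 1 else 2)"

definition hyp_factor :: "real \<Rightarrow> nat \<Rightarrow> nat \<Rightarrow> real \<Rightarrow> real" where
  "hyp_factor \<omega> m n r =
     gauss_F (- real m - sqrt (4 * \<omega>\<^sup>2 + (real n)\<^sup>2)) (- real m) (real n + 1) (- r\<^sup>2)"

text \<open>The eigenfunction with angular factor \<open>a cos(n\<theta>) + b sin(n\<theta>)\<close>.\<close>

definition eigenfunction :: "real \<Rightarrow> nat \<Rightarrow> nat \<Rightarrow> real \<Rightarrow> real \<Rightarrow> space3 \<Rightarrow> real" where
  "eigenfunction \<omega> m n a b p =
     rad p ^ n / (1 + (rad p)\<^sup>2) powr ((sqrt (4 * \<omega>\<^sup>2 + 4 * lam \<omega> m n + 1) - 1) / 2)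
     * hyp_factor \<omega> m n (rad p)
     * (a * cos (real n * ang p) + b * sin (real n * ang p))"

definition eigenfunctions :: "real \<Rightarrow> nat \<Rightarrow> nat \<Rightarrow> L2S2 set" where
  "eigenfunctions \<omega> m n = {class_of (eigenfunction \<omega> m n a b) | a b. True}"

end

theory Submission
  imports Defs
begin

text \<open>With \<open>t = 1/(1 + r\<^sup>2)\<close>, the operator \<open>L\<^sub>\<omega>\<close> maps \<open>t\<^sup>a q(t) Re (c (x\<^sub>1 + \<i> x\<^sub>2)\<^sup>n)\<close>, where
  \<open>a = (n + \<surd>(n\<^sup>2 + 4\<omega>\<^sup>2))/2\<close>, to a function of the same form whose polynomial factor is obtained from \<open>q\<close> by a
  hypergeometric differential operator. This operator is triangular on polynomials with eigenvalues \<open>\<lambda>\<^sub>m\<^sub>,\<^sub>n\<close>, and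
  its eigenvectors are the hypergeometric polynomials. The identity \<open>Q\<^sub>\<omega>(f, \<psi>) = \<langle>f, L\<^sub>\<omega> \<psi>\<rangle>\<close> for all \<open>f \<in> E\<close> follows by
  cutting off near the pole. Distinct angular modes are orthogonal by rotation, eigenfunctions of one mode because
  their eigenvalues differ, and by Weierstrass's theorem in \<open>t\<close> and the Stone-Weierstrass theorem on the sphere they
  are total. As the form is closed, the operator it defines has the maximal domain, so it is the diagonal
  operator of this orthogonal basis; since only finitely many eigenvalues lie below any bound, they are the whole spectrum.\<close>

section \<open>Smooth functions\<close>

text \<open>The obstacle is the pole r = infinity. In the second chart the eigenfunctions behave
  there like |y|^s times an angular factor, with s = sqrt(n^2 + 4 \<omega>^2), which is in general
  not smooth, so membership in E cannot be read off from derivatives. Two features of dimension two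
  replace smoothness: a point has capacity zero, and the Dirichlet integral is invariant under the
  inversion that joins the charts, so that the gradient part of the form carries no weight in the
  plane. Of a general f in E only the finite energy and the norm in H are known. The boundary term
  of Green's formula is therefore dominated by the average of a square integrable function over
  growing balls, and such averages tend to 0. Self-adjointness is handled in coordinates: g lies in
  the domain exactly when the numbers lambda_k <g, e_k> are square summable. One direction is a
  Riesz representation on finite combinations, the other is the closedness of the form; the
  resolvent divides the coordinates by lambda_k - \<mu>.\<close>

primrec times_diff :: "nat \<Rightarrow> ('a::euclidean_space \<Rightarrow> real) \<Rightarrow> bool" where
  "times_diff 0 f \<longleftrightarrow> True"
| "times_diff (Suc k) f \<longleftrightarrow> (\<forall>x. f differentiable at x) \<and>
     (\<forall>b\<in>Basis. times_diff k (\<lambda>x. frechet_derivative f (at x) b))"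

text \<open>The finite stages exhaust the greatest fixed point. Closure properties can then be
  proved by induction on the order, where plain coinduction fails because the derivative of a
  product is a sum of products and not itself a product.\<close>

lemma times_diff_all_imp_smooth:
  assumes "\<And>k. times_diff k f"
  shows "smooth f"
  using assms
proof (rule smooth.coinduct[of "\<lambda>f. \<forall>k. times_diff k f", OF allI])
  fix f :: "'a \<Rightarrow> real"
  assume all: "\<forall>k. times_diff k f"
  have "f differentiable at x" for x
    using all[rule_format, of "Suc 0"] by simp
  moreover have "times_diff k (\<lambda>x. frechet_derivative f (at x) b)" if "b \<in> Basis" for k b
    using all[rule_format, of "Suc k"] that by simp
  ultimately show "\<exists>\<phi>. f = \<phi> \<and> (\<forall>x. \<phi> differentiable at x) \<and> (\<forall>b. b \<in> Basis \<longrightarrow>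
      (\<forall>k. times_diff k (\<lambda>x. frechet_derivative \<phi> (at x) b)) \<or>
      smooth (\<lambda>x. frechet_derivative \<phi> (at x) b))"
    by blast
qed

lemma smooth_imp_times_diff: "smooth f \<Longrightarrow> times_diff k f"
proof (induction k arbitrary: f)
  case (Suc k)
  then show ?case by (auto elim: smooth.cases)
qed simp

lemma smooth_differentiable: "smooth f \<Longrightarrow> f differentiable at x"
  by (auto elim: smooth.cases)

lemma smooth_partial: "smooth f \<Longrightarrow> b \<in> Basis \<Longrightarrow> smooth (\<lambda>x. frechet_derivative f (at x) b)"
  by (auto elim: smooth.cases)

lemma times_diff_SucI:
  assumes "\<And>x. (f has_derivative f' x) (at x)"
    and "\<And>b. b \<in> Basis \<Longrightarrow> times_diff k (\<lambda>x. f' x b)"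
  shows "times_diff (Suc k) f"
proof -
  have "frechet_derivative f (at x) = f' x" for x
    using frechet_derivative_at[OF assms(1)] by simp
  then show ?thesis using assms by (auto simp: differentiable_def)
qed

lemma times_diff_Suc_has_derivative:
  "times_diff (Suc k) f \<Longrightarrow> (f has_derivative frechet_derivative f (at x)) (at x)"
  using frechet_derivative_works by auto

lemma times_diff_mono: "times_diff (Suc k) f \<Longrightarrow> times_diff k f"
proof (induction k arbitrary: f)
  case (Suc k)
  then show ?case by (metis times_diff.simps(2))
qed simp

lemma times_diff_const: "times_diff k (\<lambda>x. c)"
proof (induction k arbitrary: c)
  case (Suc k)
  show ?case by (rule times_diff_SucI[of _ "\<lambda>x h. 0"]) (auto simp: Suc)
qed simp

lemma times_diff_inner: "times_diff k (\<lambda>x. x \<bullet> v)"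
proof (cases k)
  case (Suc k)
  show ?thesis unfolding Suc
    by (rule times_diff_SucI[of _ "\<lambda>x h. h \<bullet> v"])
      (auto simp: times_diff_const intro!: derivative_eq_intros)
qed simp

lemma times_diff_add: "times_diff k f \<Longrightarrow> times_diff k g \<Longrightarrow> times_diff k (\<lambda>x. f x + g x)"
proof (induction k arbitrary: f g)
  case (Suc k)
  show ?case
    by (rule times_diff_SucI[OF has_derivative_add[OF Suc.prems[THEN times_diff_Suc_has_derivative]]])
      (use Suc in auto)
qed simp

lemma times_diff_mult: "times_diff k f \<Longrightarrow> times_diff k g \<Longrightarrow> times_diff k (\<lambda>x. f x * g x)"
proof (induction k arbitrary: f g)
  case (Suc k)
  show ?case
    by (rule times_diff_SucI[OF has_derivative_mult[OF Suc.prems[THEN times_diff_Suc_has_derivative]]])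
      (use Suc times_diff_mono[OF Suc.prems(1)] times_diff_mono[OF Suc.prems(2)] in
        \<open>auto intro!: times_diff_add Suc.IH\<close>)
qed simp

lemma smooth_const: "smooth (\<lambda>x. c)"
  by (intro times_diff_all_imp_smooth times_diff_const)

lemma smooth_inner: "smooth (\<lambda>x. x \<bullet> v)"
  by (intro times_diff_all_imp_smooth times_diff_inner)

lemma smooth_add: "smooth f \<Longrightarrow> smooth g \<Longrightarrow> smooth (\<lambda>x. f x + g x)"
  by (rule times_diff_all_imp_smooth, rule times_diff_add; erule smooth_imp_times_diff)

lemma smooth_mult: "smooth f \<Longrightarrow> smooth g \<Longrightarrow> smooth (\<lambda>x. f x * g x)"
  by (rule times_diff_all_imp_smooth, rule times_diff_mult; erule smooth_imp_times_diff)

lemma times_diff_compose: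
  fixes f :: "'a::euclidean_space \<Rightarrow> real" and \<phi> :: "real \<Rightarrow> real"
  shows "times_diff k \<phi> \<Longrightarrow> times_diff k f \<Longrightarrow> times_diff k (\<lambda>x. \<phi> (f x))"
proof (induction k arbitrary: f \<phi>)
  case (Suc k)
  \<comment> \<open>A linear map on the reals is multiplication by its value at 1, and 1 is the only
    basis vector; this rewrites the chain rule as a product of a partial derivative of
    \<open>\<phi>\<close> with one of f.\<close>
  have lin: "frechet_derivative \<phi> (at t) h = frechet_derivative \<phi> (at t) 1 * h" for t h
  proof -
    have "linear (frechet_derivative \<phi> (at t))"
      using Suc.prems by (simp add: linear_frechet_derivative)
    from linear_scale[OF this, of h 1] show ?thesis by simp
  qed
  have *: "((\<lambda>x. \<phi> (f x)) has_derivative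
      (\<lambda>h. frechet_derivative \<phi> (at (f x)) 1 * frechet_derivative f (at x) h)) (at x)" for x
    by (rule has_derivative_eq_rhs[OF has_derivative_compose[OF
          times_diff_Suc_has_derivative[OF Suc.prems(2)]
          times_diff_Suc_has_derivative[OF Suc.prems(1)]]])
      (rule ext, rule lin)
  show ?case
  proof (rule times_diff_SucI[OF *])
    fix b :: 'a assume b: "b \<in> Basis"
    have "times_diff k (\<lambda>t. frechet_derivative \<phi> (at t) 1)"
      using Suc.prems by simp
    then have "times_diff k (\<lambda>x. frechet_derivative \<phi> (at (f x)) 1)"
      by (rule Suc.IH[OF _ times_diff_mono[OF Suc.prems(2)]])
    moreover have "times_diff k (\<lambda>x. frechet_derivative f (at x) b)"
      using Suc.prems b by simp
    ultimately show "times_diff k (\<lambda>x. frechet_derivative \<phi> (at (f x)) 1 * frechet_derivative f (at x) b)"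
      by (rule times_diff_mult)
  qed
qed simp

lemma smooth_compose:
  fixes f :: "'a::euclidean_space \<Rightarrow> real" and \<phi> :: "real \<Rightarrow> real"
  shows "smooth \<phi> \<Longrightarrow> smooth f \<Longrightarrow> smooth (\<lambda>x. \<phi> (f x))"
  by (rule times_diff_all_imp_smooth, rule times_diff_compose; erule smooth_imp_times_diff)

lemma smooth_ident: "smooth (\<lambda>t::real. t)"
  using smooth_inner[of "1::real"] by simp

lemma smooth_poly: "smooth (poly (p::real poly))"
proof (induction p)
  case 0
  show ?case by (simp add: smooth_const)
next
  case (pCons a p)
  have eq: "poly (pCons a p) = (\<lambda>t. a + t * poly p t)" by auto
  show ?case unfolding eq
    by (rule smooth_add[OF smooth_const smooth_mult[OF smooth_ident pCons.IH]])
qed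

text \<open>The power function is not smooth on the whole line, so the composition lemma does not
  apply. The exponent is kept arbitrary in the induction because differentiation lowers it by
  one.\<close>

lemma times_diff_powr:
  fixes f :: "'a::euclidean_space \<Rightarrow> real"
  assumes pos: "\<And>x. f x > 0" and f: "smooth f"
  shows "times_diff k (\<lambda>x. f x powr a)"
proof (induction k arbitrary: a)
  case (Suc k)
  have d: "(f has_derivative frechet_derivative f (at x)) (at x)" for x
    using smooth_differentiable[OF f] frechet_derivative_works by blast
  have *: "((\<lambda>x. f x powr a) has_derivative
     (\<lambda>h. a * (f x powr (a - 1) * frechet_derivative f (at x) h))) (at x)" for x
  proof -
    have "((\<lambda>t. t powr a) has_derivative (\<lambda>h. h * (a * f x powr (a - 1)))) (at (f x))"
      using has_real_derivative_powr[OF pos, of a x] unfolding has_field_derivative_def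
      by (rule has_derivative_eq_rhs) auto
    from has_derivative_compose[OF d this] show ?thesis
      by (rule has_derivative_eq_rhs) (auto simp: algebra_simps)
  qed
  show ?case
    by (rule times_diff_SucI[OF *])
      (rule times_diff_mult times_diff_const Suc smooth_imp_times_diff[OF smooth_partial[OF f]] | assumption)+
qed simp

lemma smooth_powr:
  fixes f :: "'a::euclidean_space \<Rightarrow> real"
  shows "(\<And>x. f x > 0) \<Longrightarrow> smooth f \<Longrightarrow> smooth (\<lambda>x. f x powr a)"
  by (rule times_diff_all_imp_smooth, rule times_diff_powr)

text \<open>The polynomial factor makes the class of these bump functions closed under differentiation.\<close>

definition flat :: "real poly \<Rightarrow> real \<Rightarrow> real" where
  "flat p t = (if t < 1 then poly p (1 / (1 - t)) * exp (- (1 / (1 - t))) else 0)"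

lemma poly_over_exp_tendsto_0: "((\<lambda>v::real. poly p v * exp (- v)) \<longlongrightarrow> 0) at_top"
proof -
  have "((\<lambda>v::real. \<Sum>i\<le>degree p. coeff p i * (v ^ i / exp v)) \<longlongrightarrow> (\<Sum>i\<le>degree p. coeff p i * 0)) at_top"
    by (intro tendsto_intros tendsto_power_div_exp_0)
  then show ?thesis
    by (simp add: poly_altdef sum_distrib_right exp_minus divide_inverse mult.assoc)
qed

lemma inverse_left_of_one: "LIM t at_left (1::real). 1 / (1 - t) :> at_top"
proof -
  have "LIM t at_left (1::real). inverse (1 - t) :> at_top"
  proof (rule filterlim_compose[OF filterlim_inverse_at_top_right])
    have "((\<lambda>t::real. 1 - t) \<longlongrightarrow> 1 - 1) (at_left 1)" by (intro tendsto_intros)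
    then show "filterlim (\<lambda>t::real. 1 - t) (at_right 0) (at_left 1)"
      by (auto simp: filterlim_at eventually_at_left_field intro: exI[of _ 0])
  qed
  then show ?thesis by (simp add: inverse_eq_divide)
qed

text \<open>With v = 1/(1 - t) one has v' = v^2, so (p(v) exp(-v))' = v^2 (p' - p)(v) exp(-v); the
  factor \<open>[:0, 0, 1:]\<close> is v^2.\<close>

definition flat' :: "real poly \<Rightarrow> real poly" where
  "flat' p = [:0, 0, 1:] * (pderiv p - p)"

lemma flat_has_derivative: "(flat p has_real_derivative flat (flat' p) t) (at t)"
proof -
  consider "t < 1" | "t > 1" | "t = 1" by linarith
  then show ?thesis
  proof cases
    case 1
    let ?v = "1 / (1 - t)"
    have "((\<lambda>t. poly p (1 / (1 - t)) * exp (- (1 / (1 - t)))) has_real_derivative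
      poly p ?v * (exp (- ?v) * (- (?v\<^sup>2))) + poly (pderiv p) ?v * ?v\<^sup>2 * exp (- ?v)) (at t)"
    proof -
      have v: "((\<lambda>t. 1 / (1 - t)) has_real_derivative ?v\<^sup>2) (at t)"
        using 1 by (auto intro!: derivative_eq_intros simp: power2_eq_square)
      have "((\<lambda>t. poly p (1 / (1 - t))) has_real_derivative poly (pderiv p) ?v * ?v\<^sup>2) (at t)"
        by (rule DERIV_chain2[OF poly_DERIV v])
      moreover have "((\<lambda>t. exp (- (1 / (1 - t)))) has_real_derivative exp (- ?v) * (- (?v\<^sup>2))) (at t)"
        by (rule DERIV_chain2[OF DERIV_exp DERIV_minus[OF v]])
      ultimately show ?thesis
        by (rule DERIV_mult')
    qed
    also have "poly p ?v * (exp (- ?v) * (- (?v\<^sup>2))) + poly (pderiv p) ?v * ?v\<^sup>2 * exp (- ?v)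
        = flat (flat' p) t"
      using 1 by (simp add: flat_def flat'_def power2_eq_square algebra_simps)
    finally show ?thesis
      by (rule DERIV_cong_ev[THEN iffD1, rotated -1])
        (use 1 in \<open>auto simp: flat_def eventually_nhds intro!: exI[of _ "{..<1}"]\<close>)
  next
    case 2
    have "((\<lambda>t. 0) has_real_derivative flat (flat' p) t) (at t)"
      using 2 by (simp add: flat_def)
    then show ?thesis
      by (rule DERIV_cong_ev[THEN iffD1, rotated -1])
        (use 2 in \<open>auto simp: flat_def eventually_nhds intro!: exI[of _ "{1<..}"]\<close>)
  next
    case 3
    have "((\<lambda>y. (flat p y - flat p 1) / (y - 1)) \<longlongrightarrow> 0) (at 1)"
    proof -
      \<comment> \<open>Left of 1 the factor 1/(y - 1) of the difference quotient is -v, which is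
        absorbed into the polynomial; right of 1 the quotient vanishes.\<close>
      have "((\<lambda>y. - (poly ([:0,1:] * p) (1 / (1 - y)) * exp (- (1 / (1 - y))))) \<longlongrightarrow> - 0) (at_left 1)"
        by (intro tendsto_minus filterlim_compose[OF poly_over_exp_tendsto_0 inverse_left_of_one])
      then have "((\<lambda>y. (flat p y - flat p 1) / (y - 1)) \<longlongrightarrow> 0) (at_left 1)"
        unfolding minus_zero
        by (rule Lim_transform_eventually)
          (auto simp: flat_def eventually_at_left_field field_simps intro!: exI[of _ 0])
      moreover have "((\<lambda>y. (flat p y - flat p 1) / (y - 1)) \<longlongrightarrow> 0) (at_right 1)"
        by (rule Lim_transform_eventually[OF tendsto_const])
          (auto simp: flat_def eventually_at_right_field intro!: exI[of _ 2])
      ultimately show ?thesis by (simp add: filterlim_split_at)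
    qed
    then show ?thesis using 3 by (simp add: has_field_derivative_iff flat_def)
  qed
qed

lemma smooth_flat: "smooth (flat p)"
proof (intro times_diff_all_imp_smooth)
  show "times_diff k (flat p)" for k
  proof (induction k arbitrary: p)
    case (Suc k)
    show ?case
      by (rule times_diff_SucI[OF flat_has_derivative[unfolded has_field_derivative_def]])
        (use Suc in auto)
  qed simp
qed

lemma smooth_fst: "smooth (\<lambda>x::plane. fst x)" and smooth_snd: "smooth (\<lambda>x::plane. snd x)"
  using smooth_inner[of "(1,0)::plane"] smooth_inner[of "(0,1)::plane"] by (simp_all add: inner_prod_def)

lemma smooth_norm_squared: "smooth (\<lambda>x::plane. (norm x)\<^sup>2)"
proof -
  have eq: "(\<lambda>x::plane. (norm x)\<^sup>2) = (\<lambda>x. fst x * fst x + snd x * snd x)"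
    by (auto simp: norm_prod_def power2_eq_square[symmetric] fun_eq_iff)
  show ?thesis unfolding eq
    by (rule smooth_add[OF smooth_mult[OF smooth_fst smooth_fst] smooth_mult[OF smooth_snd smooth_snd]])
qed

section \<open>Weak gradients in the plane\<close>

lemma Basis_plane: "(Basis :: plane set) = {(1, 0), (0, 1)}"
  by (auto simp: Basis_prod_def)

text \<open>Restrictions to balls are integrable, hence measurable, and converge pointwise.\<close>

lemma locally_integrable_measurable:
  fixes u :: "'a::euclidean_space \<Rightarrow> 'b::euclidean_space"
  assumes "locally_integrable u"
  shows "u \<in> borel_measurable borel"
proof (rule borel_measurable_LIMSEQ_metric)
  fix n :: nat
  have "set_integrable lborel (cball 0 (real n)) u"
    using assms by (auto simp: locally_integrable_def)
  then show "(\<lambda>x. indicator (cball 0 (real n)) x *\<^sub>R u x) \<in> borel_measurable borel"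
    by (auto simp: set_integrable_def dest: borel_measurable_integrable)
next
  fix x :: 'a
  obtain N :: nat where N: "norm x < real N" using reals_Archimedean2 by blast
  show "(\<lambda>n. indicator (cball 0 (real n)) x *\<^sub>R u x) \<longlonglongrightarrow> u x"
    by (rule tendsto_eventually)
      (use N in \<open>auto simp: eventually_sequentially dist_norm intro!: exI[of _ N]\<close>)
qed

lemma locally_integrable_mult:
  fixes u :: "'a::euclidean_space \<Rightarrow> real"
  assumes u: "locally_integrable u" and K: "compact K"
    and \<phi>: "\<phi> \<in> borel_measurable borel" "\<And>x. x \<notin> K \<Longrightarrow> \<phi> x = 0" "\<And>x. \<bar>\<phi> x\<bar> \<le> C"
  shows "integrable lborel (\<lambda>x. u x * \<phi> x)"
proof (rule Bochner_Integration.integrable_bound)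
  show "integrable lborel (\<lambda>x. C * (indicator K x *\<^sub>R u x))"
    using u K by (auto simp: locally_integrable_def set_integrable_def)
  show "(\<lambda>x. u x * \<phi> x) \<in> borel_measurable lborel"
    using locally_integrable_measurable[OF u] \<phi> by simp
  have "\<bar>u x * \<phi> x\<bar> \<le> \<bar>C * (indicator K x * u x)\<bar>" for x
  proof (cases "x \<in> K")
    case True
    have "\<bar>u x\<bar> * \<bar>\<phi> x\<bar> \<le> \<bar>u x\<bar> * \<bar>C\<bar>"
      using \<phi>(3)[of x] by (intro mult_left_mono) auto
    then show ?thesis using True by (simp add: abs_mult mult.commute)
  qed (use \<phi> in auto)
  then show "AE x in lborel. norm (u x * \<phi> x) \<le> norm (C * (indicator K x *\<^sub>R u x))"
    by simp
qed

lemma locally_integrable_inner: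
  fixes G :: "'a::euclidean_space \<Rightarrow> 'b::euclidean_space"
  assumes "locally_integrable G"
  shows "locally_integrable (\<lambda>x. G x \<bullet> b)"
  unfolding locally_integrable_def set_integrable_def
proof (intro allI impI)
  fix K :: "'a set" assume "compact K"
  then have "integrable lborel (\<lambda>x. (indicator K x *\<^sub>R G x) \<bullet> b)"
    using assms by (intro integrable_inner_left) (auto simp: locally_integrable_def set_integrable_def)
  then show "integrable lborel (\<lambda>x. indicator K x *\<^sub>R (G x \<bullet> b))" by simp
qed

lemma locally_integrable_add:
  fixes u v :: "'a::euclidean_space \<Rightarrow> 'b::euclidean_space"
  shows "locally_integrable u \<Longrightarrow> locally_integrable v \<Longrightarrow> locally_integrable (\<lambda>x. u x + v x)"
  by (auto simp: locally_integrable_def)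

lemma locally_integrable_scale:
  fixes u :: "'a::euclidean_space \<Rightarrow> 'b::euclidean_space"
  shows "locally_integrable u \<Longrightarrow> locally_integrable (\<lambda>x. c *\<^sub>R u x)"
  by (auto simp: locally_integrable_def)

lemma locally_integrable_norm:
  fixes u :: "'a::euclidean_space \<Rightarrow> 'b::euclidean_space"
  assumes "locally_integrable u" "compact K"
  shows "integrable lborel (\<lambda>x. indicator K x * norm (u x))"
proof -
  have "integrable lborel (\<lambda>x. norm (indicator K x *\<^sub>R u x))"
    using assms by (intro integrable_norm) (auto simp: locally_integrable_def set_integrable_def)
  then show ?thesis by simp
qed

lemma locally_integrable_const:
  fixes c :: "'b::euclidean_space"
  shows "locally_integrable (\<lambda>x::'a::euclidean_space. c)"
  unfolding locally_integrable_def set_integrable_def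
  by (auto intro!: integrable_scaleR_left integrable_real_indicator emeasure_compact_finite
      borel_compact)

lemma locally_integrable_bound:
  fixes u :: "'a::euclidean_space \<Rightarrow> 'b::euclidean_space" and v :: "'a \<Rightarrow> 'c::euclidean_space"
  assumes "locally_integrable v" "u \<in> borel_measurable borel" "AE x in lborel. norm (u x) \<le> norm (v x)"
  shows "locally_integrable u"
  unfolding locally_integrable_def set_integrable_def
proof (intro allI impI)
  fix K :: "'a set" assume K: "compact K"
  show "integrable lborel (\<lambda>x. indicator K x *\<^sub>R u x)"
  proof (rule Bochner_Integration.integrable_bound)
    show "integrable lborel (\<lambda>x. indicator K x *\<^sub>R v x)"
      using assms K by (auto simp: locally_integrable_def set_integrable_def)
    show "(\<lambda>x. indicator K x *\<^sub>R u x) \<in> borel_measurable lborel"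
      using assms K by (auto intro!: borel_measurable_scaleR borel_measurable_indicator borel_compact)
    show "AE x in lborel. norm (indicator K x *\<^sub>R u x) \<le> norm (indicator K x *\<^sub>R v x)"
      using assms(3) by eventually_elim (auto simp: indicator_def)
  qed
qed

lemma locally_integrable_square:
  fixes u :: "'a::euclidean_space \<Rightarrow> 'b::euclidean_space"
  assumes u: "u \<in> borel_measurable borel"
    and int: "\<And>K. compact K \<Longrightarrow> set_integrable lborel K (\<lambda>x. (norm (u x))\<^sup>2)"
  shows "locally_integrable u"
proof (rule locally_integrable_bound[OF _ u])
  show "locally_integrable (\<lambda>x. 1 + (norm (u x))\<^sup>2)"
    using int by (intro locally_integrable_add locally_integrable_const) (auto simp: locally_integrable_def)
  have "t \<le> 1 + t\<^sup>2" for t :: real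
    using zero_le_power2[of "t - 1/2"] by (simp add: power2_eq_square algebra_simps)
  then show "AE x in lborel. norm (u x) \<le> norm (1 + (norm (u x))\<^sup>2)"
    by (simp add: add_nonneg_nonneg)
qed

lemma smooth_continuous: "smooth \<phi> \<Longrightarrow> continuous_on A \<phi>"
  by (meson continuous_at_imp_continuous_on differentiable_imp_continuous_within smooth_differentiable)

lemma smooth_has_derivative: "smooth \<phi> \<Longrightarrow> (\<phi> has_derivative frechet_derivative \<phi> (at x)) (at x)"
  using smooth_differentiable frechet_derivative_works by blast

text \<open>One compact set and one bound serve the function and all its partial derivatives; the
  sum of the individual bounds over the basis dominates each of them.\<close>

lemma test_functionE:
  fixes \<phi> :: "'a::euclidean_space \<Rightarrow> real"
  assumes "test_function \<phi>"
  obtains K C where "compact K" "\<And>x. x \<notin> K \<Longrightarrow> \<phi> x = 0" "\<And>x. \<bar>\<phi> x\<bar> \<le> C"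
    "\<And>x b. b \<in> Basis \<Longrightarrow> x \<notin> K \<Longrightarrow> frechet_derivative \<phi> (at x) b = 0"
    "\<And>x b. b \<in> Basis \<Longrightarrow> \<bar>frechet_derivative \<phi> (at x) b\<bar> \<le> C"
proof -
  define K where "K = closure {x. \<phi> x \<noteq> 0}"
  have sm: "smooth \<phi>" and K: "compact K" using assms by (auto simp: test_function_def K_def)
  have 0: "\<phi> x = 0" if "x \<notin> K" for x
    using that closure_subset[of "{x. \<phi> x \<noteq> 0}"] by (auto simp: K_def)
  have d0: "frechet_derivative \<phi> (at x) b = 0" if "x \<notin> K" for x b
  proof -
    have "(\<phi> has_derivative (\<lambda>h. 0)) (at x)"
      by (rule has_derivative_transform_within_open[of "\<lambda>x. 0" _ _ _ "- K"])
        (use that 0 K in \<open>auto simp: compact_imp_closed open_Compl\<close>)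
    then show ?thesis by (metis frechet_derivative_at)
  qed
  have bnd: "\<exists>B. \<forall>x. \<bar>g x\<bar> \<le> B"
    if cont: "continuous_on K g" and z: "\<And>x. x \<notin> K \<Longrightarrow> g x = 0" for g :: "'a \<Rightarrow> real"
  proof -
    have "bounded (g ` K)" by (intro compact_imp_bounded compact_continuous_image cont K)
    then obtain B where "0 < B" "\<And>x. x \<in> K \<Longrightarrow> \<bar>g x\<bar> \<le> B"
      unfolding bounded_pos by auto
    then have "\<bar>g x\<bar> \<le> B" for x using z[of x] by (cases "x \<in> K") auto
    then show ?thesis by blast
  qed
  obtain B where B: "\<And>x. \<bar>\<phi> x\<bar> \<le> B" using bnd[OF smooth_continuous[OF sm] 0] by blast
  have "\<forall>b\<in>Basis. \<exists>B. \<forall>x. \<bar>frechet_derivative \<phi> (at x) b\<bar> \<le> B"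
    using bnd[OF smooth_continuous[OF smooth_partial[OF sm]] d0] by blast
  then obtain B' where B': "\<And>b x. b \<in> Basis \<Longrightarrow> \<bar>frechet_derivative \<phi> (at x) b\<bar> \<le> B' b" by metis
  have B'0: "0 \<le> B' b" if "b \<in> Basis" for b using B'[OF that] abs_ge_zero order_trans by blast
  have B0: "0 \<le> B" using B abs_ge_zero order_trans by blast
  have "\<bar>frechet_derivative \<phi> (at x) b\<bar> \<le> B + sum B' Basis" if "b \<in> Basis" for x b
    using B'[OF that, of x] member_le_sum[of b Basis B'] B'0 that B0 by fastforce
  moreover have "\<bar>\<phi> x\<bar> \<le> B + sum B' Basis" for x
    using B[of x] B'0 by (smt (verit) sum_nonneg)
  ultimately show ?thesis using that[OF K 0 _ d0, of "B + sum B' Basis"] by blast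
qed

lemma test_function_integrable:
  fixes u :: "'a::euclidean_space \<Rightarrow> real"
  assumes "test_function \<phi>" "locally_integrable u"
  shows "integrable lborel (\<lambda>x. u x * \<phi> x)"
    and "b \<in> Basis \<Longrightarrow> integrable lborel (\<lambda>x. u x * frechet_derivative \<phi> (at x) b)"
proof -
  obtain K C where K: "compact K" "\<And>x. x \<notin> K \<Longrightarrow> \<phi> x = 0" "\<And>x. \<bar>\<phi> x\<bar> \<le> C"
    "\<And>x b. b \<in> Basis \<Longrightarrow> x \<notin> K \<Longrightarrow> frechet_derivative \<phi> (at x) b = 0"
    "\<And>x b. b \<in> Basis \<Longrightarrow> \<bar>frechet_derivative \<phi> (at x) b\<bar> \<le> C"
    using test_functionE[OF assms(1)] by blast
  have sm: "smooth \<phi>" using assms by (simp add: test_function_def)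
  show "integrable lborel (\<lambda>x. u x * \<phi> x)"
    using K by (intro locally_integrable_mult[OF assms(2) K(1)])
      (auto intro!: borel_measurable_continuous_onI smooth_continuous sm)
  show "integrable lborel (\<lambda>x. u x * frechet_derivative \<phi> (at x) b)" if b: "b \<in> Basis"
    using K b by (intro locally_integrable_mult[OF assms(2) K(1)])
      (auto intro!: borel_measurable_continuous_onI smooth_continuous smooth_partial sm)
qed

lemma has_weak_gradient_add:
  assumes "has_weak_gradient u G" "has_weak_gradient u' G'"
  shows "has_weak_gradient (\<lambda>x. u x + u' x) (\<lambda>x. G x + G' x)"
  using assms
  by (auto simp: has_weak_gradient_def locally_integrable_add distrib_right inner_add_left
      test_function_integrable locally_integrable_inner)

lemma has_weak_gradient_scale:
  assumes "has_weak_gradient u G"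
  shows "has_weak_gradient (\<lambda>x. c * u x) (\<lambda>x. c *\<^sub>R G x)"
  using assms locally_integrable_scale[of u c]
  by (auto simp: has_weak_gradient_def locally_integrable_scale mult.assoc)

lemma has_weak_gradient_zero: "has_weak_gradient (\<lambda>x. 0) (\<lambda>x. 0)"
  by (auto simp: has_weak_gradient_def locally_integrable_const)

lemma has_weak_gradient_sum:
  assumes "finite F" "\<And>k. k \<in> F \<Longrightarrow> has_weak_gradient (u k) (G k)"
  shows "has_weak_gradient (\<lambda>x. \<Sum>k\<in>F. c k * u k x) (\<lambda>x. \<Sum>k\<in>F. c k *\<^sub>R G k x)"
  using assms
  by (induction F) (auto intro!: has_weak_gradient_add has_weak_gradient_scale has_weak_gradient_zero)

lemma has_weak_gradient_cong:
  assumes "has_weak_gradient u G" "AE x in lborel. u x = u' x" "u' \<in> borel_measurable borel"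
  shows "has_weak_gradient u' G"
proof -
  have u: "locally_integrable u" using assms(1) by (simp add: has_weak_gradient_def)
  then have u': "locally_integrable u'"
    by (rule locally_integrable_bound) (use assms in \<open>auto elim: AE_mp\<close>)
  have "(\<integral>x. u' x * frechet_derivative \<phi> (at x) b \<partial>lborel)
      = (\<integral>x. u x * frechet_derivative \<phi> (at x) b \<partial>lborel)"
    if "test_function \<phi>" "b \<in> Basis" for \<phi> b
    by (rule integral_cong_AE)
      (use test_function_integrable(2)[OF that(1) u that(2)] test_function_integrable(2)[OF that(1) u' that(2)]
        assms(2) in \<open>auto elim: AE_mp\<close>)
  then show ?thesis using assms(1) u' by (auto simp: has_weak_gradient_def)
qed

section \<open>The Cauchy-Schwarz inequality and limits of weak gradients\<close>

lemma square_mult_integrable: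
  fixes f g :: "'a \<Rightarrow> real"
  assumes "f \<in> borel_measurable M" "g \<in> borel_measurable M"
    "integrable M (\<lambda>x. (f x)\<^sup>2)" "integrable M (\<lambda>x. (g x)\<^sup>2)"
  shows "integrable M (\<lambda>x. f x * g x)"
proof (rule Bochner_Integration.integrable_bound)
  show "integrable M (\<lambda>x. (f x)\<^sup>2 + (g x)\<^sup>2)" using assms by simp
  have "\<bar>f x * g x\<bar> \<le> (f x)\<^sup>2 + (g x)\<^sup>2" for x
  proof -
    have "2 * (\<bar>f x\<bar> * \<bar>g x\<bar>) \<le> (f x)\<^sup>2 + (g x)\<^sup>2"
      using sum_squares_bound[of "\<bar>f x\<bar>" "\<bar>g x\<bar>"] by (simp add: mult.assoc)
    moreover have "0 \<le> \<bar>f x\<bar> * \<bar>g x\<bar>" by simp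
    ultimately show ?thesis unfolding abs_mult by linarith
  qed
  then show "AE x in M. norm (f x * g x) \<le> norm ((f x)\<^sup>2 + (g x)\<^sup>2)"
    by (intro AE_I2) simp
qed (use assms in auto)

text \<open>The quadratic form (r, s) -> integral of (r f + s g)^2 is nonnegative, so its
  discriminant is not positive.\<close>

lemma Cauchy_Schwarz_integral:
  fixes f g :: "'a \<Rightarrow> real"
  assumes m: "f \<in> borel_measurable M" "g \<in> borel_measurable M"
    and i: "integrable M (\<lambda>x. (f x)\<^sup>2)" "integrable M (\<lambda>x. (g x)\<^sup>2)"
  shows "\<bar>\<integral>x. f x * g x \<partial>M\<bar> \<le> sqrt (\<integral>x. (f x)\<^sup>2 \<partial>M) * sqrt (\<integral>x. (g x)\<^sup>2 \<partial>M)"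
proof -
  define A B C where "A = (\<integral>x. (f x)\<^sup>2 \<partial>M)" and "B = (\<integral>x. (g x)\<^sup>2 \<partial>M)" and "C = (\<integral>x. f x * g x \<partial>M)"
  note fg = square_mult_integrable[OF m i]
  have A: "A \<ge> 0" and B: "B \<ge> 0" by (auto simp: A_def B_def)
  have nonneg: "0 \<le> r\<^sup>2 * A + 2 * r * s * C + s\<^sup>2 * B" for r s
  proof -
    have "0 \<le> (\<integral>x. (r * f x + s * g x)\<^sup>2 \<partial>M)" by simp
    also have "\<dots> = (\<integral>x. r\<^sup>2 * (f x)\<^sup>2 + 2 * r * s * (f x * g x) + s\<^sup>2 * (g x)\<^sup>2 \<partial>M)"
      by (simp add: power2_eq_square algebra_simps)
    also have "\<dots> = r\<^sup>2 * A + 2 * r * s * C + s\<^sup>2 * B"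
      unfolding A_def B_def C_def using i fg by simp
    finally show ?thesis .
  qed
  have "C\<^sup>2 \<le> A * B"
  proof (cases "A = 0")
    case True
    have "C = 0"
    proof (rule ccontr)
      assume "C \<noteq> 0"
      \<comment> \<open>For A = 0 and s = 1 the form is 2 r C + B, and this r gives it the value
        -1.\<close>
      then show False using nonneg[of "- (B + 1) / (2 * C)" 1] True B by (simp add: field_simps)
    qed
    then show ?thesis using True by simp
  next
    case False
    have "0 \<le> C\<^sup>2 * A - 2 * C * A * C + A\<^sup>2 * B" using nonneg[of "- C" A] by (simp add: algebra_simps)
    then have "0 \<le> A * (A * B - C\<^sup>2)" by (simp add: power2_eq_square algebra_simps)
    then show ?thesis using False A by (simp add: zero_le_mult_iff)
  qed
  then show ?thesis unfolding A_def[symmetric] B_def[symmetric] C_def[symmetric]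
    by (simp add: real_le_rsqrt abs_le_square_iff[symmetric] real_sqrt_mult[symmetric] real_le_rsqrt)
qed

text \<open>The defining identity pairs u and G only with bounded functions supported in a fixed
  compact set, so convergence in L1 on compact sets passes it to the limit.\<close>

lemma has_weak_gradient_limit:
  fixes u :: "'a::euclidean_space \<Rightarrow> real"
  assumes w: "\<And>i. has_weak_gradient (ui i) (Gi i)"
    and u: "locally_integrable u" and G: "locally_integrable G"
    and lu: "\<And>K. compact K \<Longrightarrow> (\<lambda>i. \<integral>x. indicator K x * \<bar>ui i x - u x\<bar> \<partial>lborel) \<longlonglongrightarrow> 0"
    and lG: "\<And>K. compact K \<Longrightarrow> (\<lambda>i. \<integral>x. indicator K x * norm (Gi i x - G x) \<partial>lborel) \<longlonglongrightarrow> 0"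
  shows "has_weak_gradient u G"
  unfolding has_weak_gradient_def
proof (intro conjI allI impI ballI)
  fix \<phi> :: "'a \<Rightarrow> real" and b :: 'a
  assume tf: "test_function \<phi>" and b: "b \<in> Basis"
  obtain K C where K: "compact K" "\<And>x. x \<notin> K \<Longrightarrow> \<phi> x = 0" "\<And>x. \<bar>\<phi> x\<bar> \<le> C"
    "\<And>x b. b \<in> Basis \<Longrightarrow> x \<notin> K \<Longrightarrow> frechet_derivative \<phi> (at x) b = 0"
    "\<And>x b. b \<in> Basis \<Longrightarrow> \<bar>frechet_derivative \<phi> (at x) b\<bar> \<le> C"
    using test_functionE[OF tf] by blast
  have sm: "smooth \<phi>" using tf by (simp add: test_function_def)
  have ui: "locally_integrable (ui i)" and Gi: "locally_integrable (Gi i)" for i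
    using w by (auto simp: has_weak_gradient_def)
  \<comment> \<open>The majorant D separates the pointwise difference from its integral: it is |u_i
    - u| for the functions and the norm of G_i - G for every component of the gradients.\<close>
  have conv: "(\<lambda>i. \<integral>x. f i x * \<psi> x \<partial>lborel) \<longlonglongrightarrow> (\<integral>x. g x * \<psi> x \<partial>lborel)"
    if f: "\<And>i. locally_integrable (f i)" and g: "locally_integrable g"
      and d: "\<And>i x. \<bar>f i x - g x\<bar> \<le> D i x"
      and D: "\<And>i. integrable lborel (\<lambda>x. indicator K x * D i x)"
      and l: "(\<lambda>i. \<integral>x. indicator K x * D i x \<partial>lborel) \<longlonglongrightarrow> 0"
      and \<psi>: "continuous_on UNIV \<psi>" "\<And>x. x \<notin> K \<Longrightarrow> \<psi> x = 0" "\<And>x. \<bar>\<psi> x\<bar> \<le> C"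
    for f :: "nat \<Rightarrow> 'a \<Rightarrow> real" and g D \<psi>
  proof -
    have m: "\<psi> \<in> borel_measurable borel" using \<psi>(1) by (intro borel_measurable_continuous_onI)
    note int = locally_integrable_mult[OF _ K(1) m \<psi>(2,3)]
    have "\<bar>(\<integral>x. f i x * \<psi> x \<partial>lborel) - (\<integral>x. g x * \<psi> x \<partial>lborel)\<bar>
        \<le> C * (\<integral>x. indicator K x * D i x \<partial>lborel)" for i
    proof -
      have "(\<integral>x. f i x * \<psi> x \<partial>lborel) - (\<integral>x. g x * \<psi> x \<partial>lborel) = (\<integral>x. f i x * \<psi> x - g x * \<psi> x \<partial>lborel)"
        using int[OF f] int[OF g] by simp
      also have "\<bar>\<dots>\<bar> \<le> (\<integral>x. C * (indicator K x * D i x) \<partial>lborel)"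
      proof (rule integral_abs_bound_integral)
        show "integrable lborel (\<lambda>x. f i x * \<psi> x - g x * \<psi> x)" using int[OF f] int[OF g] by simp
        show "integrable lborel (\<lambda>x. C * (indicator K x * D i x))" using D by simp
        show "\<bar>f i x * \<psi> x - g x * \<psi> x\<bar> \<le> C * (indicator K x * D i x)" for x
        proof (cases "x \<in> K")
          case True
          have "\<bar>f i x * \<psi> x - g x * \<psi> x\<bar> = \<bar>\<psi> x\<bar> * \<bar>f i x - g x\<bar>"
            by (simp add: abs_mult[symmetric] algebra_simps)
          also have "\<dots> \<le> C * D i x" using \<psi>(3)[of x] d[of i x] by (intro mult_mono) auto
          finally show ?thesis using True by simp
        qed (use \<psi> in auto)
      qed
      finally show ?thesis by simp
    qed
    then have "(\<lambda>i. (\<integral>x. f i x * \<psi> x \<partial>lborel) - (\<integral>x. g x * \<psi> x \<partial>lborel)) \<longlonglongrightarrow> 0"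
      by (intro Lim_null_comparison[OF _ tendsto_mult_right_zero[OF l, of C]]) auto
    then show ?thesis by (simp add: LIM_zero_iff)
  qed
  have Du: "integrable lborel (\<lambda>x. indicator K x * \<bar>ui i x - u x\<bar>)" for i
    using locally_integrable_norm[OF locally_integrable_add[OF ui locally_integrable_scale[OF u, of "-1"]] K(1)]
    by simp
  have DG: "integrable lborel (\<lambda>x. indicator K x * norm (Gi i x - G x))" for i
    using locally_integrable_norm[OF locally_integrable_add[OF Gi locally_integrable_scale[OF G, of "-1"]] K(1)]
    by simp
  have dG: "\<bar>Gi i x \<bullet> b - G x \<bullet> b\<bar> \<le> norm (Gi i x - G x)" for i x
    using b Basis_le_norm[of b "Gi i x - G x"] by (simp add: inner_diff_left)
  have l1: "(\<lambda>i. \<integral>x. ui i x * frechet_derivative \<phi> (at x) b \<partial>lborel)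
      \<longlonglongrightarrow> (\<integral>x. u x * frechet_derivative \<phi> (at x) b \<partial>lborel)"
    by (rule conv[OF ui u _ Du lu[OF K(1)] smooth_continuous[OF smooth_partial[OF sm b]]])
      (use K b in auto)
  have l2: "(\<lambda>i. \<integral>x. (Gi i x \<bullet> b) * \<phi> x \<partial>lborel) \<longlonglongrightarrow> (\<integral>x. (G x \<bullet> b) * \<phi> x \<partial>lborel)"
    by (rule conv[OF locally_integrable_inner[OF Gi] locally_integrable_inner[OF G] dG DG lG[OF K(1)]
          smooth_continuous[OF sm]]) (use K b in auto)
  have l3: "(\<integral>x. ui i x * frechet_derivative \<phi> (at x) b \<partial>lborel) = - (\<integral>x. (Gi i x \<bullet> b) * \<phi> x \<partial>lborel)" for i
    using w tf b by (auto simp: has_weak_gradient_def)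
  show "(\<integral>x. u x * frechet_derivative \<phi> (at x) b \<partial>lborel) = - (\<integral>x. (G x \<bullet> b) * \<phi> x \<partial>lborel)"
    by (rule LIMSEQ_unique[OF l1]) (unfold l3, rule tendsto_minus[OF l2])
qed (use u G in auto)

section \<open>Integrals of partial derivatives, cut-off functions and point singularities\<close>

lemma integral_derivative_compact_support:
  fixes f :: "real \<Rightarrow> real"
  assumes der: "\<And>t. (f has_real_derivative f' t) (at t)"
    and zero: "\<And>t. \<bar>t\<bar> > R \<Longrightarrow> f t = 0" and int: "integrable lborel f'"
  shows "integral\<^sup>L lborel f' = 0"
proof -
  \<comment> \<open>The interval [-S, S] must be nondegenerate and have endpoints beyond R also when
    R is negative.\<close>
  define S where "S = max R 0 + 1"
  have S: "S > R" "S > 0" by (auto simp: S_def)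
  have f'0: "f' t = 0" if "\<bar>t\<bar> > R" for t
  proof -
    have op: "open {t. \<bar>t\<bar> > R}"
      by (intro open_Collect_less continuous_intros)
    have "(f has_real_derivative 0) (at t)"
      by (rule has_field_derivative_transform_within_open[of "\<lambda>t. 0" _ _ "{t. \<bar>t\<bar> > R}"])
        (use that zero op in auto)
    then show ?thesis using der DERIV_unique by blast
  qed
  have "(f' has_integral (f S - f (- S))) {-S..S}"
    using S der
    by (intro fundamental_theorem_of_calculus)
      (auto simp: has_real_derivative_iff_has_vector_derivative intro: has_vector_derivative_at_within)
  then have "(f' has_integral 0) {-S..S}" using zero[of S] zero[of "-S"] S by simp
  then have "(f' has_integral 0) UNIV"
    by (rule has_integral_on_superset) (use S f'0 in auto)
  then show ?thesis
    using has_integral_integral_lborel[OF int] has_integral_unique by blast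
qed

text \<open>By Fubini it suffices to integrate along each line in the direction of b, where the
  fundamental theorem of calculus applies. Only the derivative in that direction has to be
  integrable; it need not be continuous.\<close>

lemma integral_partial_compact_support:
  fixes F :: "plane \<Rightarrow> real"
  assumes der: "\<And>x. (F has_derivative F' x) (at x)"
    and zero: "\<And>x. norm x > R \<Longrightarrow> F x = 0"
    and b: "b \<in> Basis" and int: "integrable lborel (\<lambda>x. F' x b)"
  shows "(\<integral>x. F' x b \<partial>lborel) = 0"
proof -
  have int': "integrable (lborel \<Otimes>\<^sub>M lborel) (\<lambda>x. F' x b)" using int by (simp add: lborel_prod)
  have lin: "F' x (h *\<^sub>R v) = h * F' x v" for x h v
    using linear_scale[OF has_derivative_linear[OF der[of x]], of h v] by simp
  have inner0: "(\<integral>t. F' (\<gamma> t) b \<partial>lborel) = 0"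
    if \<gamma>: "\<And>t. (\<gamma> has_derivative (\<lambda>h. h *\<^sub>R b)) (at t)" "\<And>t. \<bar>t\<bar> \<le> norm (\<gamma> t)" for \<gamma> :: "real \<Rightarrow> plane"
  \<comment> \<open>On an exceptional line along which the derivative is not integrable, the
    integral is 0 by convention.\<close>
  proof (cases "integrable lborel (\<lambda>t. F' (\<gamma> t) b)")
    case True
    show ?thesis
    proof (rule integral_derivative_compact_support[OF _ _ True, of "\<lambda>t. F (\<gamma> t)" R])
      show "((\<lambda>t. F (\<gamma> t)) has_real_derivative F' (\<gamma> t) b) (at t)" for t
        unfolding has_field_derivative_def
        by (rule has_derivative_eq_rhs[OF has_derivative_compose[OF \<gamma>(1) der]]) (auto simp: lin)
      show "F (\<gamma> t) = 0" if "R < \<bar>t\<bar>" for t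
        using that \<gamma>(2)[of t] by (intro zero) linarith
    qed
  qed (rule not_integrable_integral_eq)
  consider "b = (1, 0)" | "b = (0, 1)" using b by (auto simp: Basis_plane)
  then show ?thesis
  proof cases
    case 1
    have "(\<integral>y. (\<integral>x. F' (x, y) b \<partial>lborel) \<partial>lborel) = (\<integral>x. F' x b \<partial>(lborel \<Otimes>\<^sub>M lborel))"
      using lborel_pair.integral_snd[of "\<lambda>x y. F' (x, y) b"] int' by (simp add: case_prod_beta')
    moreover have "(\<integral>x. F' (x, y) b \<partial>lborel) = 0" for y
      by (rule inner0) (auto simp: 1 norm_Pair intro!: derivative_eq_intros)
    ultimately show ?thesis by (simp add: lborel_prod)
  next
    case 2
    have "(\<integral>x. (\<integral>y. F' (x, y) b \<partial>lborel) \<partial>lborel) = (\<integral>x. F' x b \<partial>(lborel \<Otimes>\<^sub>M lborel))"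
      using lborel_pair.integral_fst'[OF int'] by simp
    moreover have "(\<integral>y. F' (x, y) b \<partial>lborel) = 0" for x
      by (rule inner0) (auto simp: 2 norm_Pair intro!: derivative_eq_intros)
    ultimately show ?thesis by (simp add: lborel_prod)
  qed
qed

text \<open>The factor normalizes the value at 0 to 1. With the argument c |x|^2 this is a smooth
  radial cut-off that vanishes outside the ball of radius 1/sqrt c.\<close>

definition cut :: "real \<Rightarrow> real" where
  "cut t = exp 1 * flat 1 t"

definition cut' :: "real \<Rightarrow> real" where
  "cut' t = exp 1 * flat (flat' 1) t"

lemma cut_has_derivative: "(cut has_real_derivative cut' t) (at t)"
  unfolding cut_def[abs_def] cut'_def by (intro DERIV_cmult flat_has_derivative)

lemma smooth_cut: "smooth cut"
  unfolding cut_def[abs_def] by (intro smooth_mult smooth_const smooth_flat)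

lemma continuous_cut': "continuous_on A cut'"
  unfolding cut'_def[abs_def] by (intro continuous_intros smooth_continuous smooth_flat)

lemma cut_0: "cut 0 = 1"
  by (simp add: cut_def flat_def flip: exp_add)

lemma cut_bounds: "0 \<le> cut t" "t \<ge> 0 \<Longrightarrow> cut t \<le> 1" "t \<ge> 1 \<Longrightarrow> cut t = 0" "t \<ge> 1 \<Longrightarrow> cut' t = 0"
proof -
  have "exp (1::real) * exp (- (1 / (1 - t))) \<le> 1" if "0 \<le> t" "t < 1"
  proof -
    have "1 - 1 / (1 - t) \<le> 0" using that by (simp add: field_simps)
    then have "exp (1 - 1 / (1 - t)) \<le> 1" by simp
    then show ?thesis by (simp add: exp_add[symmetric])
  qed
  then show "t \<ge> 0 \<Longrightarrow> cut t \<le> 1" by (auto simp: cut_def flat_def)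
qed (auto simp: cut_def cut'_def flat_def)

lemma cut'_bounded: obtains B where "B > 0" "\<And>t. t \<ge> 0 \<Longrightarrow> \<bar>cut' t\<bar> \<le> B"
proof -
  have "bounded (cut' ` {0..1})"
    by (intro compact_imp_bounded compact_continuous_image continuous_cut') auto
  then obtain B where B: "B > 0" "\<And>t. t \<in> {0..1} \<Longrightarrow> \<bar>cut' t\<bar> \<le> B"
    unfolding bounded_pos by auto
  have "\<bar>cut' t\<bar> \<le> B" if "t \<ge> 0" for t
    using B(1) B(2)[of t] cut_bounds(4)[of t] that by (cases "t \<le> 1") auto
  then show ?thesis using that B by blast
qed

lemma cut_scaled_has_derivative:
  fixes x :: plane
  shows "((\<lambda>x. cut (c * (norm x)\<^sup>2)) has_derivative
    (\<lambda>v. cut' (c * (norm x)\<^sup>2) * (2 * c * (x \<bullet> v)))) (at x)"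
proof -
  have "((\<lambda>x. c * (norm x)\<^sup>2) has_derivative (\<lambda>v. 2 * c * (x \<bullet> v))) (at x)"
    unfolding power2_norm_eq_inner
    by (auto intro!: derivative_eq_intros simp: inner_commute algebra_simps)
  from has_derivative_compose[OF this cut_has_derivative[unfolded has_field_derivative_def]]
  show ?thesis by simp
qed

text \<open>Points have capacity zero in the plane, so a bounded function may be singular at one.\<close>

lemma has_weak_gradient_punctured:
  fixes u :: "plane \<Rightarrow> real"
  assumes bdd: "\<And>x. \<bar>u x\<bar> \<le> C"
    and der: "\<And>x. x \<noteq> 0 \<Longrightarrow> (u has_derivative (\<lambda>v. G x \<bullet> v)) (at x)"
    and G: "locally_integrable G"
  shows "has_weak_gradient u G"
proof -
  have C: "C \<ge> 0" using bdd[of 0] by linarith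
  have um: "u \<in> borel_measurable borel"
  proof -
    have "continuous_on (- {0}) u"
      by (intro continuous_at_imp_continuous_on ballI) (metis ComplD der has_derivative_continuous singletonI)
    then have "(\<lambda>x. indicator (- {0}) x *\<^sub>R u x) \<in> borel_measurable borel"
      by (intro borel_measurable_continuous_on_indicator) auto
    then have "(\<lambda>x. indicator (- {0}) x *\<^sub>R u x + indicator {0} x * u 0) \<in> borel_measurable borel"
      by (intro borel_measurable_add) auto
    also have "(\<lambda>x. indicator (- {0}) x *\<^sub>R u x + indicator {0} x * u 0) = u"
      by (auto simp: fun_eq_iff indicator_def)
    finally show ?thesis .
  qed
  have u: "locally_integrable u"
    by (rule locally_integrable_bound[OF locally_integrable_const[of C] um]) (use bdd C in auto)
  have "(\<integral>x. u x * frechet_derivative \<phi> (at x) b \<partial>lborel) = - (\<integral>x. (G x \<bullet> b) * \<phi> x \<partial>lborel)"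
    if tf: "test_function \<phi>" and b: "b \<in> Basis" for \<phi> b
  proof -
    obtain K M where K: "compact K" "\<And>x. x \<notin> K \<Longrightarrow> \<phi> x = 0" and M: "\<And>x. \<bar>\<phi> x\<bar> \<le> M"
      using test_functionE[OF tf] by metis
    have M0: "M \<ge> 0" using M[of 0] by linarith
    have sm: "smooth \<phi>" using tf by (simp add: test_function_def)
    obtain R where R: "\<And>x. norm x > R \<Longrightarrow> \<phi> x = 0"
      using compact_imp_bounded[OF K(1)] K(2) by (meson bounded_iff leD)
    obtain B where B: "B > 0" "\<And>t. t \<ge> 0 \<Longrightarrow> \<bar>cut' t\<bar> \<le> B" using cut'_bounded by blast
    define W where "W x = (G x \<bullet> b) * \<phi> x + u x * frechet_derivative \<phi> (at x) b" for x
    have Wint: "integrable lborel W"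
      unfolding W_def using tf b u G
      by (intro Bochner_Integration.integrable_add test_function_integrable locally_integrable_inner)
    \<comment> \<open>This factor vanishes at the singularity and is 1 outside the ball of radius
      1/k; \<open>E\<close> collects the term in which the derivative falls on it.\<close>
    define \<eta> where "\<eta> k x = 1 - cut ((real k)\<^sup>2 * (norm x)\<^sup>2)" for k and x :: plane
    define E where "E k x = u x * \<phi> x * - (cut' ((real k)\<^sup>2 * (norm x)\<^sup>2) * (2 * (real k)\<^sup>2 * (x \<bullet> b)))"
      for k and x :: plane
    have \<eta>0: "0 \<le> \<eta> k x" "\<eta> k x \<le> 1" for k x
      using cut_bounds(1,2) by (auto simp: \<eta>_def)
    have \<eta>d: "(\<eta> k has_derivative (\<lambda>v. - (cut' ((real k)\<^sup>2 * (norm x)\<^sup>2) * (2 * (real k)\<^sup>2 * (x \<bullet> v))))) (at x)" for k x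
      unfolding \<eta>_def[abs_def]
      by (rule has_derivative_eq_rhs[OF has_derivative_diff[OF has_derivative_const cut_scaled_has_derivative]]) simp
    have \<eta>m: "\<eta> k \<in> borel_measurable borel" for k
      by (intro borel_measurable_continuous_onI continuous_at_imp_continuous_on ballI has_derivative_continuous[OF \<eta>d])
    have Em: "E k \<in> borel_measurable borel" for k
    proof -
      have 1: "(\<lambda>x. cut' ((real k)\<^sup>2 * (norm x)\<^sup>2) * (2 * (real k)\<^sup>2 * (x \<bullet> b))) \<in> borel_measurable borel"
        by (intro borel_measurable_continuous_onI continuous_intros continuous_on_compose2[OF continuous_cut'[of UNIV]]) auto
      show ?thesis unfolding E_def[abs_def]
        by (intro borel_measurable_times borel_measurable_uminus um 1 borel_measurable_continuous_onI smooth_continuous sm)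
    qed
    \<comment> \<open>The gradient of the cut-off is of order k and supported in a disc of area
      pi/k^2, so the error is O(1/k). This is where dimension two gives zero capacity.\<close>
    have Ebd: "\<bar>E k x\<bar> \<le> C * M * (B * (2 * real k)) * indicator (cball 0 (1 / real k)) x" if k: "k > 0" for k x
    proof (cases "norm x \<le> 1 / real k")
      case True
      have xb: "\<bar>x \<bullet> b\<bar> \<le> 1 / real k" using Basis_le_norm[OF b, of x] True by linarith
      have "\<bar>E k x\<bar> = \<bar>u x\<bar> * \<bar>\<phi> x\<bar> * (\<bar>cut' ((real k)\<^sup>2 * (norm x)\<^sup>2)\<bar> * (2 * (real k)\<^sup>2 * \<bar>x \<bullet> b\<bar>))"
        by (simp add: E_def abs_mult)
      also have "\<dots> \<le> C * M * (B * (2 * (real k)\<^sup>2 * (1 / real k)))"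
        using bdd[of x] M[of x] B(2)[of "(real k)\<^sup>2 * (norm x)\<^sup>2"] xb C M0 B(1)
        by (intro mult_mono) auto
      also have "\<dots> = C * M * (B * (2 * real k))" using k by (simp add: power2_eq_square)
      finally show ?thesis using True by simp
    next
      case False
      have "1 \<le> (real k * norm x)" using False k by (simp add: field_simps)
      then have "1 \<le> (real k * norm x)\<^sup>2" by (simp add: one_le_power)
      then have "cut' ((real k)\<^sup>2 * (norm x)\<^sup>2) = 0" by (intro cut_bounds) (simp add: power_mult_distrib)
      then show ?thesis using False by (simp add: E_def)
    qed
    have ind: "integrable lborel (\<lambda>x::plane. c * indicator (cball 0 r) x)" for c r :: real
      by (intro integrable_mult_right integrable_real_indicator) (use emeasure_lborel_cball_finite[of "0::plane" r] in auto)
    have Eint: "integrable lborel (E k)" if "k > 0" for k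
    proof (rule Bochner_Integration.integrable_bound[OF ind])
      show "AE x in lborel. norm (E k x) \<le> norm (C * M * (B * (2 * real k)) * indicator (cball 0 (1 / real k)) x)"
        using Ebd[OF that] by (intro AE_I2) (metis abs_ge_self order_trans real_norm_def)
    qed (use Em in simp)
    have Elim: "(\<lambda>k. \<integral>x. E (Suc k) x \<partial>lborel) \<longlonglongrightarrow> 0"
    proof (rule Lim_null_comparison)
      have "\<bar>\<integral>x. E (Suc k) x \<partial>lborel\<bar> \<le> C * M * B * 2 * pi * (1 / real (Suc k))" for k
      proof -
        have "\<bar>\<integral>x. E (Suc k) x \<partial>lborel\<bar>
            \<le> (\<integral>x. C * M * (B * (2 * real (Suc k))) * indicator (cball 0 (1 / real (Suc k)) :: plane set) x \<partial>lborel)"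
          by (rule integral_abs_bound_integral[OF Eint ind]) (use Ebd[of "Suc k"] in auto)
        also have "\<dots> = C * M * (B * (2 * real (Suc k))) * measure lborel (cball 0 (1 / real (Suc k)) :: plane set)"
          by simp
        also have "measure lborel (cball 0 (1 / real (Suc k)) :: plane set) = pi * (1 / real (Suc k))\<^sup>2"
          using content_cball[of "1 / real (Suc k)" "0::plane"]
          by (simp add: unit_ball_vol_2 measure_completion power2_eq_square)
        also have "C * M * (B * (2 * real (Suc k))) * (pi * (1 / real (Suc k))\<^sup>2) = C * M * B * 2 * pi * (1 / real (Suc k))"
          by (simp add: power2_eq_square del: of_nat_Suc)
        finally show ?thesis .
      qed
      then show "\<forall>\<^sub>F k in sequentially. norm (\<integral>x. E (Suc k) x \<partial>lborel) \<le> C * M * B * 2 * pi * (1 / real (Suc k))"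
        by simp
      show "(\<lambda>k. C * M * B * 2 * pi * (1 / real (Suc k))) \<longlonglongrightarrow> 0"
        using LIMSEQ_inverse_real_of_nat by (intro tendsto_mult_right_zero) (simp add: inverse_eq_divide)
    qed
    have W\<eta>int: "integrable lborel (\<lambda>x. W x * \<eta> k x)" for k
      by (rule Bochner_Integration.integrable_bound[OF Wint])
        (use Wint \<eta>0 \<eta>m in \<open>auto simp: abs_mult mult_left_le borel_measurable_integrable\<close>)
    have zero: "(\<integral>x. W x * \<eta> (Suc k) x \<partial>lborel) + (\<integral>x. E (Suc k) x \<partial>lborel) = 0" for k
    proof -
      define D where "D x v = (G x \<bullet> v) * \<phi> x * \<eta> (Suc k) x + u x * frechet_derivative \<phi> (at x) v * \<eta> (Suc k) x
        + u x * \<phi> x * - (cut' ((real (Suc k))\<^sup>2 * (norm x)\<^sup>2) * (2 * (real (Suc k))\<^sup>2 * (x \<bullet> v)))" for x v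
      have Db: "D x b = W x * \<eta> (Suc k) x + E (Suc k) x" for x
        by (simp add: D_def W_def E_def algebra_simps)
      have "(\<integral>x. D x b \<partial>lborel) = 0"
      proof (rule integral_partial_compact_support[of "\<lambda>x. u x * \<phi> x * \<eta> (Suc k) x" D, OF _ _ b])
        show "integrable lborel (\<lambda>x. D x b)" unfolding Db using W\<eta>int Eint by simp
        show "u x * \<phi> x * \<eta> (Suc k) x = 0" if "norm x > R" for x using R[OF that] by simp
        show "((\<lambda>x. u x * \<phi> x * \<eta> (Suc k) x) has_derivative D x) (at x)" for x
        proof (cases "x = 0")
          case False
          show ?thesis
            by (rule has_derivative_eq_rhs[OF has_derivative_mult[OF has_derivative_mult[OF der[OF False] smooth_has_derivative[OF sm]] \<eta>d]])
              (simp add: D_def[abs_def] fun_eq_iff algebra_simps)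
        next
          case True
          \<comment> \<open>At the origin u need not even be continuous. The product is still
            differentiable there with derivative 0, because u is bounded while
            \<open>\<eta> (Suc k)\<close> vanishes together with its derivative.\<close>
          have \<eta>00: "\<eta> (Suc k) 0 = 0" by (simp add: \<eta>_def cut_0)
          have "(\<eta> (Suc k) has_derivative (\<lambda>v. 0)) (at 0)" using \<eta>d[of "Suc k" 0] by simp
          then have lim: "((\<lambda>y. norm (\<eta> (Suc k) y) / norm y) \<longlongrightarrow> 0) (at 0)"
            by (simp add: has_derivative_iff_norm \<eta>00)
          have bd: "norm (norm (u y * \<phi> y * \<eta> (Suc k) y) / norm y) \<le> C * M * (norm (\<eta> (Suc k) y) / norm y)" for y
          proof -
            have "\<bar>u y\<bar> * \<bar>\<phi> y\<bar> * \<bar>\<eta> (Suc k) y\<bar> \<le> C * M * \<bar>\<eta> (Suc k) y\<bar>"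
              using bdd[of y] M[of y] C M0 by (intro mult_mono) auto
            then show ?thesis by (simp add: abs_mult divide_right_mono)
          qed
          have "((\<lambda>y. norm (u y * \<phi> y * \<eta> (Suc k) y) / norm y) \<longlongrightarrow> 0) (at 0)"
            by (rule Lim_null_comparison[OF always_eventually[OF allI[OF bd]] tendsto_mult_right_zero[OF lim]])
          then have "((\<lambda>x. u x * \<phi> x * \<eta> (Suc k) x) has_derivative (\<lambda>v. 0)) (at 0)"
            by (simp add: has_derivative_iff_norm \<eta>00)
          moreover have "D 0 = (\<lambda>v. 0)" by (simp add: D_def fun_eq_iff \<eta>00)
          ultimately show ?thesis using True by simp
        qed
      qed
      then show ?thesis unfolding Db using W\<eta>int Eint[of "Suc k"] by simp
    qed
    have "(\<lambda>k. \<integral>x. W x * \<eta> (Suc k) x \<partial>lborel) \<longlonglongrightarrow> (\<integral>x. W x \<partial>lborel)"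
    proof (rule integral_dominated_convergence[where w = "\<lambda>x. norm (W x)"])
      show "AE x in lborel. (\<lambda>k. W x * \<eta> (Suc k) x) \<longlonglongrightarrow> W x"
        using AE_lborel_singleton[of 0]
      proof eventually_elim
        fix x :: plane assume x: "x \<noteq> 0"
        obtain N :: nat where N: "1 / norm x < real N" using reals_Archimedean2 by blast
        have "W x * \<eta> (Suc k) x = W x" if "k \<ge> N" for k
        proof -
          have "1 / norm x < real (Suc k)" using N that by linarith
          then have "1 \<le> real (Suc k) * norm x" using x by (simp add: field_simps)
          then have "1 \<le> (real (Suc k) * norm x)\<^sup>2" by (simp add: one_le_power)
          then show ?thesis using cut_bounds(3) by (simp add: \<eta>_def power_mult_distrib del: of_nat_Suc)
        qed
        then show "(\<lambda>k. W x * \<eta> (Suc k) x) \<longlonglongrightarrow> W x"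
          by (intro tendsto_eventually) (auto simp: eventually_sequentially)
      qed
      show "AE x in lborel. norm (W x * \<eta> (Suc k) x) \<le> norm (W x)" for k
        using \<eta>0 by (auto simp: abs_mult mult_left_le)
    qed (use Wint W\<eta>int in auto)
    then have "(\<lambda>k. (\<integral>x. W x * \<eta> (Suc k) x \<partial>lborel) + (\<integral>x. E (Suc k) x \<partial>lborel)) \<longlonglongrightarrow> (\<integral>x. W x \<partial>lborel) + 0"
      by (intro tendsto_add Elim)
    then have "(\<integral>x. W x \<partial>lborel) = 0" unfolding zero by (simp add: LIMSEQ_const_iff)
    moreover have "(\<integral>x. W x \<partial>lborel) = (\<integral>x. (G x \<bullet> b) * \<phi> x \<partial>lborel) + (\<integral>x. u x * frechet_derivative \<phi> (at x) b \<partial>lborel)"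
      unfolding W_def using tf b u G
      by (intro Bochner_Integration.integral_add test_function_integrable locally_integrable_inner)
    ultimately show ?thesis by simp
  qed
  then show ?thesis using u G by (auto simp: has_weak_gradient_def)
qed

section \<open>The fundamental lemma of the calculus of variations\<close>

lemma AE_zero_if_zero_on_boxes:
  fixes f :: "'a::euclidean_space \<Rightarrow> real"
  assumes f: "locally_integrable f"
    and zero: "\<And>a b. (\<integral>x. indicator (box a b) x * f x \<partial>lborel) = 0"
  shows "AE x in lborel. f x = 0"
proof -
  have fm: "f \<in> borel_measurable borel" by (rule locally_integrable_measurable[OF f])
  \<comment> \<open>\<open>ennreal\<close> truncates at 0, so s = 1 and s = -1 give the measures
    whose densities are the positive and the negative part of f. They agree on the boxes, an
    intersection-stable generator, and are therefore equal.\<close>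
  let ?d = "\<lambda>s. density lborel (\<lambda>x. ennreal (s * f x))"
  have int: "integrable lborel (\<lambda>x. indicator (box a b) x * f x)" for a b
  proof -
    have "set_integrable lborel (cbox a b) f" using f by (auto simp: locally_integrable_def)
    then have "set_integrable lborel (box a b) f"
      by (rule set_integrable_subset) (auto simp: box_subset_cbox)
    then show ?thesis by (simp add: set_integrable_def)
  qed
  have em: "emeasure (?d s) (box a b) = ennreal (\<integral>x. indicator (box a b) x * max 0 (s * f x) \<partial>lborel)" for s a b
  proof -
    have "emeasure (?d s) (box a b) = (\<integral>\<^sup>+x. ennreal (indicator (box a b) x * max 0 (s * f x)) \<partial>lborel)"
      using fm by (subst emeasure_density) (auto intro!: nn_integral_cong simp: indicator_def max_def ennreal_neg)
    also have "\<dots> = ennreal (\<integral>x. indicator (box a b) x * max 0 (s * f x) \<partial>lborel)"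
    proof (rule nn_integral_eq_integral)
      show "integrable lborel (\<lambda>x. indicator (box a b) x * max 0 (s * f x))"
        by (rule Bochner_Integration.integrable_bound[of _ "\<lambda>x. s * (indicator (box a b) x * f x)"])
          (use int fm in \<open>auto simp: indicator_def\<close>)
    qed auto
    finally show ?thesis .
  qed
  have eq: "emeasure (?d 1) (box a b) = emeasure (?d (-1)) (box a b)" for a b
  proof -
    have i: "integrable lborel (\<lambda>x. indicator (box a b) x * max 0 (s * f x))" for s
      by (rule Bochner_Integration.integrable_bound[of _ "\<lambda>x. s * (indicator (box a b) x * f x)"])
        (use int fm in \<open>auto simp: indicator_def\<close>)
    have "(\<integral>x. indicator (box a b) x * max 0 (1 * f x) \<partial>lborel) - (\<integral>x. indicator (box a b) x * max 0 (-1 * f x) \<partial>lborel)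
        = (\<integral>x. indicator (box a b) x * max 0 (1 * f x) - indicator (box a b) x * max 0 (-1 * f x) \<partial>lborel)"
      using i[of 1] i[of "-1"] by simp
    also have "\<dots> = (\<integral>x. indicator (box a b) x * f x \<partial>lborel)"
      by (rule Bochner_Integration.integral_cong) (auto simp: indicator_def max_def)
    finally show ?thesis unfolding em zero by simp
  qed
  have "?d 1 = ?d (-1)"
  proof (rule measure_eqI_generator_eq)
    let ?E = "range (\<lambda>(a, b). box a b::'a set)"
    show "Int_stable ?E"
      by (auto simp: Int_stable_def box_Int_box)
    show "?E \<subseteq> Pow UNIV" "sets (?d 1) = sigma_sets UNIV ?E" "sets (?d (-1)) = sigma_sets UNIV ?E"
      by (simp_all add: borel_eq_box)
    let ?A = "\<lambda>n::nat. box (- (real n *\<^sub>R One)) (real n *\<^sub>R One) :: 'a set"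
    show "range ?A \<subseteq> ?E" "(\<Union>i. ?A i) = UNIV"
      unfolding UN_box_eq_UNIV by auto
    show "emeasure (?d 1) (?A i) \<noteq> \<infinity>" for i unfolding em by simp
    show "emeasure (?d 1) X = emeasure (?d (-1)) X" if "X \<in> ?E" for X using that eq by auto
  qed
  then have "AE x in lborel. ennreal (1 * f x) = ennreal (-1 * f x)"
    using sigma_finite_measure.density_unique_iff[OF sigma_finite_lborel, of "\<lambda>x. ennreal (1 * f x)" "\<lambda>x. ennreal (-1 * f x)"] fm by simp
  then show ?thesis
  proof eventually_elim
    case (elim x)
    then show ?case by (cases "f x \<ge> 0") (auto simp: ennreal_neg ennreal_eq_0_iff)
  qed
qed

text \<open>Inside the box each factor is exp(-1/(k d)) with d the distance to a face, so the
  product is smooth, vanishes outside, and tends to the indicator of the box as k grows.\<close>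

definition box_bump :: "'a::euclidean_space \<Rightarrow> 'a \<Rightarrow> real \<Rightarrow> 'a \<Rightarrow> real" where
  "box_bump a b k x = (\<Prod>i\<in>Basis. flat 1 (1 - k * ((x - a) \<bullet> i)) * flat 1 (1 - k * ((b - x) \<bullet> i)))"

lemma smooth_prod:
  "finite I \<Longrightarrow> (\<And>i. i \<in> I \<Longrightarrow> smooth (f i)) \<Longrightarrow> smooth (\<lambda>x. \<Prod>i\<in>I. f i x)"
  by (induction I rule: finite_induct) (auto intro: smooth_const smooth_mult)

lemma smooth_box_bump: "smooth (box_bump a b k)"
  unfolding box_bump_def[abs_def]
proof (intro smooth_prod smooth_mult finite_Basis)
  fix i :: 'a
  have "smooth (\<lambda>x. flat 1 ((1 + k * (a \<bullet> i)) + x \<bullet> ((- k) *\<^sub>R i)))"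
    by (intro smooth_compose[OF smooth_flat] smooth_add smooth_const smooth_inner)
  then show "smooth (\<lambda>x. flat 1 (1 - k * ((x - a) \<bullet> i)))"
    by (simp add: algebra_simps inner_diff_left)
  have "smooth (\<lambda>x. flat 1 ((1 - k * (b \<bullet> i)) + x \<bullet> (k *\<^sub>R i)))"
    by (intro smooth_compose[OF smooth_flat] smooth_add smooth_const smooth_inner)
  then show "smooth (\<lambda>x. flat 1 (1 - k * ((b - x) \<bullet> i)))"
    by (simp add: algebra_simps inner_diff_left)
qed

lemma flat_1_bounds: "0 \<le> flat 1 t" "flat 1 t \<le> 1" "t \<ge> 1 \<Longrightarrow> flat 1 t = 0"
  by (auto simp: flat_def)

lemma box_bump_outside:
  assumes "k > 0" "x \<notin> box a b"
  shows "box_bump a b k x = 0"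
proof -
  obtain i where i: "i \<in> Basis" "\<not> (a \<bullet> i < x \<bullet> i \<and> x \<bullet> i < b \<bullet> i)"
    using assms by (auto simp: mem_box)
  then have "(x - a) \<bullet> i \<le> 0 \<or> (b - x) \<bullet> i \<le> 0" by (auto simp: inner_diff_left)
  then have "flat 1 (1 - k * ((x - a) \<bullet> i)) = 0 \<or> flat 1 (1 - k * ((b - x) \<bullet> i)) = 0"
    using assms(1) by (auto intro!: flat_1_bounds(3) simp: mult_nonneg_nonpos)
  then show ?thesis using i(1) by (auto simp: box_bump_def intro!: prod_zero)
qed

lemma box_bump_bounds: "0 \<le> box_bump a b k x" "box_bump a b k x \<le> 1"
  unfolding box_bump_def
  by (auto intro!: prod_nonneg prod_le_1 mult_nonneg_nonneg mult_le_one flat_1_bounds)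

lemma test_function_box_bump:
  assumes "k > 0"
  shows "test_function (box_bump a b k)"
proof -
  have "{x. box_bump a b k x \<noteq> 0} \<subseteq> box a b" using box_bump_outside[OF assms] by auto
  then have "bounded {x. box_bump a b k x \<noteq> 0}" using bounded_box bounded_subset by blast
  then show ?thesis by (simp add: test_function_def smooth_box_bump compact_closure)
qed

lemma box_bump_tendsto:
  "(\<lambda>k. box_bump a b (real (Suc k)) x) \<longlonglongrightarrow> indicator (box a b) x"
proof (cases "x \<in> box a b")
  case True
  have lim: "(\<lambda>k. flat 1 (1 - real (Suc k) * d)) \<longlonglongrightarrow> 1" if "d > 0" for d
  proof -
    have "(\<lambda>k. exp (- (1 / d * inverse (real (Suc k))))) \<longlonglongrightarrow> exp (- (1 / d * 0))"
      by (intro tendsto_intros LIMSEQ_inverse_real_of_nat)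
    moreover have "flat 1 (1 - real (Suc k) * d) = exp (- (1 / d * inverse (real (Suc k))))" for k
    proof -
      have "0 < real (Suc k) * d" using that by simp
      then show ?thesis by (simp add: flat_def field_simps del: of_nat_Suc)
    qed
    ultimately show ?thesis by simp
  qed
  have "(\<lambda>k. \<Prod>i\<in>Basis. flat 1 (1 - real (Suc k) * ((x - a) \<bullet> i)) * flat 1 (1 - real (Suc k) * ((b - x) \<bullet> i)))
     \<longlonglongrightarrow> (\<Prod>i\<in>(Basis::'a set). 1 * 1)"
    using True by (intro tendsto_prod tendsto_mult lim) (auto simp: mem_box inner_diff_left)
  then show ?thesis using True by (simp add: box_bump_def[abs_def] del: of_nat_Suc)
next
  case False
  then show ?thesis by (simp add: box_bump_outside del: of_nat_Suc)
qed

lemma AE_zero_if_zero_on_test_functions: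
  fixes f :: "'a::euclidean_space \<Rightarrow> real"
  assumes f: "locally_integrable f"
    and zero: "\<And>\<phi>. test_function \<phi> \<Longrightarrow> (\<integral>x. f x * \<phi> x \<partial>lborel) = 0"
  shows "AE x in lborel. f x = 0"
proof (rule AE_zero_if_zero_on_boxes[OF f])
  fix a b :: 'a
  have fm: "f \<in> borel_measurable borel" by (rule locally_integrable_measurable[OF f])
  have "(\<lambda>k. \<integral>x. f x * box_bump a b (real (Suc k)) x \<partial>lborel) \<longlonglongrightarrow> (\<integral>x. f x * indicator (box a b) x \<partial>lborel)"
  proof (rule integral_dominated_convergence[where w = "\<lambda>x. norm (indicator (cbox a b) x *\<^sub>R f x)"])
    show "integrable lborel (\<lambda>x. norm (indicator (cbox a b) x *\<^sub>R f x))"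
      using f by (intro integrable_norm) (auto simp: locally_integrable_def set_integrable_def)
    show "AE x in lborel. (\<lambda>k. f x * box_bump a b (real (Suc k)) x) \<longlonglongrightarrow> f x * indicator (box a b) x"
      by (intro AE_I2 tendsto_mult tendsto_const box_bump_tendsto)
    show "AE x in lborel. norm (f x * box_bump a b (real (Suc k)) x) \<le> norm (indicator (cbox a b) x *\<^sub>R f x)" for k
    proof (rule AE_I2)
      fix x
      show "norm (f x * box_bump a b (real (Suc k)) x) \<le> norm (indicator (cbox a b) x *\<^sub>R f x)"
      proof (cases "x \<in> cbox a b")
        case True
        then show ?thesis using box_bump_bounds[of a b "real (Suc k)" x] by (simp add: abs_mult mult_left_le)
      next
        case False
        then have "x \<notin> box a b" using box_subset_cbox by blast
        then show ?thesis by (simp add: box_bump_outside del: of_nat_Suc)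
      qed
    qed
    show "(\<lambda>x. f x * box_bump a b (real (Suc k)) x) \<in> borel_measurable lborel" for k
      using borel_measurable_times[OF fm borel_measurable_continuous_onI[OF
          smooth_continuous[OF smooth_box_bump[of a b "real (Suc k)"]]]] by simp
  qed (use fm in simp)
  moreover have "(\<integral>x. f x * box_bump a b (real (Suc k)) x \<partial>lborel) = 0" for k
    by (intro zero test_function_box_bump) simp
  ultimately show "(\<integral>x. indicator (box a b) x * f x \<partial>lborel) = 0"
    by (simp add: LIMSEQ_const_iff mult.commute)
qed

text \<open>Needed because \<open>weak_differential\<close> is an arbitrary choice: it lets every
  explicitly computed gradient replace the chosen one almost everywhere.\<close>

lemma has_weak_gradient_unique:
  assumes "has_weak_gradient u G" "has_weak_gradient u G'"
  shows "AE x in lborel. G x = G' x"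
proof -
  have "AE x in lborel. G x \<bullet> b - G' x \<bullet> b = 0" if b: "b \<in> Basis" for b
  proof (rule AE_zero_if_zero_on_test_functions)
    have l: "locally_integrable (\<lambda>x. G x \<bullet> b)" "locally_integrable (\<lambda>x. G' x \<bullet> b)"
      using assms by (auto simp: has_weak_gradient_def locally_integrable_inner)
    show "locally_integrable (\<lambda>x. G x \<bullet> b - G' x \<bullet> b)"
      using locally_integrable_add[OF l(1) locally_integrable_scale[OF l(2), of "-1"]] by simp
    show "(\<integral>x. (G x \<bullet> b - G' x \<bullet> b) * \<phi> x \<partial>lborel) = 0" if "test_function \<phi>" for \<phi>
      using assms that b test_function_integrable(1)[OF that l(1)] test_function_integrable(1)[OF that l(2)]
      by (auto simp: has_weak_gradient_def left_diff_distrib)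
  qed
  then have "AE x in lborel. \<forall>b\<in>Basis. G x \<bullet> b - G' x \<bullet> b = 0"
    by (intro AE_finite_allI) auto
  then show ?thesis
    by eventually_elim (auto intro: euclidean_eqI)
qed

section \<open>Completeness of spaces of square integrable functions\<close>

lemma norm_add_square_le: "(norm (a + b))\<^sup>2 \<le> 2 * (norm a)\<^sup>2 + 2 * (norm (b::'b::real_normed_vector))\<^sup>2"
proof -
  have "(norm (a + b))\<^sup>2 \<le> (norm a + norm b)\<^sup>2" by (intro power_mono norm_triangle_ineq) auto
  also have "\<dots> \<le> 2 * (norm a)\<^sup>2 + 2 * (norm b)\<^sup>2"
    using zero_le_power2[of "norm a - norm b"] by (simp add: power2_eq_square algebra_simps)
  finally show ?thesis .
qed

text \<open>Riesz-Fischer. Along a subsequence whose squared increments d_k have integral at most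
  4^(-k), the sum of the 2^k d_k is finite almost everywhere, so the increments decay geometrically.
  Only differences are assumed square integrable, and vector values allow gradients and functions to
  be treated together.\<close>

lemma L2_complete:
  fixes f :: "nat \<Rightarrow> 'a \<Rightarrow> 'b::{banach,second_countable_topology}"
  assumes m: "\<And>i. f i \<in> borel_measurable M"
    and sq: "\<And>i j. integrable M (\<lambda>x. (norm (f i x - f j x))\<^sup>2)"
    and cauchy: "\<And>e. e > 0 \<Longrightarrow> \<exists>N. \<forall>i\<ge>N. \<forall>j\<ge>N. (\<integral>x. (norm (f i x - f j x))\<^sup>2 \<partial>M) \<le> e"
  obtains g r where "g \<in> borel_measurable M" "strict_mono (r :: nat \<Rightarrow> nat)"
    "AE x in M. (\<lambda>k. f (r k) x) \<longlonglongrightarrow> g x"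
    "\<And>i. integrable M (\<lambda>x. (norm (f i x - g x))\<^sup>2)"
    "(\<lambda>i. \<integral>x. (norm (f i x - g x))\<^sup>2 \<partial>M) \<longlonglongrightarrow> 0"
proof -
  have "\<forall>k. \<exists>N. \<forall>i\<ge>N. \<forall>j\<ge>N. (\<integral>x. (norm (f i x - f j x))\<^sup>2 \<partial>M) \<le> (1/4) ^ k"
    using cauchy by simp
  then obtain N where N: "\<And>k i j. i \<ge> N k \<Longrightarrow> j \<ge> N k \<Longrightarrow> (\<integral>x. (norm (f i x - f j x))\<^sup>2 \<partial>M) \<le> (1/4) ^ k"
    by metis
  \<comment> \<open>The sum makes r k at least N k, and the summand k makes r strictly
    increasing.\<close>
  define r where "r k = (\<Sum>i\<le>k. N i) + k" for k :: nat
  have r: "strict_mono r" by (rule strict_mono_Suc_iff[THEN iffD2]) (simp add: r_def)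
  have rN: "r k \<ge> N k" for k
  proof -
    have "N k \<le> (\<Sum>i\<le>k. N i)" by (rule member_le_sum) auto
    then show ?thesis by (simp add: r_def)
  qed
  define d where "d k x = (norm (f (r (Suc k)) x - f (r k) x))\<^sup>2" for k x
  have dm: "d k \<in> borel_measurable M" for k unfolding d_def[abs_def] using m by measurable
  have dint: "(\<integral>\<^sup>+x. ennreal (d k x) \<partial>M) \<le> ennreal ((1/4) ^ k)" for k
  proof -
    have "(\<integral>\<^sup>+x. ennreal (d k x) \<partial>M) = ennreal (\<integral>x. d k x \<partial>M)"
      unfolding d_def by (intro nn_integral_eq_integral sq) auto
    also have "\<dots> \<le> ennreal ((1/4) ^ k)"
      unfolding d_def using rN[of k] strict_monoD[OF r, of k "Suc k"] by (intro ennreal_leI N) auto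
    finally show ?thesis .
  qed
  have "(\<integral>\<^sup>+x. (\<Sum>k. ennreal (2 ^ k * d k x)) \<partial>M) = (\<Sum>k. \<integral>\<^sup>+x. ennreal (2 ^ k * d k x) \<partial>M)"
    using dm by (intro nn_integral_suminf) simp
  also have "\<dots> = (\<Sum>k. ennreal (2 ^ k) * (\<integral>\<^sup>+x. ennreal (d k x) \<partial>M))"
  proof -
    have "ennreal (2 ^ k * d k x) = ennreal (2 ^ k) * ennreal (d k x)" for k x
      by (simp add: ennreal_mult d_def)
    then show ?thesis using dm by (simp add: nn_integral_cmult)
  qed
  also have "\<dots> \<le> (\<Sum>k. ennreal ((1/2) ^ k))"
  proof (intro suminf_le summableI)
    fix k
    have "ennreal (2 ^ k) * (\<integral>\<^sup>+x. ennreal (d k x) \<partial>M) \<le> ennreal (2 ^ k) * ennreal ((1/4) ^ k)"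
      by (intro mult_left_mono dint) auto
    also have "\<dots> = ennreal ((1/2) ^ k)"
      by (simp add: ennreal_mult[symmetric] power_mult_distrib[symmetric])
    finally show "ennreal (2 ^ k) * (\<integral>\<^sup>+x. ennreal (d k x) \<partial>M) \<le> ennreal ((1/2) ^ k)" .
  qed
  also have "\<dots> = ennreal (\<Sum>k. (1/2) ^ k)"
    by (intro suminf_ennreal2) (auto intro: summable_geometric)
  also have "\<dots> < \<infinity>" by simp
  finally have "AE x in M. (\<Sum>k. ennreal (2 ^ k * d k x)) \<noteq> \<infinity>"
    using dm by (intro nn_integral_PInf_AE) (auto simp: less_top)
  then have conv: "AE x in M. convergent (\<lambda>k. f (r k) x)"
  proof eventually_elim
    case (elim x)
    have "summable (\<lambda>k. 2 ^ k * d k x)"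
      using elim by (intro summable_suminf_not_top) (auto simp: d_def)
    then have "(\<lambda>k. 2 ^ k * d k x) \<longlonglongrightarrow> 0" by (rule summable_LIMSEQ_zero)
    then have "Bseq (\<lambda>k. 2 ^ k * d k x)" by (intro convergent_imp_Bseq convergentI)
    then obtain S where S: "\<And>k. \<bar>2 ^ k * d k x\<bar> \<le> S"
      unfolding Bseq_def real_norm_def by blast
    have le: "norm (f (r (Suc k)) x - f (r k) x) \<le> sqrt S * (sqrt (1/2)) ^ k" for k
    proof -
      have "d k x \<le> S * (1/2) ^ k" using S[of k] by (simp add: d_def field_simps power_divide)
      then have "sqrt (d k x) \<le> sqrt (S * (1/2) ^ k)" by simp
      then show ?thesis by (simp add: d_def real_sqrt_mult real_sqrt_power)
    qed
    have sm: "summable (\<lambda>k. sqrt S * (sqrt (1/2)) ^ k)"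
      by (intro summable_mult summable_geometric) (auto simp: real_sqrt_less_iff)
    have "summable (\<lambda>k. f (r (Suc k)) x - f (r k) x)"
      by (rule summable_comparison_test'[OF sm le])
    then have "convergent (\<lambda>k. \<Sum>i<k. f (r (Suc i)) x - f (r i) x)" by (simp add: summable_iff_convergent)
    then have "convergent (\<lambda>k. f (r k) x - f (r 0) x)" using sum_lessThan_telescope[of "\<lambda>k. f (r k) x"] by simp
    then show ?case by (simp add: convergent_diff_const_right_iff)
  qed
  define g where "g x = lim (\<lambda>k. f (r k) x)" for x
  have gm: "g \<in> borel_measurable M" unfolding g_def[abs_def] by (rule borel_measurable_lim_metric) (rule m)
  have lim: "AE x in M. (\<lambda>k. f (r k) x) \<longlonglongrightarrow> g x"
    using conv by eventually_elim (simp add: g_def convergent_LIMSEQ_iff)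
  \<comment> \<open>Fatou's lemma carries the Cauchy bound from f_j to the almost everywhere limit
    of the subsequence, for every fixed i.\<close>
  have fatou: "(\<integral>\<^sup>+x. ennreal ((norm (f i x - g x))\<^sup>2) \<partial>M) \<le> ennreal e"
    if e: "\<And>j. j \<ge> N' \<Longrightarrow> (\<integral>x. (norm (f i x - f j x))\<^sup>2 \<partial>M) \<le> e" for i e N'
  proof -
    have "(\<integral>\<^sup>+x. ennreal ((norm (f i x - g x))\<^sup>2) \<partial>M)
        = (\<integral>\<^sup>+x. liminf (\<lambda>k. ennreal ((norm (f i x - f (r k) x))\<^sup>2)) \<partial>M)"
    proof (rule nn_integral_cong_AE)
      show "AE x in M. ennreal ((norm (f i x - g x))\<^sup>2) = liminf (\<lambda>k. ennreal ((norm (f i x - f (r k) x))\<^sup>2))"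
        using lim
      proof eventually_elim
        case (elim x)
        have "(\<lambda>k. ennreal ((norm (f i x - f (r k) x))\<^sup>2)) \<longlonglongrightarrow> ennreal ((norm (f i x - g x))\<^sup>2)"
          by (rule tendsto_ennrealI[OF tendsto_power[OF tendsto_norm[OF tendsto_diff[OF tendsto_const elim]]]])
        then show ?case by (rule lim_imp_Liminf[OF trivial_limit_sequentially, symmetric])
      qed
    qed
    also have "\<dots> \<le> liminf (\<lambda>k. \<integral>\<^sup>+x. ennreal ((norm (f i x - f (r k) x))\<^sup>2) \<partial>M)"
      using m by (intro nn_integral_liminf) simp
    also have "\<dots> \<le> ennreal e"
    proof (rule Liminf_le)
      show "\<forall>\<^sub>F k in sequentially. (\<integral>\<^sup>+x. ennreal ((norm (f i x - f (r k) x))\<^sup>2) \<partial>M) \<le> ennreal e"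
        unfolding eventually_sequentially
      proof (intro exI[of _ N'] allI impI)
        fix k assume "k \<ge> N'"
        then have "r k \<ge> N'" using seq_suble[OF r, of k] by linarith
        have "(\<integral>\<^sup>+x. ennreal ((norm (f i x - f (r k) x))\<^sup>2) \<partial>M) = ennreal (\<integral>x. (norm (f i x - f (r k) x))\<^sup>2 \<partial>M)"
          by (intro nn_integral_eq_integral sq) auto
        also have "\<dots> \<le> ennreal e" by (intro ennreal_leI e) fact
        finally show "(\<integral>\<^sup>+x. ennreal ((norm (f i x - f (r k) x))\<^sup>2) \<partial>M) \<le> ennreal e" .
      qed
    qed auto
    finally show ?thesis .
  qed
  obtain N1 where N1: "\<And>i j. i \<ge> N1 \<Longrightarrow> j \<ge> N1 \<Longrightarrow> (\<integral>x. (norm (f i x - f j x))\<^sup>2 \<partial>M) \<le> 1"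
    using cauchy[of 1] by auto
  have int1: "integrable M (\<lambda>x. (norm (f i x - g x))\<^sup>2)" if "i \<ge> N1" for i
  proof (rule integrableI_bounded)
    show "(\<lambda>x. (norm (f i x - g x))\<^sup>2) \<in> borel_measurable M" using m gm by measurable
    have "(\<integral>\<^sup>+x. ennreal ((norm (f i x - g x))\<^sup>2) \<partial>M) \<le> ennreal 1" by (rule fatou[OF N1[OF that]])
    then show "(\<integral>\<^sup>+x. ennreal (norm ((norm (f i x - g x))\<^sup>2)) \<partial>M) < \<infinity>"
      by (simp add: order_le_less_trans[OF _ ennreal_one_less_top])
  qed
  have int: "integrable M (\<lambda>x. (norm (f i x - g x))\<^sup>2)" for i
  proof (rule Bochner_Integration.integrable_bound)
    show "integrable M (\<lambda>x. 2 * (norm (f i x - f N1 x))\<^sup>2 + 2 * (norm (f N1 x - g x))\<^sup>2)"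
      using sq int1[OF order_refl] by simp
    show "(\<lambda>x. (norm (f i x - g x))\<^sup>2) \<in> borel_measurable M" using m gm by measurable
    show "AE x in M. norm ((norm (f i x - g x))\<^sup>2) \<le> norm (2 * (norm (f i x - f N1 x))\<^sup>2 + 2 * (norm (f N1 x - g x))\<^sup>2)"
    proof (rule AE_I2)
      fix x
      show "norm ((norm (f i x - g x))\<^sup>2) \<le> norm (2 * (norm (f i x - f N1 x))\<^sup>2 + 2 * (norm (f N1 x - g x))\<^sup>2)"
        using norm_add_square_le[of "f i x - f N1 x" "f N1 x - g x"] by simp
    qed
  qed
  have "(\<lambda>i. \<integral>x. (norm (f i x - g x))\<^sup>2 \<partial>M) \<longlonglongrightarrow> 0"
  proof (rule LIMSEQ_I)
    fix e :: real assume e: "e > 0"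
    obtain N2 where N2: "\<And>i j. i \<ge> N2 \<Longrightarrow> j \<ge> N2 \<Longrightarrow> (\<integral>x. (norm (f i x - f j x))\<^sup>2 \<partial>M) \<le> e / 2"
      using cauchy[of "e / 2"] e by auto
    have "norm ((\<integral>x. (norm (f i x - g x))\<^sup>2 \<partial>M) - 0) < e" if "i \<ge> N2" for i
    proof -
      have "ennreal (\<integral>x. (norm (f i x - g x))\<^sup>2 \<partial>M) = (\<integral>\<^sup>+x. ennreal ((norm (f i x - g x))\<^sup>2) \<partial>M)"
        by (intro nn_integral_eq_integral[symmetric] int) auto
      also have "\<dots> \<le> ennreal (e / 2)" by (rule fatou[OF N2[OF that]])
      finally have "(\<integral>x. (norm (f i x - g x))\<^sup>2 \<partial>M) \<le> e / 2" using e by (simp add: ennreal_le_iff)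
      then show ?thesis using e by simp
    qed
    then show "\<exists>no. \<forall>n\<ge>no. norm ((\<integral>x. (norm (f n x - g x))\<^sup>2 \<partial>M) - 0) < e" by blast
  qed
  then show ?thesis using that gm r lim int by blast
qed

section \<open>The two stereographic charts\<close>

text \<open>The change of variables theorem is formulated on \<open>real^2\<close>, where the
  derivative has a matrix and a determinant; this isomorphism transports it to the plane.\<close>

definition vec_of_plane :: "plane \<Rightarrow> real^2" where
  "vec_of_plane x = (\<chi> i. if i = 1 then fst x else snd x)"

definition plane_of_vec :: "real^2 \<Rightarrow> plane" where
  "plane_of_vec v = (v $ 1, v $ 2)"

lemma plane_of_vec_inverse [simp]: "plane_of_vec (vec_of_plane x) = x" "vec_of_plane (plane_of_vec v) = v"
  by (auto simp: plane_of_vec_def vec_of_plane_def vec_eq_iff forall_2)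

lemma bounded_linear_vec_of_plane: "bounded_linear vec_of_plane"
  by (auto simp: linear_conv_bounded_linear[symmetric] vec_of_plane_def vec_eq_iff intro!: linearI)

lemma bounded_linear_plane_of_vec: "bounded_linear plane_of_vec"
  by (auto simp: linear_conv_bounded_linear[symmetric] plane_of_vec_def intro!: linearI)

lemma plane_of_vec_measurable: "plane_of_vec \<in> borel_measurable borel"
  by (intro borel_measurable_continuous_onI linear_continuous_on bounded_linear_plane_of_vec)

lemma distr_plane_of_vec: "distr lborel borel plane_of_vec = lborel"
proof (rule lborel_eqI[symmetric])
  fix l u :: plane
  assume le: "\<And>b. b \<in> Basis \<Longrightarrow> l \<bullet> b \<le> u \<bullet> b"
  have "plane_of_vec -` box l u = box (vec_of_plane l) (vec_of_plane u)"
    by (auto simp: mem_box plane_of_vec_def vec_of_plane_def Basis_plane Basis_vec_def UNIV_2 inner_axis inner_prod_def)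
  then have "emeasure (distr lborel borel plane_of_vec) (box l u)
      = emeasure lborel (box (vec_of_plane l) (vec_of_plane u))"
    using plane_of_vec_measurable by (subst emeasure_distr) auto
  also have "\<dots> = (\<Prod>b\<in>Basis. (vec_of_plane u - vec_of_plane l) \<bullet> b)"
    using le[of "(1, 0)"] le[of "(0, 1)"] by (intro emeasure_lborel_box)
      (auto simp: Basis_plane Basis_vec_def UNIV_2 inner_axis vec_of_plane_def inner_prod_def)
  also have "(\<Prod>b\<in>Basis. (vec_of_plane u - vec_of_plane l) \<bullet> b) = (\<Prod>b\<in>Basis. (u - l) \<bullet> b)"
    by (simp add: Basis_plane Basis_vec_def UNIV_2 inner_axis vec_of_plane_def axis_eq_axis inner_prod_def)
  finally show "emeasure (distr lborel borel plane_of_vec) (box l u) = (\<Prod>b\<in>Basis. (u - l) \<bullet> b)" .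
qed simp

lemma integral_plane_of_vec:
  fixes f :: "plane \<Rightarrow> real"
  assumes "f \<in> borel_measurable borel"
  shows "integrable lborel (\<lambda>v. f (plane_of_vec v)) \<longleftrightarrow> integrable lborel f"
    and "(\<integral>v. f (plane_of_vec v) \<partial>lborel) = (\<integral>x. f x \<partial>lborel)"
  using integrable_distr_eq[of plane_of_vec lborel borel f] integral_distr[of plane_of_vec lborel borel f]
    assms plane_of_vec_measurable by (simp_all add: distr_plane_of_vec)

text \<open>J is the absolute value of the Jacobian determinant, written out in partial derivatives.
  Maps of S onto itself cover the two applications, the rotations and the inversion.\<close>

lemma lebesgue_change_of_variables_plane:
  fixes f :: "plane \<Rightarrow> real" and g :: "plane \<Rightarrow> plane"
  assumes S: "S \<in> sets borel" and gS: "g ` S = S"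
    and der: "\<And>x. x \<in> S \<Longrightarrow> (g has_derivative g' x) (at x)" and inj: "inj_on g S"
    and J: "\<And>x. x \<in> S \<Longrightarrow> J x = \<bar>fst (g' x (1, 0)) * snd (g' x (0, 1)) - fst (g' x (0, 1)) * snd (g' x (1, 0))\<bar>"
    and f: "integrable lborel f" and m: "(\<lambda>x. indicator S x * (J x * f (g x))) \<in> borel_measurable borel"
  shows "(\<integral>x. indicator S x * (J x * f (g x)) \<partial>lborel) = (\<integral>x. indicator S x * f x \<partial>lborel)"
proof -
  let ?S = "plane_of_vec -` S"
  let ?g = "\<lambda>v. vec_of_plane (g (plane_of_vec v))"
  let ?g' = "\<lambda>v h. vec_of_plane (g' (plane_of_vec v) (plane_of_vec h))"
  \<comment> \<open>The transformation formula is stated for vector-valued functions, so scalars are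
    regarded as elements of \<open>real^1\<close>.\<close>
  let ?f = "\<lambda>v. vec (f (plane_of_vec v)) :: real^1"
  have fm: "f \<in> borel_measurable borel" using f by auto
  have Sb: "?S \<in> sets borel" using measurable_sets[OF plane_of_vec_measurable S] by simp
  have S': "?S \<in> sets lebesgue" using Sb by simp
  have d: "(?g has_derivative ?g' v) (at v within ?S)" if "v \<in> ?S" for v
  proof -
    have "(g has_derivative g' (plane_of_vec v)) (at (plane_of_vec v))" using der that by simp
    then have "((\<lambda>v. g (plane_of_vec v)) has_derivative (\<lambda>h. g' (plane_of_vec v) (plane_of_vec h))) (at v)"
      by (rule has_derivative_compose[OF bounded_linear_imp_has_derivative[OF bounded_linear_plane_of_vec]])
    from bounded_linear.has_derivative[OF bounded_linear_vec_of_plane this]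
    show ?thesis by (rule has_derivative_at_withinI)
  qed
  have inj': "inj_on ?g ?S"
  proof (rule inj_onI)
    fix v w assume vw: "v \<in> ?S" "w \<in> ?S" "?g v = ?g w"
    then have "g (plane_of_vec v) = g (plane_of_vec w)" by (metis plane_of_vec_inverse(1))
    then have "plane_of_vec v = plane_of_vec w" using inj vw by (auto dest: inj_onD)
    then show "v = w" by (metis plane_of_vec_inverse(2))
  qed
  have im: "?g ` ?S = ?S"
  proof (intro equalityI subsetI)
    fix w assume "w \<in> ?g ` ?S"
    then show "w \<in> ?S" using gS by auto
  next
    fix v assume "v \<in> ?S"
    then have "plane_of_vec v \<in> g ` S" unfolding gS by simp
    then obtain y where y: "y \<in> S" "plane_of_vec v = g y" by blast
    have "v = ?g (vec_of_plane y)" using plane_of_vec_inverse(2)[of v] by (simp add: y(2))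
    then show "v \<in> ?g ` ?S" using y(1) by (intro image_eqI[of _ _ "vec_of_plane y"]) auto
  qed
  have det: "\<bar>det (matrix (?g' v))\<bar> = J (plane_of_vec v)" if "v \<in> ?S" for v
  proof -
    have "plane_of_vec (axis 1 1) = (1, 0)" "plane_of_vec (axis 2 1) = (0, 1)"
      by (simp_all add: plane_of_vec_def axis_def)
    then show ?thesis using J that
      by (simp add: det_2 matrix_def vec_of_plane_def)
  qed
  have fi: "integrable lborel (\<lambda>v. indicator ?S v *\<^sub>R f (plane_of_vec v))"
  proof -
    have "integrable lborel (\<lambda>v. f (plane_of_vec v))" using f by (simp add: integral_plane_of_vec(1)[OF fm])
    then show ?thesis by (rule integrable_mult_indicator[rotated]) (use Sb in simp)
  qed
  have ab: "(\<lambda>v. f (plane_of_vec v)) absolutely_integrable_on ?S"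
    unfolding set_integrable_def
    by (subst integrable_completion) (use fi in auto)
  have "?f absolutely_integrable_on ?g ` ?S \<and> integral (?g ` ?S) ?f = vec (integral ?S (\<lambda>v. f (plane_of_vec v)))"
    unfolding im absolutely_integrable_on_1_iff integral_on_1_eq using ab by simp
  with has_absolute_integral_change_of_variables[OF S' d inj', of ?f "vec (integral ?S (\<lambda>v. f (plane_of_vec v)))"]
  have res: "(\<lambda>v. \<bar>det (matrix (?g' v))\<bar> *\<^sub>R ?f (?g v)) absolutely_integrable_on ?S"
    "integral ?S (\<lambda>v. \<bar>det (matrix (?g' v))\<bar> *\<^sub>R ?f (?g v)) = vec (integral ?S (\<lambda>v. f (plane_of_vec v)))"
    by auto
  have ab': "(\<lambda>v. J (plane_of_vec v) * f (g (plane_of_vec v))) absolutely_integrable_on ?S"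
  proof -
    have "(\<lambda>v. \<bar>det (matrix (?g' v))\<bar> * f (g (plane_of_vec v))) absolutely_integrable_on ?S"
      using res(1) unfolding absolutely_integrable_on_1_iff by simp
    moreover have "set_integrable lebesgue ?S (\<lambda>v. \<bar>det (matrix (?g' v))\<bar> * f (g (plane_of_vec v)))
        = set_integrable lebesgue ?S (\<lambda>v. J (plane_of_vec v) * f (g (plane_of_vec v)))"
      by (rule set_integrable_cong) (simp_all only: det)
    ultimately show ?thesis by blast
  qed
  have "integral ?S (\<lambda>v. J (plane_of_vec v) * f (g (plane_of_vec v))) = integral ?S (\<lambda>v. \<bar>det (matrix (?g' v))\<bar> * f (g (plane_of_vec v)))"
    using det by (intro Henstock_Kurzweil_Integration.integral_cong) auto
  also have "\<dots> = integral ?S (\<lambda>v. f (plane_of_vec v))"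
    using res(2) unfolding integral_on_1_eq by (simp add: vec_eq_iff)
  finally have eq: "integral ?S (\<lambda>v. J (plane_of_vec v) * f (g (plane_of_vec v))) = integral ?S (\<lambda>v. f (plane_of_vec v))" .
  have leb: "(LINT v:?S|lebesgue. h (plane_of_vec v)) = (\<integral>x. indicator S x * h x \<partial>lborel)"
    if h: "(\<lambda>x. indicator S x * h x) \<in> borel_measurable borel" for h :: "plane \<Rightarrow> real"
  proof -
    have "(LINT v:?S|lebesgue. h (plane_of_vec v)) = (\<integral>v. indicator S (plane_of_vec v) * h (plane_of_vec v) \<partial>lebesgue)"
      by (simp add: set_lebesgue_integral_def indicator_def)
    also have "\<dots> = (\<integral>v. indicator S (plane_of_vec v) * h (plane_of_vec v) \<partial>lborel)"
      using measurable_compose[OF plane_of_vec_measurable h] by (intro integral_completion) simp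
    also have "\<dots> = (\<integral>x. indicator S x * h x \<partial>lborel)" by (rule integral_plane_of_vec(2)[OF h])
    finally show ?thesis .
  qed
  have fS: "(\<lambda>x. indicator S x * f x) \<in> borel_measurable borel" using fm S by simp
  show ?thesis
    using set_lebesgue_integral_eq_integral(2)[OF ab] set_lebesgue_integral_eq_integral(2)[OF ab'] eq
      leb[OF fS] leb[OF m] by simp
qed

section \<open>Rotations of the plane\<close>

definition rotation :: "real \<Rightarrow> plane \<Rightarrow> plane" where
  "rotation \<alpha> x = (cos \<alpha> * fst x - sin \<alpha> * snd x, sin \<alpha> * fst x + cos \<alpha> * snd x)"

lemma rotation_linear: "bounded_linear (rotation \<alpha>)"
  by (auto simp: linear_conv_bounded_linear[symmetric] rotation_def algebra_simps intro!: linearI)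

lemma rotation_inverse: "rotation (- \<alpha>) (rotation \<alpha> x) = x"
proof -
  have "cos \<alpha> * (cos \<alpha> * a) + sin \<alpha> * (sin \<alpha> * a) = a" for a
    using sin_cos_squared_add[of \<alpha>] by (metis distrib_right mult.assoc mult_1 power2_eq_square add.commute)
  then show ?thesis by (simp add: rotation_def prod_eq_iff algebra_simps)
qed

lemma integral_rotation:
  fixes f :: "plane \<Rightarrow> real"
  assumes f: "integrable lborel f"
  shows "(\<integral>x. f (rotation \<alpha> x) \<partial>lborel) = (\<integral>x. f x \<partial>lborel)"
proof -
  have m: "rotation \<alpha> \<in> borel_measurable borel"
    by (intro borel_measurable_continuous_onI linear_continuous_on rotation_linear)
  have fm: "f \<in> borel_measurable borel" using f by auto
  have "(\<integral>x. indicator UNIV x * (1 * f (rotation \<alpha> x)) \<partial>lborel) = (\<integral>x. indicator UNIV x * f x \<partial>lborel)"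
  proof (rule lebesgue_change_of_variables_plane[OF _ _ _ _ _ f, where g' = "\<lambda>x. rotation \<alpha>"])
    show "range (rotation \<alpha>) = UNIV"
      by (metis minus_minus rotation_inverse surjI)
    show "inj (rotation \<alpha>)" by (metis injI rotation_inverse)
    show "(rotation \<alpha> has_derivative rotation \<alpha>) (at x)" for x
      by (rule bounded_linear_imp_has_derivative[OF rotation_linear])
    show "1 = \<bar>fst (rotation \<alpha> (1, 0)) * snd (rotation \<alpha> (0, 1)) - fst (rotation \<alpha> (0, 1)) * snd (rotation \<alpha> (1, 0))\<bar>"
      using sin_cos_squared_add[of \<alpha>] by (simp add: rotation_def power2_eq_square add.commute)
    show "(\<lambda>x. indicator UNIV x * (1 * f (rotation \<alpha> x))) \<in> borel_measurable borel"
      using measurable_compose[OF m fm] by simp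
  qed auto
  then show ?thesis by simp
qed

section \<open>The conformal factor and integrability of powers of 1 + r^2\<close>

lemma norm_plane: "(norm (x::plane))\<^sup>2 = (fst x)\<^sup>2 + (snd x)\<^sup>2"
  by (simp add: norm_prod_def)

lemma one_plus_norm_pos [simp]: "1 + (norm x)\<^sup>2 > 0" "1 + (norm x)\<^sup>2 \<noteq> 0"
  by (simp_all add: add_pos_nonneg less_imp_neq[symmetric])

lemma conf_pos [simp]: "conf x > 0" "conf x \<noteq> 0" "conf x \<ge> 0"
  by (simp_all add: conf_def less_imp_le)

lemma continuous_conf: "continuous_on A conf"
  unfolding conf_def[abs_def] by (intro continuous_intros) (auto simp: zero_less_power)

lemma conf_measurable [measurable]: "conf \<in> borel_measurable borel"
  by (intro borel_measurable_continuous_onI continuous_conf)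

lemma square_powr: "t > 0 \<Longrightarrow> (t\<^sup>2) powr a = t powr (2 * a)" for t :: real
  by (simp add: powr_powr flip: powr_numeral)

text \<open>The integrand is compared with (1 + |t|)^(-2p), which has an elementary antiderivative;
  (1 + |t|)^2 <= 2 (1 + t^2) accounts for the constant 2^p.\<close>

lemma integrable_inverse_power_1:
  fixes p :: real assumes p: "p > 1/2"
  shows "(\<integral>\<^sup>+t. ennreal ((1 + t\<^sup>2) powr - p) \<partial>lborel) < \<infinity>"
proof -
  define g where "g t = (1 + \<bar>t\<bar>) powr (- 2 * p)" for t :: real
  have gm: "g \<in> borel_measurable borel" unfolding g_def[abs_def] by measurable
  have g0: "(\<integral>\<^sup>+t. ennreal (g t) * indicator {0..} t \<partial>lborel) < \<infinity>"
  proof -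
    have "(\<integral>\<^sup>+t. ennreal (g t) * indicator {0..} t \<partial>lborel) = ennreal (0 - (1 + 0) powr (1 - 2 * p) / (1 - 2 * p))"
    proof (rule nn_integral_FTC_atLeast[OF gm])
      show "((\<lambda>t. (1 + t) powr (1 - 2 * p) / (1 - 2 * p)) has_real_derivative g t) (at t)" if "0 \<le> t" for t
        using that p by (auto intro!: derivative_eq_intros simp: g_def)
      have "((\<lambda>t. (1 + t) powr (1 - 2 * p)) \<longlongrightarrow> 0) at_top"
        using p by (intro tendsto_neg_powr filterlim_tendsto_add_at_top[OF tendsto_const filterlim_ident]) auto
      then show "((\<lambda>t. (1 + t) powr (1 - 2 * p) / (1 - 2 * p)) \<longlongrightarrow> 0) at_top"
        using tendsto_divide[OF _ tendsto_const[of "1 - 2 * p"]] p by fastforce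
    qed (simp add: g_def)
    then show ?thesis by simp
  qed
  have le: "(1 + t\<^sup>2) powr - p \<le> 2 powr p * g t" for t
  proof -
    have "(1 + \<bar>t\<bar>)\<^sup>2 \<le> 2 * (1 + t\<^sup>2)"
      using zero_le_power2[of "1 - \<bar>t\<bar>"] by (simp add: power2_eq_square algebra_simps)
    then have "(1 + \<bar>t\<bar>)\<^sup>2 / 2 \<le> 1 + t\<^sup>2" by simp
    then have "(1 + t\<^sup>2) powr - p \<le> ((1 + \<bar>t\<bar>)\<^sup>2 / 2) powr - p"
      using p by (intro powr_mono2') (auto simp: zero_less_power)
    also have "\<dots> = ((1 + \<bar>t\<bar>)\<^sup>2) powr - p / 2 powr - p"
      by (simp add: powr_divide)
    also have "\<dots> = ((1 + \<bar>t\<bar>)\<^sup>2) powr - p * 2 powr p"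
      by (simp add: powr_minus_divide[of 2 p])
    also have "((1 + \<bar>t\<bar>)\<^sup>2) powr - p = g t"
      by (subst square_powr) (auto simp: g_def)
    finally show ?thesis by (simp add: mult.commute)
  qed
  have refl: "(\<integral>\<^sup>+t. ennreal (g t) * indicator {..0} t \<partial>lborel) = (\<integral>\<^sup>+t. ennreal (g t) * indicator {0..} t \<partial>lborel)"
    using nn_integral_real_affine[of "\<lambda>t. ennreal (g t) * indicator {..0} t" "-1" 0] gm
    by (simp add: g_def indicator_def)
  have "(\<integral>\<^sup>+t. ennreal ((1 + t\<^sup>2) powr - p) \<partial>lborel)
     \<le> (\<integral>\<^sup>+t. ennreal (2 powr p) * (ennreal (g t) * indicator {0..} t + ennreal (g t) * indicator {..0} t) \<partial>lborel)"
  proof (rule nn_integral_mono)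
    fix t :: real
    have "ennreal ((1 + t\<^sup>2) powr - p) \<le> ennreal (2 powr p) * ennreal (g t)"
      using le[of t] by (simp add: ennreal_mult[symmetric] g_def ennreal_leI)
    also have "\<dots> \<le> ennreal (2 powr p) * (ennreal (g t) * indicator {0..} t + ennreal (g t) * indicator {..0} t)"
      by (intro mult_left_mono) (auto simp: indicator_def)
    finally show "ennreal ((1 + t\<^sup>2) powr - p) \<le> ennreal (2 powr p) * (ennreal (g t) * indicator {0..} t + ennreal (g t) * indicator {..0} t)" .
  qed
  also have "\<dots> = ennreal (2 powr p) * ((\<integral>\<^sup>+t. ennreal (g t) * indicator {0..} t \<partial>lborel) + (\<integral>\<^sup>+t. ennreal (g t) * indicator {0..} t \<partial>lborel))"
    using gm refl by (simp add: nn_integral_cmult nn_integral_add)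
  also have "\<dots> < \<infinity>" using g0 by (simp add: ennreal_mult_less_top)
  finally show ?thesis .
qed

text \<open>Polar coordinates are avoided: (1 + s^2)(1 + t^2) <= (1 + s^2 + t^2)^2 bounds the
  integrand by a product of one-dimensional ones with exponent p = (1 + \<sigma>)/2 > 1/2.\<close>

lemma integrable_inverse_power_plane:
  fixes \<sigma> :: real assumes \<sigma>: "\<sigma> > 0"
  shows "integrable lborel (\<lambda>x::plane. (1 + (norm x)\<^sup>2) powr - (1 + \<sigma>))"
proof (rule integrableI_bounded)
  show "(\<lambda>x::plane. (1 + (norm x)\<^sup>2) powr - (1 + \<sigma>)) \<in> borel_measurable lborel" by measurable
  define p where "p = (1 + \<sigma>) / 2"
  have p: "p > 1/2" using \<sigma> by (simp add: p_def)
  let ?h = "\<lambda>t::real. ennreal ((1 + t\<^sup>2) powr - p)"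
  have "(\<integral>\<^sup>+x. ennreal (norm ((1 + (norm (x::plane))\<^sup>2) powr - (1 + \<sigma>))) \<partial>lborel) \<le> (\<integral>\<^sup>+x. ?h (fst x) * ?h (snd x) \<partial>(lborel \<Otimes>\<^sub>M lborel))"
    unfolding lborel_prod
  proof (rule nn_integral_mono)
    fix x :: plane
    have pos: "0 < 1 + (fst x)\<^sup>2" "0 < 1 + (snd x)\<^sup>2" by (simp_all add: add_pos_nonneg)
    have "(1 + (fst x)\<^sup>2) * (1 + (snd x)\<^sup>2) \<le> (1 + (norm x)\<^sup>2)\<^sup>2"
    proof -
      have "(1 + (norm x)\<^sup>2)\<^sup>2 = (1 + (fst x)\<^sup>2) * (1 + (snd x)\<^sup>2)
          + ((fst x)\<^sup>2 + (snd x)\<^sup>2 + (fst x)\<^sup>2 * (snd x)\<^sup>2 + (fst x)\<^sup>2 * (fst x)\<^sup>2 + (snd x)\<^sup>2 * (snd x)\<^sup>2)"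
        unfolding norm_plane power2_eq_square[of "1 + _"] by (simp add: algebra_simps)
      then show ?thesis by (simp add: add_nonneg_nonneg)
    qed
    then have "((1 + (norm x)\<^sup>2)\<^sup>2) powr - p \<le> ((1 + (fst x)\<^sup>2) * (1 + (snd x)\<^sup>2)) powr - p"
      using p pos by (intro powr_mono2') (auto simp: mult_pos_pos)
    also have "\<dots> = (1 + (fst x)\<^sup>2) powr - p * (1 + (snd x)\<^sup>2) powr - p"
      using pos by (simp add: powr_mult)
    also have "((1 + (norm x)\<^sup>2)\<^sup>2) powr - p = (1 + (norm x)\<^sup>2) powr - (1 + \<sigma>)"
    proof -
      have "2 * - p = - (1 + \<sigma>)" unfolding p_def by argo
      then show ?thesis by (simp only: square_powr[OF one_plus_norm_pos(1)])
    qed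
    finally show "ennreal (norm ((1 + (norm x)\<^sup>2) powr - (1 + \<sigma>))) \<le> ?h (fst x) * ?h (snd x)"
      by (simp add: ennreal_mult[symmetric] ennreal_leI)
  qed
  also have "\<dots> = (\<integral>\<^sup>+s. (\<integral>\<^sup>+t. ?h s * ?h t \<partial>lborel) \<partial>lborel)"
    by (subst lborel.nn_integral_fst[symmetric]) auto
  also have "\<dots> = (\<integral>\<^sup>+s. ?h s \<partial>lborel) * (\<integral>\<^sup>+t. ?h t \<partial>lborel)"
    by (simp add: nn_integral_cmult nn_integral_multc)
  also have "\<dots> < \<infinity>" using integrable_inverse_power_1[OF p] by (simp add: ennreal_mult_less_top)
  finally show "(\<integral>\<^sup>+x. ennreal (norm ((1 + (norm (x::plane))\<^sup>2) powr - (1 + \<sigma>))) \<partial>lborel) < \<infinity>" .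
qed

lemma integrable_conf: "integrable lborel conf"
proof -
  have eq: "conf = (\<lambda>x. 4 * (1 + (norm x)\<^sup>2) powr - (1 + 1))"
    by (simp add: fun_eq_iff conf_def powr_minus divide_inverse)
  show ?thesis unfolding eq by (intro integrable_mult_right integrable_inverse_power_plane) simp
qed

section \<open>Inversion, the transition map between the charts\<close>

definition inversion :: "plane \<Rightarrow> plane" where
  "inversion x = x /\<^sub>R (norm x)\<^sup>2"

lemma inversion_eq_0 [simp]: "inversion x = 0 \<longleftrightarrow> x = 0"
  by (auto simp: inversion_def)

lemma norm_inversion: "norm (inversion x) = 1 / norm x"
  by (cases "x = 0") (auto simp: inversion_def power2_eq_square divide_inverse)

text \<open>This includes the origin, which division by zero makes a fixed point.\<close>

lemma inversion_inversion [simp]: "inversion (inversion x) = x"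
proof (cases "x = 0")
  case False
  have "inversion (inversion x) = inversion x /\<^sub>R (1 / norm x)\<^sup>2"
    by (simp add: inversion_def[of "inversion x"] norm_inversion)
  then show ?thesis using False by (simp add: inversion_def power_divide)
qed (simp add: inversion_def)

text \<open>The differential of the inversion at x: the reflection in the line orthogonal to x,
  divided by |x|^2. It is therefore symmetric and conformal.\<close>

definition inversion' :: "plane \<Rightarrow> plane \<Rightarrow> plane" where
  "inversion' x v = v /\<^sub>R (norm x)\<^sup>2 - (2 * (x \<bullet> v) / (norm x)^4) *\<^sub>R x"

lemma inversion_has_derivative:
  assumes "x \<noteq> 0" shows "(inversion has_derivative inversion' x) (at x)"
proof -
  have d: "((\<lambda>x::plane. x \<bullet> x) has_derivative (\<lambda>v. 2 * (x \<bullet> v))) (at x)"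
    by (auto intro!: derivative_eq_intros simp: inner_commute)
  have nz: "x \<bullet> x \<noteq> 0" using assms by simp
  have n4: "norm x ^ 4 = (x \<bullet> x) * (x \<bullet> x)"
    by (simp add: power4_eq_xxxx power2_norm_eq_inner[symmetric] power2_eq_square)
  have eq: "inversion = (\<lambda>x. inverse (x \<bullet> x) *\<^sub>R x)"
    by (simp add: inversion_def fun_eq_iff power2_norm_eq_inner)
  show ?thesis unfolding eq
    by (rule has_derivative_eq_rhs[OF has_derivative_scaleR[OF Deriv.has_derivative_inverse[OF nz d] has_derivative_ident]])
      (auto simp: inversion'_def fun_eq_iff power2_norm_eq_inner n4 divide_inverse)
qed

text \<open>The factor |x|^4 is the reciprocal of the Jacobian of the inversion, so that
  \<open>conf\<close> times Lebesgue measure is invariant.\<close>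

lemma conf_inversion: "x \<noteq> 0 \<Longrightarrow> conf (inversion x) = norm x ^ 4 * conf x"
proof -
  assume x: "x \<noteq> 0"
  have "1 + (1 / norm x)\<^sup>2 = (1 + (norm x)\<^sup>2) / (norm x)\<^sup>2"
    using x by (simp add: power_divide add_divide_distrib)
  then show ?thesis by (simp add: conf_def norm_inversion power_divide flip: power_mult)
qed

lemma inversion_measurable [measurable]: "inversion \<in> borel_measurable borel"
  unfolding inversion_def[abs_def] by measurable

lemma integral_inversion:
  fixes f :: "plane \<Rightarrow> real"
  assumes f: "integrable lborel (\<lambda>x. conf x * f x)" and fm: "f \<in> borel_measurable borel"
  shows "(\<integral>x. conf x * f (inversion x) \<partial>lborel) = (\<integral>x. conf x * f x \<partial>lborel)"
proof -
  let ?S = "- {0::plane}"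
  let ?J = "\<lambda>x::plane. inverse (norm x ^ 4)"
  have eq: "indicator ?S x * (?J x * (conf (inversion x) * f (inversion x))) = indicator ?S x * (conf x * f (inversion x))" for x
    by (cases "x = 0") (auto simp: conf_inversion)
  have "(\<integral>x. indicator ?S x * (?J x * (conf (inversion x) * f (inversion x))) \<partial>lborel) = (\<integral>x. indicator ?S x * (conf x * f x) \<partial>lborel)"
  proof (rule lebesgue_change_of_variables_plane[OF _ _ inversion_has_derivative _ _ f])
    show "inversion ` ?S = ?S"
    proof (intro equalityI subsetI)
      fix x assume "x \<in> ?S"
      then show "x \<in> inversion ` ?S" by (intro image_eqI[of _ _ "inversion x"]) auto
    qed auto
    show "inj_on inversion ?S" by (metis inj_on_def inversion_inversion)
    show "?J x = \<bar>fst (inversion' x (1, 0)) * snd (inversion' x (0, 1)) - fst (inversion' x (0, 1)) * snd (inversion' x (1, 0))\<bar>"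
      if "x \<in> ?S" for x
    proof -
      define n where "n = (norm x)\<^sup>2"
      have n: "n = (fst x)\<^sup>2 + (snd x)\<^sup>2" "n > 0" "norm x ^ 4 = n\<^sup>2"
        using that by (simp_all add: n_def norm_plane[symmetric])
      have "fst (inversion' x (1, 0)) * snd (inversion' x (0, 1)) - fst (inversion' x (0, 1)) * snd (inversion' x (1, 0))
        = (1 / n - 2 * (fst x)\<^sup>2 / n\<^sup>2) * (1 / n - 2 * (snd x)\<^sup>2 / n\<^sup>2) - (2 * fst x * snd x / n\<^sup>2)\<^sup>2"
        unfolding inversion'_def n(3) n_def[symmetric]
        by (simp add: inner_prod_def power2_eq_square divide_inverse algebra_simps)
      also have "\<dots> = 1 / n\<^sup>2 - 2 * ((fst x)\<^sup>2 + (snd x)\<^sup>2) / (n * n\<^sup>2)"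
        using n(2) by (simp add: power2_eq_square field_simps)
      \<comment> \<open>The sign is that of a reflection; only the absolute value enters the
        Jacobian.\<close>
      also have "\<dots> = - (1 / n\<^sup>2)"
        unfolding n(1)[symmetric] using n(2) by (simp add: field_simps)
      finally show ?thesis using n by (simp add: divide_inverse)
    qed
    show "(\<lambda>x. indicator ?S x * (?J x * (conf (inversion x) * f (inversion x)))) \<in> borel_measurable borel"
      using fm by measurable
  qed auto
  then have "(\<integral>x. indicator ?S x * (conf x * f (inversion x)) \<partial>lborel) = (\<integral>x. indicator ?S x * (conf x * f x) \<partial>lborel)"
    unfolding eq .
  moreover have "(\<integral>x. indicator ?S x * (conf x * g x) \<partial>lborel) = (\<integral>x. conf x * g x \<partial>lborel)"
    if "g \<in> borel_measurable borel" for g :: "plane \<Rightarrow> real"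
  proof (rule integral_cong_AE)
    show "AE x in lborel. indicator ?S x * (conf x * g x) = conf x * g x"
      using AE_lborel_singleton[of 0] by eventually_elim simp
  qed (use that in measurable)
  ultimately show ?thesis using fm by simp
qed

section \<open>The area measure of the sphere in both charts\<close>

definition plane_measure :: "plane measure" where
  "plane_measure = density lborel (\<lambda>x. ennreal (conf x))"

lemma sets_plane_measure [simp, measurable_cong]: "sets plane_measure = sets borel"
  and space_plane_measure [simp]: "space plane_measure = UNIV"
  by (simp_all add: plane_measure_def)

lemma plane_measure_integral:
  fixes f :: "plane \<Rightarrow> real"
  assumes "f \<in> borel_measurable borel"
  shows "integrable plane_measure f \<longleftrightarrow> integrable lborel (\<lambda>x. conf x * f x)"
    and "(\<integral>x. f x \<partial>plane_measure) = (\<integral>x. conf x * f x \<partial>lborel)"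
  using assms unfolding plane_measure_def
  by (subst integrable_density, simp_all) (subst integral_density, simp_all)

lemma AE_plane_measure: "(AE x in plane_measure. P x) \<longleftrightarrow> (AE x in lborel. P x)"
  using AE_density[of "\<lambda>x. ennreal (conf x)" lborel P] unfolding plane_measure_def by simp

lemma finite_plane_measure: "finite_measure plane_measure"
proof
  have "emeasure plane_measure UNIV = (\<integral>\<^sup>+x. ennreal (conf x) \<partial>lborel)"
    by (simp add: plane_measure_def emeasure_density)
  also have "\<dots> = ennreal (\<integral>x. conf x \<partial>lborel)"
    by (intro nn_integral_eq_integral integrable_conf) simp
  finally show "emeasure plane_measure (space plane_measure) \<noteq> \<infinity>" by simp
qed

text \<open>As the total area is finite, measures of sets are integrals of indicators, to which the
  change of variables applies.\<close>

lemma distr_inversion: "distr plane_measure borel inversion = plane_measure"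
proof (rule measure_eqI)
  fix A assume "A \<in> sets (distr plane_measure borel inversion)"
  then have A: "A \<in> sets borel" by simp
  interpret finite_measure plane_measure by (rule finite_plane_measure)
  have iA: "integrable plane_measure (indicator B :: plane \<Rightarrow> real)" if "B \<in> sets borel" for B
    using that by (intro integrable_real_indicator) (auto simp: less_top[symmetric] emeasure_finite)
  have A': "inversion -` A \<in> sets borel" using measurable_sets[OF inversion_measurable A] by simp
  have "measure plane_measure (inversion -` A) = (\<integral>x. indicator A (inversion x) \<partial>plane_measure)"
    using A' by (simp add: indicator_vimage[symmetric])
  also have "\<dots> = (\<integral>x. conf x * indicator A (inversion x) \<partial>lborel)"
    using A by (intro plane_measure_integral) simp
  also have "\<dots> = (\<integral>x. conf x * indicator A x \<partial>lborel)"
    using A iA[OF A] plane_measure_integral(1)[of "indicator A"] by (intro integral_inversion) simp_all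
  also have "\<dots> = measure plane_measure A"
    using A plane_measure_integral(2)[of "indicator A"] by simp
  finally show "emeasure (distr plane_measure borel inversion) A = emeasure plane_measure A"
    using A by (simp add: emeasure_distr emeasure_eq_measure)
qed simp

lemma stereo_inv_stereo [simp]: "stereo (inv_stereo x) = x"
proof -
  define c where "c = 2 / (1 + (norm x)\<^sup>2)"
  have "1 - ((norm x)\<^sup>2 - 1) / (1 + (norm x)\<^sup>2) = c"
    by (simp add: c_def field_simps)
  moreover have "c \<noteq> 0" by (simp add: c_def)
  ultimately show ?thesis by (simp add: stereo_def inv_stereo_def c_def[symmetric])
qed

lemma rad_inv_stereo [simp]: "rad (inv_stereo x) = norm x"
  by (simp add: rad_def)

lemma inv_stereo'_eq: "x \<noteq> 0 \<Longrightarrow> inv_stereo' x = inv_stereo (inversion x)"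
proof -
  assume x: "x \<noteq> 0"
  have n: "1 + (1 / norm x)\<^sup>2 = (1 + (norm x)\<^sup>2) / (norm x)\<^sup>2"
    "(1 / norm x)\<^sup>2 - 1 = (1 - (norm x)\<^sup>2) / (norm x)\<^sup>2"
    using x by (simp_all add: power_divide add_divide_distrib diff_divide_distrib)
  show ?thesis using x
    by (simp add: inv_stereo'_def inv_stereo_def norm_inversion n) (simp add: inversion_def)
qed

lemma measurable_dV: "f \<in> borel_measurable dV \<longleftrightarrow> f \<in> borel_measurable (restrict_space borel S2)"
  by (simp add: dV_def cong: measurable_cong_sets)

lemma dV_eq: "dV = distr plane_measure (restrict_space borel S2) inv_stereo"
  by (simp add: dV_def plane_measure_def)

lemma inv_stereo_measurable': "inv_stereo' \<in> borel \<rightarrow>\<^sub>M restrict_space borel S2"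
proof (rule measurable_restrict_space2)
  show "inv_stereo' \<in> borel_measurable borel"
    unfolding inv_stereo'_def
    by (intro borel_measurable_continuous_onI continuous_intros) auto
qed (simp add: inv_stereo_in_S2)

text \<open>The parametrizations differ by the inversion except at the origin, a null set, so the
  invariance of the measure makes the two charts interchangeable.\<close>

lemma dV_eq': "dV = distr plane_measure (restrict_space borel S2) inv_stereo'"
proof -
  have "dV = distr (distr plane_measure borel inversion) (restrict_space borel S2) inv_stereo"
    by (simp add: dV_eq distr_inversion)
  also have "\<dots> = distr plane_measure (restrict_space borel S2) (inv_stereo \<circ> inversion)"
    by (rule distr_distr[OF measurable_inv_stereo]) simp
  also have "\<dots> = distr plane_measure (restrict_space borel S2) inv_stereo'"
  proof (rule distr_cong_AE[OF refl refl])
    show "AE x in plane_measure. (inv_stereo \<circ> inversion) x = inv_stereo' x"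
      unfolding AE_plane_measure using AE_lborel_singleton[of 0]
      by eventually_elim (simp add: inv_stereo'_eq)
  qed (use measurable_inv_stereo inv_stereo_measurable' in \<open>auto simp: comp_def cong: measurable_cong_sets\<close>)
  finally show ?thesis .
qed

lemma measurable_chart:
  assumes "f \<in> borel_measurable dV"
  shows "(\<lambda>x. f (inv_stereo x)) \<in> borel_measurable borel" "(\<lambda>x. f (inv_stereo' x)) \<in> borel_measurable borel"
  using assms measurable_inv_stereo inv_stereo_measurable'
  by (auto simp: measurable_dV intro: measurable_compose)

lemma integral_dV:
  fixes f :: "space3 \<Rightarrow> real"
  assumes f: "f \<in> borel_measurable dV"
  shows "integrable dV f \<longleftrightarrow> integrable lborel (\<lambda>x. conf x * f (inv_stereo x))"
    and "(\<integral>p. f p \<partial>dV) = (\<integral>x. conf x * f (inv_stereo x) \<partial>lborel)"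
    and "integrable dV f \<longleftrightarrow> integrable lborel (\<lambda>x. conf x * f (inv_stereo' x))"
    and "(\<integral>p. f p \<partial>dV) = (\<integral>x. conf x * f (inv_stereo' x) \<partial>lborel)"
proof -
  have m: "inv_stereo \<in> plane_measure \<rightarrow>\<^sub>M restrict_space borel S2" "inv_stereo' \<in> plane_measure \<rightarrow>\<^sub>M restrict_space borel S2"
    using measurable_inv_stereo inv_stereo_measurable' by (simp_all cong: measurable_cong_sets)
  note f' = f[unfolded measurable_dV]
  show "integrable dV f \<longleftrightarrow> integrable lborel (\<lambda>x. conf x * f (inv_stereo x))"
    unfolding dV_eq integrable_distr_eq[OF m(1) f'] by (rule plane_measure_integral(1)[OF measurable_chart(1)[OF f]])
  show "(\<integral>p. f p \<partial>dV) = (\<integral>x. conf x * f (inv_stereo x) \<partial>lborel)"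
    unfolding dV_eq integral_distr[OF m(1) f'] by (rule plane_measure_integral(2)[OF measurable_chart(1)[OF f]])
  show "integrable dV f \<longleftrightarrow> integrable lborel (\<lambda>x. conf x * f (inv_stereo' x))"
    unfolding dV_eq' integrable_distr_eq[OF m(2) f'] by (rule plane_measure_integral(1)[OF measurable_chart(2)[OF f]])
  show "(\<integral>p. f p \<partial>dV) = (\<integral>x. conf x * f (inv_stereo' x) \<partial>lborel)"
    unfolding dV_eq' integral_distr[OF m(2) f'] by (rule plane_measure_integral(2)[OF measurable_chart(2)[OF f]])
qed

lemma AE_dV_charts:
  assumes "AE p in dV. P p"
  shows "AE x in lborel. P (inv_stereo x)" "AE x in lborel. P (inv_stereo' x)"
proof -
  have m: "inv_stereo \<in> plane_measure \<rightarrow>\<^sub>M restrict_space borel S2" "inv_stereo' \<in> plane_measure \<rightarrow>\<^sub>M restrict_space borel S2"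
    using measurable_inv_stereo inv_stereo_measurable' by (simp_all cong: measurable_cong_sets)
  show "AE x in lborel. P (inv_stereo x)"
    using AE_distrD[OF m(1) assms[unfolded dV_eq]] by (simp add: AE_plane_measure)
  show "AE x in lborel. P (inv_stereo' x)"
    using AE_distrD[OF m(2) assms[unfolded dV_eq']] by (simp add: AE_plane_measure)
qed

text \<open>One chart suffices, since \<open>dV\<close> is by definition the image of a measure on
  that chart; measurability makes the set of equality an admissible event for the image
  measure.\<close>

lemma AE_dV_eqI:
  fixes f g :: "space3 \<Rightarrow> real"
  assumes f: "f \<in> borel_measurable dV" and g: "g \<in> borel_measurable dV"
    and eq: "AE x in lborel. f (inv_stereo x) = g (inv_stereo x)"
  shows "AE p in dV. f p = g p"
proof -
  have m: "inv_stereo \<in> plane_measure \<rightarrow>\<^sub>M restrict_space borel S2"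
    using measurable_inv_stereo by (simp cong: measurable_cong_sets)
  have "{p \<in> space (restrict_space borel S2). f p = g p} \<in> sets (restrict_space borel S2)"
    using f g unfolding measurable_dV by measurable
  then show ?thesis
    unfolding dV_eq by (subst AE_distr_iff[OF m]) (use eq in \<open>auto simp: AE_plane_measure\<close>)
qed

lemma stereo_measurable: "stereo \<in> restrict_space borel S2 \<rightarrow>\<^sub>M borel"
proof -
  have [measurable]: "(fst :: space3 \<Rightarrow> plane) \<in> borel_measurable borel" "(snd :: space3 \<Rightarrow> real) \<in> borel_measurable borel"
    by (intro borel_measurable_continuous_onI continuous_intros)+
  show ?thesis unfolding stereo_def[abs_def] by (intro measurable_restrict_space1) measurable
qed

lemma measurable_dV_stereo:
  fixes h :: "plane \<Rightarrow> 'b::topological_space"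
  assumes "h \<in> borel_measurable borel"
  shows "(\<lambda>p. h (stereo p)) \<in> borel_measurable dV"
proof -
  have "(\<lambda>p. h (stereo p)) \<in> borel_measurable (restrict_space borel S2)"
    by (rule measurable_compose[OF stereo_measurable assms])
  then show ?thesis by (simp add: dV_def cong: measurable_cong_sets)
qed

section \<open>Classes, representatives and completeness of the Hilbert space\<close>

lemma l2_rel_refl: "l2_rel f f \<longleftrightarrow> square_integrable f"
  by (simp add: l2_rel_def)

lemma fun_of_square_integrable: "square_integrable (fun_of u)"
  using Quotient3_rep_reflp[OF Quotient3_L2S2, of u] by (simp add: l2_rel_refl)

lemma fun_of_measurable: "fun_of u \<in> borel_measurable dV"
  using fun_of_square_integrable by (simp add: square_integrable_def)

lemma class_of_fun_of [simp]: "class_of (fun_of u) = u"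
  by (rule Quotient3_abs_rep[OF Quotient3_L2S2])

lemma fun_of_class_of: "square_integrable f \<Longrightarrow> AE p in dV. fun_of (class_of f) p = f p"
  using Quotient3_rep_abs[OF Quotient3_L2S2, of f] by (auto simp: l2_rel_def)

lemma class_of_eq:
  "square_integrable f \<Longrightarrow> square_integrable g \<Longrightarrow> class_of f = class_of g \<longleftrightarrow> (AE p in dV. f p = g p)"
  using Quotient3_rel[OF Quotient3_L2S2, of f g] by (auto simp: l2_rel_def)

lemma inner_class_of:
  "square_integrable f \<Longrightarrow> square_integrable g \<Longrightarrow> class_of f \<bullet> class_of g = (\<integral>p. f p * g p \<partial>dV)"
  by (simp add: inner_L2S2.abs_eq l2_rel_refl)

lemma scaleR_class_of: "square_integrable f \<Longrightarrow> c *\<^sub>R class_of f = class_of (\<lambda>p. c * f p)"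
  by (simp add: scaleR_L2S2.abs_eq l2_rel_refl)

lemma plus_class_of:
  "square_integrable f \<Longrightarrow> square_integrable g \<Longrightarrow> class_of f + class_of g = class_of (\<lambda>p. f p + g p)"
  by (simp add: plus_L2S2.abs_eq l2_rel_refl)

lemma zero_class_of: "0 = class_of (\<lambda>p. 0)"
  by (simp add: zero_L2S2_def)

lemma sum_class_of:
  assumes "finite F" "\<And>k. k \<in> F \<Longrightarrow> square_integrable (f k)"
  shows "square_integrable (\<lambda>p. \<Sum>k\<in>F. c k * f k p)"
    and "(\<Sum>k\<in>F. c k *\<^sub>R class_of (f k)) = class_of (\<lambda>p. \<Sum>k\<in>F. c k * f k p)"
proof -
  have "square_integrable (\<lambda>p. \<Sum>k\<in>F. c k * f k p)
      \<and> (\<Sum>k\<in>F. c k *\<^sub>R class_of (f k)) = class_of (\<lambda>p. \<Sum>k\<in>F. c k * f k p)"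
    using assms
  proof (induction F)
    case empty
    then show ?case by (simp add: square_integrable_zero zero_class_of)
  next
    case (insert k F)
    then show ?case
      by (simp add: scaleR_class_of plus_class_of square_integrable_add square_integrable_scale)
  qed
  then show "square_integrable (\<lambda>p. \<Sum>k\<in>F. c k * f k p)"
    "(\<Sum>k\<in>F. c k *\<^sub>R class_of (f k)) = class_of (\<lambda>p. \<Sum>k\<in>F. c k * f k p)" by auto
qed

lemma norm_diff_class_of:
  assumes "square_integrable f" "square_integrable g"
  shows "(norm (class_of f - class_of g))\<^sup>2 = (\<integral>p. (f p - g p)\<^sup>2 \<partial>dV)"
proof -
  have "class_of f - class_of g = class_of f + (- 1) *\<^sub>R class_of g" by simp
  also have "\<dots> = class_of (\<lambda>p. f p + (- 1) * g p)"
    by (simp only: scaleR_class_of[OF assms(2)] plus_class_of[OF assms(1) square_integrable_scale[OF assms(2)]])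
  finally have "(norm (class_of f - class_of g))\<^sup>2 = class_of (\<lambda>p. f p + (- 1) * g p) \<bullet> class_of (\<lambda>p. f p + (- 1) * g p)"
    by (simp add: power2_norm_eq_inner)
  also have "\<dots> = (\<integral>p. (f p - g p)\<^sup>2 \<partial>dV)"
    using square_integrable_add[OF assms(1) square_integrable_scale[OF assms(2), of "-1"]]
    by (subst inner_class_of) (simp_all add: power2_eq_square)
  finally show ?thesis .
qed

lemma norm_diff_fun_of: "(norm (u - v))\<^sup>2 = (\<integral>p. (fun_of u p - fun_of v p)\<^sup>2 \<partial>dV)"
  using norm_diff_class_of[OF fun_of_square_integrable fun_of_square_integrable, of u v] by simp

lemma square_integrable_diff:
  "square_integrable f \<Longrightarrow> square_integrable g \<Longrightarrow> square_integrable (\<lambda>p. f p - g p)"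
  using square_integrable_add[OF _ square_integrable_scale[of g "-1"], of f] by simp

text \<open>Representatives of a Cauchy sequence of classes are Cauchy in mean square whatever their
  choice, so Riesz-Fischer applies. Completeness is what makes eigenfunction series
  converge.\<close>

instance L2S2 :: complete_space
proof
  fix X :: "nat \<Rightarrow> L2S2"
  assume X: "Cauchy X"
  let ?f = "\<lambda>i. fun_of (X i)"
  have sq: "integrable dV (\<lambda>p. (norm (?f i p - ?f j p))\<^sup>2)" for i j
    using square_integrable_diff[OF fun_of_square_integrable fun_of_square_integrable]
    by (simp add: square_integrable_def)
  have cauchy: "\<exists>N. \<forall>i\<ge>N. \<forall>j\<ge>N. (\<integral>p. (norm (?f i p - ?f j p))\<^sup>2 \<partial>dV) \<le> e" if "e > 0" for e
  proof -
    obtain N where N: "\<And>i j. i \<ge> N \<Longrightarrow> j \<ge> N \<Longrightarrow> norm (X i - X j) < sqrt e"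
      using CauchyD[OF X, of "sqrt e"] \<open>e > 0\<close> by auto
    have "(\<integral>p. (norm (?f i p - ?f j p))\<^sup>2 \<partial>dV) \<le> e" if "i \<ge> N" "j \<ge> N" for i j
    proof -
      have "(norm (X i - X j))\<^sup>2 \<le> (sqrt e)\<^sup>2" using N[OF that] by (intro power_mono) auto
      then show ?thesis using \<open>e > 0\<close> by (simp add: norm_diff_fun_of)
    qed
    then show ?thesis by blast
  qed
  obtain g r where g: "g \<in> borel_measurable dV"
    "\<And>i. integrable dV (\<lambda>p. (norm (?f i p - g p))\<^sup>2)"
    "(\<lambda>i. \<integral>p. (norm (?f i p - g p))\<^sup>2 \<partial>dV) \<longlonglongrightarrow> 0"
    using L2_complete[of ?f dV, OF fun_of_measurable sq cauchy] by blast
  have "square_integrable (\<lambda>p. ?f 0 p - g p)"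
    using g(1) g(2)[of 0] fun_of_measurable[of "X 0"] by (simp add: square_integrable_def borel_measurable_diff)
  from square_integrable_diff[OF fun_of_square_integrable[of "X 0"] this] have sg: "square_integrable g" by simp
  have "(\<lambda>i. (norm (X i - class_of g))\<^sup>2) \<longlonglongrightarrow> 0"
    using g(3) norm_diff_class_of[OF fun_of_square_integrable sg] by simp
  then have "(\<lambda>i. sqrt ((norm (X i - class_of g))\<^sup>2)) \<longlonglongrightarrow> sqrt 0" by (rule tendsto_real_sqrt)
  then have "(\<lambda>i. norm (X i - class_of g)) \<longlonglongrightarrow> 0" by simp
  then have "X \<longlonglongrightarrow> class_of g" using Lim_null tendsto_norm_zero_iff by blast
  then show "convergent X" by (rule convergentI)
qed

section \<open>The quadratic form\<close>

lemma weak_differential_of: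
  assumes "weakly_differentiable f"
  shows "has_weak_gradient (f \<circ> inv_stereo) (weak_differential f)"
proof -
  obtain G where "has_weak_gradient (f \<circ> inv_stereo) G"
    using assms unfolding weakly_differentiable_def by blast
  then show ?thesis unfolding weak_differential_def by (rule someI[of "has_weak_gradient (f \<circ> inv_stereo)"])
qed

text \<open>The density of \<omega>^2 r^2 dV with respect to Lebesgue measure. The gradient term
  needs no such weight: in dimension two the conformal factors of the metric on covectors and of the
  area cancel.\<close>

definition potential :: "real \<Rightarrow> plane \<Rightarrow> real" where
  "potential \<omega> x = \<omega>\<^sup>2 * (norm x)\<^sup>2 * conf x"

lemma potential_nonneg [simp]: "potential \<omega> x \<ge> 0"
  by (simp add: potential_def)

lemma potential_measurable [measurable]: "potential \<omega> \<in> borel_measurable borel"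
  unfolding potential_def[abs_def] by measurable

text \<open>Both summands of the energy density are nonnegative, so each of them is integrable on
  its own.\<close>

lemma E_formD:
  assumes f: "f \<in> E_form \<omega>"
  shows "has_weak_gradient (\<lambda>x. fun_of f (inv_stereo x)) (weak_differential (fun_of f))"
    and "weak_differential (fun_of f) \<in> borel_measurable borel"
    and "integrable lborel (\<lambda>x. (norm (weak_differential (fun_of f) x))\<^sup>2)"
    and "integrable lborel (\<lambda>x. potential \<omega> x * (fun_of f (inv_stereo x))\<^sup>2)"
proof -
  let ?G = "weak_differential (fun_of f)"
  have wd: "weakly_differentiable (fun_of f)" and int: "integrable dV (Q_dens \<omega> f f)"
    using f by (auto simp: E_form_def)
  show "has_weak_gradient (\<lambda>x. fun_of f (inv_stereo x)) ?G"
    using weak_differential_of[OF wd] by (simp add: comp_def)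
  then have "locally_integrable ?G" by (simp add: has_weak_gradient_def)
  then show Gm[measurable]: "?G \<in> borel_measurable borel" by (rule locally_integrable_measurable)
  have um[measurable]: "(\<lambda>x. fun_of f (inv_stereo x)) \<in> borel_measurable borel"
    by (rule measurable_chart[OF fun_of_measurable])
  have "integrable lborel (\<lambda>x. conf x * Q_dens \<omega> f f (inv_stereo x))"
    using integral_dV(1)[OF borel_measurable_integrable[OF int]] int by simp
  then have sum: "integrable lborel (\<lambda>x. (norm (?G x))\<^sup>2 + potential \<omega> x * (fun_of f (inv_stereo x))\<^sup>2)"
    by (simp add: Q_dens_def potential_def distrib_left power2_norm_eq_inner power2_eq_square[of "fun_of _ _"] algebra_simps)
  show "integrable lborel (\<lambda>x. (norm (?G x))\<^sup>2)"
    by (rule Bochner_Integration.integrable_bound[OF sum]) auto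
  show "integrable lborel (\<lambda>x. potential \<omega> x * (fun_of f (inv_stereo x))\<^sup>2)"
    by (rule Bochner_Integration.integrable_bound[OF sum]) auto
qed

lemma inner_mult_integrable:
  fixes F G :: "'a \<Rightarrow> plane"
  assumes [measurable]: "F \<in> borel_measurable M" "G \<in> borel_measurable M"
    and "integrable M (\<lambda>x. (norm (F x))\<^sup>2)" "integrable M (\<lambda>x. (norm (G x))\<^sup>2)"
  shows "integrable M (\<lambda>x. F x \<bullet> G x)"
proof (rule Bochner_Integration.integrable_bound)
  show "integrable M (\<lambda>x. norm (F x) * norm (G x))"
    using assms by (intro square_mult_integrable) auto
  show "AE x in M. norm (F x \<bullet> G x) \<le> norm (norm (F x) * norm (G x))"
    by (simp add: Cauchy_Schwarz_ineq2)
qed simp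

lemma weighted_mult_integrable:
  fixes f g w :: "plane \<Rightarrow> real"
  assumes [measurable]: "f \<in> borel_measurable borel" "g \<in> borel_measurable borel" "w \<in> borel_measurable borel"
    and w: "\<And>x. w x \<ge> 0"
    and "integrable lborel (\<lambda>x. w x * (f x)\<^sup>2)" "integrable lborel (\<lambda>x. w x * (g x)\<^sup>2)"
  shows "integrable lborel (\<lambda>x. w x * (f x * g x))"
proof -
  have "integrable lborel (\<lambda>x. (sqrt (w x) * f x) * (sqrt (w x) * g x))"
    using assms by (intro square_mult_integrable) (auto simp: power_mult_distrib)
  also have "(\<lambda>x. (sqrt (w x) * f x) * (sqrt (w x) * g x)) = (\<lambda>x. w x * (f x * g x))"
    using w by (auto simp: fun_eq_iff mult.assoc mult.left_commute[of "f _"] simp flip: mult.assoc[of "sqrt _" "sqrt _"])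
  finally show ?thesis .
qed

lemma Q_form_eq:
  assumes f: "f \<in> E_form \<omega>" and g: "g \<in> E_form \<omega>"
  shows "Q_form \<omega> f g = (\<integral>x. weak_differential (fun_of f) x \<bullet> weak_differential (fun_of g) x \<partial>lborel)
     + (\<integral>x. potential \<omega> x * (fun_of f (inv_stereo x) * fun_of g (inv_stereo x)) \<partial>lborel)"
proof -
  note [measurable] = E_formD(2)[OF f] E_formD(2)[OF g] fun_of_measurable
    measurable_chart(1)[OF fun_of_measurable[of f]] measurable_chart(1)[OF fun_of_measurable[of g]]
  have "(\<lambda>p. (weak_differential (fun_of f) (stereo p) \<bullet> weak_differential (fun_of g) (stereo p)) / conf (stereo p))
      \<in> borel_measurable dV"
    by (rule measurable_dV_stereo[where h = "\<lambda>x. (weak_differential (fun_of f) x \<bullet> weak_differential (fun_of g) x) / conf x"])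
      measurable
  moreover have "(\<lambda>p. \<omega>\<^sup>2 * (norm (stereo p))\<^sup>2) \<in> borel_measurable dV"
    by (rule measurable_dV_stereo[where h = "\<lambda>x. \<omega>\<^sup>2 * (norm x)\<^sup>2"]) measurable
  ultimately have "Q_dens \<omega> f g \<in> borel_measurable dV"
    unfolding Q_dens_def[abs_def] rad_def by measurable
  then have "Q_form \<omega> f g = (\<integral>x. conf x * Q_dens \<omega> f g (inv_stereo x) \<partial>lborel)"
    unfolding Q_form_def by (rule integral_dV(2))
  also have "\<dots> = (\<integral>x. weak_differential (fun_of f) x \<bullet> weak_differential (fun_of g) x
     + potential \<omega> x * (fun_of f (inv_stereo x) * fun_of g (inv_stereo x)) \<partial>lborel)"
    by (rule Bochner_Integration.integral_cong) (simp_all add: Q_dens_def potential_def distrib_left algebra_simps)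
  also have "\<dots> = (\<integral>x. weak_differential (fun_of f) x \<bullet> weak_differential (fun_of g) x \<partial>lborel)
     + (\<integral>x. potential \<omega> x * (fun_of f (inv_stereo x) * fun_of g (inv_stereo x)) \<partial>lborel)"
    using E_formD[OF f] E_formD[OF g]
    by (intro Bochner_Integration.integral_add inner_mult_integrable weighted_mult_integrable) simp_all
  finally show ?thesis .
qed

lemma Q_form_commute: "Q_form \<omega> f g = Q_form \<omega> g f"
  by (simp add: Q_form_def Q_dens_def[abs_def] inner_commute mult.commute mult.left_commute)

text \<open>The representative \<open>fun_of\<close> and the differential are chosen arbitrarily;
  uniqueness identifies them almost everywhere with f and G1. The energy is computed in the first
  chart alone, while G2 ensures weak differentiability at the pole.\<close>

lemma E_formI:
  assumes f: "square_integrable f"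
    and G1: "has_weak_gradient (\<lambda>x. f (inv_stereo x)) G1" and G2: "has_weak_gradient (\<lambda>x. f (inv_stereo' x)) G2"
    and int: "integrable lborel (\<lambda>x. (norm (G1 x))\<^sup>2)" "integrable lborel (\<lambda>x. potential \<omega> x * (f (inv_stereo x))\<^sup>2)"
  shows "class_of f \<in> E_form \<omega>"
    and "AE x in lborel. weak_differential (fun_of (class_of f)) x = G1 x"
proof -
  let ?u = "fun_of (class_of f)"
  note ae = AE_dV_charts[OF fun_of_class_of[OF f]]
  note [measurable] = fun_of_measurable measurable_chart[OF fun_of_measurable[of "class_of f"]]
  have w1: "has_weak_gradient (?u \<circ> inv_stereo) G1"
    by (rule has_weak_gradient_cong[OF G1]) (use ae(1) in \<open>auto simp: comp_def elim: AE_mp\<close>)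
  have w2: "has_weak_gradient (?u \<circ> inv_stereo') G2"
    by (rule has_weak_gradient_cong[OF G2]) (use ae(2) in \<open>auto simp: comp_def elim: AE_mp\<close>)
  have wd: "weakly_differentiable ?u" using w1 w2 by (auto simp: weakly_differentiable_def)
  note w = weak_differential_of[OF wd]
  show G: "AE x in lborel. weak_differential ?u x = G1 x"
    by (rule has_weak_gradient_unique[OF w w1])
  have [measurable]: "weak_differential ?u \<in> borel_measurable borel" "G1 \<in> borel_measurable borel"
    using w w1 by (auto simp: has_weak_gradient_def locally_integrable_measurable)
  have "(\<lambda>p. (weak_differential ?u (stereo p) \<bullet> weak_differential ?u (stereo p)) / conf (stereo p))
      \<in> borel_measurable dV"
    by (rule measurable_dV_stereo[where h = "\<lambda>x. (weak_differential ?u x \<bullet> weak_differential ?u x) / conf x"])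
      measurable
  moreover have "(\<lambda>p. \<omega>\<^sup>2 * (norm (stereo p))\<^sup>2) \<in> borel_measurable dV"
    by (rule measurable_dV_stereo[where h = "\<lambda>x. \<omega>\<^sup>2 * (norm x)\<^sup>2"]) measurable
  ultimately have Qm: "Q_dens \<omega> (class_of f) (class_of f) \<in> borel_measurable dV"
    unfolding Q_dens_def[abs_def] rad_def by measurable
  have "integrable lborel (\<lambda>x. (norm (G1 x))\<^sup>2 + potential \<omega> x * (f (inv_stereo x))\<^sup>2)" using int by simp
  moreover have "AE x in lborel. (norm (G1 x))\<^sup>2 + potential \<omega> x * (f (inv_stereo x))\<^sup>2
      = conf x * Q_dens \<omega> (class_of f) (class_of f) (inv_stereo x)"
    using G ae(1)
  proof eventually_elim
    case (elim x)
    then show ?case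
      by (simp add: Q_dens_def potential_def distrib_left power2_norm_eq_inner power2_eq_square[of "f _"] algebra_simps)
  qed
  moreover have "(\<lambda>x. (norm (G1 x))\<^sup>2 + potential \<omega> x * (f (inv_stereo x))\<^sup>2) \<in> borel_measurable lborel"
    using int by (auto dest: borel_measurable_integrable)
  ultimately have "integrable lborel (\<lambda>x. conf x * Q_dens \<omega> (class_of f) (class_of f) (inv_stereo x))"
    using measurable_chart(1)[OF Qm] by (subst integrable_cong_AE[symmetric]) auto
  then have "integrable dV (Q_dens \<omega> (class_of f) (class_of f))" using integral_dV(1)[OF Qm] by simp
  then show "class_of f \<in> E_form \<omega>" using wd by (simp add: E_form_def)
qed

section \<open>Angular modes\<close>

definition cplx :: "plane \<Rightarrow> complex" where
  "cplx x = Complex (fst x) (snd x)"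

text \<open>A harmonic homogeneous polynomial of degree n, that is, r^n times a combination of cos(n
  \<theta>) and sin(n \<theta>).\<close>

definition hpoly :: "complex \<Rightarrow> nat \<Rightarrow> plane \<Rightarrow> real" where
  "hpoly c n x = Re (c * cplx x ^ n)"

definition tcoord :: "plane \<Rightarrow> real" where
  "tcoord x = 1 / (1 + (norm x)\<^sup>2)"

definition radial :: "real \<Rightarrow> real poly \<Rightarrow> plane \<Rightarrow> real" where
  "radial a q x = tcoord x powr a * poly q (tcoord x)"

text \<open>The Euler operator t d/dt, conjugated by t^a: it sends t^a q to t^a (a q + t q'). One
  more factor t in \<open>radial_has_derivative\<close> comes from dt = -2 t^2 (x . dx).\<close>

definition radial' :: "real \<Rightarrow> real poly \<Rightarrow> real poly" where
  "radial' a q = smult a q + [:0, 1:] * pderiv q"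

lemma norm_cplx [simp]: "cmod (cplx x) = norm x"
  by (simp add: cplx_def norm_complex_def norm_prod_def)

lemma tcoord_pos [simp]: "tcoord x > 0" "tcoord x \<noteq> 0" "tcoord x \<ge> 0" and tcoord_le_1: "tcoord x \<le> 1"
  by (simp_all add: tcoord_def less_imp_le field_simps)

lemma hpoly_bound: "\<bar>hpoly c n x\<bar> \<le> cmod c * norm x ^ n"
  using abs_Re_le_cmod[of "c * cplx x ^ n"] by (simp add: hpoly_def norm_mult norm_power)

lemma hpoly_Suc: "hpoly c (Suc n) x = fst x * hpoly c n x + snd x * hpoly (\<i> * c) n x"
  by (simp add: hpoly_def cplx_def algebra_simps complex_eq_iff)

lemma smooth_hpoly: "smooth (hpoly c n)"
proof (induction n arbitrary: c)
  case 0
  have "hpoly c 0 = (\<lambda>x. Re c)" by (simp add: hpoly_def fun_eq_iff)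
  then show ?case by (simp add: smooth_const)
next
  case (Suc n)
  have "hpoly c (Suc n) = (\<lambda>x. fst x * hpoly c n x + snd x * hpoly (\<i> * c) n x)"
    by (simp add: fun_eq_iff hpoly_Suc)
  then show ?case using smooth_add[OF smooth_mult[OF smooth_fst Suc] smooth_mult[OF smooth_snd Suc]] by simp
qed

lemma bounded_linear_cplx: "bounded_linear cplx"
  by (auto simp: linear_conv_bounded_linear[symmetric] cplx_def complex_eq_iff intro!: linearI)

text \<open>The complex derivative of c z^n, split into its partial derivatives. For n = 0 the
  truncated exponent n - 1 is harmless because the coefficient is 0.\<close>

lemma hpoly_has_derivative:
  "(hpoly c n has_derivative (\<lambda>v. (hpoly (of_nat n * c) (n - 1) x, hpoly (\<i> * of_nat n * c) (n - 1) x) \<bullet> v)) (at x)"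
proof -
  have "((\<lambda>x. c * cplx x ^ n) has_derivative (\<lambda>v. c * (of_nat n * cplx v * cplx x ^ (n - 1)))) (at x)"
    by (intro has_derivative_mult_right has_derivative_power bounded_linear_imp_has_derivative bounded_linear_cplx)
  from bounded_linear.has_derivative[OF bounded_linear_Re this]
  show ?thesis unfolding hpoly_def[abs_def]
    by (rule has_derivative_eq_rhs) (auto simp: fun_eq_iff inner_prod_def cplx_def algebra_simps)
qed

text \<open>Euler's identity for a homogeneous function of degree n.\<close>

lemma hpoly_euler:
  "fst x * hpoly (of_nat n * c) (n - 1) x + snd x * hpoly (\<i> * of_nat n * c) (n - 1) x = real n * hpoly c n x"
proof (cases n)
  case (Suc m)
  have e: "hpoly (of_nat n * d) m x = real n * hpoly d m x" for d by (simp add: hpoly_def mult.assoc)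
  have i: "\<i> * of_nat n * c = of_nat n * (\<i> * c)" by (simp add: ac_simps)
  have m: "n - 1 = m" using Suc by simp
  have "fst x * hpoly (of_nat n * c) (n - 1) x + snd x * hpoly (\<i> * of_nat n * c) (n - 1) x
      = real n * (fst x * hpoly c m x + snd x * hpoly (\<i> * c) m x)"
    unfolding i m e by (simp add: algebra_simps)
  also have "\<dots> = real n * hpoly c n x" unfolding Suc hpoly_Suc ..
  finally show ?thesis .
qed (simp add: hpoly_def)

lemma tcoord_has_derivative: "(tcoord has_derivative (\<lambda>v. - 2 * (x \<bullet> v) * (tcoord x)\<^sup>2)) (at x)"
proof -
  have d: "((\<lambda>x::plane. 1 + x \<bullet> x) has_derivative (\<lambda>v. 2 * (x \<bullet> v))) (at x)"
    by (auto intro!: derivative_eq_intros simp: inner_commute)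
  have nz: "1 + x \<bullet> x \<noteq> 0" using one_plus_norm_pos(2)[of x] by (simp add: power2_norm_eq_inner)
  have eq: "tcoord = (\<lambda>x. inverse (1 + x \<bullet> x))"
    by (simp add: tcoord_def fun_eq_iff power2_norm_eq_inner divide_inverse)
  show ?thesis unfolding eq
    by (rule has_derivative_eq_rhs[OF Deriv.has_derivative_inverse[OF nz d]]) (auto simp: fun_eq_iff power2_eq_square)
qed

lemma radial_has_derivative:
  "(radial a q has_derivative (\<lambda>v. - 2 * (x \<bullet> v) * radial (a + 1) (radial' a q) x)) (at x)"
proof -
  let ?t = "tcoord x"
  have "((\<lambda>t. t powr a * poly q t) has_real_derivative
      ?t powr a * poly (pderiv q) ?t + a * ?t powr (a - 1) * poly q ?t) (at ?t)"
    by (rule DERIV_mult'[OF has_real_derivative_powr poly_DERIV]) simp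
  from has_derivative_compose[OF tcoord_has_derivative this[unfolded has_field_derivative_def]]
  show ?thesis unfolding radial_def[abs_def]
  proof (rule has_derivative_eq_rhs, intro ext)
    fix v
    have p: "?t powr (a + 1) = ?t powr a * ?t" "?t powr a = ?t powr (a - 1) * ?t"
      by (simp_all add: powr_add[symmetric] powr_mult_base powr_add powr_diff)
    show "(?t powr a * poly (pderiv q) ?t + a * ?t powr (a - 1) * poly q ?t) * (- 2 * (x \<bullet> v) * ?t\<^sup>2)
       = - 2 * (x \<bullet> v) * (?t powr (a + 1) * poly (radial' a q) ?t)"
      unfolding p(1) by (subst (1 2) p(2)) (simp add: radial'_def power2_eq_square algebra_simps)
  qed
qed

lemma smooth_radial: "smooth (radial a q)"
proof -
  have s1: "smooth (\<lambda>x::plane. 1 + (norm x)\<^sup>2)" by (intro smooth_add smooth_const smooth_norm_squared)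
  have st: "smooth tcoord"
  proof -
    have "tcoord = (\<lambda>x. (1 + (norm x)\<^sup>2) powr - 1)"
      by (simp add: tcoord_def fun_eq_iff powr_minus divide_inverse)
    then show ?thesis using smooth_powr[OF _ s1, of "- 1"] by simp
  qed
  show ?thesis unfolding radial_def[abs_def]
    by (intro smooth_mult smooth_powr[OF _ st] smooth_compose[OF smooth_poly st]) simp
qed

text \<open>With \<open>t = 1/(1 + r\<^sup>2)\<close>, the indicial exponents at the two poles of the radial equation for the angular
  mode \<open>n\<close> suggest the ansatz \<open>r\<^sup>n t\<^sup>a q(t)\<close> with \<open>a = (n + \<surd>(n\<^sup>2 + 4\<omega>\<^sup>2))/2\<close>.\<close>

definition sexp :: "real \<Rightarrow> nat \<Rightarrow> real" where
  "sexp \<omega> n = sqrt ((real n)\<^sup>2 + 4 * \<omega>\<^sup>2)"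

definition aexp :: "real \<Rightarrow> nat \<Rightarrow> real" where
  "aexp \<omega> n = (real n + sexp \<omega> n) / 2"

definition psi :: "real \<Rightarrow> nat \<Rightarrow> complex \<Rightarrow> real poly \<Rightarrow> plane \<Rightarrow> real" where
  "psi \<omega> n c q x = hpoly c n x * radial (aexp \<omega> n) q x"

definition grad_psi :: "real \<Rightarrow> nat \<Rightarrow> complex \<Rightarrow> real poly \<Rightarrow> plane \<Rightarrow> plane" where
  "grad_psi \<omega> n c q x =
     radial (aexp \<omega> n) q x *\<^sub>R (hpoly (of_nat n * c) (n - 1) x, hpoly (\<i> * of_nat n * c) (n - 1) x)
     + (- 2 * hpoly c n x * radial (aexp \<omega> n + 1) (radial' (aexp \<omega> n) q) x) *\<^sub>R x"

text \<open>\<open>L\<^sub>\<omega>\<close> acts on the polynomial factor as a hypergeometric differential operator.\<close>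

definition hyper_op :: "real \<Rightarrow> nat \<Rightarrow> real poly \<Rightarrow> real poly" where
  "hyper_op \<omega> n q = [:0, - 1, 1:] * pderiv (pderiv q)
     + [:- (1 + sexp \<omega> n), 2 * aexp \<omega> n + 2:] * pderiv q
     + smult (aexp \<omega> n * (aexp \<omega> n + 1) - \<omega>\<^sup>2) q"

lemma sexp_facts:
  "(sexp \<omega> n)\<^sup>2 = (real n)\<^sup>2 + 4 * \<omega>\<^sup>2" "sexp \<omega> n \<ge> real n" "sexp \<omega> n \<ge> 0" "\<omega> \<ge> 0 \<Longrightarrow> sexp \<omega> n \<ge> 2 * \<omega>"
  "\<omega> \<ge> 0 \<Longrightarrow> sexp \<omega> n \<le> real n + 2 * \<omega>" "sexp 0 n = real n"
proof -
  show "sexp \<omega> n \<ge> real n" unfolding sexp_def by (rule real_le_rsqrt) simp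
  show "\<omega> \<ge> 0 \<Longrightarrow> sexp \<omega> n \<ge> 2 * \<omega>" unfolding sexp_def by (rule real_le_rsqrt) (simp add: power_mult_distrib)
  show "\<omega> \<ge> 0 \<Longrightarrow> sexp \<omega> n \<le> real n + 2 * \<omega>"
    unfolding sexp_def by (rule real_le_lsqrt) (auto simp: power2_eq_square algebra_simps)
qed (auto simp: sexp_def)

text \<open>\<open>aexp\<close> is the larger root of the indicial equation a^2 = n a +
  \<omega>^2.\<close>

lemma aexp_facts: "2 * aexp \<omega> n = real n + sexp \<omega> n" "aexp \<omega> n * aexp \<omega> n = real n * aexp \<omega> n + \<omega>\<^sup>2" "aexp \<omega> n \<ge> 0"
proof -
  show 1: "2 * aexp \<omega> n = real n + sexp \<omega> n" by (simp add: aexp_def)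
  have "(2 * aexp \<omega> n - real n)\<^sup>2 = (real n)\<^sup>2 + 4 * \<omega>\<^sup>2" unfolding 1 by (simp add: sexp_facts(1))
  then show "aexp \<omega> n * aexp \<omega> n = real n * aexp \<omega> n + \<omega>\<^sup>2" by (simp add: power2_eq_square algebra_simps)
  show "aexp \<omega> n \<ge> 0" by (simp add: aexp_def sexp_facts)
qed

lemma psi_has_derivative: "(psi \<omega> n c q has_derivative (\<lambda>v. grad_psi \<omega> n c q x \<bullet> v)) (at x)"
  unfolding psi_def[abs_def]
  by (rule has_derivative_eq_rhs[OF has_derivative_mult[OF hpoly_has_derivative radial_has_derivative]])
    (auto simp: fun_eq_iff grad_psi_def inner_add_left algebra_simps)

lemma smooth_psi: "smooth (psi \<omega> n c q)"
  unfolding psi_def[abs_def] by (intro smooth_mult smooth_hpoly smooth_radial)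

lemma frechet_derivative_psi: "frechet_derivative (psi \<omega> n c q) (at x) v = grad_psi \<omega> n c q x \<bullet> v"
  using frechet_derivative_at[OF psi_has_derivative] by metis

lemma smooth_grad_psi: "b \<in> Basis \<Longrightarrow> smooth (\<lambda>x. grad_psi \<omega> n c q x \<bullet> b)"
  using smooth_partial[OF smooth_psi, of b \<omega> n c q] by (simp add: frechet_derivative_psi)

lemma grad_psi_measurable [measurable]: "grad_psi \<omega> n c q \<in> borel_measurable borel"
proof -
  have "grad_psi \<omega> n c q = (\<lambda>x. \<Sum>b\<in>Basis. (grad_psi \<omega> n c q x \<bullet> b) *\<^sub>R b)"
    by (simp add: fun_eq_iff euclidean_representation)
  also have "\<dots> \<in> borel_measurable borel"
    by (intro borel_measurable_sum borel_measurable_scaleR borel_measurable_const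
        borel_measurable_continuous_onI smooth_continuous smooth_grad_psi)
  finally show ?thesis .
qed

lemma psi_measurable [measurable]: "psi \<omega> n c q \<in> borel_measurable borel"
  by (intro borel_measurable_continuous_onI smooth_continuous smooth_psi)

text \<open>The left side is the Euclidean Laplacian of psi. The angular polynomial is harmonic, and
  by Euler's identity the cross term is a multiple of it, so only an ordinary differential
  expression in t remains.\<close>

lemma psi_laplacian:
  "(\<Sum>b\<in>Basis. frechet_derivative (\<lambda>x. grad_psi \<omega> n c q x \<bullet> b) (at x) b)
    = potential \<omega> x * psi \<omega> n c q x - conf x * psi \<omega> n c (hyper_op \<omega> n q) x"
proof -
  define a where "a = aexp \<omega> n"
  let ?q1 = "radial' a q"
  let ?q2 = "radial' (a + 1) ?q1"
  define h where "h = hpoly c n"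
  define hx where "hx = hpoly (of_nat n * c) (n - 1)"
  define hy where "hy = hpoly (\<i> * of_nat n * c) (n - 1)"
  define k where "k = hpoly (of_nat (n - 1) * (of_nat n * c)) (n - 1 - 1)"
  define R0 where "R0 = radial a q"
  define R1 where "R1 = radial (a + 1) ?q1"
  define R2 where "R2 = radial (a + 1 + 1) ?q2"
  \<comment> \<open>Harmonicity: two factors \<i> make the second partial derivatives in the two
    directions opposite, so they cancel in the Laplacian. The mixed derivatives \<open>kk\<close>
    and \<open>kk'\<close> drop out.\<close>
  have k: "hpoly (\<i> * of_nat (n - 1) * (\<i> * of_nat n * c)) (n - 1 - 1) = (\<lambda>x. - k x)"
    by (simp add: k_def hpoly_def fun_eq_iff algebra_simps)
  have hd: "(h has_derivative (\<lambda>v. (hx x, hy x) \<bullet> v)) (at x)"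
    unfolding h_def hx_def hy_def by (rule hpoly_has_derivative)
  obtain kk where hxd: "(hx has_derivative (\<lambda>v. (k x, kk) \<bullet> v)) (at x)"
    unfolding hx_def k_def using hpoly_has_derivative by blast
  obtain kk' where hyd: "(hy has_derivative (\<lambda>v. (kk', - k x) \<bullet> v)) (at x)"
    unfolding hy_def using hpoly_has_derivative[of "\<i> * of_nat n * c" "n - 1" x] unfolding k by blast
  have Rd: "(R0 has_derivative (\<lambda>v. - 2 * (x \<bullet> v) * R1 x)) (at x)" "(R1 has_derivative (\<lambda>v. - 2 * (x \<bullet> v) * R2 x)) (at x)"
    unfolding R0_def R1_def R2_def by (rule radial_has_derivative)+
  have g1: "(\<lambda>x. grad_psi \<omega> n c q x \<bullet> (1, 0)) = (\<lambda>x. R0 x * hx x + (- 2 * h x * R1 x) * fst x)"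
    and g2: "(\<lambda>x. grad_psi \<omega> n c q x \<bullet> (0, 1)) = (\<lambda>x. R0 x * hy x + (- 2 * h x * R1 x) * snd x)"
    by (simp_all add: fun_eq_iff grad_psi_def inner_prod_def R0_def R1_def h_def hx_def hy_def a_def)
  have "((\<lambda>x. R0 x * hx x + (- 2 * h x * R1 x) * fst x) has_derivative
     (\<lambda>v. R0 x * ((k x, kk) \<bullet> v) + (- 2 * (x \<bullet> v) * R1 x) * hx x
        + ((- 2 * h x * R1 x) * fst v + ((- 2 * h x) * (- 2 * (x \<bullet> v) * R2 x) + (- 2 * ((hx x, hy x) \<bullet> v)) * R1 x) * fst x))) (at x)"
    by (intro has_derivative_add has_derivative_mult Rd hxd hd has_derivative_mult_right has_derivative_fst has_derivative_ident)
  from frechet_derivative_at[OF this, symmetric]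
  have e1: "frechet_derivative (\<lambda>x. grad_psi \<omega> n c q x \<bullet> (1, 0)) (at x) (1, 0)
     = R0 x * k x + (- 2 * fst x * R1 x) * hx x + ((- 2 * h x * R1 x) + ((- 2 * h x) * (- 2 * fst x * R2 x) + (- 2 * hx x) * R1 x) * fst x)"
    unfolding g1 by (simp add: inner_prod_def)
  have "((\<lambda>x. R0 x * hy x + (- 2 * h x * R1 x) * snd x) has_derivative
     (\<lambda>v. R0 x * ((kk', - k x) \<bullet> v) + (- 2 * (x \<bullet> v) * R1 x) * hy x
        + ((- 2 * h x * R1 x) * snd v + ((- 2 * h x) * (- 2 * (x \<bullet> v) * R2 x) + (- 2 * ((hx x, hy x) \<bullet> v)) * R1 x) * snd x))) (at x)"
    by (intro has_derivative_add has_derivative_mult Rd hyd hd has_derivative_mult_right has_derivative_snd has_derivative_ident)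
  from frechet_derivative_at[OF this, symmetric]
  have e2: "frechet_derivative (\<lambda>x. grad_psi \<omega> n c q x \<bullet> (0, 1)) (at x) (0, 1)
     = - (R0 x * k x) + (- 2 * snd x * R1 x) * hy x + ((- 2 * h x * R1 x) + ((- 2 * h x) * (- 2 * snd x * R2 x) + (- 2 * hy x) * R1 x) * snd x)"
    unfolding g2 by (simp add: inner_prod_def)
  have eu: "fst x * hx x + snd x * hy x = real n * h x" unfolding hx_def hy_def h_def by (rule hpoly_euler)
  have "(\<Sum>b\<in>Basis. frechet_derivative (\<lambda>x. grad_psi \<omega> n c q x \<bullet> b) (at x) b)
      = - 4 * R1 x * (fst x * hx x + snd x * hy x) - 4 * h x * R1 x + 4 * h x * R2 x * ((fst x)\<^sup>2 + (snd x)\<^sup>2)"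
    unfolding Basis_plane by (simp add: e1 e2 power2_eq_square algebra_simps)
  also have "\<dots> = 4 * h x * ((norm x)\<^sup>2 * R2 x - (real n + 1) * R1 x)"
    unfolding eu norm_plane by (simp add: algebra_simps)
  also have "\<dots> = potential \<omega> x * psi \<omega> n c q x - conf x * psi \<omega> n c (hyper_op \<omega> n q) x"
  proof -
    define t where "t = tcoord x"
    have t: "t > 0" "t * (1 + (norm x)\<^sup>2) = 1" by (simp_all add: t_def tcoord_def)
    \<comment> \<open>This relation eliminates r in favour of t.\<close>
    have \<rho>: "t * (norm x)\<^sup>2 = 1 - t" using t(2) by (simp add: algebra_simps)
    have cf: "conf x = 4 * t * t" by (simp add: conf_def t_def tcoord_def power2_eq_square)
    have pw: "t powr (a + 1) = t powr a * t" "t powr (a + 1 + 1) = t powr a * t * t"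
      using t(1) by (simp_all add: powr_add power2_eq_square)
    define P0 P1 P2 where "P0 = poly q t" and "P1 = poly (pderiv q) t" and "P2 = poly (pderiv (pderiv q)) t"
    define s where "s = sexp \<omega> n"
    have as: "s = 2 * a - real n" "a * a = real n * a + \<omega>\<^sup>2"
      using aexp_facts[of \<omega> n] by (simp_all add: a_def s_def)
    have q1: "poly ?q1 t = a * P0 + t * P1" by (simp add: radial'_def P0_def P1_def)
    have q2: "poly ?q2 t = (a + 1) * (a * P0 + t * P1) + t * (a * P1 + (P1 + t * P2))"
      by (simp add: radial'_def P0_def P1_def P2_def pderiv_add pderiv_mult pderiv_smult pderiv_pCons)
    have qd: "poly (hyper_op \<omega> n q) t = (t * t - t) * P2 + ((2 * a + 2) * t - (1 + s)) * P1 + (a * (a + 1) - \<omega>\<^sup>2) * P0"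
      by (simp add: hyper_op_def P0_def P1_def P2_def a_def s_def algebra_simps)
    \<comment> \<open>The indicial equation is exactly what makes the coefficients of
      \<open>P0\<close> on the two sides agree.\<close>
    have key: "(1 - t) * poly ?q2 t - (real n + 1) * poly ?q1 t = \<omega>\<^sup>2 * (1 - t) * P0 - t * poly (hyper_op \<omega> n q) t"
      unfolding q1 q2 qd as(1) using as(2) by algebra
    have "4 * h x * ((norm x)\<^sup>2 * R2 x - (real n + 1) * R1 x)
       = 4 * h x * (t powr a * t) * ((1 - t) * poly ?q2 t - (real n + 1) * poly ?q1 t)"
      unfolding R1_def R2_def radial_def t_def[symmetric] pw \<rho>[symmetric] by (simp add: algebra_simps)
    also have "\<dots> = 4 * h x * (t powr a * t) * (\<omega>\<^sup>2 * (t * (norm x)\<^sup>2) * P0 - t * poly (hyper_op \<omega> n q) t)"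
      unfolding key \<rho> ..
    also have "\<dots> = potential \<omega> x * psi \<omega> n c q x - conf x * psi \<omega> n c (hyper_op \<omega> n q) x"
      unfolding potential_def cf psi_def radial_def t_def[symmetric] h_def a_def[symmetric] P0_def
      by (simp add: algebra_simps)
    finally show ?thesis .
  qed
  finally show ?thesis .
qed

section \<open>Decay at the pole and square integrability\<close>

lemma poly_tcoord_bound: obtains C where "C \<ge> 0" "\<And>x. \<bar>poly (q::real poly) (tcoord x)\<bar> \<le> C"
proof -
  have "bounded (poly q ` {0..1})"
    by (intro compact_imp_bounded compact_continuous_image continuous_intros) auto
  then obtain C where "C > 0" "\<And>t. t \<in> {0..1} \<Longrightarrow> \<bar>poly q t\<bar> \<le> C" unfolding bounded_pos by auto
  then show ?thesis using that[of C] tcoord_le_1 by simp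
qed

lemma tcoord_powr: "tcoord x powr a = (1 + (norm x)\<^sup>2) powr - a"
  by (simp add: tcoord_def powr_divide powr_minus_divide)

lemma norm_power_le: "norm x ^ n \<le> (1 + (norm (x::plane))\<^sup>2) powr (real n / 2)"
proof -
  have "norm x ^ n \<le> sqrt (1 + (norm x)\<^sup>2) ^ n"
    by (intro power_mono real_le_rsqrt) auto
  also have "\<dots> = (1 + (norm x)\<^sup>2) powr (real n / 2)"
    by (simp add: powr_half_sqrt[symmetric] powr_powr flip: powr_realpow)
  finally show ?thesis .
qed

lemma hpoly_radial_bound:
  obtains K where "K \<ge> 0" "\<And>x. \<bar>hpoly c n x * radial a q x\<bar> \<le> K * (1 + (norm x)\<^sup>2) powr (real n / 2 - a)"
proof -
  obtain C where C: "C \<ge> 0" "\<And>x. \<bar>poly q (tcoord x)\<bar> \<le> C" using poly_tcoord_bound by blast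
  have "\<bar>hpoly c n x * radial a q x\<bar> \<le> cmod c * C * (1 + (norm x)\<^sup>2) powr (real n / 2 - a)" for x
  proof -
    have "\<bar>hpoly c n x * radial a q x\<bar> = \<bar>hpoly c n x\<bar> * (tcoord x powr a * \<bar>poly q (tcoord x)\<bar>)"
      by (simp add: radial_def abs_mult)
    also have "\<dots> \<le> (cmod c * (1 + (norm x)\<^sup>2) powr (real n / 2)) * (tcoord x powr a * C)"
      using C order_trans[OF hpoly_bound mult_left_mono[OF norm_power_le]]
      by (intro mult_mono) auto
    also have "\<dots> = cmod c * C * ((1 + (norm x)\<^sup>2) powr (real n / 2) * (1 + (norm x)\<^sup>2) powr - a)"
      by (simp add: tcoord_powr)
    also have "\<dots> = cmod c * C * (1 + (norm x)\<^sup>2) powr (real n / 2 - a)"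
      by (simp add: powr_add[symmetric])
    finally show ?thesis .
  qed
  then show ?thesis using that[of "cmod c * C"] C by simp
qed

text \<open>The growth r^n against the decay of t^a leaves n/2 - a = -s/2 as the exponent of 1 +
  r^2.\<close>

lemma psi_bound:
  obtains K where "K \<ge> 0" "\<And>x. \<bar>psi \<omega> n c q x\<bar> \<le> K * (1 + (norm x)\<^sup>2) powr - (sexp \<omega> n / 2)"
proof -
  obtain K where K: "K \<ge> 0" "\<And>x. \<bar>hpoly c n x * radial (aexp \<omega> n) q x\<bar> \<le> K * (1 + (norm x)\<^sup>2) powr (real n / 2 - aexp \<omega> n)"
    using hpoly_radial_bound by blast
  have "real n / 2 - aexp \<omega> n = - (sexp \<omega> n / 2)" by (simp add: aexp_def field_simps)
  then show ?thesis using that K unfolding psi_def by simp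
qed

lemma norm_scale_bound:
  assumes "\<And>x. \<bar>f x\<bar> \<le> K * (1 + (norm x)\<^sup>2) powr e"
  shows "norm (f x *\<^sub>R (x::plane)) \<le> K * (1 + (norm x)\<^sup>2) powr (e + 1/2)"
proof -
  have "norm (f x *\<^sub>R x) \<le> (K * (1 + (norm x)\<^sup>2) powr e) * (1 + (norm x)\<^sup>2) powr (1/2)"
    unfolding norm_scaleR using assms[of x] norm_power_le[of x 1] order_trans[OF abs_ge_zero assms[of x]]
    by (intro mult_mono) auto
  also have "\<dots> = K * (1 + (norm x)\<^sup>2) powr (e + 1/2)" by (simp add: powr_add)
  finally show ?thesis .
qed

text \<open>One power of r is gained over \<open>psi_bound\<close>. For n = 0 the terms with n - 1
  vanish identically and are treated separately, since truncated subtraction would spoil the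
  exponent.\<close>

lemma grad_psi_bound:
  obtains K where "K \<ge> 0" "\<And>x. norm (grad_psi \<omega> n c q x) \<le> K * (1 + (norm x)\<^sup>2) powr - ((sexp \<omega> n + 1) / 2)"
proof -
  let ?a = "aexp \<omega> n"
  let ?e = "- ((sexp \<omega> n + 1) / 2)"
  obtain K1 where K1: "K1 \<ge> 0" "\<And>x. \<bar>hpoly (of_nat n * c) (n - 1) x * radial ?a q x\<bar> \<le> K1 * (1 + (norm x)\<^sup>2) powr ?e"
  proof (cases n)
    case 0
    then show ?thesis using that[of 0] by (simp add: hpoly_def)
  next
    case (Suc m)
    have "real (n - 1) / 2 - ?a = ?e" by (simp add: aexp_def Suc field_simps)
    then show ?thesis using hpoly_radial_bound[of "of_nat n * c" "n - 1" ?a q] that by metis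
  qed
  obtain K2 where K2: "K2 \<ge> 0" "\<And>x. \<bar>hpoly (\<i> * of_nat n * c) (n - 1) x * radial ?a q x\<bar> \<le> K2 * (1 + (norm x)\<^sup>2) powr ?e"
  proof (cases n)
    case 0
    then show ?thesis using that[of 0] by (simp add: hpoly_def)
  next
    case (Suc m)
    have "real (n - 1) / 2 - ?a = ?e" by (simp add: aexp_def Suc field_simps)
    then show ?thesis using hpoly_radial_bound[of "\<i> * of_nat n * c" "n - 1" ?a q] that by metis
  qed
  obtain K3 where K3: "K3 \<ge> 0" "\<And>x. \<bar>hpoly c n x * radial (?a + 1) (radial' ?a q) x\<bar> \<le> K3 * (1 + (norm x)\<^sup>2) powr (real n / 2 - (?a + 1))"
    using hpoly_radial_bound by blast
  have e3: "real n / 2 - (?a + 1) + 1/2 = ?e" by (simp add: aexp_def field_simps)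
  have "norm (grad_psi \<omega> n c q x) \<le> (K1 + K2 + 2 * K3) * (1 + (norm x)\<^sup>2) powr ?e" for x
  proof -
    let ?v = "radial ?a q x *\<^sub>R (hpoly (of_nat n * c) (n - 1) x, hpoly (\<i> * of_nat n * c) (n - 1) x)"
    let ?w = "(hpoly c n x * radial (?a + 1) (radial' ?a q) x) *\<^sub>R x"
    have g: "grad_psi \<omega> n c q x = ?v + (- 2) *\<^sub>R ?w" by (simp add: grad_psi_def)
    have "norm (v + (- 2) *\<^sub>R w) \<le> norm v + 2 * norm w" for v w :: plane
      using norm_triangle_ineq[of v "(- 2) *\<^sub>R w"] by simp
    then have "norm (grad_psi \<omega> n c q x) \<le> norm ?v + 2 * norm ?w" unfolding g .
    moreover have "norm ?v \<le> K1 * (1 + (norm x)\<^sup>2) powr ?e + K2 * (1 + (norm x)\<^sup>2) powr ?e"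
      using norm_Pair_le[of "radial ?a q x * hpoly (of_nat n * c) (n - 1) x" "radial ?a q x * hpoly (\<i> * of_nat n * c) (n - 1) x"] K1(2)[of x] K2(2)[of x]
      by (simp add: mult.commute)
    moreover have "norm ?w \<le> K3 * (1 + (norm x)\<^sup>2) powr ?e"
      using norm_scale_bound[of "\<lambda>x. hpoly c n x * radial (?a + 1) (radial' ?a q) x", OF K3(2)] unfolding e3 .
    ultimately show ?thesis by (simp add: distrib_right)
  qed
  then show ?thesis using that[of "K1 + K2 + 2 * K3"] K1 K2 K3 by simp
qed

text \<open>When \<open>\<omega> = n = 0\<close> the function does not decay at the pole, but its gradient still does.\<close>

lemma grad_psi_bound_0:
  obtains K where "K \<ge> 0" "\<And>x. norm (grad_psi 0 n c q x) \<le> K * (1 + (norm x)\<^sup>2) powr - 1"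
proof (cases n)
  case 0
  have a: "aexp 0 n = 0" by (simp add: aexp_def sexp_facts 0)
  \<comment> \<open>With a = 0 the Euler operator leaves t q', and its factor t is the additional
    decay.\<close>
  have r: "radial 1 (radial' 0 q) x = radial 2 (pderiv q) x" for x
    using powr_add[of "tcoord x" 1 1] by (simp add: radial_def radial'_def)
  obtain K where K: "K \<ge> 0" "\<And>x. \<bar>hpoly c 0 x * radial 2 (pderiv q) x\<bar> \<le> K * (1 + (norm x)\<^sup>2) powr (real 0 / 2 - 2)"
    using hpoly_radial_bound by blast
  have "norm (grad_psi 0 n c q x) \<le> (2 * K) * (1 + (norm x)\<^sup>2) powr - 1" for x
  proof -
    let ?v = "(hpoly c 0 x * radial 2 (pderiv q) x) *\<^sub>R x"
    have g: "grad_psi 0 n c q x = (- 2) *\<^sub>R ?v"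
      by (simp add: grad_psi_def a r) (simp add: 0 hpoly_def zero_prod_def[symmetric] mult.assoc)
    have n2: "norm ((- 2) *\<^sub>R v) = 2 * norm v" for v :: plane by simp
    have "norm ?v \<le> K * (1 + (norm x)\<^sup>2) powr (real 0 / 2 - 2 + 1/2)"
      by (rule norm_scale_bound[of "\<lambda>x. hpoly c 0 x * radial 2 (pderiv q) x", OF K(2)])
    also have "\<dots> \<le> K * (1 + (norm x)\<^sup>2) powr - 1"
      by (intro mult_left_mono powr_mono K) auto
    finally show ?thesis unfolding g n2 by linarith
  qed
  then show ?thesis using that[of "2 * K"] K(1) by simp
next
  case (Suc m)
  obtain K where K: "K \<ge> 0" "\<And>x. norm (grad_psi 0 n c q x) \<le> K * (1 + (norm x)\<^sup>2) powr - ((sexp 0 n + 1) / 2)"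
    using grad_psi_bound by blast
  have "(1 + (norm x)\<^sup>2) powr - ((sexp 0 n + 1) / 2) \<le> (1 + (norm x)\<^sup>2) powr - 1" for x :: plane
    by (intro powr_mono) (auto simp: sexp_facts Suc)
  then show ?thesis using that[OF K(1)] K by (meson mult_left_mono order_trans)
qed

lemma psi_bounded: obtains K where "\<And>x. \<bar>psi \<omega> n c q x\<bar> \<le> K"
proof -
  obtain K where K: "K \<ge> 0" "\<And>x. \<bar>psi \<omega> n c q x\<bar> \<le> K * (1 + (norm x)\<^sup>2) powr - (sexp \<omega> n / 2)"
    using psi_bound by blast
  have "(1 + (norm x)\<^sup>2) powr - (sexp \<omega> n / 2) \<le> 1" for x :: plane
    using powr_mono[of "- (sexp \<omega> n / 2)" 0 "1 + (norm x)\<^sup>2"] sexp_facts(3)[of \<omega> n] by simp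
  then have "\<bar>psi \<omega> n c q x\<bar> \<le> K" for x using K by (meson mult_left_le order_trans)
  then show ?thesis using that by blast
qed

lemma grad_psi_square_integrable:
  assumes "\<omega> \<ge> 0"
  shows "integrable lborel (\<lambda>x. (norm (grad_psi \<omega> n c q x))\<^sup>2)"
proof -
  \<comment> \<open>Integrability over the plane requires a positive e. For \<omega> > 0 it is s >=
    2 \<omega>; for \<omega> = 0 the improved gradient bound gives e = 1.\<close>
  obtain K e where K: "K \<ge> 0" "e > 0" "\<And>x. norm (grad_psi \<omega> n c q x) \<le> K * (1 + (norm x)\<^sup>2) powr - ((1 + e) / 2)"
  proof (cases "\<omega> = 0")
    case True
    obtain K where "K \<ge> 0" "\<And>x. norm (grad_psi 0 n c q x) \<le> K * (1 + (norm x)\<^sup>2) powr - 1"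
      using grad_psi_bound_0 by blast
    then show ?thesis using that[of K 1] True by simp
  next
    case False
    then have "sexp \<omega> n > 0" using sexp_facts(4)[of \<omega> n] assms by linarith
    moreover obtain K where "K \<ge> 0" "\<And>x. norm (grad_psi \<omega> n c q x) \<le> K * (1 + (norm x)\<^sup>2) powr - ((sexp \<omega> n + 1) / 2)"
      using grad_psi_bound by blast
    ultimately show ?thesis using that[of K "sexp \<omega> n"] by (simp add: add.commute)
  qed
  show ?thesis
  proof (rule Bochner_Integration.integrable_bound)
    show "integrable lborel (\<lambda>x::plane. K\<^sup>2 * (1 + (norm x)\<^sup>2) powr - (1 + e))"
      by (intro integrable_mult_right integrable_inverse_power_plane K)
    show "AE x in lborel. norm ((norm (grad_psi \<omega> n c q x))\<^sup>2) \<le> norm (K\<^sup>2 * (1 + (norm x)\<^sup>2) powr - (1 + e))"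
    proof (rule AE_I2)
      fix x :: plane
      have "(norm (grad_psi \<omega> n c q x))\<^sup>2 \<le> (K * (1 + (norm x)\<^sup>2) powr - ((1 + e) / 2))\<^sup>2"
        using K(3) by (intro power_mono) auto
      also have "\<dots> = K\<^sup>2 * (1 + (norm x)\<^sup>2) powr - (1 + e)"
        by (simp add: power_mult_distrib power2_eq_square[of "_ powr _"] powr_add[symmetric])
      finally show "norm ((norm (grad_psi \<omega> n c q x))\<^sup>2) \<le> norm (K\<^sup>2 * (1 + (norm x)\<^sup>2) powr - (1 + e))" by simp
    qed
  qed measurable
qed

lemma psi_square_integrable: "integrable lborel (\<lambda>x. conf x * (psi \<omega> n c q x)\<^sup>2)"
proof -
  obtain K where K: "\<And>x. \<bar>psi \<omega> n c q x\<bar> \<le> K" using psi_bounded by blast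
  show ?thesis
  proof (rule Bochner_Integration.integrable_bound)
    show "integrable lborel (\<lambda>x. conf x * K\<^sup>2)" using integrable_conf by simp
    have "(psi \<omega> n c q x)\<^sup>2 \<le> K\<^sup>2" for x using power_mono[OF K[of x], of 2] by simp
    then show "AE x in lborel. norm (conf x * (psi \<omega> n c q x)\<^sup>2) \<le> norm (conf x * K\<^sup>2)"
      by (auto simp: abs_mult intro!: mult_left_mono)
  qed measurable
qed

text \<open>For \<omega> > 0 the potential alone decays like 1/r^2, just too slowly for the plane;
  the decay r^(-s) of psi makes up for it.\<close>

lemma psi_potential_integrable:
  assumes "\<omega> \<ge> 0"
  shows "integrable lborel (\<lambda>x. potential \<omega> x * (psi \<omega> n c q x)\<^sup>2)"
proof (cases "\<omega> = 0")
  case True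
  then show ?thesis by (simp add: potential_def)
next
  case False
  then have s: "sexp \<omega> n > 0" using sexp_facts(4)[of \<omega> n] assms by linarith
  obtain K where K: "K \<ge> 0" "\<And>x. \<bar>psi \<omega> n c q x\<bar> \<le> K * (1 + (norm x)\<^sup>2) powr - (sexp \<omega> n / 2)"
    using psi_bound by blast
  show ?thesis
  proof (rule Bochner_Integration.integrable_bound)
    show "integrable lborel (\<lambda>x::plane. (4 * \<omega>\<^sup>2 * K\<^sup>2) * (1 + (norm x)\<^sup>2) powr - (1 + sexp \<omega> n))"
      by (intro integrable_mult_right integrable_inverse_power_plane s)
    show "AE x in lborel. norm (potential \<omega> x * (psi \<omega> n c q x)\<^sup>2)
        \<le> norm ((4 * \<omega>\<^sup>2 * K\<^sup>2) * (1 + (norm x)\<^sup>2) powr - (1 + sexp \<omega> n))"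
    proof (rule AE_I2)
      fix x :: plane
      let ?w = "1 + (norm x)\<^sup>2"
      have "(psi \<omega> n c q x)\<^sup>2 \<le> (K * ?w powr - (sexp \<omega> n / 2))\<^sup>2"
        using power_mono[OF K(2)[of x], of 2] by simp
      also have "\<dots> = K\<^sup>2 * ?w powr - sexp \<omega> n"
        by (simp add: power_mult_distrib power2_eq_square[of "_ powr _"] powr_add[symmetric])
      finally have 1: "(psi \<omega> n c q x)\<^sup>2 \<le> K\<^sup>2 * ?w powr - sexp \<omega> n" .
      have "potential \<omega> x \<le> \<omega>\<^sup>2 * ?w * conf x" by (simp add: potential_def mult_left_mono mult_right_mono)
      also have "\<dots> = 4 * \<omega>\<^sup>2 * ?w powr - 1"
        by (simp add: conf_def powr_minus divide_inverse power2_eq_square[of ?w])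
      finally have 2: "potential \<omega> x \<le> 4 * \<omega>\<^sup>2 * ?w powr - 1" .
      have "potential \<omega> x * (psi \<omega> n c q x)\<^sup>2 \<le> (4 * \<omega>\<^sup>2 * ?w powr - 1) * (K\<^sup>2 * ?w powr - sexp \<omega> n)"
        by (intro mult_mono 1 2) auto
      also have "\<dots> = (4 * \<omega>\<^sup>2 * K\<^sup>2) * ?w powr - (1 + sexp \<omega> n)"
      proof -
        have "?w powr - (1 + sexp \<omega> n) = ?w powr - 1 * ?w powr - sexp \<omega> n"
          using powr_add[of ?w "- 1" "- sexp \<omega> n"] by (simp only: minus_add_distrib)
        then show ?thesis by (simp only: ac_simps)
      qed
      finally show "norm (potential \<omega> x * (psi \<omega> n c q x)\<^sup>2) \<le> norm ((4 * \<omega>\<^sup>2 * K\<^sup>2) * ?w powr - (1 + sexp \<omega> n))"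
        by simp
    qed
  qed measurable
qed

section \<open>The differential of the inversion\<close>

lemma inversion'_inner: "inversion' x v \<bullet> w = v \<bullet> inversion' x w"
  by (simp add: inversion'_def inner_diff_left inner_diff_right inner_commute)

lemma inversion'_linear: "linear (inversion' x)"
  by (intro linearI) (simp_all add: inversion'_def inner_add_right algebra_simps scaleR_add_right add_divide_distrib scaleR_left_distrib)

lemma norm_inversion':
  assumes "x \<noteq> 0"
  shows "(norm (inversion' x v))\<^sup>2 = (norm v)\<^sup>2 / norm x ^ 4"
proof -
  define m where "m = (norm x)\<^sup>2"
  have m: "m > 0" "x \<bullet> x = m" using assms by (simp_all add: m_def power2_norm_eq_inner)
  have m4: "norm x ^ 4 = m\<^sup>2" by (simp add: m_def flip: power_mult)
  have "(norm (inversion' x v))\<^sup>2 = (norm v)\<^sup>2 / m\<^sup>2 - 4 * (x \<bullet> v)\<^sup>2 / (m * m\<^sup>2) + 4 * (x \<bullet> v)\<^sup>2 * m / (m\<^sup>2)\<^sup>2"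
    unfolding inversion'_def m4 m_def[symmetric] power2_norm_eq_inner
    by (simp add: inner_diff_left inner_diff_right m(2) inner_commute power2_eq_square divide_inverse algebra_simps)
  also have "\<dots> = (norm v)\<^sup>2 / m\<^sup>2"
    using m(1) by (simp add: power2_eq_square field_simps)
  finally show ?thesis by (simp add: m4)
qed

lemma inversion'_measurable:
  assumes [measurable]: "F \<in> borel_measurable borel"
  shows "(\<lambda>x. inversion' x (F (inversion x))) \<in> borel_measurable borel"
  unfolding inversion'_def by measurable

text \<open>Conformal invariance of the Dirichlet integral.\<close>

lemma pullback_energy:
  assumes Fm: "F \<in> borel_measurable borel" and F: "integrable lborel (\<lambda>x. (norm (F x :: plane))\<^sup>2)"
  shows "integrable lborel (\<lambda>x. (norm (inversion' x (F (inversion x))))\<^sup>2)"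
    and "(\<integral>x. (norm (inversion' x (F (inversion x))))\<^sup>2 \<partial>lborel) = (\<integral>x. (norm (F x))\<^sup>2 \<partial>lborel)"
proof -
  note [measurable] = Fm inversion'_measurable[OF Fm]
  let ?h = "\<lambda>x. (norm (F x))\<^sup>2 / conf x"
  have hm: "?h \<in> borel_measurable borel" by measurable
  have im: "inversion \<in> plane_measure \<rightarrow>\<^sub>M borel" by (simp cong: measurable_cong_sets)
  have i1: "integrable plane_measure ?h" using F plane_measure_integral(1)[OF hm] by simp
  then have "integrable plane_measure (\<lambda>x. ?h (inversion x))"
    using integrable_distr_eq[OF im hm] by (simp add: distr_inversion)
  then have i2: "integrable lborel (\<lambda>x. conf x * ?h (inversion x))"
    using plane_measure_integral(1)[of "\<lambda>x. ?h (inversion x)"] by simp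
  have ae: "AE x in lborel. conf x * ?h (inversion x) = (norm (inversion' x (F (inversion x))))\<^sup>2"
    using AE_lborel_singleton[of 0]
  proof eventually_elim
    case (elim x)
    then show ?case by (simp add: conf_inversion norm_inversion')
  qed
  show "integrable lborel (\<lambda>x. (norm (inversion' x (F (inversion x))))\<^sup>2)"
    using integrable_cong_AE[OF _ _ ae] i2 by simp
  have "(\<integral>x. (norm (inversion' x (F (inversion x))))\<^sup>2 \<partial>lborel) = (\<integral>x. conf x * ?h (inversion x) \<partial>lborel)"
    using integral_cong_AE[OF _ _ ae] by simp
  also have "\<dots> = (\<integral>x. ?h (inversion x) \<partial>plane_measure)"
    using plane_measure_integral(2)[of "\<lambda>x. ?h (inversion x)"] by simp
  also have "\<dots> = (\<integral>x. ?h x \<partial>plane_measure)"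
    using integral_distr[OF im hm] by (simp add: distr_inversion)
  also have "\<dots> = (\<integral>x. (norm (F x))\<^sup>2 \<partial>lborel)"
    using plane_measure_integral(2)[OF hm] by simp
  finally show "(\<integral>x. (norm (inversion' x (F (inversion x))))\<^sup>2 \<partial>lborel) = (\<integral>x. (norm (F x))\<^sup>2 \<partial>lborel)" .
qed

section \<open>Integration by parts on the sphere\<close>

definition psi_fun :: "real \<Rightarrow> nat \<Rightarrow> complex \<Rightarrow> real poly \<Rightarrow> space3 \<Rightarrow> real" where
  "psi_fun \<omega> n c q p = psi \<omega> n c q (stereo p)"

text \<open>The chain rule for gradients calls for the transposed differential of the transition
  map, which by symmetry is \<open>inversion'\<close> itself.\<close>

definition grad_psi' :: "real \<Rightarrow> nat \<Rightarrow> complex \<Rightarrow> real poly \<Rightarrow> plane \<Rightarrow> plane" where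
  "grad_psi' \<omega> n c q x = inversion' x (grad_psi \<omega> n c q (inversion x))"

lemma locally_integrable_square_integrable:
  fixes G :: "'a::euclidean_space \<Rightarrow> 'b::euclidean_space"
  assumes "G \<in> borel_measurable borel" "integrable lborel (\<lambda>x. (norm (G x))\<^sup>2)"
  shows "locally_integrable G"
proof (rule locally_integrable_square[OF assms(1)])
  fix K :: "'a set" assume "compact K"
  then have "K \<in> sets lborel" by (simp add: borel_compact)
  from integrable_mult_indicator[OF this assms(2)]
  show "set_integrable lborel K (\<lambda>x. (norm (G x))\<^sup>2)" by (simp add: set_integrable_def)
qed

lemma integrable_indicator_cball:
  "integrable lborel (\<lambda>x. (indicator (cball (0::plane) r) x :: real)\<^sup>2)"
proof -
  have "(\<lambda>x. (indicator (cball (0::plane) r) x :: real)\<^sup>2) = indicator (cball 0 r)"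
    by (auto simp: fun_eq_iff indicator_def)
  moreover have "integrable lborel (indicator (cball (0::plane) r) :: plane \<Rightarrow> real)"
    using emeasure_lborel_cball_finite[of "0::plane" r] by (intro integrable_real_indicator) auto
  ultimately show ?thesis by simp
qed

lemma psi_fun_chart1:
  assumes "\<omega> \<ge> 0"
  shows "has_weak_gradient (\<lambda>x. psi_fun \<omega> n c q (inv_stereo x)) (grad_psi \<omega> n c q)"
proof -
  obtain K where K: "\<And>x. \<bar>psi \<omega> n c q x\<bar> \<le> K" using psi_bounded by blast
  have "has_weak_gradient (psi \<omega> n c q) (grad_psi \<omega> n c q)"
    by (rule has_weak_gradient_punctured[OF K psi_has_derivative])
      (intro locally_integrable_square_integrable grad_psi_measurable grad_psi_square_integrable assms)
  then show ?thesis by (simp add: psi_fun_def)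
qed

text \<open>The pole is the origin of this chart, and the function may fail to be differentiable
  there. It is bounded, and conformal invariance makes its gradient square integrable, so the
  singular point can be ignored.\<close>

lemma psi_fun_chart2:
  assumes "\<omega> \<ge> 0"
  shows "has_weak_gradient (\<lambda>x. psi_fun \<omega> n c q (inv_stereo' x)) (grad_psi' \<omega> n c q)"
proof -
  obtain K where K: "\<And>x. \<bar>psi \<omega> n c q x\<bar> \<le> K" using psi_bounded by blast
  have l: "locally_integrable (grad_psi' \<omega> n c q)"
    unfolding grad_psi'_def[abs_def]
    by (intro locally_integrable_square_integrable inversion'_measurable pullback_energy(1)
        grad_psi_measurable grad_psi_square_integrable assms)
  have d: "((\<lambda>x. psi_fun \<omega> n c q (inv_stereo' x)) has_derivative (\<lambda>v. grad_psi' \<omega> n c q x \<bullet> v)) (at x)"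
    if x: "x \<noteq> 0" for x
  proof (rule has_derivative_transform_within_open[of "\<lambda>x. psi \<omega> n c q (inversion x)" _ _ _ "- {0}"])
    show "((\<lambda>x. psi \<omega> n c q (inversion x)) has_derivative (\<lambda>v. grad_psi' \<omega> n c q x \<bullet> v)) (at x)"
      by (rule has_derivative_eq_rhs[OF has_derivative_compose[OF inversion_has_derivative[OF x] psi_has_derivative]])
        (simp add: grad_psi'_def fun_eq_iff inversion'_inner)
  qed (use x in \<open>auto simp: psi_fun_def inv_stereo'_eq\<close>)
  show ?thesis
    by (rule has_weak_gradient_punctured[OF _ d l, of K]) (simp add: psi_fun_def K)
qed

lemma psi_fun_measurable: "psi_fun \<omega> n c q \<in> borel_measurable dV"
  unfolding psi_fun_def[abs_def] by (rule measurable_dV_stereo) simp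

lemma psi_fun_square_integrable: "square_integrable (psi_fun \<omega> n c q)"
proof -
  have "(\<lambda>p. (psi_fun \<omega> n c q p)\<^sup>2) \<in> borel_measurable dV"
    using psi_fun_measurable by (intro borel_measurable_power)
  then have "integrable dV (\<lambda>p. (psi_fun \<omega> n c q p)\<^sup>2)"
    by (subst integral_dV(1)) (use psi_square_integrable in \<open>auto simp: psi_fun_def\<close>)
  then show ?thesis by (simp add: square_integrable_def psi_fun_measurable)
qed

lemma psi_fun_E_form:
  assumes "\<omega> \<ge> 0"
  shows "class_of (psi_fun \<omega> n c q) \<in> E_form \<omega>"
    and "AE x in lborel. weak_differential (fun_of (class_of (psi_fun \<omega> n c q))) x = grad_psi \<omega> n c q x"
  by (rule E_formI[OF psi_fun_square_integrable psi_fun_chart1 psi_fun_chart2 grad_psi_square_integrable];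
      use assms psi_potential_integrable in \<open>simp add: psi_fun_def\<close>)+

lemma measure_cball_plane: "r \<ge> 0 \<Longrightarrow> measure lborel (cball (0::plane) r) = pi * r\<^sup>2"
  using content_cball[of r "0::plane"] by (simp add: unit_ball_vol_2 measure_completion power2_eq_square)

text \<open>Cauchy-Schwarz bounds the integral of |V| over a ball by sqrt pi times its radius times
  the L2 norm, which only gives boundedness. Splitting at a fixed ball, outside of which the norm is
  small, gives the limit 0, since the inner part contributes O(1/k).\<close>

lemma L2_ball_average_tendsto_0:
  fixes V :: "plane \<Rightarrow> real"
  assumes V: "V \<in> borel_measurable borel" "integrable lborel (\<lambda>x. (V x)\<^sup>2)"
  shows "(\<lambda>k. (1 / real (Suc k)) * (\<integral>x. indicator (cball 0 (real (Suc k))) x * \<bar>V x\<bar> \<partial>lborel)) \<longlonglongrightarrow> 0"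
proof (rule LIMSEQ_I)
  fix e :: real assume e: "e > 0"
  have ind2: "integrable lborel (\<lambda>x. (indicator (cball (0::plane) r) x :: real)\<^sup>2)" for r :: real
    by (rule integrable_indicator_cball)
  have "(\<lambda>A. \<integral>x. (V x)\<^sup>2 * indicator (- cball 0 (real A)) x \<partial>lborel) \<longlonglongrightarrow> (\<integral>x. 0 \<partial>(lborel :: plane measure))"
  proof (rule integral_dominated_convergence[where w = "\<lambda>x. (V x)\<^sup>2"])
    show "AE x in lborel. (\<lambda>A. (V x)\<^sup>2 * indicator (- cball 0 (real A)) x) \<longlonglongrightarrow> 0"
    proof (rule AE_I2)
      fix x :: plane
      obtain N :: nat where "norm x < real N" using reals_Archimedean2 by blast
      then show "(\<lambda>A. (V x)\<^sup>2 * indicator (- cball 0 (real A)) x) \<longlonglongrightarrow> 0"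
        by (intro tendsto_eventually) (auto simp: eventually_sequentially indicator_def intro!: exI[of _ N])
    qed
  qed (use V in \<open>auto simp: indicator_def\<close>)
  then have "(\<lambda>A. \<integral>x. (V x)\<^sup>2 * indicator (- cball 0 (real A)) x \<partial>lborel) \<longlonglongrightarrow> 0" by simp
  \<comment> \<open>With a tail of norm e/4 and sqrt pi <= 2, the outer part stays below e/2; the
    inner part will be below e/4.\<close>
  moreover have "(e / 4)\<^sup>2 > 0" using e by simp
  ultimately have "\<forall>\<^sub>F A in sequentially. (\<integral>x. (V x)\<^sup>2 * indicator (- cball 0 (real A)) x \<partial>lborel) < (e / 4)\<^sup>2"
    by (rule order_tendstoD(2))
  then obtain A where "(\<integral>x. (V x)\<^sup>2 * indicator (- cball 0 (real A)) x \<partial>lborel) < (e / 4)\<^sup>2"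
    using eventually_happens'[OF sequentially_bot] by blast
  then have tail: "sqrt (\<integral>x. (V x)\<^sup>2 * indicator (- cball 0 (real A)) x \<partial>lborel) \<le> e / 4"
    using e by (intro real_le_lsqrt) auto
  define C where "C = (\<integral>x. indicator (cball 0 (real A)) x * \<bar>V x\<bar> \<partial>lborel)"
  have intV: "integrable lborel (\<lambda>x. indicator (cball 0 r) x * \<bar>V x\<bar>)" for r
    using V ind2 by (intro square_mult_integrable) (auto intro!: borel_measurable_indicator borel_closed)
  have tsq: "integrable lborel (\<lambda>x. (indicator (- cball 0 (real A)) x * \<bar>V x\<bar>)\<^sup>2)"
    by (rule Bochner_Integration.integrable_bound[OF V(2)]) (use V in \<open>auto simp: indicator_def\<close>)
  have bound: "(\<integral>x. indicator (cball 0 r) x * \<bar>V x\<bar> \<partial>lborel) \<le> C + sqrt pi * r * (e / 4)" if r: "r \<ge> 0" for r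
  proof -
    have i: "integrable lborel (\<lambda>x. indicator (cball 0 r) x * (indicator (- cball 0 (real A)) x * \<bar>V x\<bar>))"
      using V ind2 tsq by (intro square_mult_integrable) (auto intro!: borel_measurable_indicator borel_closed)
    have "(\<integral>x. indicator (cball 0 r) x * \<bar>V x\<bar> \<partial>lborel)
       \<le> (\<integral>x. indicator (cball 0 (real A)) x * \<bar>V x\<bar> + indicator (cball 0 r) x * (indicator (- cball 0 (real A)) x * \<bar>V x\<bar>) \<partial>lborel)"
      by (intro integral_mono intV Bochner_Integration.integrable_add i) (auto simp: indicator_def)
    also have "\<dots> = C + (\<integral>x. indicator (cball 0 r) x * (indicator (- cball 0 (real A)) x * \<bar>V x\<bar>) \<partial>lborel)"
      using intV i by (simp add: C_def)
    also have "(\<integral>x. indicator (cball 0 r) x * (indicator (- cball 0 (real A)) x * \<bar>V x\<bar>) \<partial>lborel)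
       \<le> sqrt (\<integral>x. (indicator (cball (0::plane) r) x)\<^sup>2 \<partial>lborel) * sqrt (\<integral>x. (indicator (- cball 0 (real A)) x * \<bar>V x\<bar>)\<^sup>2 \<partial>lborel)"
      by (rule order_trans[OF abs_ge_self Cauchy_Schwarz_integral]) (use V ind2 tsq in \<open>auto intro!: borel_measurable_indicator borel_closed\<close>)
    also have "(\<integral>x. (indicator (cball (0::plane) r) x)\<^sup>2 \<partial>lborel) = pi * r\<^sup>2"
      using measure_cball_plane[OF r] by (simp add: power2_eq_square indicator_inter_arith[symmetric])
    also have "sqrt (pi * r\<^sup>2) = sqrt pi * r" using r by (simp add: real_sqrt_mult)
    also have "(\<integral>x. (indicator (- cball 0 (real A)) x * \<bar>V x\<bar>)\<^sup>2 \<partial>lborel) = (\<integral>x. (V x)\<^sup>2 * indicator (- cball 0 (real A)) x \<partial>lborel)"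
      by (rule Bochner_Integration.integral_cong) (auto simp: indicator_def)
    finally have "(\<integral>x. indicator (cball 0 r) x * \<bar>V x\<bar> \<partial>lborel)
        \<le> C + sqrt pi * r * sqrt (\<integral>x. (V x)\<^sup>2 * indicator (- cball 0 (real A)) x \<partial>lborel)" by simp
    also have "\<dots> \<le> C + sqrt pi * r * (e / 4)"
      using r by (intro add_left_mono mult_left_mono tail) simp
    finally show ?thesis .
  qed
  have sp: "sqrt pi \<le> 2" using pi_less_4 real_sqrt_le_mono[of pi 4] by simp
  obtain N :: nat where N: "real N > 4 * C / e" using reals_Archimedean2 by blast
  have "norm ((1 / real (Suc k)) * (\<integral>x. indicator (cball 0 (real (Suc k))) x * \<bar>V x\<bar> \<partial>lborel) - 0) < e" if "k \<ge> N" for k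
  proof -
    have k: "real (Suc k) > 0" "4 * C / e < real (Suc k)" using N that by auto
    have "(1 / real (Suc k)) * (\<integral>x. indicator (cball 0 (real (Suc k))) x * \<bar>V x\<bar> \<partial>lborel)
        \<le> (1 / real (Suc k)) * (C + sqrt pi * real (Suc k) * (e / 4))"
      by (intro mult_left_mono bound) auto
    also have "\<dots> = C / real (Suc k) + sqrt pi * (e / 4)" using k by (simp add: field_simps del: of_nat_Suc)
    also have "C / real (Suc k) < e / 4"
    proof -
      have "4 * C < e * real (Suc k)" using k(2) e by (simp add: field_simps del: of_nat_Suc)
      then show ?thesis using k(1) by (simp add: field_simps del: of_nat_Suc)
    qed
    also have "e / 4 + sqrt pi * (e / 4) \<le> e / 4 + 2 * (e / 4)" using sp e by (intro add_left_mono mult_right_mono) auto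
    also have "\<dots> < e" using e by simp
    finally show ?thesis by (simp add: abs_of_nonneg del: of_nat_Suc)
  qed
  then show "\<exists>no. \<forall>k\<ge>no. norm ((1 / real (Suc k)) * (\<integral>x. indicator (cball 0 (real (Suc k))) x * \<bar>V x\<bar> \<partial>lborel) - 0) < e"
    by blast
qed

text \<open>Controls the boundary term at the pole in the integration by parts.\<close>

lemma grad_psi_pairing_bound:
  assumes \<omega>: "\<omega> \<ge> 0" and f: "f \<in> E_form \<omega>"
  obtains V where "V \<in> borel_measurable borel" "integrable lborel (\<lambda>x. (V x)\<^sup>2)"
    "\<And>x. \<bar>fun_of f (inv_stereo x)\<bar> * norm (grad_psi \<omega> n c q x) \<le> \<bar>V x\<bar>"
proof -
  let ?U = "\<lambda>x. fun_of f (inv_stereo x)"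
  have Um[measurable]: "?U \<in> borel_measurable borel" by (rule measurable_chart[OF fun_of_measurable])
  have Uc: "integrable lborel (\<lambda>x. conf x * (?U x)\<^sup>2)"
    using fun_of_square_integrable[of f] integral_dV(1)[of "\<lambda>p. (fun_of f p)\<^sup>2"]
    by (auto simp: square_integrable_def)
  show ?thesis
  proof (cases "\<omega> = 0")
    case True
    obtain K where K: "K \<ge> 0" "\<And>x. norm (grad_psi 0 n c q x) \<le> K * (1 + (norm x)\<^sup>2) powr - 1"
      using grad_psi_bound_0 by blast
    define V where "V x = ?U x * (K * (1 + (norm x)\<^sup>2) powr - 1)" for x
    \<comment> \<open>For \<omega> = 0 the square of the gradient bound is a multiple of
      \<open>conf\<close>, against which the square of f is integrable.\<close>
    have w: "((1 + (norm x)\<^sup>2) powr - 1)\<^sup>2 = conf x / 4" for x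
      by (simp add: conf_def powr_minus_divide power_divide)
    have "(\<lambda>x. (V x)\<^sup>2) = (\<lambda>x. (K\<^sup>2 / 4) * (conf x * (?U x)\<^sup>2))"
      unfolding V_def power_mult_distrib w by (simp add: fun_eq_iff)
    then have "integrable lborel (\<lambda>x. (V x)\<^sup>2)" using Uc by simp
    moreover have "\<bar>?U x\<bar> * norm (grad_psi \<omega> n c q x) \<le> \<bar>V x\<bar>" for x
    proof -
      have "\<bar>?U x\<bar> * norm (grad_psi \<omega> n c q x) \<le> \<bar>?U x\<bar> * (K * (1 + (norm x)\<^sup>2) powr - 1)"
        unfolding True by (intro mult_left_mono K) auto
      then show ?thesis using K(1) by (simp add: V_def abs_mult)
    qed
    ultimately show ?thesis using that[of V] unfolding V_def by measurable
  next
    case False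
    then have pos: "\<omega> > 0" using \<omega> by simp
    obtain K where K: "K \<ge> 0" "\<And>x. norm (grad_psi \<omega> n c q x) \<le> K * (1 + (norm x)\<^sup>2) powr - ((sexp \<omega> n + 1) / 2)"
      using grad_psi_bound by blast
    \<comment> \<open>For \<omega> > 0 the finite potential energy of f is used as well:
      potential/(4 \<omega>^2) + conf/4 equals 1/(1 + r^2), which is precisely the square of this
      weight.\<close>
    define V where "V x = ?U x * (K * (1 + (norm x)\<^sup>2) powr - (1/2))" for x
    have "integrable lborel (\<lambda>x. K\<^sup>2 * ((1 / (4 * \<omega>\<^sup>2)) * (potential \<omega> x * (?U x)\<^sup>2) + (1/4) * (conf x * (?U x)\<^sup>2)))"
      using Uc E_formD(4)[OF f] by simp
    also have "(\<lambda>x. K\<^sup>2 * ((1 / (4 * \<omega>\<^sup>2)) * (potential \<omega> x * (?U x)\<^sup>2) + (1/4) * (conf x * (?U x)\<^sup>2))) = (\<lambda>x. (V x)\<^sup>2)"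
    proof
      fix x :: plane
      let ?w = "1 + (norm x)\<^sup>2"
      have w: "(?w powr - (1/2))\<^sup>2 = 1 / ?w"
        using powr_add[of ?w "- (1/2)" "- (1/2)"] by (simp add: power2_eq_square powr_minus_divide)
      have "(1 / (4 * \<omega>\<^sup>2)) * potential \<omega> x + (1/4) * conf x = (1/4) * (?w * conf x)"
        using False by (simp add: potential_def field_simps)
      also have "\<dots> = 1 / ?w"
      proof -
        have "(1/4) * (v * (4 / v\<^sup>2)) = 1 / v" if "v \<noteq> 0" for v :: real
          using that by (simp add: power2_eq_square)
        from this[OF one_plus_norm_pos(2)] show ?thesis unfolding conf_def .
      qed
      finally have e: "(1 / (4 * \<omega>\<^sup>2)) * potential \<omega> x + (1/4) * conf x = 1 / ?w" .
      have "K\<^sup>2 * ((1 / (4 * \<omega>\<^sup>2)) * (potential \<omega> x * (?U x)\<^sup>2) + (1/4) * (conf x * (?U x)\<^sup>2))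
          = K\<^sup>2 * (((1 / (4 * \<omega>\<^sup>2)) * potential \<omega> x + (1/4) * conf x) * (?U x)\<^sup>2)"
        by (simp only: distrib_right mult.assoc)
      also have "\<dots> = K\<^sup>2 * (?U x)\<^sup>2 * (1 / ?w)" unfolding e by simp
      finally have "K\<^sup>2 * ((1 / (4 * \<omega>\<^sup>2)) * (potential \<omega> x * (?U x)\<^sup>2) + (1/4) * (conf x * (?U x)\<^sup>2))
          = K\<^sup>2 * (?U x)\<^sup>2 * (1 / ?w)" .
      then show "K\<^sup>2 * ((1 / (4 * \<omega>\<^sup>2)) * (potential \<omega> x * (?U x)\<^sup>2) + (1/4) * (conf x * (?U x)\<^sup>2)) = (V x)\<^sup>2"
        by (simp add: V_def power_mult_distrib w)
    qed
    finally have "integrable lborel (\<lambda>x. (V x)\<^sup>2)" .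
    moreover have "\<bar>?U x\<bar> * norm (grad_psi \<omega> n c q x) \<le> \<bar>V x\<bar>" for x
    proof -
      have "(1 + (norm x)\<^sup>2) powr - ((sexp \<omega> n + 1) / 2) \<le> (1 + (norm x)\<^sup>2) powr - (1/2)"
        using sexp_facts(3)[of \<omega> n] by (intro powr_mono) auto
      then have "norm (grad_psi \<omega> n c q x) \<le> K * (1 + (norm x)\<^sup>2) powr - (1/2)"
        using K by (meson mult_left_mono order_trans)
      then have "\<bar>?U x\<bar> * norm (grad_psi \<omega> n c q x) \<le> \<bar>?U x\<bar> * (K * (1 + (norm x)\<^sup>2) powr - (1/2))"
        by (intro mult_left_mono) auto
      then show ?thesis using K(1) by (simp add: V_def abs_mult)
    qed
    ultimately show ?thesis using that[of V] unfolding V_def by measurable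
  qed
qed

text \<open>Green's formula. The weak gradient of f is tested against the cut-off components of the
  smooth gradient of psi; the error lives in balls of radius k + 1 and carries a factor 1/(k + 1),
  so it is controlled by the averages above.\<close>

lemma Q_form_psi:
  assumes \<omega>: "\<omega> \<ge> 0" and f: "f \<in> E_form \<omega>"
  shows "Q_form \<omega> f (class_of (psi_fun \<omega> n c q)) = f \<bullet> class_of (psi_fun \<omega> n c (hyper_op \<omega> n q))"
proof -
  let ?U = "\<lambda>x. fun_of f (inv_stereo x)"
  let ?G = "weak_differential (fun_of f)"
  let ?g = "grad_psi \<omega> n c q"
  define p where "p = psi \<omega> n c q"
  define T where "T = psi \<omega> n c (hyper_op \<omega> n q)"
  have pm[measurable]: "p \<in> borel_measurable borel" and Tm[measurable]: "T \<in> borel_measurable borel"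
    by (simp_all add: p_def T_def)
  note fE = E_formD[OF f]
  have Um[measurable]: "?U \<in> borel_measurable borel" by (rule measurable_chart[OF fun_of_measurable])
  note [measurable] = fE(2)
  have Ul: "locally_integrable ?U" and Gl: "locally_integrable ?G" using fE(1) by (auto simp: has_weak_gradient_def)
  have Uc: "integrable lborel (\<lambda>x. conf x * (?U x)\<^sup>2)"
    using fun_of_square_integrable[of f] integral_dV(1)[of "\<lambda>p. (fun_of f p)\<^sup>2"]
    by (auto simp: square_integrable_def)
  \<comment> \<open>The claim amounts to W having integral 0.\<close>
  define W where "W x = ?G x \<bullet> ?g x + potential \<omega> x * (?U x * p x) - conf x * (?U x * T x)" for x
  have i1: "integrable lborel (\<lambda>x. ?G x \<bullet> ?g x)"
    using fE \<omega> by (intro inner_mult_integrable grad_psi_square_integrable) auto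
  have i2: "integrable lborel (\<lambda>x. potential \<omega> x * (?U x * p x))"
    using fE \<omega> psi_potential_integrable[OF \<omega>, of n c q] by (intro weighted_mult_integrable) (auto simp: p_def)
  have i3: "integrable lborel (\<lambda>x. conf x * (?U x * T x))"
    using Uc psi_square_integrable[of \<omega> n c "hyper_op \<omega> n q"] by (intro weighted_mult_integrable) (auto simp: T_def)
  have Wi: "integrable lborel W" unfolding W_def using i1 i2 i3 by simp
  \<comment> \<open>The cut-off with this scale vanishes outside the ball of radius k + 1 and tends
    to 1 pointwise.\<close>
  define s where "s k = 1 / (real (Suc k))\<^sup>2" for k
  have s: "s k > 0" for k by (simp add: s_def)
  define \<eta> where "\<eta> k x = cut (s k * (norm (x::plane))\<^sup>2)" for k x
  define E where "E k x = ?U x * (cut' (s k * (norm x)\<^sup>2) * (2 * s k * (x \<bullet> ?g x)))" for k x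
  have \<eta>sm: "smooth (\<eta> k)" for k
    unfolding \<eta>_def by (intro smooth_compose[OF smooth_cut] smooth_mult smooth_const smooth_norm_squared)
  have \<eta>0: "0 \<le> \<eta> k x" "\<eta> k x \<le> 1" for k x
    using s[of k] by (auto simp: \<eta>_def intro!: cut_bounds)
  have outside: "1 \<le> s k * (norm x)\<^sup>2" if "norm x > real (Suc k)" for k and x :: plane
  proof -
    have "(real (Suc k))\<^sup>2 \<le> (norm x)\<^sup>2" using that by (intro power_mono) auto
    then show ?thesis by (simp add: s_def field_simps del: of_nat_Suc)
  qed
  have tf: "test_function (\<lambda>x. \<eta> k x * (?g x \<bullet> b))" if "b \<in> Basis" for k b
  proof -
    have "{x. \<eta> k x * (?g x \<bullet> b) \<noteq> 0} \<subseteq> cball 0 (real (Suc k))"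
    proof (rule subsetI, rule ccontr)
      fix x assume x: "x \<in> {x. \<eta> k x * (?g x \<bullet> b) \<noteq> 0}" "x \<notin> cball 0 (real (Suc k))"
      then have "\<eta> k x = 0" unfolding \<eta>_def by (intro cut_bounds outside) (simp add: not_le)
      then show False using x(1) by simp
    qed
    then have "bounded {x. \<eta> k x * (?g x \<bullet> b) \<noteq> 0}" using bounded_cball bounded_subset by blast
    then show ?thesis using that
      by (auto simp: test_function_def compact_closure intro!: smooth_mult \<eta>sm smooth_grad_psi)
  qed
  have fd: "frechet_derivative (\<lambda>x. \<eta> k x * (?g x \<bullet> b)) (at x) b
      = \<eta> k x * frechet_derivative (\<lambda>x. ?g x \<bullet> b) (at x) b + cut' (s k * (norm x)\<^sup>2) * (2 * s k * (x \<bullet> b)) * (?g x \<bullet> b)"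
    if b: "b \<in> Basis" for k b x
  proof -
    have "((\<lambda>x. \<eta> k x * (?g x \<bullet> b)) has_derivative (\<lambda>v. \<eta> k x * frechet_derivative (\<lambda>x. ?g x \<bullet> b) (at x) v
        + cut' (s k * (norm x)\<^sup>2) * (2 * s k * (x \<bullet> v)) * (?g x \<bullet> b))) (at x)"
      unfolding \<eta>_def
      by (rule has_derivative_mult[OF cut_scaled_has_derivative smooth_has_derivative[OF smooth_grad_psi[OF b]]])
    from frechet_derivative_at[OF this, symmetric] show ?thesis by simp
  qed
  \<comment> \<open>The defining identity of the weak gradient, summed over the two directions: the
    derivative falling on the gradient of psi yields its Laplacian, the one falling on the cut-off
    yields E.\<close>
  have parts: "(\<integral>x. \<eta> k x * W x \<partial>lborel) = - (\<integral>x. E k x \<partial>lborel)" and Ei: "integrable lborel (E k)" for k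
  proof -
    have Gint: "integrable lborel (\<lambda>x. (?G x \<bullet> b) * (\<eta> k x * (?g x \<bullet> b)))" if "b \<in> Basis" for b
      by (rule test_function_integrable(1)[OF tf[OF that] locally_integrable_inner[OF Gl]])
    have Uint: "integrable lborel (\<lambda>x. ?U x * frechet_derivative (\<lambda>x. \<eta> k x * (?g x \<bullet> b)) (at x) b)" if "b \<in> Basis" for b
      by (rule test_function_integrable(2)[OF tf[OF that] Ul that])
    have eqG: "(\<Sum>b\<in>Basis. (?G x \<bullet> b) * (\<eta> k x * (?g x \<bullet> b))) = \<eta> k x * (?G x \<bullet> ?g x)" for x
      by (subst (2) euclidean_inner) (simp add: sum_distrib_left algebra_simps)
    have eqU: "(\<Sum>b\<in>Basis. ?U x * frechet_derivative (\<lambda>x. \<eta> k x * (?g x \<bullet> b)) (at x) b)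
       = \<eta> k x * (?U x * (potential \<omega> x * p x - conf x * T x)) + E k x" for x
    proof -
      have "(\<Sum>b\<in>Basis. ?U x * frechet_derivative (\<lambda>x. \<eta> k x * (?g x \<bullet> b)) (at x) b)
        = ?U x * (\<eta> k x * (\<Sum>b\<in>Basis. frechet_derivative (\<lambda>x. ?g x \<bullet> b) (at x) b)
           + cut' (s k * (norm x)\<^sup>2) * (2 * s k) * (\<Sum>b\<in>Basis. (x \<bullet> b) * (?g x \<bullet> b)))"
        by (simp add: fd sum_distrib_left sum.distrib[symmetric] algebra_simps)
      then show ?thesis
        unfolding psi_laplacian euclidean_inner[symmetric] by (simp add: E_def p_def T_def algebra_simps)
    qed
    have "(\<integral>x. (\<Sum>b\<in>Basis. ?U x * frechet_derivative (\<lambda>x. \<eta> k x * (?g x \<bullet> b)) (at x) b) \<partial>lborel)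
       = - (\<integral>x. (\<Sum>b\<in>Basis. (?G x \<bullet> b) * (\<eta> k x * (?g x \<bullet> b))) \<partial>lborel)"
      using fE(1) tf Gint Uint
      by (simp add: Bochner_Integration.integral_sum has_weak_gradient_def sum_negf)
    then have eq: "(\<integral>x. \<eta> k x * (?U x * (potential \<omega> x * p x - conf x * T x)) + E k x \<partial>lborel) = - (\<integral>x. \<eta> k x * (?G x \<bullet> ?g x) \<partial>lborel)"
      unfolding eqU eqG .
    have \<eta>m[measurable]: "\<eta> k \<in> borel_measurable borel" by (intro borel_measurable_continuous_onI smooth_continuous \<eta>sm)
    have \<eta>i: "integrable lborel (\<lambda>x. \<eta> k x * h x)" if "integrable lborel h" for h :: "plane \<Rightarrow> real"
      by (rule Bochner_Integration.integrable_bound[OF that])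
        (use that \<eta>0[of k] in \<open>auto simp: abs_mult mult_left_le_one_le borel_measurable_integrable\<close>)
    have j: "integrable lborel (\<lambda>x. \<eta> k x * (?U x * (potential \<omega> x * p x - conf x * T x)))"
      using \<eta>i[OF Bochner_Integration.integrable_diff[OF i2 i3]] by (simp add: algebra_simps)
    have "integrable lborel (\<lambda>x. (\<Sum>b\<in>Basis. ?U x * frechet_derivative (\<lambda>x. \<eta> k x * (?g x \<bullet> b)) (at x) b))"
      using Uint by simp
    from Bochner_Integration.integrable_diff[OF this j] show Ei: "integrable lborel (E k)"
      unfolding eqU by simp
    have "(\<integral>x. \<eta> k x * W x \<partial>lborel) = (\<integral>x. \<eta> k x * (?G x \<bullet> ?g x) + \<eta> k x * (?U x * (potential \<omega> x * p x - conf x * T x)) \<partial>lborel)"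
      by (rule Bochner_Integration.integral_cong) (simp_all add: W_def algebra_simps)
    also have "\<dots> = (\<integral>x. \<eta> k x * (?G x \<bullet> ?g x) \<partial>lborel) + (\<integral>x. \<eta> k x * (?U x * (potential \<omega> x * p x - conf x * T x)) \<partial>lborel)"
      by (rule Bochner_Integration.integral_add[OF \<eta>i[OF i1] j])
    finally show "(\<integral>x. \<eta> k x * W x \<partial>lborel) = - (\<integral>x. E k x \<partial>lborel)"
      using eq unfolding Bochner_Integration.integral_add[OF j Ei] by linarith
  qed
  have lim1: "(\<lambda>k. \<integral>x. \<eta> k x * W x \<partial>lborel) \<longlonglongrightarrow> (\<integral>x. W x \<partial>lborel)"
  proof (rule integral_dominated_convergence[where w = "\<lambda>x. norm (W x)"])
    show "AE x in lborel. (\<lambda>k. \<eta> k x * W x) \<longlonglongrightarrow> W x"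
    proof (rule AE_I2)
      fix x :: plane
      have "(\<lambda>k. inverse (real (Suc k)) ^ 2) \<longlonglongrightarrow> 0 ^ 2"
        by (intro tendsto_power LIMSEQ_inverse_real_of_nat)
      then have "s \<longlonglongrightarrow> 0" by (simp add: s_def[abs_def] power_inverse divide_inverse)
      then have "(\<lambda>k. s k * (norm x)\<^sup>2) \<longlonglongrightarrow> 0" by (rule tendsto_mult_left_zero)
      then have "(\<lambda>k. \<eta> k x) \<longlonglongrightarrow> cut 0"
        unfolding \<eta>_def by (rule isCont_tendsto_compose[OF DERIV_isCont[OF cut_has_derivative]])
      then have "(\<lambda>k. \<eta> k x * W x) \<longlonglongrightarrow> cut 0 * W x" by (intro tendsto_mult tendsto_const)
      then show "(\<lambda>k. \<eta> k x * W x) \<longlonglongrightarrow> W x" by (simp add: cut_0)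
    qed
    show "AE x in lborel. norm (\<eta> k x * W x) \<le> norm (W x)" for k
      using \<eta>0[of k] by (auto simp: abs_mult mult_left_le_one_le)
    show "(\<lambda>x. \<eta> k x * W x) \<in> borel_measurable lborel" for k
      using Wi borel_measurable_continuous_onI[OF smooth_continuous[OF \<eta>sm[of k]]] by (auto dest: borel_measurable_integrable)
  qed (use Wi in auto)
  obtain V where V: "V \<in> borel_measurable borel" "integrable lborel (\<lambda>x. (V x)\<^sup>2)" "\<And>x. \<bar>?U x\<bar> * norm (?g x) \<le> \<bar>V x\<bar>"
    using grad_psi_pairing_bound[OF \<omega> f] by blast
  obtain B where B: "B > 0" "\<And>t. t \<ge> 0 \<Longrightarrow> \<bar>cut' t\<bar> \<le> B" using cut'_bounded by blast
  have Ebd: "\<bar>E k x\<bar> \<le> (2 * B * (1 / real (Suc k))) * (indicator (cball 0 (real (Suc k))) x * \<bar>V x\<bar>)" for k x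
  proof (cases "norm x \<le> real (Suc k)")
    case True
    have "\<bar>E k x\<bar> = \<bar>cut' (s k * (norm x)\<^sup>2)\<bar> * (2 * s k * (\<bar>?U x\<bar> * \<bar>x \<bullet> ?g x\<bar>))"
      using s[of k] by (simp add: E_def abs_mult)
    also have "\<dots> \<le> B * (2 * s k * (\<bar>?U x\<bar> * (real (Suc k) * norm (?g x))))"
    proof -
      have "\<bar>x \<bullet> ?g x\<bar> \<le> real (Suc k) * norm (?g x)"
        by (rule order_trans[OF Cauchy_Schwarz_ineq2 mult_right_mono[OF True]]) simp
      then show ?thesis using B(2)[of "s k * (norm x)\<^sup>2"] s[of k] B(1)
        by (intro mult_mono mult_left_mono) auto
    qed
    also have "\<dots> = (2 * B * (1 / real (Suc k))) * (\<bar>?U x\<bar> * norm (?g x))"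
      by (simp add: s_def power2_eq_square del: of_nat_Suc)
    also have "\<dots> \<le> (2 * B * (1 / real (Suc k))) * \<bar>V x\<bar>"
      using B(1) by (intro mult_left_mono V) auto
    finally show ?thesis using True by (simp del: of_nat_Suc)
  next
    case False
    then have "cut' (s k * (norm x)\<^sup>2) = 0" by (intro cut_bounds outside) simp
    then show ?thesis using B(1) by (simp add: E_def)
  qed
  have Vi: "integrable lborel (\<lambda>x. indicator (cball 0 r) x * \<bar>V x\<bar>)" for r
    using V(1,2) integrable_indicator_cball
    by (intro square_mult_integrable) (auto intro!: borel_measurable_indicator borel_closed)
  have lim2: "(\<lambda>k. \<integral>x. E k x \<partial>lborel) \<longlonglongrightarrow> 0"
  proof (rule Lim_null_comparison)
    show "\<forall>\<^sub>F k in sequentially. norm (\<integral>x. E k x \<partial>lborel)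
       \<le> 2 * B * ((1 / real (Suc k)) * (\<integral>x. indicator (cball 0 (real (Suc k))) x * \<bar>V x\<bar> \<partial>lborel))"
    proof (intro always_eventually allI)
      fix k
      have "\<bar>\<integral>x. E k x \<partial>lborel\<bar> \<le> (\<integral>x. (2 * B * (1 / real (Suc k))) * (indicator (cball 0 (real (Suc k))) x * \<bar>V x\<bar>) \<partial>lborel)"
        by (rule integral_abs_bound_integral[OF Ei integrable_mult_right[OF Vi] Ebd])
      then show "norm (\<integral>x. E k x \<partial>lborel) \<le> 2 * B * ((1 / real (Suc k)) * (\<integral>x. indicator (cball 0 (real (Suc k))) x * \<bar>V x\<bar> \<partial>lborel))"
        by (simp add: mult.assoc del: of_nat_Suc)
    qed
    show "(\<lambda>k. 2 * B * ((1 / real (Suc k)) * (\<integral>x. indicator (cball 0 (real (Suc k))) x * \<bar>V x\<bar> \<partial>lborel))) \<longlonglongrightarrow> 0"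
      by (intro tendsto_mult_right_zero L2_ball_average_tendsto_0 V)
  qed
  have "(\<integral>x. W x \<partial>lborel) = 0"
    using LIMSEQ_unique[OF lim1] tendsto_minus[OF lim2] unfolding parts by simp
  then have "(\<integral>x. ?G x \<bullet> ?g x \<partial>lborel) + (\<integral>x. potential \<omega> x * (?U x * p x) \<partial>lborel) = (\<integral>x. conf x * (?U x * T x) \<partial>lborel)"
    unfolding W_def using i1 i2 i3 by simp
  moreover have "Q_form \<omega> f (class_of (psi_fun \<omega> n c q)) = (\<integral>x. ?G x \<bullet> ?g x \<partial>lborel) + (\<integral>x. potential \<omega> x * (?U x * p x) \<partial>lborel)"
  proof -
    note e = psi_fun_E_form[OF \<omega>, of n c q]
    note [measurable] = E_formD(2)[OF e(1)] measurable_chart(1)[OF fun_of_measurable[of "class_of (psi_fun \<omega> n c q)"]]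
    have "(\<integral>x. ?G x \<bullet> weak_differential (fun_of (class_of (psi_fun \<omega> n c q))) x \<partial>lborel) = (\<integral>x. ?G x \<bullet> ?g x \<partial>lborel)"
      by (rule integral_cong_AE) (use e(2) in \<open>auto elim: AE_mp\<close>)
    moreover have "(\<integral>x. potential \<omega> x * (?U x * fun_of (class_of (psi_fun \<omega> n c q)) (inv_stereo x)) \<partial>lborel)
        = (\<integral>x. potential \<omega> x * (?U x * p x) \<partial>lborel)"
      by (rule integral_cong_AE)
        (use AE_dV_charts(1)[OF fun_of_class_of[OF psi_fun_square_integrable[of \<omega> n c q]]] in
          \<open>auto simp: psi_fun_def p_def elim: AE_mp\<close>)
    ultimately show ?thesis by (simp add: Q_form_eq[OF f e(1)])
  qed
  moreover have "f \<bullet> class_of (psi_fun \<omega> n c (hyper_op \<omega> n q)) = (\<integral>x. conf x * (?U x * T x) \<partial>lborel)"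
  proof -
    have "f \<bullet> class_of (psi_fun \<omega> n c (hyper_op \<omega> n q)) = (\<integral>x. fun_of f x * psi_fun \<omega> n c (hyper_op \<omega> n q) x \<partial>dV)"
      using inner_class_of[OF fun_of_square_integrable[of f] psi_fun_square_integrable] by simp
    also have "\<dots> = (\<integral>x. conf x * (?U x * T x) \<partial>lborel)"
      by (subst integral_dV(2)[OF borel_measurable_times[OF fun_of_measurable psi_fun_measurable]])
        (simp add: psi_fun_def T_def)
    finally show ?thesis .
  qed
  ultimately show ?thesis by simp
qed

section \<open>Operators with an orthonormal basis of eigenvectors\<close>

text \<open>Zero vectors are allowed in the system, so that it may be indexed redundantly.\<close>

locale orthonormal_system =
  fixes e :: "nat \<Rightarrow> 'h::{real_inner,banach}"
  assumes orth: "i \<noteq> j \<Longrightarrow> e i \<bullet> e j = 0"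
    and unit: "e i = 0 \<or> norm (e i) = 1"
    and total: "(\<And>i. x \<bullet> e i = 0) \<Longrightarrow> x = 0"
begin

lemma eqI: "(\<And>i. x \<bullet> e i = y \<bullet> e i) \<Longrightarrow> x = y"
  using total[of "x - y"] by (simp add: inner_diff_left)

lemma inner_self: "e i \<noteq> 0 \<Longrightarrow> e i \<bullet> e i = 1"
  using unit[of i] by (simp add: norm_eq_1)

text \<open>A coefficient in front of a zero vector cannot be recovered from inner products, so it
  is required to be 0.\<close>

lemma sum_inner:
  assumes "finite F" "\<And>i. e i = 0 \<Longrightarrow> a i = 0"
  shows "(\<Sum>i\<in>F. a i *\<^sub>R e i) \<bullet> e j = (if j \<in> F then a j else 0)"
proof -
  have "a i * (e i \<bullet> e j) = (if i = j then a j else 0)" for i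
    using orth[of i j] inner_self[of j] assms(2)[of j] by (cases "e j = 0") auto
  then show ?thesis using assms(1) by (simp add: inner_sum_left)
qed

lemma norm_sum:
  assumes "finite F" "\<And>i. e i = 0 \<Longrightarrow> a i = 0"
  shows "(norm (\<Sum>i\<in>F. a i *\<^sub>R e i))\<^sup>2 = (\<Sum>i\<in>F. (a i)\<^sup>2)"
proof -
  have "(norm (\<Sum>i\<in>F. a i *\<^sub>R e i))\<^sup>2 = (\<Sum>j\<in>F. a j * ((\<Sum>i\<in>F. a i *\<^sub>R e i) \<bullet> e j))"
    by (simp add: power2_norm_eq_inner inner_sum_right)
  also have "\<dots> = (\<Sum>i\<in>F. (a i)\<^sup>2)"
    by (rule sum.cong) (simp_all add: sum_inner[OF assms] power2_eq_square)
  finally show ?thesis .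
qed

lemma bessel:
  assumes "finite F"
  shows "(\<Sum>i\<in>F. (x \<bullet> e i)\<^sup>2) \<le> (norm x)\<^sup>2"
proof -
  let ?y = "\<Sum>i\<in>F. (x \<bullet> e i) *\<^sub>R e i"
  have y: "(norm ?y)\<^sup>2 = (\<Sum>i\<in>F. (x \<bullet> e i)\<^sup>2)" by (rule norm_sum[OF assms]) simp
  have xy: "x \<bullet> ?y = (\<Sum>i\<in>F. (x \<bullet> e i)\<^sup>2)" by (simp add: inner_sum_right power2_eq_square)
  have "0 \<le> (norm (x - ?y))\<^sup>2" by simp
  also have "\<dots> = (norm x)\<^sup>2 - 2 * (x \<bullet> ?y) + (norm ?y)\<^sup>2"
    by (simp add: power2_norm_eq_inner inner_diff_left inner_diff_right inner_commute)
  finally show ?thesis using xy y by simp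
qed

lemma summable_coeffs: "summable (\<lambda>i. (x \<bullet> e i)\<^sup>2)"
  by (rule bounded_imp_summable[of _ "(norm x)\<^sup>2"]) (auto intro: bessel)

text \<open>Orthogonality makes the squared norm of each block of the series the corresponding block
  of the summable squares, so the series is Cauchy.\<close>

lemma synthesis:
  assumes a: "summable (\<lambda>i. (a i)\<^sup>2)" and 0: "\<And>i. e i = 0 \<Longrightarrow> a i = 0"
  shows "summable (\<lambda>i. a i *\<^sub>R e i)" and "(\<Sum>i. a i *\<^sub>R e i) \<bullet> e j = a j"
proof -
  show sm: "summable (\<lambda>i. a i *\<^sub>R e i)"
    unfolding summable_Cauchy
  proof (intro allI impI)
    fix r :: real assume r: "r > 0"
    then obtain N where N: "\<And>m n. m \<ge> N \<Longrightarrow> norm (\<Sum>i=m..<n. (a i)\<^sup>2) < r\<^sup>2"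
      using a[unfolded summable_Cauchy, rule_format, of "r\<^sup>2"] by auto
    have "norm (\<Sum>i=m..<n. a i *\<^sub>R e i) < r" if "m \<ge> N" for m n
    proof -
      have "(norm (\<Sum>i=m..<n. a i *\<^sub>R e i))\<^sup>2 < r\<^sup>2"
        using N[OF that, of n] norm_sum[of "{m..<n}" a, OF _ 0] by (simp add: sum_nonneg)
      then show ?thesis by (rule power2_less_imp_less) (use r in simp)
    qed
    then show "\<exists>N. \<forall>m\<ge>N. \<forall>n. norm (\<Sum>i=m..<n. a i *\<^sub>R e i) < r" by blast
  qed
  have "(\<lambda>n. (\<Sum>i<n. a i *\<^sub>R e i) \<bullet> e j) \<longlonglongrightarrow> (\<Sum>i. a i *\<^sub>R e i) \<bullet> e j"
    by (intro tendsto_inner tendsto_const summable_LIMSEQ sm)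
  moreover have "(\<lambda>n. (\<Sum>i<n. a i *\<^sub>R e i) \<bullet> e j) \<longlonglongrightarrow> a j"
    by (rule tendsto_eventually)
      (auto simp: sum_inner[OF finite_lessThan 0] eventually_sequentially intro!: exI[of _ "Suc j"])
  ultimately show "(\<Sum>i. a i *\<^sub>R e i) \<bullet> e j = a j" by (rule LIMSEQ_unique)
qed

lemma expansion: "(\<lambda>n. \<Sum>i<n. (x \<bullet> e i) *\<^sub>R e i) \<longlonglongrightarrow> x"
proof -
  have 0: "x \<bullet> e i = 0" if "e i = 0" for i using that by simp
  have "(\<Sum>i. (x \<bullet> e i) *\<^sub>R e i) = x"
    by (rule eqI) (rule synthesis(2)[OF summable_coeffs 0])
  then show ?thesis using summable_LIMSEQ[OF synthesis(1)[OF summable_coeffs 0]] by simp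
qed

lemma parseval: "(\<lambda>n. \<Sum>i<n. (x \<bullet> e i)\<^sup>2) \<longlonglongrightarrow> (norm x)\<^sup>2"
proof -
  have "(\<lambda>n. (norm (\<Sum>i<n. (x \<bullet> e i) *\<^sub>R e i))\<^sup>2) \<longlonglongrightarrow> (norm x)\<^sup>2"
    by (intro tendsto_power tendsto_norm expansion)
  then show ?thesis by (simp add: norm_sum)
qed

lemma dim_span_subset:
  assumes "finite I"
  shows "dim (span (e ` I)) = card {i \<in> I. e i \<noteq> 0}"
proof -
  let ?I = "{i \<in> I. e i \<noteq> 0}"
  have "span (e ` I) = span (e ` ?I)"
  proof -
    have "e ` I \<subseteq> insert 0 (e ` ?I)" by auto
    then have "span (e ` I) \<subseteq> span (insert 0 (e ` ?I))" by (rule span_mono)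
    moreover have "span (e ` ?I) \<subseteq> span (e ` I)" by (rule span_mono) auto
    ultimately show ?thesis by (simp add: span_insert_0)
  qed
  moreover have "independent (e ` ?I)"
  proof (rule pairwise_orthogonal_independent)
    show "pairwise orthogonal (e ` ?I)"
    proof (rule pairwiseI)
      fix x y assume xy: "x \<in> e ` ?I" "y \<in> e ` ?I" "x \<noteq> y"
      then obtain i j where "x = e i" "y = e j" by blast
      then show "orthogonal x y" using xy(3) orth[of i j] by (cases "i = j") (auto simp: orthogonal_def)
    qed
  qed auto
  moreover have "inj_on e ?I"
  proof (rule inj_onI)
    fix i j assume ij: "i \<in> ?I" "j \<in> ?I" "e i = e j"
    then have "e i \<bullet> e j \<noteq> 0" using inner_self[of j] by simp
    then show "i = j" using orth by blast
  qed
  ultimately show ?thesis by (simp add: dim_eq_card_independent card_image)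
qed

end

text \<open>\<open>coord\<close> and \<open>maximal\<close> together say that A is the maximal
  operator of multiplication by lm in coordinates; \<open>lm_finite\<close> says that lm tends to
  infinity.\<close>

locale diagonal_operator = orthonormal_system e for e :: "nat \<Rightarrow> 'h::{real_inner,banach}" +
  fixes lm :: "nat \<Rightarrow> real" and D :: "'h set" and A :: "'h \<Rightarrow> 'h"
  assumes lm_finite: "finite {i. lm i \<le> C}"
    and coord: "g \<in> D \<Longrightarrow> A g \<bullet> e i = lm i * (g \<bullet> e i)"
    and maximal: "(\<And>i. h \<bullet> e i = lm i * (g \<bullet> e i)) \<Longrightarrow> g \<in> D \<and> A g = h"
begin

lemma eigenvector: "e i \<in> D" "A (e i) = lm i *\<^sub>R e i"
proof -
  have "(lm i *\<^sub>R e i) \<bullet> e j = lm j * (e i \<bullet> e j)" for j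
    using orth[of i j] by (cases "i = j") auto
  from maximal[OF this] show "e i \<in> D" "A (e i) = lm i *\<^sub>R e i" by auto
qed

lemma finite_level: "finite {i. lm i = \<mu>}"
  by (rule finite_subset[OF _ lm_finite[of \<mu>]]) auto

lemma eigenspace_eq: "eigenspace D A \<mu> = span (e ` {i. lm i = \<mu>})"
proof (intro equalityI subsetI)
  fix u assume "u \<in> eigenspace D A \<mu>"
  then have u: "u \<in> D" "A u = \<mu> *\<^sub>R u" by (auto simp: eigenspace_def)
  have z: "u \<bullet> e i = 0" if "lm i \<noteq> \<mu>" for i
    using coord[OF u(1), of i] that by (simp add: u(2))
  have "u = (\<Sum>i\<in>{i. lm i = \<mu>}. (u \<bullet> e i) *\<^sub>R e i)"
    by (rule eqI) (use z in \<open>auto simp: sum_inner[OF finite_level]\<close>)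
  also have "\<dots> \<in> span (e ` {i. lm i = \<mu>})"
    by (intro span_sum span_scale span_base) auto
  finally show "u \<in> span (e ` {i. lm i = \<mu>})" .
next
  fix u assume u: "u \<in> span (e ` {i. lm i = \<mu>})"
  have "u \<bullet> e j = 0" if "lm j \<noteq> \<mu>" for j
    using u
  proof (induction u rule: span_induct_alt)
    case (step c x y)
    then obtain i where "x = e i" "lm i = \<mu>" by auto
    then show ?case using step orth[of i j] that by (auto simp: inner_add_left)
  qed simp
  then have "(\<mu> *\<^sub>R u) \<bullet> e j = lm j * (u \<bullet> e j)" for j by (cases "lm j = \<mu>") auto
  from maximal[OF this] show "u \<in> eigenspace D A \<mu>" by (simp add: eigenspace_def)
qed

lemma dim_eigenspace: "dim (eigenspace D A \<mu>) = card {i. lm i = \<mu> \<and> e i \<noteq> 0}"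
  using dim_span_subset[OF finite_level, of \<mu>] by (simp add: eigenspace_eq)

lemma eigenvalue_iff: "eigenvalue D A \<mu> \<longleftrightarrow> (\<exists>i. lm i = \<mu> \<and> e i \<noteq> 0)"
proof
  assume "eigenvalue D A \<mu>"
  then obtain u where u: "u \<in> D" "A u = \<mu> *\<^sub>R u" "u \<noteq> 0" by (auto simp: eigenvalue_def eigenspace_def)
  obtain i where i: "u \<bullet> e i \<noteq> 0" using total u(3) by blast
  then have "lm i = \<mu>" using coord[OF u(1), of i] by (simp add: u(2))
  then show "\<exists>i. lm i = \<mu> \<and> e i \<noteq> 0" using i by auto
next
  assume "\<exists>i. lm i = \<mu> \<and> e i \<noteq> 0"
  then show "eigenvalue D A \<mu>" using eigenvector by (auto simp: eigenvalue_def eigenspace_def)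
qed

text \<open>Only finitely many values lie below \<mu> + 1, so their distances to \<mu> have a
  minimum; the other values are farther than 1 away.\<close>

lemma gap:
  assumes "\<And>i. e i \<noteq> 0 \<Longrightarrow> lm i \<noteq> \<mu>"
  obtains d where "d > 0" "\<And>i. e i \<noteq> 0 \<Longrightarrow> d \<le> \<bar>lm i - \<mu>\<bar>"
proof -
  let ?F = "{i. lm i \<le> \<mu> + 1} \<inter> {i. e i \<noteq> 0}"
  have F: "finite ?F" using lm_finite by blast
  define d where "d = Min (insert 1 ((\<lambda>i. \<bar>lm i - \<mu>\<bar>) ` ?F))"
  have "d > 0" unfolding d_def using F assms by (subst Min_gr_iff) auto
  moreover have "d \<le> \<bar>lm i - \<mu>\<bar>" if "e i \<noteq> 0" for i
  proof (cases "lm i \<le> \<mu> + 1")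
    case True
    then show ?thesis unfolding d_def using F that by (intro Min_le) auto
  next
    case False
    have "d \<le> 1" unfolding d_def using F by (intro Min_le) auto
    then show ?thesis using False by simp
  qed
  ultimately show ?thesis by (rule that)
qed

lemma spectrum_eq: "spectrum D A = {lm i | i. e i \<noteq> 0}"
proof (intro equalityI subsetI)
  fix \<mu> assume \<mu>: "\<mu> \<in> spectrum D A"
  show "\<mu> \<in> {lm i | i. e i \<noteq> 0}"
  proof (rule ccontr)
    assume "\<mu> \<notin> {lm i | i. e i \<noteq> 0}"
    then have ne: "lm i \<noteq> \<mu>" if "e i \<noteq> 0" for i using that by auto
    obtain d where d: "d > 0" "\<And>i. e i \<noteq> 0 \<Longrightarrow> d \<le> \<bar>lm i - \<mu>\<bar>" using gap[OF ne] by blast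
    \<comment> \<open>The coordinates of the resolvent. At a zero vector the numerator is 0, so lm i
      = \<mu> does no harm there.\<close>
    define a where "a u i = (u \<bullet> e i) / (lm i - \<mu>)" for u i
    have a0: "a u i = 0" if "e i = 0" for u i using that by (simp add: a_def)
    have abd: "(a u i)\<^sup>2 \<le> (1 / d\<^sup>2) * (u \<bullet> e i)\<^sup>2" for u i
    proof (cases "e i = 0")
      case False
      have "d\<^sup>2 \<le> (lm i - \<mu>)\<^sup>2" using power_mono[OF d(2)[OF False], of 2] d(1) by simp
      then have "(u \<bullet> e i)\<^sup>2 / (lm i - \<mu>)\<^sup>2 \<le> (u \<bullet> e i)\<^sup>2 / d\<^sup>2"
        using d(1) by (intro divide_left_mono mult_pos_pos) (auto simp: ne[OF False])
      then show ?thesis by (simp add: a_def power_divide)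
    qed (simp add: a0)
    have as: "summable (\<lambda>i. (a u i)\<^sup>2)" for u
      by (rule summable_comparison_test'[OF summable_mult[OF summable_coeffs[of u], of "1 / d\<^sup>2"], of 0])
        (use abd in auto)
    define R where "R u = (\<Sum>i. a u i *\<^sub>R e i)" for u
    have Re: "R u \<bullet> e i = a u i" for u i unfolding R_def by (rule synthesis(2)[OF as a0])
    have "bounded_linear R"
    proof (rule bounded_linear_intro)
      show "R (u + v) = R u + R v" for u v
        by (rule eqI) (simp add: Re inner_add_left a_def add_divide_distrib)
      show "R (c *\<^sub>R u) = c *\<^sub>R R u" for c u
        by (rule eqI) (simp add: Re a_def)
      show "norm (R u) \<le> norm u * (1 / d)" for u
      proof -
        have "(norm (R u))\<^sup>2 \<le> (1 / d\<^sup>2) * (norm u)\<^sup>2"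
        proof (rule LIMSEQ_le[OF parseval tendsto_mult_left[OF parseval]])
          show "\<exists>N. \<forall>n\<ge>N. (\<Sum>i<n. (R u \<bullet> e i)\<^sup>2) \<le> (1 / d\<^sup>2) * (\<Sum>i<n. (u \<bullet> e i)\<^sup>2)"
            unfolding Re sum_distrib_left using abd by (auto intro!: sum_mono)
        qed
        also have "\<dots> = (norm u * (1 / d))\<^sup>2" by (simp add: power_mult_distrib power_divide)
        finally show ?thesis by (rule power2_le_imp_le) (use d(1) in simp)
      qed
    qed
    moreover have "R u \<in> D \<and> A (R u) - \<mu> *\<^sub>R R u = u" for u
    proof -
      have "(\<mu> *\<^sub>R R u + u) \<bullet> e i = lm i * (R u \<bullet> e i)" for i
      proof (cases "e i = 0")
        case False
        have "u \<bullet> e i = (lm i - \<mu>) * a u i" using ne[OF False] by (simp add: a_def)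
        then show ?thesis by (simp add: inner_add_left Re algebra_simps)
      qed simp
      from maximal[OF this] show ?thesis by simp
    qed
    moreover have "R (A u - \<mu> *\<^sub>R u) = u" if "u \<in> D" for u
    proof (rule eqI)
      fix i
      show "R (A u - \<mu> *\<^sub>R u) \<bullet> e i = u \<bullet> e i"
      proof (cases "e i = 0")
        case False
        have "(A u - \<mu> *\<^sub>R u) \<bullet> e i = (lm i - \<mu>) * (u \<bullet> e i)"
          by (simp add: inner_diff_left coord[OF that] algebra_simps)
        then show ?thesis using ne[OF False] by (simp add: Re a_def)
      qed simp
    qed
    ultimately have "\<mu> \<in> resolvent_set D A" unfolding resolvent_set_def by blast
    then show False using \<mu> by (simp add: spectrum_def)
  qed
next
  fix \<mu> assume "\<mu> \<in> {lm i | i. e i \<noteq> 0}"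
  then obtain i where i: "\<mu> = lm i" "e i \<noteq> 0" by blast
  have "\<mu> \<notin> resolvent_set D A"
  proof
    assume "\<mu> \<in> resolvent_set D A"
    then obtain R where R: "bounded_linear R" "\<forall>u\<in>D. R (A u - \<mu> *\<^sub>R u) = u"
      unfolding resolvent_set_def by blast
    \<comment> \<open>A - \<mu> annihilates the eigenvector, so a left inverse would send 0 to
      it.\<close>
    have "R 0 = e i" using R(2) eigenvector[of i] i(1) by force
    then show False using i(2) linear_0[OF bounded_linear.linear[OF R(1)]] by simp
  qed
  then show "\<mu> \<in> spectrum D A" by (simp add: spectrum_def)
qed

end

section \<open>The hypergeometric polynomials\<close>

definition hyper_coeff :: "real \<Rightarrow> nat \<Rightarrow> nat \<Rightarrow> nat \<Rightarrow> real" where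
  "hyper_coeff \<omega> m n j = pochhammer (- real m - sexp \<omega> n) j * pochhammer (- real m) j
     / (pochhammer (real n + 1) j * fact j)"

lemma hyper_coeff_0 [simp]: "hyper_coeff \<omega> m n 0 = 1"
  by (simp add: hyper_coeff_def)

text \<open>The ratio of consecutive hypergeometric coefficients, cleared of denominators; the signs
  of the two numerator factors cancel.\<close>

lemma hyper_coeff_Suc:
  "hyper_coeff \<omega> m n (Suc j) * ((real j + 1) * (real j + 1 + real n))
    = hyper_coeff \<omega> m n j * ((real m + sexp \<omega> n - real j) * (real m - real j))"
proof -
  have gen: "(A * x) * (B * y) / ((C * c) * (d * F)) * (d * c) = A * B / (C * F) * (x * y)"
    if "C \<noteq> 0" "c \<noteq> 0" "d \<noteq> 0" "F \<noteq> 0" for A B C F x y c d :: real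
    using that by (simp add: field_simps)
  have p: "pochhammer (real n + 1) j \<noteq> 0" by (simp add: pochhammer_pos less_imp_neq[symmetric])
  have xy: "(- real m - sexp \<omega> n + real j) * (- real m + real j) = (real m + sexp \<omega> n - real j) * (real m - real j)"
    by (simp add: algebra_simps)
  have c: "(real j + 1) * (real j + 1 + real n) = real (Suc j) * (real n + 1 + real j)" by (simp add: algebra_simps)
  show ?thesis
    unfolding hyper_coeff_def pochhammer_Suc fact_Suc c xy[symmetric]
    by (rule gen[OF p]) auto
qed

text \<open>By s >= 0 all ratios up to index m are positive. Positivity rules out cancellation in
  the leading coefficients of the polynomials below.\<close>

lemma hyper_coeff_pos: "j \<le> m \<Longrightarrow> hyper_coeff \<omega> m n j > 0"
proof (induction j)
  case (Suc j)
  have "hyper_coeff \<omega> m n j * ((real m + sexp \<omega> n - real j) * (real m - real j)) > 0"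
    using Suc sexp_facts(3)[of \<omega> n] by (intro mult_pos_pos) auto
  then have "hyper_coeff \<omega> m n (Suc j) * ((real j + 1) * (real j + 1 + real n)) > 0"
    by (simp only: hyper_coeff_Suc)
  then show ?case by (rule zero_less_mult_pos2) (simp add: add_nonneg_pos)
qed simp

lemma hyper_coeff_eq_0: "j > m \<Longrightarrow> hyper_coeff \<omega> m n j = 0"
  by (simp add: hyper_coeff_def pochhammer_of_nat_eq_0_lemma)

lemma hyper_factor_sum: "hyp_factor \<omega> m n r = (\<Sum>j\<le>m. hyper_coeff \<omega> m n j * (- r\<^sup>2) ^ j)"
proof -
  have "hyp_factor \<omega> m n r = (\<Sum>j. hyper_coeff \<omega> m n j * (- r\<^sup>2) ^ j)"
    unfolding hyp_factor_def gauss_F_def eval_fps_def hyper_coeff_def sexp_def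
    by (simp add: add.commute)
  also have "\<dots> = (\<Sum>j\<le>m. hyper_coeff \<omega> m n j * (- r\<^sup>2) ^ j)"
    by (rule suminf_finite) (auto simp: hyper_coeff_eq_0)
  finally show ?thesis .
qed

lemma hyp_factor_even_poly:
  "\<exists>P :: real poly. degree P = 2 * m \<and> (\<forall>r. poly P (- r) = poly P r) \<and> (\<forall>r. hyp_factor \<omega> m n r = poly P r)"
proof (intro exI conjI allI)
  let ?P = "\<Sum>j\<le>m. monom (hyper_coeff \<omega> m n j * (- 1) ^ j) (2 * j)"
  have P: "poly ?P r = hyp_factor \<omega> m n r" for r
    unfolding hyper_factor_sum poly_sum
  proof (rule sum.cong)
    fix j
    have "(- r\<^sup>2) ^ j = (- 1) ^ j * r ^ (2 * j)"
      by (subst power_minus) (simp add: power_mult)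
    then show "poly (monom (hyper_coeff \<omega> m n j * (- 1) ^ j) (2 * j)) r = hyper_coeff \<omega> m n j * (- r\<^sup>2) ^ j"
      by (simp add: poly_monom)
  qed simp
  show "hyp_factor \<omega> m n r = poly ?P r" for r by (simp add: P)
  show "poly ?P (- r) = poly ?P r" for r by (simp only: P hyper_factor_sum power2_minus)
  show "degree ?P = 2 * m"
  proof (rule antisym)
    show "degree ?P \<le> 2 * m"
      by (intro degree_sum_le) (auto intro: order_trans[OF degree_monom_le])
    have "coeff ?P (2 * m) = (\<Sum>j\<le>m. if j = m then hyper_coeff \<omega> m n j * (- 1) ^ j else 0)"
      unfolding coeff_sum by (rule sum.cong) auto
    also have "\<dots> = hyper_coeff \<omega> m n m * (- 1) ^ m" by (subst sum.delta) simp_all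
    also have "\<dots> \<noteq> 0" using hyper_coeff_pos[of m m \<omega> n] by simp
    finally show "2 * m \<le> degree ?P" by (rule le_degree)
  qed
qed

definition tpoly :: "nat \<Rightarrow> nat \<Rightarrow> real poly" where
  "tpoly j i = [:- 1, 1:] ^ j * [:0, 1:] ^ i"

text \<open>t^m times the hypergeometric factor, written in t: as -r^2 t = t - 1, the product of t^m
  and (-r^2)^j becomes (t - 1)^j t^(m - j).\<close>

definition hyper_poly :: "real \<Rightarrow> nat \<Rightarrow> nat \<Rightarrow> real poly" where
  "hyper_poly \<omega> m n = (\<Sum>j\<le>m. smult (hyper_coeff \<omega> m n j) (tpoly j (m - j)))"

lemma poly_tpoly: "poly (tpoly j i) t = (t - 1) ^ j * t ^ i"
  by (simp add: tpoly_def)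

lemma pderiv_tpoly: "[:0, 1:] * [:- 1, 1:] * pderiv (tpoly j i)
   = smult (real j) ([:0, 1:] * tpoly j i) + smult (real i) ([:- 1, 1:] * tpoly j i)"
proof -
  have X: "[:0, 1:] * pderiv ([:0, 1:] ^ i) = smult (real i) ([:0, 1:] ^ i :: real poly)"
    by (cases i) (simp_all add: pderiv_power_Suc pderiv_pCons del: power_Suc, simp_all add: mult_smult_right)
  have Y: "[:- 1, 1:] * pderiv ([:- 1, 1:] ^ j) = smult (real j) ([:- 1, 1:] ^ j :: real poly)"
    by (cases j) (simp_all add: pderiv_power_Suc pderiv_pCons del: power_Suc, simp_all add: mult_smult_right)
  have "[:0, 1:] * [:- 1, 1:] * pderiv (tpoly j i)
     = [:- 1, 1:] ^ j * [:- 1, 1:] * ([:0, 1:] * pderiv ([:0, 1:] ^ i))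
       + [:0, 1:] ^ i * [:0, 1:] * ([:- 1, 1:] * pderiv ([:- 1, 1:] ^ j))"
    unfolding tpoly_def pderiv_mult by (simp only: distrib_left ac_simps)
  also have "\<dots> = smult (real j) ([:0, 1:] * tpoly j i) + smult (real i) ([:- 1, 1:] * tpoly j i)"
    unfolding X Y tpoly_def by (simp only: mult_smult_left mult_smult_right ac_simps)
  finally show ?thesis .
qed

text \<open>This permits division by t and t - 1 when polynomial identities are checked
  pointwise.\<close>

lemma poly_eq_if_eq_off_01:
  fixes p q :: "real poly"
  assumes "\<And>t. t \<noteq> 0 \<Longrightarrow> t \<noteq> 1 \<Longrightarrow> poly p t = poly q t"
  shows "p = q"
proof -
  have "poly ((p - q) * ([:0, 1:] * [:- 1, 1:])) t = 0" for t
    using assms[of t] by (cases "t = 0 \<or> t = 1") auto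
  then have "(p - q) * ([:0, 1:] * [:- 1, 1:]) = 0" using poly_all_0_iff_0 by blast
  then have "p - q = 0 \<or> [:0, 1:] * [:- 1, 1:] = (0 :: real poly)" by (simp only: mult_eq_0_iff)
  then show ?thesis by simp
qed

text \<open>The operator preserves the total degree j + i and couples only neighbouring j, so the
  eigenvalue equation becomes a three-term relation. The truncated indices j - 1 and i - 1 occur
  with coefficient 0 where they are wrong.\<close>

lemma hyper_op_tpoly:
  "hyper_op \<omega> n (tpoly j i) = smult (real j * (real j + real n)) (tpoly (j - 1) (i + 1))
     + smult (2 * real i * real j + (real n + 1) * real i + (1 + sexp \<omega> n) * real j
         + (aexp \<omega> n * (aexp \<omega> n + 1) - \<omega>\<^sup>2)) (tpoly j i)
     + smult (real i * (real i + sexp \<omega> n)) (tpoly (j + 1) (i - 1))"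
proof (rule poly_eq_if_eq_off_01)
  fix t :: real assume t: "t \<noteq> 0" "t \<noteq> 1"
  define y where "y = t - 1"
  define u where "u = tpoly j i"
  define u0 u1 u2 where "u0 = poly u t" and "u1 = poly (pderiv u) t" and "u2 = poly (pderiv (pderiv u)) t"
  \<comment> \<open>Multiplication by r or \<open>r'\<close> shifts one exponent unit between t - 1
    and t, which is what the two neighbouring terms are.\<close>
  define r r' where "r = t / y" and "r' = y / t"
  have y: "y \<noteq> 0" "t = y + 1" using t by (simp_all add: y_def)
  have d1: "t * y * u1 = (real j * t + real i * y) * u0"
    using arg_cong[OF pderiv_tpoly[of j i], of "\<lambda>p. poly p t"]
    by (simp add: u_def u0_def u1_def y_def algebra_simps)
  have "pderiv ([:0, 1:] * [:- 1, 1:] * pderiv u) = pderiv (smult (real j) ([:0, 1:] * u) + smult (real i) ([:- 1, 1:] * u))"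
    unfolding u_def pderiv_tpoly ..
  then have "poly (pderiv ([:0, 1:] * [:- 1, 1:] * pderiv u)) t
      = poly (pderiv (smult (real j) ([:0, 1:] * u) + smult (real i) ([:- 1, 1:] * u))) t" by simp
  then have d2: "t * y * u2 = (real i + real j) * u0 + (real j * t + real i * y) * u1 - (t + y) * u1"
    unfolding pderiv_add pderiv_smult pderiv_mult
    by (simp add: pderiv_pCons u0_def u1_def u2_def y_def algebra_simps)
  have e1: "t * u1 = (real j * r + real i) * u0"
    using d1 y(1) by (simp add: r_def field_simps)
  have e2: "y * u1 = (real j + real i * r') * u0"
    using d1 t(1) by (simp add: r'_def field_simps)
  have v1: "real j * poly (tpoly (j - 1) (i + 1)) t = real j * (r * u0)"
    by (cases j) (use y(1) in \<open>simp_all add: poly_tpoly u0_def u_def r_def y_def field_simps\<close>)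
  have v2: "real i * poly (tpoly (j + 1) (i - 1)) t = real i * (r' * u0)"
    by (cases i) (use t(1) in \<open>simp_all add: poly_tpoly u0_def u_def r'_def y_def field_simps\<close>)
  define s where "s = sexp \<omega> n"
  define l where "l = aexp \<omega> n * (aexp \<omega> n + 1) - \<omega>\<^sup>2"
  have "poly (hyper_op \<omega> n u) t = t * y * u2 + ((real n + 1) * (t * u1) + (1 + s) * (y * u1)) + l * u0"
    using aexp_facts(1)[of \<omega> n]
    by (simp add: hyper_op_def u0_def u1_def u2_def y_def s_def l_def algebra_simps)
  also have "\<dots> = (real i + real j) * u0 + (real j * (t * u1) + real i * (y * u1)) - (t * u1 + y * u1)
      + ((real n + 1) * (t * u1) + (1 + s) * (y * u1)) + l * u0"
    unfolding d2 by (simp add: algebra_simps)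
  also have "\<dots> = (real j + real n) * (real j * (r * u0)) + (2 * real i * real j + (real n + 1) * real i + (1 + s) * real j + l) * u0
      + (real i + s) * (real i * (r' * u0))"
    unfolding e1 e2 by (simp add: algebra_simps)
  also have "\<dots> = (real j + real n) * (real j * poly (tpoly (j - 1) (i + 1)) t)
      + (2 * real i * real j + (real n + 1) * real i + (1 + s) * real j + l) * u0
      + (real i + s) * (real i * poly (tpoly (j + 1) (i - 1)) t)"
    unfolding v1 v2 ..
  finally show "poly (hyper_op \<omega> n (tpoly j i)) t
     = poly (smult (real j * (real j + real n)) (tpoly (j - 1) (i + 1))
     + smult (2 * real i * real j + (real n + 1) * real i + (1 + sexp \<omega> n) * real j
         + (aexp \<omega> n * (aexp \<omega> n + 1) - \<omega>\<^sup>2)) (tpoly j i)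
     + smult (real i * (real i + sexp \<omega> n)) (tpoly (j + 1) (i - 1))) t"
    by (simp add: u_def u0_def s_def l_def algebra_simps)
qed

lemma hyper_op_add: "hyper_op \<omega> n (p + q) = hyper_op \<omega> n p + hyper_op \<omega> n q"
  unfolding hyper_op_def pderiv_add distrib_left smult_add_right
  by (simp only: add.assoc add.commute add.left_commute)

lemma hyper_op_smult: "hyper_op \<omega> n (smult c p) = smult c (hyper_op \<omega> n p)"
  unfolding hyper_op_def pderiv_smult mult_smult_right smult_add_right smult_smult
  by (simp only: mult.commute)

lemma hyper_op_sum: "hyper_op \<omega> n (\<Sum>i\<in>I. f i) = (\<Sum>i\<in>I. hyper_op \<omega> n (f i))"
proof (induction I rule: infinite_finite_induct)
  case (insert i I)
  then show ?case by (simp add: hyper_op_add)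
qed (simp_all add: hyper_op_def)

lemma smult_sum_right: "smult c (\<Sum>i\<in>I. f i) = (\<Sum>i\<in>I. smult c (f i))"
  by (induction I rule: infinite_finite_induct) (simp_all add: smult_add_right)

lemma lam_eq: "lam \<omega> m n = real m * real m + real m * (real n + 1 + sexp \<omega> n) + (aexp \<omega> n * (aexp \<omega> n + 1) - \<omega>\<^sup>2)"
  unfolding lam_def aexp_def sexp_def[symmetric] by (simp add: power2_eq_square field_simps)

text \<open>The coefficients come from the Gauss series. Shifting the index in both off-diagonal
  sums and applying their recurrence turns everything into multiples of the same
  \<open>tpoly j (m - j)\<close>.\<close>

lemma hyper_op_hyper_poly: "hyper_op \<omega> n (hyper_poly \<omega> m n) = smult (lam \<omega> m n) (hyper_poly \<omega> m n)"
proof -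
  let ?c = "hyper_coeff \<omega> m n"
  let ?s = "sexp \<omega> n"
  let ?l = "aexp \<omega> n * (aexp \<omega> n + 1) - \<omega>\<^sup>2"
  let ?d = "\<lambda>j. 2 * real (m - j) * real j + (real n + 1) * real (m - j) + (1 + ?s) * real j + ?l"
  let ?u = "\<lambda>j. tpoly j (m - j)"
  have S1: "(\<Sum>j\<le>m. smult (?c j * (real j * (real j + real n))) (tpoly (j - 1) (m - j + 1)))
      = (\<Sum>j\<le>m. smult (?c j * ((real m + ?s - real j) * (real m - real j))) (?u j))"
  proof (cases m)
    case (Suc k)
    have "(\<Sum>j\<le>Suc k. smult (?c j * (real j * (real j + real n))) (tpoly (j - 1) (Suc k - j + 1)))
       = (\<Sum>j\<le>k. smult (?c (Suc j) * (real (Suc j) * (real (Suc j) + real n))) (tpoly j (k - j + 1)))"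
      by (subst sum.atMost_Suc_shift) simp
    also have "\<dots> = (\<Sum>j\<le>k. smult (?c j * ((real m + ?s - real j) * (real m - real j))) (tpoly j (Suc k - j)))"
    proof (rule sum.cong)
      fix j assume "j \<in> {..k}"
      then have "k - j + 1 = Suc k - j" by simp
      moreover have "?c (Suc j) * (real (Suc j) * (real (Suc j) + real n)) = ?c j * ((real m + ?s - real j) * (real m - real j))"
        using hyper_coeff_Suc[of \<omega> m n j] by (simp add: add.commute)
      ultimately show "smult (?c (Suc j) * (real (Suc j) * (real (Suc j) + real n))) (tpoly j (k - j + 1))
        = smult (?c j * ((real m + ?s - real j) * (real m - real j))) (tpoly j (Suc k - j))" by (simp only:)
    qed simp
    finally show ?thesis unfolding Suc by simp
  qed simp
  have S3: "(\<Sum>j\<le>m. smult (?c j * (real (m - j) * (real (m - j) + ?s))) (tpoly (j + 1) (m - j - 1)))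
      = (\<Sum>j\<le>m. smult (?c j * (real j * (real j + real n))) (?u j))"
  proof (cases m)
    case (Suc k)
    have "(\<Sum>j\<le>Suc k. smult (?c j * (real j * (real j + real n))) (tpoly j (Suc k - j)))
       = (\<Sum>j\<le>k. smult (?c (Suc j) * (real (Suc j) * (real (Suc j) + real n))) (tpoly (Suc j) (k - j)))"
      by (subst sum.atMost_Suc_shift) simp
    also have "\<dots> = (\<Sum>j\<le>k. smult (?c j * (real (Suc k - j) * (real (Suc k - j) + ?s))) (tpoly (j + 1) (Suc k - j - 1)))"
    proof (rule sum.cong)
      fix j assume j: "j \<in> {..k}"
      have "?c (Suc j) * (real (Suc j) * (real (Suc j) + real n)) = ?c j * ((real m + ?s - real j) * (real m - real j))"
        using hyper_coeff_Suc[of \<omega> m n j] by (simp add: add.commute)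
      also have "\<dots> = ?c j * (real (Suc k - j) * (real (Suc k - j) + ?s))"
        using j Suc by (simp add: of_nat_diff algebra_simps)
      finally show "smult (?c (Suc j) * (real (Suc j) * (real (Suc j) + real n))) (tpoly (Suc j) (k - j))
        = smult (?c j * (real (Suc k - j) * (real (Suc k - j) + ?s))) (tpoly (j + 1) (Suc k - j - 1))" using j by simp
    qed simp
    finally show ?thesis unfolding Suc by simp
  qed simp
  have "hyper_op \<omega> n (hyper_poly \<omega> m n)
      = (\<Sum>j\<le>m. smult (?c j * (real j * (real j + real n))) (tpoly (j - 1) (m - j + 1))
         + smult (?c j * ?d j) (?u j)
         + smult (?c j * (real (m - j) * (real (m - j) + ?s))) (tpoly (j + 1) (m - j - 1)))"
    unfolding hyper_poly_def hyper_op_sum hyper_op_smult hyper_op_tpoly by (simp only: smult_add_right smult_smult)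
  also have "\<dots> = (\<Sum>j\<le>m. smult (?c j * ((real m + ?s - real j) * (real m - real j))) (?u j)
         + smult (?c j * ?d j) (?u j) + smult (?c j * (real j * (real j + real n))) (?u j))"
    by (simp only: sum.distrib S1 S3)
  also have "\<dots> = (\<Sum>j\<le>m. smult (lam \<omega> m n) (smult (?c j) (?u j)))"
  proof (rule sum.cong)
    fix j assume "j \<in> {..m}"
    then have e: "real (m - j) = real m - real j" by simp
    \<comment> \<open>After the shifts the dependence on j cancels and the eigenvalue
      remains.\<close>
    have "?c j * ((real m + ?s - real j) * (real m - real j)) + ?c j * ?d j + ?c j * (real j * (real j + real n)) = lam \<omega> m n * ?c j"
      unfolding lam_eq e by (simp add: algebra_simps)
    then show "smult (?c j * ((real m + ?s - real j) * (real m - real j))) (?u j)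
         + smult (?c j * ?d j) (?u j) + smult (?c j * (real j * (real j + real n))) (?u j)
         = smult (lam \<omega> m n) (smult (?c j) (?u j))"
      by (simp only: smult_add_left[symmetric] smult_smult)
  qed simp
  also have "\<dots> = smult (lam \<omega> m n) (hyper_poly \<omega> m n)" by (simp only: hyper_poly_def smult_sum_right)
  finally show ?thesis .
qed

lemma degree_tpoly: "degree (tpoly j i) = j + i" and lead_tpoly: "lead_coeff (tpoly j i) = 1"
proof -
  have nz: "[:- 1, 1:] ^ j \<noteq> (0 :: real poly)" "[:0, 1:] ^ i \<noteq> (0 :: real poly)" by auto
  show "degree (tpoly j i) = j + i"
    unfolding tpoly_def degree_mult_eq[OF nz] by (simp add: degree_power_eq)
  show "lead_coeff (tpoly j i) = 1"
    unfolding tpoly_def lead_coeff_mult lead_coeff_power by simp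
qed

text \<open>Each \<open>tpoly j (m - j)\<close> is monic of degree m, so the coefficient of t^m is
  the sum of the positive \<open>hyper_coeff \<omega> m n j\<close>.\<close>

lemma degree_hyper_poly: "degree (hyper_poly \<omega> m n) \<le> m" and coeff_hyper_poly: "coeff (hyper_poly \<omega> m n) m > 0"
proof -
  show "degree (hyper_poly \<omega> m n) \<le> m"
    unfolding hyper_poly_def
    by (intro degree_sum_le) (auto intro!: order_trans[OF degree_smult_le] simp: degree_tpoly)
  have "coeff (tpoly j (m - j)) m = 1" if "j \<le> m" for j
    using lead_tpoly[of j "m - j"] degree_tpoly[of j "m - j"] that by simp
  then have "coeff (hyper_poly \<omega> m n) m = (\<Sum>j\<le>m. hyper_coeff \<omega> m n j)"
    unfolding hyper_poly_def coeff_sum by (intro sum.cong) auto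
  also have "\<dots> > 0" by (intro sum_pos hyper_coeff_pos) auto
  finally show "coeff (hyper_poly \<omega> m n) m > 0" .
qed

text \<open>Hence the polynomials \<open>hyper_poly \<omega> m n\<close>, \<open>m = 0, 1, \<dots>\<close>, span all polynomials.\<close>

lemma hyper_poly_functional_zero:
  fixes \<Lambda> :: "real poly \<Rightarrow> real"
  assumes add: "\<And>p q. \<Lambda> (p + q) = \<Lambda> p + \<Lambda> q" and smult: "\<And>c p. \<Lambda> (smult c p) = c * \<Lambda> p"
    and zero: "\<And>m. \<Lambda> (hyper_poly \<omega> m n) = 0"
  shows "\<Lambda> p = 0"
proof -
  have "degree p < k \<Longrightarrow> \<Lambda> p = 0" for k
  proof (induction k arbitrary: p)
    case (Suc k)
    let ?h = "hyper_poly \<omega> k n"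
    define c where "c = coeff p k / coeff ?h k"
    define r where "r = p - smult c ?h"
    have "coeff r k = 0" using coeff_hyper_poly[where m = k] by (simp add: r_def c_def less_imp_neq[symmetric])
    moreover have "degree r \<le> k"
      unfolding r_def using Suc.prems degree_hyper_poly[of \<omega> k n]
      by (intro degree_diff_le) (auto intro: order_trans[OF degree_smult_le])
    ultimately have "r = 0 \<or> degree r < k"
      by (metis leading_coeff_0_iff le_neq_implies_less)
    then have "\<Lambda> r = 0"
    proof
      assume "r = 0"
      then show ?thesis using smult[of 0 r] by simp
    qed (rule Suc.IH)
    moreover have "p = r + smult c ?h" by (simp add: r_def)
    ultimately show ?case by (simp add: add smult zero)
  qed simp
  then show ?thesis by blast
qed

text \<open>The angular factor a cos(n \<theta>) + b sin(n \<theta>) is the real part of (a - \<i>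
  b) exp(\<i> n \<theta>), whence the conjugated constant.\<close>

lemma psi_fun_hyper_poly: "eigenfunction \<omega> m n a b p = psi_fun \<omega> n (Complex a (- b)) (hyper_poly \<omega> m n) p"
proof -
  define x where "x = stereo p"
  define t where "t = tcoord x"
  define N where "N = (norm x)\<^sup>2"
  have w: "1 + N > 0" by (simp add: N_def)
  have t: "t = 1 / (1 + N)" "t > 0" by (simp_all add: t_def N_def tcoord_def)
  have tN: "- N * t = t - 1" using w unfolding t(1) by (simp add: field_simps)
  \<comment> \<open>The radicand is the perfect square (2m + n + 1 + s)^2, so the exponent splits
    into t^a and the t^m that turns the series into a polynomial in t.\<close>
  have ex: "(sqrt (4 * \<omega>\<^sup>2 + 4 * lam \<omega> m n + 1) - 1) / 2 = aexp \<omega> n + real m"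
  proof -
    have "4 * \<omega>\<^sup>2 + 4 * lam \<omega> m n + 1 = (2 * real m + real n + 1 + sexp \<omega> n)\<^sup>2"
      unfolding lam_def sexp_def[symmetric] by (simp add: power2_eq_square field_simps)
    moreover have "0 \<le> 2 * real m + real n + 1 + sexp \<omega> n" using sexp_facts(3)[of \<omega> n] by simp
    ultimately show ?thesis by (simp add: aexp_def)
  qed
  have z: "cplx x = rcis (norm x) (ang p)"
    using rcis_cmod_Arg[of "cplx x"] unfolding norm_cplx ang_def x_def[symmetric] cplx_def[symmetric] by simp
  have ang: "norm x ^ n * (a * cos (real n * ang p) + b * sin (real n * ang p)) = hpoly (Complex a (- b)) n x"
    unfolding hpoly_def z DeMoivre2 by (simp add: rcis_def cis.ctr complex_eq_iff algebra_simps)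
  have rad: "1 / (1 + N) powr (aexp \<omega> n + real m) * hyp_factor \<omega> m n (norm x) = radial (aexp \<omega> n) (hyper_poly \<omega> m n) x"
  proof -
    have "1 / (1 + N) powr (aexp \<omega> n + real m) = t powr aexp \<omega> n * t ^ m"
      unfolding t(1) using w by (simp add: powr_divide powr_add powr_realpow power_divide)
    moreover have "t ^ m * hyp_factor \<omega> m n (norm x) = poly (hyper_poly \<omega> m n) t"
      unfolding hyper_factor_sum hyper_poly_def poly_sum sum_distrib_left N_def[symmetric]
    proof (rule sum.cong)
      fix j assume "j \<in> {..m}"
      then have "t ^ m = t ^ j * t ^ (m - j)" by (simp flip: power_add)
      then have "t ^ m * (hyper_coeff \<omega> m n j * (- N) ^ j) = hyper_coeff \<omega> m n j * ((- N * t) ^ j * t ^ (m - j))"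
        by (simp only: power_mult_distrib ac_simps)
      then show "t ^ m * (hyper_coeff \<omega> m n j * (- N) ^ j) = poly (smult (hyper_coeff \<omega> m n j) (tpoly j (m - j))) t"
        unfolding tN by (simp add: poly_tpoly)
    qed simp
    ultimately show ?thesis by (simp add: radial_def t_def mult.assoc)
  qed
  have "eigenfunction \<omega> m n a b p = (norm x ^ n * (a * cos (real n * ang p) + b * sin (real n * ang p)))
      * (1 / (1 + N) powr (aexp \<omega> n + real m) * hyp_factor \<omega> m n (norm x))"
    unfolding eigenfunction_def ex rad_def x_def[symmetric] N_def by (simp add: divide_inverse ac_simps)
  also have "\<dots> = psi_fun \<omega> n (Complex a (- b)) (hyper_poly \<omega> m n) p"
    unfolding ang rad by (simp add: psi_fun_def psi_def x_def)
  finally show ?thesis .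
qed

section \<open>Totality of the angular modes\<close>

lemma integral_rotation_antisymmetric:
  assumes "integrable lborel F" "\<And>x. F (rotation \<alpha> x) = - F x"
  shows "(\<integral>x. F x \<partial>lborel) = (0::real)"
  using integral_rotation[OF assms(1), of \<alpha>] assms(2) by simp

lemma cplx_rotation: "cplx (rotation \<alpha> x) = cis \<alpha> * cplx x"
  by (simp add: cplx_def rotation_def complex_eq_iff)

lemma norm_rotation: "norm (rotation \<alpha> x) = norm x"
  unfolding norm_cplx[symmetric] cplx_rotation by (simp add: norm_mult)

text \<open>The product of two real parts splits into pieces of angular frequencies n + k and n - k.
  Rotation by pi divided by a nonzero frequency reverses the sign of the piece; if n = k, the second
  piece vanishes pointwise by the condition on c and d.\<close>

lemma psi_angular_orthogonal:
  assumes nk: "n \<noteq> k \<or> (n > 0 \<and> Re (c * cnj d) = 0)"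
  shows "class_of (psi_fun \<omega> n c p) \<bullet> class_of (psi_fun \<omega> k d q) = 0"
proof -
  let ?z = cplx
  define g where "g x = conf x * (radial (aexp \<omega> n) p x * radial (aexp \<omega> k) q x)" for x
  have grot: "g (rotation \<alpha> x) = g x" for \<alpha> x
    by (simp add: g_def conf_def radial_def tcoord_def norm_rotation)
  define I1 where "I1 x = g x * Re (c * d * ?z x ^ (n + k))" for x
  define I2 where "I2 x = g x * Re (c * cnj d * (?z x ^ n * cnj (?z x) ^ k))" for x
  have split: "conf x * (psi \<omega> n c p x * psi \<omega> k d q x) = (1/2) * (I1 x + I2 x)" for x
  proof -
    have re: "Re u * Re v = (1/2) * (Re (u * v) + Re (u * cnj v))" for u v by simp
    have "hpoly c n x * hpoly d k x = (1/2) * (Re (c * d * ?z x ^ (n + k)) + Re (c * cnj d * (?z x ^ n * cnj (?z x) ^ k)))"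
      unfolding hpoly_def re by (simp only: power_add complex_cnj_mult complex_cnj_power ac_simps)
    moreover have "cf * ((h * r) * (h' * r')) = (1/2) * (cf * (r * r') * A + cf * (r * r') * B)"
      if "h * h' = (1/2) * (A + B)" for cf h h' r r' A B :: real
    proof -
      have "cf * ((h * r) * (h' * r')) = cf * (r * r') * (h * h')" by (simp only: ac_simps)
      then show ?thesis unfolding that by (simp add: algebra_simps)
    qed
    ultimately show ?thesis unfolding psi_def I1_def I2_def g_def by blast
  qed
  have bd: "integrable lborel (\<lambda>x. g x * Re (C * (?z x ^ n * W x ^ k)))"
    if W: "\<And>x. cmod (W x) = norm x" "W \<in> borel_measurable borel" for C W
  proof -
    obtain C1 where C1: "C1 \<ge> 0" "\<And>x. \<bar>poly p (tcoord x)\<bar> \<le> C1" using poly_tcoord_bound by blast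
    obtain C2 where C2: "C2 \<ge> 0" "\<And>x. \<bar>poly q (tcoord x)\<bar> \<le> C2" using poly_tcoord_bound by blast
    have rb: "norm x ^ l * \<bar>radial (aexp \<omega> l) r x\<bar> \<le> B"
      if B: "\<And>x. \<bar>poly r (tcoord x)\<bar> \<le> B" "B \<ge> 0" for l r B and x :: plane
    proof -
      have "norm x ^ l * \<bar>radial (aexp \<omega> l) r x\<bar> \<le> (1 + (norm x)\<^sup>2) powr (real l / 2) * ((1 + (norm x)\<^sup>2) powr - aexp \<omega> l * B)"
        unfolding radial_def abs_mult tcoord_powr using B by (intro mult_mono norm_power_le) auto
      also have "\<dots> = (1 + (norm x)\<^sup>2) powr - (sexp \<omega> l / 2) * B"
      proof -
        have "real l / 2 + - aexp \<omega> l = - (sexp \<omega> l / 2)" by (simp add: aexp_def field_simps)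
        then show ?thesis using powr_add[of "1 + (norm x)\<^sup>2" "real l / 2" "- aexp \<omega> l"] by simp
      qed
      also have "\<dots> \<le> 1 * B"
        using B(2) sexp_facts(3)[of \<omega> l] powr_mono[of "- (sexp \<omega> l / 2)" 0 "1 + (norm x)\<^sup>2"]
        by (intro mult_right_mono) auto
      finally show ?thesis by simp
    qed
    have zm[measurable]: "cplx \<in> borel_measurable borel"
      by (intro borel_measurable_continuous_onI linear_continuous_on bounded_linear_cplx)
    have rm[measurable]: "radial a r \<in> borel_measurable borel" for a r
      by (intro borel_measurable_continuous_onI smooth_continuous smooth_radial)
    note [measurable] = W(2)
    show ?thesis
    proof (rule Bochner_Integration.integrable_bound)
      show "integrable lborel (\<lambda>x. (C1 * C2 * cmod C) * conf x)" using integrable_conf by simp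
      show "(\<lambda>x. g x * Re (C * (?z x ^ n * W x ^ k))) \<in> borel_measurable lborel"
        unfolding g_def by measurable
      show "AE x in lborel. norm (g x * Re (C * (?z x ^ n * W x ^ k))) \<le> norm ((C1 * C2 * cmod C) * conf x)"
      proof (rule AE_I2)
        fix x :: plane
        have "\<bar>Re (C * (?z x ^ n * W x ^ k))\<bar> \<le> cmod C * (norm x ^ n * norm x ^ k)"
          using abs_Re_le_cmod[of "C * (?z x ^ n * W x ^ k)"] W(1) by (simp add: norm_mult norm_power)
        then have "\<bar>g x * Re (C * (?z x ^ n * W x ^ k))\<bar>
            \<le> (conf x * (\<bar>radial (aexp \<omega> n) p x\<bar> * \<bar>radial (aexp \<omega> k) q x\<bar>)) * (cmod C * (norm x ^ n * norm x ^ k))"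
          unfolding g_def abs_mult by (intro mult_mono) (auto simp: abs_mult)
        also have "\<dots> = cmod C * conf x * ((norm x ^ n * \<bar>radial (aexp \<omega> n) p x\<bar>) * (norm x ^ k * \<bar>radial (aexp \<omega> k) q x\<bar>))"
          by (simp only: ac_simps)
        also have "\<dots> \<le> cmod C * conf x * (C1 * C2)"
          by (intro mult_left_mono mult_mono rb C1 C2 mult_nonneg_nonneg) auto
        finally show "norm (g x * Re (C * (?z x ^ n * W x ^ k))) \<le> norm ((C1 * C2 * cmod C) * conf x)"
          using C1(1) C2(1) by (simp add: abs_mult ac_simps)
      qed
    qed
  qed
  have zm: "cplx \<in> borel_measurable borel"
    by (intro borel_measurable_continuous_onI linear_continuous_on bounded_linear_cplx)
  have i1: "integrable lborel I1"
    using bd[of cplx "c * d"] zm unfolding I1_def by (simp add: power_add mult.assoc)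
  have cm: "(\<lambda>x. cnj (?z x)) \<in> borel_measurable borel"
    by (intro borel_measurable_continuous_onI continuous_on_cnj linear_continuous_on bounded_linear_cplx)
  have i2: "integrable lborel I2"
    using bd[of "\<lambda>x. cnj (?z x)" "c * cnj d"] cm unfolding I2_def by simp
  \<comment> \<open>The assumption excludes n = k = 0, so the frequency n + k is never 0.\<close>
  have pos: "real n + real k > 0" using nk by auto
  have z1: "(\<integral>x. I1 x \<partial>lborel) = 0"
  proof (rule integral_rotation_antisymmetric[OF i1])
    fix x
    have "real (n + k) * (pi / (real n + real k)) = pi" using pos by simp
    then have e: "cis (pi / (real n + real k)) ^ (n + k) = (- 1 :: complex)"
      using Complex.DeMoivre[of "pi / (real n + real k)" "n + k"] by (simp only: cis_pi)
    show "I1 (rotation (pi / (real n + real k)) x) = - I1 x"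
      unfolding I1_def grot cplx_rotation power_mult_distrib e by (simp add: algebra_simps)
  qed
  have z2: "(\<integral>x. I2 x \<partial>lborel) = 0"
  proof (cases "n = k")
    case False
    define \<beta> where "\<beta> = pi / (real n - real k)"
    have nk': "real n - real k \<noteq> 0" using False by simp
    show ?thesis
    proof (rule integral_rotation_antisymmetric[OF i2])
      fix x
      have "cis \<beta> ^ n * cnj (cis \<beta>) ^ k = cis (real n * \<beta> + real k * - \<beta>)"
        by (simp add: cis_cnj Complex.DeMoivre cis_mult)
      also have "real n * \<beta> + real k * - \<beta> = (real n - real k) * \<beta>" by (simp add: left_diff_distrib)
      also have "\<dots> = pi" unfolding \<beta>_def using nk' by (simp del: right_minus_eq eq_iff_diff_eq_0)
      finally have e: "cis \<beta> ^ n * cnj (cis \<beta>) ^ k = - 1" by simp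
      have "?z (rotation \<beta> x) ^ n * cnj (?z (rotation \<beta> x)) ^ k = (cis \<beta> ^ n * cnj (cis \<beta>) ^ k) * (?z x ^ n * cnj (?z x) ^ k)"
        unfolding cplx_rotation complex_cnj_mult power_mult_distrib by (simp only: ac_simps)
      then show "I2 (rotation \<beta> x) = - I2 x" unfolding I2_def grot e by (simp add: algebra_simps)
    qed
  next
    case True
    then have "Re (c * cnj d) = 0" using nk by simp
    moreover have "?z x ^ n * cnj (?z x) ^ k = of_real (norm x ^ (2 * n))" for x
      unfolding True[symmetric] power_mult_distrib[symmetric] complex_norm_square[symmetric] norm_cplx
      by (simp add: power_mult)
    ultimately have "I2 = (\<lambda>x. 0)" unfolding I2_def by (simp add: fun_eq_iff)
    then show ?thesis by simp
  qed
  have "class_of (psi_fun \<omega> n c p) \<bullet> class_of (psi_fun \<omega> k d q) = (\<integral>x. conf x * (psi \<omega> n c p x * psi \<omega> k d q x) \<partial>lborel)"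
    unfolding inner_class_of[OF psi_fun_square_integrable psi_fun_square_integrable]
    by (subst integral_dV(2)[OF borel_measurable_times[OF psi_fun_measurable psi_fun_measurable]]) (simp add: psi_fun_def)
  also have "\<dots> = (1/2) * ((\<integral>x. I1 x \<partial>lborel) + (\<integral>x. I2 x \<partial>lborel))"
    unfolding split using i1 i2 by simp
  finally show ?thesis by (simp add: z1 z2)
qed

section \<open>Approximation by continuous functions on the sphere\<close>

lemma integral_zero_uniform_limit:
  fixes w g :: "'a \<Rightarrow> real"
  assumes w: "integrable M w" and wg: "integrable M (\<lambda>x. w x * g x)"
    and approx: "\<And>e. e > 0 \<Longrightarrow> \<exists>g'. integrable M (\<lambda>x. w x * g' x) \<and> (\<integral>x. w x * g' x \<partial>M) = 0 \<and> (\<forall>x. \<bar>g x - g' x\<bar> \<le> e)"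
  shows "(\<integral>x. w x * g x \<partial>M) = 0"
proof -
  define A where "A = (\<integral>x. \<bar>w x\<bar> \<partial>M)"
  have A: "A \<ge> 0" by (simp add: A_def)
  have bd: "\<bar>\<integral>x. w x * g x \<partial>M\<bar> \<le> e * A" if e0: "e > 0" for e
  proof -
    obtain g' where g': "integrable M (\<lambda>x. w x * g' x)" "(\<integral>x. w x * g' x \<partial>M) = 0" "\<And>x. \<bar>g x - g' x\<bar> \<le> e"
      using approx[OF e0] by blast
    have "(\<integral>x. w x * g x \<partial>M) = (\<integral>x. w x * g x - w x * g' x \<partial>M)" using wg g'(1,2) by simp
    also have "\<bar>\<dots>\<bar> \<le> (\<integral>x. e * \<bar>w x\<bar> \<partial>M)"
    proof (rule order_trans[OF integral_abs_bound integral_mono])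
      show "\<bar>w x * g x - w x * g' x\<bar> \<le> e * \<bar>w x\<bar>" for x
      proof -
        have "\<bar>w x * g x - w x * g' x\<bar> = \<bar>g x - g' x\<bar> * \<bar>w x\<bar>"
          by (simp add: abs_mult[symmetric] algebra_simps)
        also have "\<dots> \<le> e * \<bar>w x\<bar>" by (intro mult_right_mono g') simp
        finally show ?thesis .
      qed
    qed (use w wg g' in auto)
    finally show ?thesis by (simp add: A_def)
  qed
  have "\<bar>\<integral>x. w x * g x \<partial>M\<bar> \<le> 0 + d" if "d > 0" for d
  proof -
    \<comment> \<open>A + 1 keeps the divisor positive also when w has zero norm.\<close>
    have "\<bar>\<integral>x. w x * g x \<partial>M\<bar> \<le> d / (A + 1) * A" using A that by (intro bd) (simp add: divide_pos_pos)
    also have "\<dots> \<le> d" using A that by (simp add: field_simps)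
    finally show ?thesis by simp
  qed
  then have "\<bar>\<integral>x. w x * g x \<partial>M\<bar> \<le> 0" by (rule field_le_epsilon)
  then show ?thesis by simp
qed

lemma continuous_unit_bounded:
  fixes g :: "real \<Rightarrow> real"
  assumes "continuous_on {0..1} g"
  obtains B where "\<And>t. 0 \<le> t \<Longrightarrow> t \<le> 1 \<Longrightarrow> \<bar>g t\<bar> \<le> B"
proof -
  have "bounded (g ` {0..1})" by (intro compact_imp_bounded compact_continuous_image assms) auto
  then obtain B where "\<forall>y\<in>g ` {0..1}. norm y \<le> B" unfolding bounded_iff by blast
  then show ?thesis using that[of B] by simp
qed

text \<open>The coordinate t = 1/(1 + r^2) in terms of the height; in this form it is continuous at
  the pole.\<close>

definition tau :: "space3 \<Rightarrow> real" where
  "tau p = (1 - snd p) / 2"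

definition zeta :: "space3 \<Rightarrow> complex" where
  "zeta p = cplx (fst p)"

lemma tau_inv_stereo: "tau (inv_stereo x) = tcoord x"
proof -
  have "1 - ((norm x)\<^sup>2 - 1) / (1 + (norm x)\<^sup>2) = 2 / (1 + (norm x)\<^sup>2)"
    by (simp add: field_simps)
  moreover have "(2 / v) / 2 = 1 / v" for v :: real by simp
  ultimately show ?thesis unfolding tau_def inv_stereo_def tcoord_def snd_conv by (simp only:)
qed

lemma zeta_inv_stereo: "zeta (inv_stereo x) = of_real (2 * tcoord x) * cplx x"
  by (simp add: zeta_def inv_stereo_def tcoord_def cplx_def complex_eq_iff)

text \<open>By the equation of the sphere |zeta|^2 is a function of tau, which turns products of
  powers of zeta and of its conjugate back into pure powers.\<close>

lemma S2_facts:
  assumes "p \<in> S2"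
  shows "tau p \<in> {0..1}" "zeta p * cnj (zeta p) = of_real (4 * tau p * (1 - tau p))"
proof -
  have n: "(norm (fst p))\<^sup>2 + (snd p)\<^sup>2 = 1"
    using assms by (simp add: S2_def norm_prod_def)
  have "(snd p)\<^sup>2 \<le> 1" using n zero_le_power2[of "norm (fst p)"] by linarith
  then have "\<bar>snd p\<bar> \<le> 1" by (simp add: abs_square_le_1)
  then show "tau p \<in> {0..1}" by (auto simp: tau_def)
  have "zeta p * cnj (zeta p) = of_real ((norm (fst p))\<^sup>2)"
    unfolding zeta_def by (simp add: complex_norm_square[symmetric])
  also have "(norm (fst p))\<^sup>2 = 4 * tau p * (1 - tau p)"
    using n by (simp add: tau_def power2_eq_square field_simps)
  finally show "zeta p * cnj (zeta p) = of_real (4 * tau p * (1 - tau p))" .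
qed

lemma continuous_on_tau: "continuous_on A tau"
  unfolding tau_def[abs_def] by (intro continuous_intros) auto

lemma continuous_on_zeta: "continuous_on A zeta"
  unfolding zeta_def[abs_def]
  by (intro continuous_on_compose2[OF linear_continuous_on[OF bounded_linear_cplx, of UNIV]] continuous_intros) auto

lemma continuous_inv_stereo: "continuous_on A inv_stereo"
  unfolding inv_stereo_def[abs_def] by (intro continuous_intros) auto

text \<open>Finite sums of angular modes with complex coefficients continuous in tau. The rule
  \<open>cong\<close> identifies functions that agree on the sphere, the only place where the
  relation between tau and zeta holds.\<close>

inductive trig_poly :: "(space3 \<Rightarrow> real) \<Rightarrow> bool" where
  gen: "continuous_on {0..1} \<alpha> \<Longrightarrow> trig_poly (\<lambda>p. Re (\<alpha> (tau p) * zeta p ^ n))"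
| add: "trig_poly f \<Longrightarrow> trig_poly g \<Longrightarrow> trig_poly (\<lambda>p. f p + g p)"
| cong: "trig_poly f \<Longrightarrow> (\<And>p. p \<in> S2 \<Longrightarrow> f p = g p) \<Longrightarrow> trig_poly g"

lemma trig_poly_continuous: "trig_poly f \<Longrightarrow> continuous_on S2 f"
proof (induction rule: trig_poly.induct)
  case (gen \<alpha> n)
  have "continuous_on S2 (\<lambda>p. \<alpha> (tau p))"
    by (rule continuous_on_compose2[OF gen continuous_on_tau]) (use S2_facts(1) in auto)
  then show ?case by (intro continuous_on_Re continuous_on_mult continuous_on_power continuous_on_zeta)
next
  case (add f g)
  then show ?case by (intro continuous_on_add)
next
  case (cong f g)
  then show ?case using continuous_on_cong[of S2 S2 f g] by simp
qed

text \<open>The product of two modes has the frequencies n + k and n - k; the surplus |zeta|^(2k) in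
  the second is absorbed into its coefficient.\<close>

lemma trig_poly_gen_mult_le:
  assumes a: "continuous_on {0..1} \<alpha>" and b: "continuous_on {0..1} \<beta>" and kn: "k \<le> n"
  shows "trig_poly (\<lambda>p. Re (\<alpha> (tau p) * zeta p ^ n) * Re (\<beta> (tau p) * zeta p ^ k))"
proof (rule trig_poly.cong)
  let ?\<gamma> = "\<lambda>t. \<alpha> t * \<beta> t / 2"
  let ?\<delta> = "\<lambda>t. \<alpha> t * cnj (\<beta> t) * of_real (4 * t * (1 - t)) ^ k / 2"
  show "trig_poly (\<lambda>p. Re (?\<gamma> (tau p) * zeta p ^ (n + k)) + Re (?\<delta> (tau p) * zeta p ^ (n - k)))"
    by (intro trig_poly.add trig_poly.gen[of ?\<gamma>] trig_poly.gen[of ?\<delta>] continuous_intros a b continuous_on_cnj) auto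
  fix p assume p: "p \<in> S2"
  have re: "Re u * Re v = Re (u * v / 2) + Re (u * cnj v / 2)" for u v by (simp add: field_simps)
  have n: "zeta p ^ n = zeta p ^ k * zeta p ^ (n - k)" using kn by (simp flip: power_add)
  have "zeta p ^ n * cnj (zeta p ^ k) = of_real (4 * tau p * (1 - tau p)) ^ k * zeta p ^ (n - k)"
    unfolding n S2_facts(2)[OF p, symmetric] power_mult_distrib complex_cnj_power by (simp only: ac_simps)
  then have e: "(\<alpha> (tau p) * zeta p ^ n) * cnj (\<beta> (tau p) * zeta p ^ k) / 2 = ?\<delta> (tau p) * zeta p ^ (n - k)"
    by (simp add: algebra_simps)
  have e': "(\<alpha> (tau p) * zeta p ^ n) * (\<beta> (tau p) * zeta p ^ k) / 2 = ?\<gamma> (tau p) * zeta p ^ (n + k)"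
    by (simp add: power_add algebra_simps)
  show "Re (?\<gamma> (tau p) * zeta p ^ (n + k)) + Re (?\<delta> (tau p) * zeta p ^ (n - k))
      = Re (\<alpha> (tau p) * zeta p ^ n) * Re (\<beta> (tau p) * zeta p ^ k)"
    unfolding re e e' ..
qed

lemma trig_poly_gen_mult:
  assumes "continuous_on {0..1} \<alpha>" "continuous_on {0..1} \<beta>"
  shows "trig_poly (\<lambda>p. Re (\<alpha> (tau p) * zeta p ^ n) * Re (\<beta> (tau p) * zeta p ^ k))"
proof (cases "k \<le> n")
  case False
  then have "trig_poly (\<lambda>p. Re (\<beta> (tau p) * zeta p ^ k) * Re (\<alpha> (tau p) * zeta p ^ n))"
    by (intro trig_poly_gen_mult_le assms) simp
  then show ?thesis by (rule trig_poly.cong) (rule mult.commute)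
qed (rule trig_poly_gen_mult_le[OF assms])

lemma trig_poly_mult: "trig_poly f \<Longrightarrow> trig_poly g \<Longrightarrow> trig_poly (\<lambda>p. f p * g p)"
proof (induction arbitrary: g rule: trig_poly.induct)
  case (gen \<alpha> n)
  from gen(2) show ?case
  proof (induction rule: trig_poly.induct)
    case (gen \<beta> k)
    then show ?case using \<open>continuous_on {0..1} \<alpha>\<close> by (intro trig_poly_gen_mult)
  next
    case (add f g)
    show ?case by (rule trig_poly.cong[OF trig_poly.add[OF add.IH]]) (rule distrib_left[symmetric])
  next
    case (cong f g)
    show ?case by (rule trig_poly.cong[OF cong.IH]) (simp add: cong.hyps)
  qed
next
  case (add f g h)
  show ?case
    by (rule trig_poly.cong[OF trig_poly.add[OF add.IH(1)[OF add.prems] add.IH(2)[OF add.prems]]])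
      (rule distrib_right[symmetric])
next
  case (cong f g h)
  show ?case by (rule trig_poly.cong[OF cong.IH[OF cong.prems]]) (simp add: cong.hyps)
qed

lemma trig_poly_dense:
  assumes "continuous_on S2 h" "e > 0"
  shows "\<exists>g. trig_poly g \<and> (\<forall>p\<in>S2. \<bar>h p - g p\<bar> < e)"
proof (rule Stone_Weierstrass_HOL[OF _ _ trig_poly_continuous])
  show "compact S2" by (simp add: S2_def)
  show c: "trig_poly (\<lambda>p. c)" for c
    using trig_poly.gen[of "\<lambda>t. of_real c" 0] by simp
  show "\<exists>f. trig_poly f \<and> f p \<noteq> f q" if pq: "p \<in> S2 \<and> q \<in> S2 \<and> p \<noteq> q" for p q
  proof -
    have "trig_poly (\<lambda>p. Re (zeta p))" using trig_poly.gen[of "\<lambda>t. 1" 1] by simp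
    moreover have "trig_poly (\<lambda>p. Im (zeta p))" using trig_poly.gen[of "\<lambda>t. - \<i>" 1] by simp
    moreover have "trig_poly (\<lambda>p. tau p)" using trig_poly.gen[of "\<lambda>t. of_real t" 0] by (simp add: continuous_on_of_real)
    moreover have "Re (zeta p) \<noteq> Re (zeta q) \<or> Im (zeta p) \<noteq> Im (zeta q) \<or> tau p \<noteq> tau q"
      using pq by (auto simp: zeta_def cplx_def tau_def prod_eq_iff)
    ultimately show ?thesis by blast
  qed
qed (use assms in \<open>auto intro: trig_poly.add trig_poly_mult\<close>)

text \<open>Orthogonality for all polynomials q extends to h_n t^a \<phi>(t) with \<phi> continuous.
  After f is weighted by a fixed power of t, every mode in the algebra of trigonometric polynomials
  has this form, so the weighted f is orthogonal to all continuous functions on the sphere.\<close>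

lemma psi_fun_total:
  assumes \<omega>: "\<omega> \<ge> 0" and orth: "\<And>n c q. f \<bullet> class_of (psi_fun \<omega> n c q) = 0"
  shows "f = 0"
proof -
  let ?U = "\<lambda>x. fun_of f (inv_stereo x)"
  have Um[measurable]: "?U \<in> borel_measurable borel" by (rule measurable_chart[OF fun_of_measurable])
  have Uc: "integrable lborel (\<lambda>x. conf x * (?U x)\<^sup>2)"
    using fun_of_square_integrable[of f] integral_dV(1)[of "\<lambda>p. (fun_of f p)\<^sup>2"]
    by (auto simp: square_integrable_def)
  have cU: "integrable lborel (\<lambda>x. conf x * ?U x)"
    using weighted_mult_integrable[of ?U "\<lambda>x. 1" conf] Uc integrable_conf by simp
  have tm[measurable]: "tcoord \<in> borel_measurable borel" unfolding tcoord_def[abs_def] by measurable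
  have orth': "(\<integral>x. conf x * (?U x * psi \<omega> n c q x) \<partial>lborel) = 0" for n c q
  proof -
    have "f \<bullet> class_of (psi_fun \<omega> n c q) = (\<integral>x. conf x * (?U x * psi \<omega> n c q x) \<partial>lborel)"
      using inner_class_of[OF fun_of_square_integrable[of f] psi_fun_square_integrable]
      by (simp add: integral_dV(2)[OF borel_measurable_times[OF fun_of_measurable psi_fun_measurable]]) (simp add: psi_fun_def)
    then show ?thesis using orth by simp
  qed
  have bounded_int: "integrable lborel (\<lambda>x. w x * g x)"
    if "integrable lborel w" "g \<in> borel_measurable borel" "\<And>x. \<bar>g x\<bar> \<le> B" for w g :: "plane \<Rightarrow> real" and B
  proof (rule Bochner_Integration.integrable_bound)
    show "integrable lborel (\<lambda>x. B * w x)" using that by simp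
    show "AE x in lborel. norm (w x * g x) \<le> norm (B * w x)"
    proof (rule AE_I2)
      fix x
      have "\<bar>g x\<bar> \<le> \<bar>B\<bar>" using that(3)[of x] by linarith
      then show "norm (w x * g x) \<le> norm (B * w x)" by (simp add: abs_mult mult.commute mult_right_mono)
    qed
  qed (use that in auto)
  have W: "(\<integral>x. conf x * ?U x * psi \<omega> n c 1 x * \<phi> (tcoord x) \<partial>lborel) = 0"
    if \<phi>: "continuous_on {0..1} \<phi>" for n c and \<phi> :: "real \<Rightarrow> real"
  proof (rule integral_zero_uniform_limit)
    obtain K where K: "\<And>x. \<bar>psi \<omega> n c 1 x\<bar> \<le> K" using psi_bounded by blast
    show w: "integrable lborel (\<lambda>x. conf x * ?U x * psi \<omega> n c 1 x)"
      by (rule bounded_int[OF cU _ K]) simp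
    have bd: "\<exists>B. \<forall>x. \<bar>g (tcoord x)\<bar> \<le> B" if g: "continuous_on {0..1} g" for g :: "real \<Rightarrow> real"
    proof -
      obtain B where "\<And>t. 0 \<le> t \<Longrightarrow> t \<le> 1 \<Longrightarrow> \<bar>g t\<bar> \<le> B" using continuous_unit_bounded[OF g] by blast
      then show ?thesis using tcoord_le_1 by (intro exI[of _ B]) simp
    qed
    have gm: "(\<lambda>x. g (tcoord x)) \<in> borel_measurable borel" if g: "continuous_on {0..1} g" for g :: "real \<Rightarrow> real"
    proof -
      have "continuous_on UNIV tcoord"
        by (intro continuous_at_imp_continuous_on ballI has_derivative_continuous[OF tcoord_has_derivative])
      then have "continuous_on UNIV (\<lambda>x. g (tcoord x))"
        by (rule continuous_on_compose2[OF g]) (auto simp: tcoord_le_1)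
      then show ?thesis by (rule borel_measurable_continuous_onI)
    qed
    have ii: "integrable lborel (\<lambda>x. conf x * ?U x * psi \<omega> n c 1 x * g (tcoord x))" if g: "continuous_on {0..1} g" for g
      using bd[OF g] bounded_int[OF w gm[OF g]] by blast
    show "integrable lborel (\<lambda>x. conf x * ?U x * psi \<omega> n c 1 x * \<phi> (tcoord x))" by (rule ii[OF \<phi>])
    fix e :: real assume "e > 0"
    obtain g where g: "real_polynomial_function g" "\<And>t. t \<in> {0..1} \<Longrightarrow> \<bar>\<phi> t - g t\<bar> < e"
      using Stone_Weierstrass_real_polynomial_function[OF _ \<phi> \<open>e > 0\<close>] compact_Icc by blast
    obtain a N where aN: "g = (\<lambda>t. \<Sum>i\<le>N. a i * t ^ i)" using g(1) unfolding real_polynomial_function_iff_sum by blast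
    define q where "q = (\<Sum>i\<le>N. monom (a i) i)"
    have gq: "g t = poly q t" for t by (simp add: aN q_def poly_sum poly_monom)
    have cg: "continuous_on {0..1} g" unfolding gq[abs_def] by (intro continuous_intros)
    have eq: "conf x * ?U x * psi \<omega> n c 1 x * g (tcoord x) = conf x * (?U x * psi \<omega> n c q x)" for x
      by (simp add: psi_def radial_def gq)
    have "(\<integral>x. conf x * ?U x * psi \<omega> n c 1 x * g (tcoord x) \<partial>lborel) = 0" unfolding eq by (rule orth')
    moreover have "\<forall>x. \<bar>\<phi> (tcoord x) - g (tcoord x)\<bar> \<le> e"
      using g(2) tcoord_le_1 by (intro allI less_imp_le) simp
    ultimately show "\<exists>g'. integrable lborel (\<lambda>x. conf x * ?U x * psi \<omega> n c 1 x * g' x)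
        \<and> (\<integral>x. conf x * ?U x * psi \<omega> n c 1 x * g' x \<partial>lborel) = 0 \<and> (\<forall>x. \<bar>\<phi> (tcoord x) - g' x\<bar> \<le> e)"
      using ii[OF cg] by (intro exI[of _ "\<lambda>x. g (tcoord x)"]) simp
  qed
  \<comment> \<open>One power serves all n: from s <= n + 2 \<omega> one gets \<omega> + 1 + n - a
    >= 1, so a positive power t^b is left over and the coefficient stays continuous at t = 0. The n
    in the exponent comes from zeta = 2 t z.\<close>
  define w where "w x = conf x * ?U x * tcoord x powr (\<omega> + 1)" for x
  have wi: "integrable lborel w"
  proof -
    have "\<bar>tcoord x powr (\<omega> + 1)\<bar> \<le> 1" for x
      using powr_mono2[of "\<omega> + 1" "tcoord x" 1] \<omega> tcoord_le_1[of x] by simp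
    then show ?thesis unfolding w_def by (intro bounded_int[OF cU]) auto
  qed
  have contm: "(\<lambda>x. h (inv_stereo x)) \<in> borel_measurable borel" if "continuous_on S2 h" for h :: "space3 \<Rightarrow> real"
    by (intro borel_measurable_continuous_onI continuous_on_compose2[OF that continuous_inv_stereo])
      (auto simp: inv_stereo_in_S2)
  have hi: "integrable lborel (\<lambda>x. w x * h (inv_stereo x))" if h: "continuous_on S2 h" for h
  proof -
    have "bounded (h ` S2)" by (intro compact_imp_bounded compact_continuous_image h) (simp add: S2_def)
    then obtain B where "\<And>p. p \<in> S2 \<Longrightarrow> \<bar>h p\<bar> \<le> B" unfolding bounded_iff by auto
    then have "\<bar>h (inv_stereo x)\<bar> \<le> B" for x by (simp add: inv_stereo_in_S2)
    then show ?thesis by (rule bounded_int[OF wi contm[OF h]])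
  qed
  have trig0: "(\<integral>x. w x * h (inv_stereo x) \<partial>lborel) = 0" if "trig_poly h" for h
    using that
  proof (induction rule: trig_poly.induct)
    case (gen \<alpha> n)
    define b where "b = \<omega> + 1 + real n - aexp \<omega> n"
    have b: "b > 0" using sexp_facts(5)[OF \<omega>, of n] by (simp add: b_def aexp_def field_simps)
    have cr: "continuous_on {0..1} (\<lambda>t. 2 ^ n * t powr b * Re (\<alpha> t))" and ci: "continuous_on {0..1} (\<lambda>t. 2 ^ n * t powr b * Im (\<alpha> t))"
      using b by (intro continuous_intros continuous_on_powr' gen; auto)+
    have eq: "w x * Re (\<alpha> (tau (inv_stereo x)) * zeta (inv_stereo x) ^ n)
        = conf x * ?U x * psi \<omega> n 1 1 x * (2 ^ n * tcoord x powr b * Re (\<alpha> (tcoord x)))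
        + conf x * ?U x * psi \<omega> n \<i> 1 x * (2 ^ n * tcoord x powr b * Im (\<alpha> (tcoord x)))" for x
    proof -
      let ?t = "tcoord x"
      have "Re (\<alpha> ?t * (of_real (2 * ?t) * cplx x) ^ n) = (2 * ?t) ^ n * Re (\<alpha> ?t * cplx x ^ n)"
      proof -
        have "\<alpha> ?t * (of_real (2 * ?t) * cplx x) ^ n = of_real ((2 * ?t) ^ n) * (\<alpha> ?t * cplx x ^ n)"
          unfolding of_real_power power_mult_distrib[of "of_real (2 * ?t)" "cplx x"] by (simp only: ac_simps)
        moreover have "Re (of_real r * z) = r * Re z" for r z by simp
        ultimately show ?thesis by (simp only:)
      qed
      also have "Re (\<alpha> ?t * cplx x ^ n) = Re (\<alpha> ?t) * hpoly 1 n x + Im (\<alpha> ?t) * hpoly \<i> n x"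
        by (simp add: hpoly_def)
      finally have r: "Re (\<alpha> (tau (inv_stereo x)) * zeta (inv_stereo x) ^ n)
        = (2 * ?t) ^ n * (Re (\<alpha> ?t) * hpoly 1 n x + Im (\<alpha> ?t) * hpoly \<i> n x)"
        unfolding tau_inv_stereo zeta_inv_stereo .
      have "?t powr (\<omega> + 1) * ?t ^ n = ?t powr (\<omega> + 1 + real n)"
        by (simp add: powr_add powr_realpow)
      also have "\<dots> = ?t powr aexp \<omega> n * ?t powr b"
      proof -
        have "\<omega> + 1 + real n = aexp \<omega> n + b" by (simp add: b_def)
        then show ?thesis by (simp only: powr_add)
      qed
      finally have pw: "?t powr (\<omega> + 1) * ?t ^ n = ?t powr aexp \<omega> n * ?t powr b" .
      have "w x * ((2 * ?t) ^ n * (Re (\<alpha> ?t) * hpoly 1 n x + Im (\<alpha> ?t) * hpoly \<i> n x))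
         = conf x * ?U x * 2 ^ n * (?t powr (\<omega> + 1) * ?t ^ n) * (Re (\<alpha> ?t) * hpoly 1 n x + Im (\<alpha> ?t) * hpoly \<i> n x)"
        unfolding w_def power_mult_distrib by (simp only: ac_simps)
      then show ?thesis unfolding r pw psi_def radial_def by (simp add: algebra_simps)
    qed
    have ii: "integrable lborel (\<lambda>x. conf x * ?U x * psi \<omega> n c 1 x * \<phi> (tcoord x))"
      if \<phi>: "continuous_on {0..1} \<phi>" for c and \<phi> :: "real \<Rightarrow> real"
    proof -
      obtain K where K: "\<And>x. \<bar>psi \<omega> n c 1 x\<bar> \<le> K" using psi_bounded by blast
      obtain B where B: "\<And>t. 0 \<le> t \<Longrightarrow> t \<le> 1 \<Longrightarrow> \<bar>\<phi> t\<bar> \<le> B" using continuous_unit_bounded[OF \<phi>] by blast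
      have "continuous_on S2 (\<lambda>p. \<phi> (tau p))"
        by (rule continuous_on_compose2[OF \<phi> continuous_on_tau]) (use S2_facts(1) in auto)
      from contm[OF this] have m: "(\<lambda>x. \<phi> (tcoord x)) \<in> borel_measurable borel" by (simp add: tau_inv_stereo)
      have "\<bar>\<phi> (tcoord x)\<bar> \<le> B" for x by (intro B tcoord_le_1) simp
      then show ?thesis by (rule bounded_int[OF bounded_int[OF cU psi_measurable K] m])
    qed
    show ?case
      unfolding eq Bochner_Integration.integral_add[OF ii[OF cr] ii[OF ci]] W[OF cr] W[OF ci] by simp
  next
    case (add f g)
    then show ?case using hi[OF trig_poly_continuous[OF add(1)]] hi[OF trig_poly_continuous[OF add(2)]]
      by (simp add: distrib_left)
  next
    case (cong f g)
    then show ?case by (simp add: inv_stereo_in_S2)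
  qed
  have cont0: "(\<integral>x. w x * h (inv_stereo x) \<partial>lborel) = 0" if h: "continuous_on S2 h" for h
  proof (rule integral_zero_uniform_limit[OF wi hi[OF h]])
    fix e :: real assume "e > 0"
    then obtain g where g: "trig_poly g" "\<And>p. p \<in> S2 \<Longrightarrow> \<bar>h p - g p\<bar> < e" using trig_poly_dense[OF h] by blast
    then show "\<exists>g'. integrable lborel (\<lambda>x. w x * g' x) \<and> (\<integral>x. w x * g' x \<partial>lborel) = 0 \<and> (\<forall>x. \<bar>h (inv_stereo x) - g' x\<bar> \<le> e)"
      using hi[OF trig_poly_continuous[OF g(1)]] trig0[OF g(1)]
      by (intro exI[of _ "\<lambda>x. g (inv_stereo x)"]) (auto simp: inv_stereo_in_S2 less_imp_le)
  qed
  have wm[measurable]: "w \<in> borel_measurable borel" unfolding w_def by measurable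
  have inj: "inv_stereo x = inv_stereo y \<Longrightarrow> x = y" for x y by (metis stereo_inv_stereo)
  have cbox0: "(\<integral>x. w x * indicator (cbox a b) x \<partial>lborel) = 0" for a b :: plane
  proof (cases "cbox a b = {}")
    case False
    let ?C = "inv_stereo ` cbox a b"
    have C: "compact ?C" "?C \<noteq> {}" using False by (auto intro!: compact_continuous_image continuous_inv_stereo)
    \<comment> \<open>Continuous functions on the sphere that decrease to the indicator of the
      compact image of the box.\<close>
    define h where "h k p = max 0 (1 - real k * infdist p ?C)" for k p
    have hc: "continuous_on S2 (h k)" for k
      unfolding h_def[abs_def] by (intro continuous_intros)
    have "(\<lambda>k. \<integral>x. w x * h k (inv_stereo x) \<partial>lborel) \<longlonglongrightarrow> (\<integral>x. w x * indicator (cbox a b) x \<partial>lborel)"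
    proof (rule integral_dominated_convergence[where w = "\<lambda>x. norm (w x)"])
      show "AE x in lborel. (\<lambda>k. w x * h k (inv_stereo x)) \<longlonglongrightarrow> w x * indicator (cbox a b) x"
      proof (rule AE_I2)
        fix x :: plane
        have "(\<lambda>k. h k (inv_stereo x)) \<longlonglongrightarrow> indicator (cbox a b) x"
        proof (cases "x \<in> cbox a b")
          case True
          then have "infdist (inv_stereo x) ?C = 0" by (intro infdist_zero) auto
          then show ?thesis using True by (simp add: h_def)
        next
          case False
          then have "inv_stereo x \<notin> ?C" using inj by blast
          then have d: "infdist (inv_stereo x) ?C > 0"
            using in_closed_iff_infdist_zero[OF compact_imp_closed[OF C(1)] C(2)] infdist_nonneg by (metis less_le)
          obtain N :: nat where N: "1 / infdist (inv_stereo x) ?C < real N" using reals_Archimedean2 by blast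
          have "h k (inv_stereo x) = 0" if "k \<ge> N" for k
          proof -
            have "1 / infdist (inv_stereo x) ?C < real k" using N that by linarith
            then have "1 \<le> real k * infdist (inv_stereo x) ?C" using d by (simp add: field_simps)
            then show ?thesis by (simp add: h_def)
          qed
          then show ?thesis using False by (intro tendsto_eventually) (auto simp: eventually_sequentially)
        qed
        then show "(\<lambda>k. w x * h k (inv_stereo x)) \<longlonglongrightarrow> w x * indicator (cbox a b) x"
          by (intro tendsto_mult tendsto_const)
      qed
      show "AE x in lborel. norm (w x * h k (inv_stereo x)) \<le> norm (w x)" for k
        by (intro AE_I2) (auto simp: h_def abs_mult infdist_nonneg intro!: mult_left_le)
      show "(\<lambda>x. w x * h k (inv_stereo x)) \<in> borel_measurable lborel" for k
        using contm[OF hc[of k]] by simp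
    qed (use wi in auto)
    then show ?thesis by (simp add: cont0[OF hc] LIMSEQ_const_iff)
  qed simp
  have "AE x in lborel. w x = 0"
  proof (rule AE_zero_if_zero_on_boxes)
    show "locally_integrable w"
      unfolding locally_integrable_def set_integrable_def
      using integrable_mult_indicator[OF _ wi] borel_compact by auto
    fix a b :: plane
    have "cbox a b - box a b \<in> null_sets lebesgue"
      using negligible_frontier_interval negligible_iff_null_sets by blast
    then have "cbox a b - box a b \<in> null_sets lborel"
      by (simp add: null_sets_completion_iff)
    then have "AE x in lborel. x \<notin> cbox a b - box a b" by (rule AE_not_in)
    then have "AE x in lborel. indicator (box a b) x * w x = w x * indicator (cbox a b) x"
    proof eventually_elim
      case (elim x)
      then show ?case using box_subset_cbox[of a b] by (auto simp: indicator_def)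
    qed
    then have "(\<integral>x. indicator (box a b) x * w x \<partial>lborel) = (\<integral>x. w x * indicator (cbox a b) x \<partial>lborel)"
      by (rule integral_cong_AE[rotated -1]) auto
    then show "(\<integral>x. indicator (box a b) x * w x \<partial>lborel) = 0" by (simp add: cbox0)
  qed
  then have "AE x in lborel. fun_of f (inv_stereo x) = 0"
    by eventually_elim (simp add: w_def)
  then have "AE p in dV. fun_of f p = 0"
    by (intro AE_dV_eqI fun_of_measurable) auto
  then have "class_of (fun_of f) = class_of (\<lambda>p. 0)"
    using class_of_eq[OF fun_of_square_integrable square_integrable_zero, of f] by blast
  then show ?thesis by (simp add: zero_class_of)
qed

section \<open>The basis of eigenvectors\<close>

instance L2S2 :: banach ..

lemma psi_fun_add: "psi_fun \<omega> n c (p + q) x = psi_fun \<omega> n c p x + psi_fun \<omega> n c q x"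
  by (simp add: psi_fun_def psi_def radial_def algebra_simps)

lemma psi_fun_smult: "psi_fun \<omega> n c (smult k q) x = k * psi_fun \<omega> n c q x"
  by (simp add: psi_fun_def psi_def radial_def)

lemma psi_fun_Complex:
  "psi_fun \<omega> n (Complex a (- b)) q x = a * psi_fun \<omega> n 1 q x + b * psi_fun \<omega> n (- \<i>) q x"
  by (simp add: psi_fun_def psi_def hpoly_def algebra_simps)

definition psi_vec :: "real \<Rightarrow> nat \<Rightarrow> complex \<Rightarrow> real poly \<Rightarrow> L2S2" where
  "psi_vec \<omega> n c q = class_of (psi_fun \<omega> n c q)"

lemma psi_vec_add: "psi_vec \<omega> n c (p + q) = psi_vec \<omega> n c p + psi_vec \<omega> n c q"
  unfolding psi_vec_def plus_class_of[OF psi_fun_square_integrable psi_fun_square_integrable]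
  by (simp only: psi_fun_add[symmetric])

lemma psi_vec_smult: "psi_vec \<omega> n c (smult k q) = k *\<^sub>R psi_vec \<omega> n c q"
  unfolding psi_vec_def scaleR_class_of[OF psi_fun_square_integrable]
  by (simp only: psi_fun_smult[symmetric])

lemma psi_vec_Complex: "psi_vec \<omega> n (Complex a (- b)) q = a *\<^sub>R psi_vec \<omega> n 1 q + b *\<^sub>R psi_vec \<omega> n (- \<i>) q"
  unfolding psi_vec_def scaleR_class_of[OF psi_fun_square_integrable]
    plus_class_of[OF square_integrable_scale[OF psi_fun_square_integrable] square_integrable_scale[OF psi_fun_square_integrable]]
  by (simp only: psi_fun_Complex[symmetric])

lemma lam_strict_mono: "m < m' \<Longrightarrow> lam \<omega> m n < lam \<omega> m' n"
  using sexp_facts(3)[of \<omega> n]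
  by (simp add: lam_eq add_less_le_mono mult_strict_mono mult_right_mono)

text \<open>s >= n makes the base of the square at least m + n + 1/2. This crude bound is enough to
  leave finitely many pairs below any level.\<close>

lemma lam_lower: "real m + real n - \<omega>\<^sup>2 \<le> lam \<omega> m n"
proof -
  let ?y = "real m + real n"
  have "(?y + 1 / 2)\<^sup>2 \<le> (real m + (real n + 1 + sexp \<omega> n) / 2)\<^sup>2"
    using sexp_facts(2)[of n \<omega>] by (intro power_mono) auto
  then have "?y * ?y + ?y - \<omega>\<^sup>2 \<le> lam \<omega> m n"
    unfolding lam_def sexp_def[symmetric] by (simp add: power2_eq_square algebra_simps)
  moreover have "0 \<le> ?y * ?y" by simp
  ultimately show ?thesis by linarith
qed

text \<open>A continuous function that vanishes almost everywhere vanishes everywhere; along a ray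
  on which the angular factor is nonzero, t runs through (0, 1) and forces q to have infinitely many
  roots.\<close>

lemma psi_eq_0_imp:
  assumes zero: "psi_vec \<omega> n c q = 0" and c: "cmod c = 1" and n: "n > 0 \<or> Re c \<noteq> 0"
  shows "q = 0"
proof (rule ccontr)
  assume q: "q \<noteq> 0"
  have "psi_vec \<omega> n c q \<bullet> psi_vec \<omega> n c q = (\<integral>x. conf x * (psi \<omega> n c q x * psi \<omega> n c q x) \<partial>lborel)"
    unfolding psi_vec_def inner_class_of[OF psi_fun_square_integrable psi_fun_square_integrable]
    by (subst integral_dV(2)[OF borel_measurable_times[OF psi_fun_measurable psi_fun_measurable]]) (simp add: psi_fun_def)
  then have "(\<integral>x. conf x * (psi \<omega> n c q x)\<^sup>2 \<partial>lborel) = 0" using zero by (simp add: power2_eq_square)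
  then have "AE x in lborel. conf x * (psi \<omega> n c q x)\<^sup>2 = 0"
    using integral_nonneg_eq_0_iff_AE[OF psi_square_integrable] by simp
  then have ae: "AE x in lebesgue. x \<in> {x. psi \<omega> n c q x = 0}"
    by (intro AE_completion) (auto elim: AE_mp)
  have "closed {x. psi \<omega> n c q x = 0}"
    by (intro closed_Collect_eq smooth_continuous smooth_psi continuous_intros)
  from mem_closed_if_AE_lebesgue[OF this ae] have z: "psi \<omega> n c q x = 0" for x by simp
  obtain w where w: "Re (c * w ^ n) \<noteq> 0" "w \<noteq> 0"
  proof (cases "n = 0")
    case True
    then show ?thesis using n that[of 1] by simp
  next
    case False
    \<comment> \<open>The direction of a crest of the angular factor, where c w^n = 1.\<close>
    define w where "w = cis (- Arg c / real n)"
    have "c = cis (Arg c)" using rcis_cmod_Arg[of c] c by (simp add: rcis_def)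
    moreover have "w ^ n = cis (- Arg c)" using False by (simp add: w_def Complex.DeMoivre)
    ultimately have "c * w ^ n = 1" by (metis add.right_inverse cis_mult cis_zero)
    then show ?thesis using that[of w] by (simp add: w_def)
  qed
  have "poly q t = 0" if t: "t \<in> {0<..<1}" for t
  proof -
    \<comment> \<open>Chosen so that the point r w has |x|^2 = 1/t - 1, hence coordinate t.\<close>
    define r where "r = sqrt (1 / t - 1) / cmod w"
    have r: "r > 0" using t w(2) by (simp add: r_def field_simps)
    define x where "x = (r * Re w, r * Im w)"
    have cx: "cplx x = of_real r * w" by (simp add: x_def cplx_def complex_eq_iff)
    have "norm x = r * cmod w" using r unfolding norm_cplx[symmetric] cx by (simp add: norm_mult)
    then have "(norm x)\<^sup>2 = 1 / t - 1" using w(2) t by (simp add: r_def field_simps)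
    then have tx: "tcoord x = t" by (simp add: tcoord_def)
    have "hpoly c n x = r ^ n * Re (c * w ^ n)"
    proof -
      have "c * (of_real r * w) ^ n = of_real (r ^ n) * (c * w ^ n)"
        unfolding of_real_power power_mult_distrib by (simp only: ac_simps)
      moreover have "Re (of_real u * v) = u * Re v" for u v by simp
      ultimately show ?thesis unfolding hpoly_def cx by (simp only:)
    qed
    then show ?thesis using z[of x] r w(1) t by (simp add: psi_def radial_def tx)
  qed
  then have "{0<..<1} \<subseteq> {t. poly q t = 0}" by auto
  then have "finite {0<..<1::real}" using poly_roots_finite[OF q] finite_subset by blast
  then show False using infinite_Ioo[of 0 "1::real"] by simp
qed

text \<open>The eigenvectors are enumerated by \<open>(m, n)\<close> and the choice between \<open>cos(n\<theta>)\<close> and \<open>sin(n\<theta>)\<close>;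
  for \<open>n = 0\<close> the latter yields the zero vector.\<close>

definition ix_m :: "nat \<Rightarrow> nat" where "ix_m k = fst (prod_decode k)"
definition ix_n :: "nat \<Rightarrow> nat" where "ix_n k = snd (prod_decode k) div 2"
definition ix_s :: "nat \<Rightarrow> bool" where "ix_s k = odd (snd (prod_decode k))"
definition ix :: "nat \<Rightarrow> nat \<Rightarrow> bool \<Rightarrow> nat" where
  "ix m n s = prod_encode (m, 2 * n + (if s then 1 else 0))"

lemma ix_simps [simp]: "ix_m (ix m n s) = m" "ix_n (ix m n s) = n" "ix_s (ix m n s) = s"
  by (auto simp: ix_def ix_m_def ix_n_def ix_s_def)

lemma ix_collapse [simp]: "ix (ix_m k) (ix_n k) (ix_s k) = k"
proof -
  have "2 * (j div 2) + (if odd j then 1 else 0) = j" for j :: nat by (cases "even j") auto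
  then show ?thesis by (simp add: ix_def ix_m_def ix_n_def ix_s_def)
qed

text \<open>The real part of z^n is the cosine mode and that of -\<i> z^n the sine mode.\<close>

definition phase :: "bool \<Rightarrow> complex" where "phase s = (if s then - \<i> else 1)"

lemma phase_facts: "cmod (phase s) = 1" "s \<noteq> s' \<Longrightarrow> Re (phase s * cnj (phase s')) = 0"
  "Re (phase s) \<noteq> 0 \<longleftrightarrow> \<not> s"
  by (auto simp: phase_def)

text \<open>The normalization is put into the polynomial so that the unit vectors keep the form
  \<open>psi_vec\<close>; for the zero vector the factor is 0 by convention.\<close>

definition eig_poly :: "real \<Rightarrow> nat \<Rightarrow> real poly" where
  "eig_poly \<omega> k = smult (inverse (norm (psi_vec \<omega> (ix_n k) (phase (ix_s k)) (hyper_poly \<omega> (ix_m k) (ix_n k)))))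
     (hyper_poly \<omega> (ix_m k) (ix_n k))"

definition eig_vec :: "real \<Rightarrow> nat \<Rightarrow> L2S2" where
  "eig_vec \<omega> k = psi_vec \<omega> (ix_n k) (phase (ix_s k)) (eig_poly \<omega> k)"

definition eig_val :: "real \<Rightarrow> nat \<Rightarrow> real" where
  "eig_val \<omega> k = lam \<omega> (ix_m k) (ix_n k)"

lemma eig_vec_sgn: "eig_vec \<omega> k = sgn (psi_vec \<omega> (ix_n k) (phase (ix_s k)) (hyper_poly \<omega> (ix_m k) (ix_n k)))"
  by (simp add: eig_vec_def eig_poly_def psi_vec_smult sgn_div_norm)

lemma eig_vec_eq_0: "eig_vec \<omega> k = 0 \<longleftrightarrow> ix_s k \<and> ix_n k = 0"
proof
  assume "eig_vec \<omega> k = 0"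
  then have z: "psi_vec \<omega> (ix_n k) (phase (ix_s k)) (hyper_poly \<omega> (ix_m k) (ix_n k)) = 0"
    by (simp add: eig_vec_sgn sgn_zero_iff)
  have "hyper_poly \<omega> (ix_m k) (ix_n k) \<noteq> 0"
    using coeff_hyper_poly[of \<omega> "ix_m k" "ix_n k"] by auto
  then show "ix_s k \<and> ix_n k = 0"
    using psi_eq_0_imp[OF z phase_facts(1)] phase_facts(3)[of "ix_s k"] by (metis neq0_conv)
next
  assume "ix_s k \<and> ix_n k = 0"
  then have "psi_fun \<omega> (ix_n k) (phase (ix_s k)) q = (\<lambda>p. 0)" for q
    by (simp add: fun_eq_iff psi_fun_def psi_def hpoly_def phase_def)
  then show "eig_vec \<omega> k = 0" by (simp add: eig_vec_def psi_vec_def zero_class_of)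
qed

lemma hyper_op_eig_poly: "hyper_op \<omega> (ix_n k) (eig_poly \<omega> k) = smult (eig_val \<omega> k) (eig_poly \<omega> k)"
  by (simp add: eig_poly_def eig_val_def hyper_op_smult hyper_op_hyper_poly mult.commute)

lemma eig_vec_E_form: "\<omega> \<ge> 0 \<Longrightarrow> eig_vec \<omega> k \<in> E_form \<omega>"
  by (simp add: eig_vec_def psi_vec_def psi_fun_E_form)

lemma Q_form_eig_vec:
  assumes "\<omega> \<ge> 0" "f \<in> E_form \<omega>"
  shows "Q_form \<omega> f (eig_vec \<omega> k) = eig_val \<omega> k * (f \<bullet> eig_vec \<omega> k)"
  using Q_form_psi[OF assms, of "ix_n k" "phase (ix_s k)" "eig_poly \<omega> k"]
  unfolding hyper_op_eig_poly by (simp add: eig_vec_def psi_vec_def[symmetric] psi_vec_smult)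

lemma eig_vec_orthogonal:
  assumes \<omega>: "\<omega> \<ge> 0" and ij: "i \<noteq> j"
  shows "eig_vec \<omega> i \<bullet> eig_vec \<omega> j = 0"
proof (cases "ix_n i \<noteq> ix_n j \<or> (ix_n i > 0 \<and> ix_s i \<noteq> ix_s j)")
  case True
  then show ?thesis
    unfolding eig_vec_def psi_vec_def using phase_facts(2) by (intro psi_angular_orthogonal) auto
next
  case False
  show ?thesis
  proof (cases "ix_s i = ix_s j")
    case True
    have n: "ix_n i = ix_n j" using False by blast
    have "ix_m i \<noteq> ix_m j"
    proof
      assume "ix_m i = ix_m j"
      then have "ix (ix_m i) (ix_n i) (ix_s i) = ix (ix_m j) (ix_n j) (ix_s j)" using n True by (simp only:)
      then show False using ij by simp
    qed
    then have "eig_val \<omega> i \<noteq> eig_val \<omega> j"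
      using n lam_strict_mono[of "ix_m i" "ix_m j" \<omega> "ix_n j"] lam_strict_mono[of "ix_m j" "ix_m i" \<omega> "ix_n j"]
      by (auto simp: eig_val_def neq_iff)
    moreover have "eig_val \<omega> i * (eig_vec \<omega> j \<bullet> eig_vec \<omega> i) = eig_val \<omega> j * (eig_vec \<omega> i \<bullet> eig_vec \<omega> j)"
      using Q_form_eig_vec[OF \<omega> eig_vec_E_form[OF \<omega>], of j i] Q_form_eig_vec[OF \<omega> eig_vec_E_form[OF \<omega>], of i j]
      by (simp add: Q_form_commute[of \<omega> "eig_vec \<omega> j"])
    ultimately show ?thesis by (simp add: inner_commute)
  next
    case neq: False
    \<comment> \<open>The remaining case is n = 0 with different phases, where the sine vector is
      0.\<close>
    then have "eig_vec \<omega> i = 0 \<or> eig_vec \<omega> j = 0" using False by (auto simp: eig_vec_eq_0)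
    then show ?thesis by auto
  qed
qed

lemma eig_vec_total:
  assumes \<omega>: "\<omega> \<ge> 0" and z: "\<And>k. f \<bullet> eig_vec \<omega> k = 0"
  shows "f = 0"
proof (rule psi_fun_total[OF \<omega>])
  fix n c q
  have "f \<bullet> psi_vec \<omega> n (phase s) (hyper_poly \<omega> m n) = 0" for m s
    using z[of "ix m n s"] by (auto simp: eig_vec_sgn sgn_div_norm)
  then have p: "f \<bullet> psi_vec \<omega> n (phase s) q = 0" for s
    by (intro hyper_poly_functional_zero[of "\<lambda>q. f \<bullet> psi_vec \<omega> n (phase s) q" \<omega> n q])
      (auto simp: psi_vec_add psi_vec_smult inner_add_right)
  have "psi_vec \<omega> n c q = Re c *\<^sub>R psi_vec \<omega> n (phase False) q + (- Im c) *\<^sub>R psi_vec \<omega> n (phase True) q"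
    using psi_vec_Complex[of \<omega> n "Re c" "- Im c" q] by (simp add: phase_def)
  then have "f \<bullet> psi_vec \<omega> n c q = 0" by (simp only: inner_add_right inner_scaleR_right p)
  then show "f \<bullet> class_of (psi_fun \<omega> n c q) = 0" by (simp add: psi_vec_def)
qed

lemma orthonormal_eig_vec: "\<omega> \<ge> 0 \<Longrightarrow> orthonormal_system (eig_vec \<omega>)"
proof
  show "eig_vec \<omega> i = 0 \<or> norm (eig_vec \<omega> i) = 1" for i
    by (simp add: eig_vec_sgn norm_sgn sgn_zero_iff)
qed (use eig_vec_orthogonal eig_vec_total in auto)

section \<open>Closedness of the form\<close>

text \<open>A finite combination as a function and not only as a class, so that an explicit weak
  gradient in each chart accompanies it.\<close>

definition comb :: "real \<Rightarrow> (nat \<Rightarrow> real) \<Rightarrow> nat set \<Rightarrow> space3 \<Rightarrow> real" where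
  "comb \<omega> a F p = (\<Sum>k\<in>F. a k * psi_fun \<omega> (ix_n k) (phase (ix_s k)) (eig_poly \<omega> k) p)"

definition grad_comb :: "real \<Rightarrow> (nat \<Rightarrow> real) \<Rightarrow> nat set \<Rightarrow> plane \<Rightarrow> plane" where
  "grad_comb \<omega> a F x = (\<Sum>k\<in>F. a k *\<^sub>R grad_psi \<omega> (ix_n k) (phase (ix_s k)) (eig_poly \<omega> k) x)"

lemma comb_square_integrable: "finite F \<Longrightarrow> square_integrable (comb \<omega> a F)"
  and class_of_comb: "finite F \<Longrightarrow> class_of (comb \<omega> a F) = (\<Sum>k\<in>F. a k *\<^sub>R eig_vec \<omega> k)"
  unfolding comb_def[abs_def] eig_vec_def psi_vec_def
  by (simp_all add: sum_class_of psi_fun_square_integrable)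

lemma grad_comb_measurable [measurable]: "grad_comb \<omega> a F \<in> borel_measurable borel"
  unfolding grad_comb_def[abs_def] by measurable

lemma comb_chart_measurable: "(\<lambda>x. comb \<omega> a F (inv_stereo x)) \<in> borel_measurable borel"
  unfolding comb_def by (simp add: psi_fun_def) measurable

lemma L2_sum_integrable:
  fixes g :: "nat \<Rightarrow> plane \<Rightarrow> 'b::euclidean_space"
  assumes "finite F" and [measurable]: "\<And>k. g k \<in> borel_measurable borel" "w \<in> borel_measurable borel"
    and w: "\<And>x. w x \<ge> (0::real)" and int: "\<And>k. integrable lborel (\<lambda>x. w x * (norm (g k x))\<^sup>2)"
  shows "integrable lborel (\<lambda>x. w x * (norm (\<Sum>k\<in>F. a k *\<^sub>R g k x))\<^sup>2)"
  using assms(1)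
proof (induction F)
  case (insert k F)
  show ?case
  proof (rule Bochner_Integration.integrable_bound)
    show "integrable lborel (\<lambda>x. 2 * (a k)\<^sup>2 * (w x * (norm (g k x))\<^sup>2) + 2 * (w x * (norm (\<Sum>k\<in>F. a k *\<^sub>R g k x))\<^sup>2))"
      using insert.IH int by simp
    show "AE x in lborel. norm (w x * (norm (\<Sum>k\<in>insert k F. a k *\<^sub>R g k x))\<^sup>2)
        \<le> norm (2 * (a k)\<^sup>2 * (w x * (norm (g k x))\<^sup>2) + 2 * (w x * (norm (\<Sum>k\<in>F. a k *\<^sub>R g k x))\<^sup>2))"
    proof (rule AE_I2)
      fix x
      have "(norm (\<Sum>k\<in>insert k F. a k *\<^sub>R g k x))\<^sup>2 \<le> 2 * (norm (a k *\<^sub>R g k x))\<^sup>2 + 2 * (norm (\<Sum>k\<in>F. a k *\<^sub>R g k x))\<^sup>2"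
        unfolding sum.insert[OF insert.hyps] by (rule norm_add_square_le)
      from mult_left_mono[OF this w[of x]]
      show "norm (w x * (norm (\<Sum>k\<in>insert k F. a k *\<^sub>R g k x))\<^sup>2)
        \<le> norm (2 * (a k)\<^sup>2 * (w x * (norm (g k x))\<^sup>2) + 2 * (w x * (norm (\<Sum>k\<in>F. a k *\<^sub>R g k x))\<^sup>2))"
        using w[of x] by (simp add: power_mult_distrib algebra_simps)
    qed
  qed measurable
qed simp

lemma comb_integrable:
  assumes \<omega>: "\<omega> \<ge> 0" and F: "finite F"
  shows "integrable lborel (\<lambda>x. (norm (grad_comb \<omega> a F x))\<^sup>2)"
    and "integrable lborel (\<lambda>x. potential \<omega> x * (comb \<omega> a F (inv_stereo x))\<^sup>2)"
    and "integrable lborel (\<lambda>x. conf x * (comb \<omega> a F (inv_stereo x))\<^sup>2)"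
proof -
  show "integrable lborel (\<lambda>x. (norm (grad_comb \<omega> a F x))\<^sup>2)"
    using L2_sum_integrable[OF F, of "\<lambda>k. grad_psi \<omega> (ix_n k) (phase (ix_s k)) (eig_poly \<omega> k)" "\<lambda>x. 1" a]
      grad_psi_square_integrable[OF \<omega>] by (simp add: grad_comb_def)
  show "integrable lborel (\<lambda>x. potential \<omega> x * (comb \<omega> a F (inv_stereo x))\<^sup>2)"
    using L2_sum_integrable[OF F, of "\<lambda>k. psi \<omega> (ix_n k) (phase (ix_s k)) (eig_poly \<omega> k)" "potential \<omega>" a]
      psi_potential_integrable[OF \<omega>] by (simp add: comb_def psi_fun_def)
  show "integrable lborel (\<lambda>x. conf x * (comb \<omega> a F (inv_stereo x))\<^sup>2)"
    using L2_sum_integrable[OF F, of "\<lambda>k. psi \<omega> (ix_n k) (phase (ix_s k)) (eig_poly \<omega> k)" conf a]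
      psi_square_integrable by (simp add: comb_def psi_fun_def)
qed

lemma comb_chart1:
  "\<omega> \<ge> 0 \<Longrightarrow> finite F \<Longrightarrow> has_weak_gradient (\<lambda>x. comb \<omega> a F (inv_stereo x)) (grad_comb \<omega> a F)"
  unfolding comb_def grad_comb_def[abs_def] by (intro has_weak_gradient_sum psi_fun_chart1)

lemma comb_chart2:
  assumes "\<omega> \<ge> 0" "finite F"
  shows "has_weak_gradient (\<lambda>x. comb \<omega> a F (inv_stereo' x)) (\<lambda>x. inversion' x (grad_comb \<omega> a F (inversion x)))"
proof -
  have "has_weak_gradient (\<lambda>x. comb \<omega> a F (inv_stereo' x))
     (\<lambda>x. \<Sum>k\<in>F. a k *\<^sub>R grad_psi' \<omega> (ix_n k) (phase (ix_s k)) (eig_poly \<omega> k) x)"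
    unfolding comb_def using assms by (intro has_weak_gradient_sum psi_fun_chart2)
  then show ?thesis
    by (simp add: grad_comb_def grad_psi'_def linear_sum[OF inversion'_linear] linear_scale[OF inversion'_linear])
qed

lemma comb_E_form:
  assumes "\<omega> \<ge> 0" "finite F"
  shows "class_of (comb \<omega> a F) \<in> E_form \<omega>"
    and "AE x in lborel. weak_differential (fun_of (class_of (comb \<omega> a F))) x = grad_comb \<omega> a F x"
  using E_formI[OF comb_square_integrable comb_chart1 comb_chart2 comb_integrable(1,2)] assms by blast+

lemma Q_form_comb_eq:
  assumes \<omega>: "\<omega> \<ge> 0" and f: "f \<in> E_form \<omega>" and F: "finite F"
  shows "Q_form \<omega> f (class_of (comb \<omega> a F))
    = (\<integral>x. weak_differential (fun_of f) x \<bullet> grad_comb \<omega> a F x \<partial>lborel)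
      + (\<integral>x. potential \<omega> x * (fun_of f (inv_stereo x) * comb \<omega> a F (inv_stereo x)) \<partial>lborel)"
proof -
  note e = comb_E_form[OF \<omega> F, of a]
  note [measurable] = E_formD(2)[OF e(1)] E_formD(2)[OF f] comb_chart_measurable measurable_chart(1)[OF fun_of_measurable[of f]]
    measurable_chart(1)[OF fun_of_measurable[of "class_of (comb \<omega> a F)"]]
  have "(\<integral>x. weak_differential (fun_of f) x \<bullet> weak_differential (fun_of (class_of (comb \<omega> a F))) x \<partial>lborel)
      = (\<integral>x. weak_differential (fun_of f) x \<bullet> grad_comb \<omega> a F x \<partial>lborel)"
    by (rule integral_cong_AE) (use e(2) in \<open>auto elim: AE_mp\<close>)
  moreover have "(\<integral>x. potential \<omega> x * (fun_of f (inv_stereo x) * fun_of (class_of (comb \<omega> a F)) (inv_stereo x)) \<partial>lborel)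
      = (\<integral>x. potential \<omega> x * (fun_of f (inv_stereo x) * comb \<omega> a F (inv_stereo x)) \<partial>lborel)"
    by (rule integral_cong_AE)
      (use AE_dV_charts(1)[OF fun_of_class_of[OF comb_square_integrable[OF F, of \<omega> a]]] in \<open>auto elim: AE_mp\<close>)
  ultimately show ?thesis by (simp add: Q_form_eq[OF f e(1)])
qed

text \<open>Linearity in the second argument passes through the explicit gradients, because the
  chosen weak differential of a sum is only almost everywhere the sum of the chosen ones.\<close>

lemma Q_form_comb:
  assumes \<omega>: "\<omega> \<ge> 0" and f: "f \<in> E_form \<omega>" and F: "finite F"
  shows "Q_form \<omega> f (class_of (comb \<omega> a F)) = (\<Sum>k\<in>F. a k * (eig_val \<omega> k * (f \<bullet> eig_vec \<omega> k)))"
proof -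
  let ?G = "weak_differential (fun_of f)" and ?U = "\<lambda>x. fun_of f (inv_stereo x)"
  let ?g = "\<lambda>k. grad_psi \<omega> (ix_n k) (phase (ix_s k)) (eig_poly \<omega> k)"
  let ?p = "\<lambda>k. psi \<omega> (ix_n k) (phase (ix_s k)) (eig_poly \<omega> k)"
  note fE = E_formD[OF f]
  have Um: "?U \<in> borel_measurable borel" by (rule measurable_chart(1)[OF fun_of_measurable])
  have i1: "integrable lborel (\<lambda>x. ?G x \<bullet> ?g k x)" for k
    using fE grad_psi_square_integrable[OF \<omega>] by (intro inner_mult_integrable) auto
  have i2: "integrable lborel (\<lambda>x. potential \<omega> x * (?U x * ?p k x))" for k
    using fE Um psi_potential_integrable[OF \<omega>] by (intro weighted_mult_integrable) auto
  have single: "(\<integral>x. ?G x \<bullet> ?g k x \<partial>lborel) + (\<integral>x. potential \<omega> x * (?U x * ?p k x) \<partial>lborel) = eig_val \<omega> k * (f \<bullet> eig_vec \<omega> k)" for k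
  proof -
    \<comment> \<open>A singleton combination expresses the eigenvector identity through the same
      explicit integrals.\<close>
    have c: "class_of (comb \<omega> (\<lambda>_. 1) {k}) = eig_vec \<omega> k" by (simp add: class_of_comb)
    show ?thesis
      using Q_form_comb_eq[OF \<omega> f, of "{k}" "\<lambda>_. 1"] Q_form_eig_vec[OF \<omega> f, of k]
      unfolding c by (simp add: comb_def grad_comb_def psi_fun_def)
  qed
  have "Q_form \<omega> f (class_of (comb \<omega> a F))
      = (\<integral>x. (\<Sum>k\<in>F. a k * (?G x \<bullet> ?g k x)) \<partial>lborel) + (\<integral>x. (\<Sum>k\<in>F. a k * (potential \<omega> x * (?U x * ?p k x))) \<partial>lborel)"
    unfolding Q_form_comb_eq[OF \<omega> f F] grad_comb_def comb_def
    by (simp add: inner_sum_right psi_fun_def sum_distrib_left mult.left_commute)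
  also have "\<dots> = (\<Sum>k\<in>F. a k * ((\<integral>x. ?G x \<bullet> ?g k x \<partial>lborel) + (\<integral>x. potential \<omega> x * (?U x * ?p k x) \<partial>lborel)))"
    using i1 i2 by (simp add: Bochner_Integration.integral_sum sum.distrib[symmetric] distrib_left)
  finally show ?thesis unfolding single .
qed

text \<open>The eigenvectors diagonalize the form and the inner product at once, so no cross terms
  remain. This makes energy Cauchy sequences a matter of summability.\<close>

lemma comb_energy:
  assumes \<omega>: "\<omega> \<ge> 0" and F: "finite F" and 0: "\<And>k. eig_vec \<omega> k = 0 \<Longrightarrow> a k = 0"
  shows "(\<integral>x. (norm (grad_comb \<omega> a F x))\<^sup>2 \<partial>lborel) + (\<integral>x. potential \<omega> x * (comb \<omega> a F (inv_stereo x))\<^sup>2 \<partial>lborel)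
      = (\<Sum>k\<in>F. eig_val \<omega> k * (a k)\<^sup>2)"
    and "(\<integral>x. conf x * (comb \<omega> a F (inv_stereo x))\<^sup>2 \<partial>lborel) = (\<Sum>k\<in>F. (a k)\<^sup>2)"
proof -
  interpret orthonormal_system "eig_vec \<omega>" by (rule orthonormal_eig_vec[OF \<omega>])
  let ?S = "class_of (comb \<omega> a F)"
  note e = comb_E_form[OF \<omega> F, of a]
  note [measurable] = E_formD(2)[OF e(1)] comb_chart_measurable measurable_chart(1)[OF fun_of_measurable[of ?S]]
  have inn: "?S \<bullet> eig_vec \<omega> k = (if k \<in> F then a k else 0)" for k
    unfolding class_of_comb[OF F] by (rule sum_inner[OF F 0])
  have "Q_form \<omega> ?S ?S = (\<Sum>k\<in>F. eig_val \<omega> k * (a k)\<^sup>2)"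
    unfolding Q_form_comb[OF \<omega> e(1) F] by (rule sum.cong) (simp_all add: inn power2_eq_square)
  moreover have "(\<integral>x. weak_differential (fun_of ?S) x \<bullet> grad_comb \<omega> a F x \<partial>lborel) = (\<integral>x. (norm (grad_comb \<omega> a F x))\<^sup>2 \<partial>lborel)"
    by (rule integral_cong_AE) (use e(2) in \<open>auto simp: power2_norm_eq_inner elim: AE_mp\<close>)
  moreover have "(\<integral>x. potential \<omega> x * (fun_of ?S (inv_stereo x) * comb \<omega> a F (inv_stereo x)) \<partial>lborel)
      = (\<integral>x. potential \<omega> x * (comb \<omega> a F (inv_stereo x))\<^sup>2 \<partial>lborel)"
    by (rule integral_cong_AE)
      (use AE_dV_charts(1)[OF fun_of_class_of[OF comb_square_integrable[OF F, of \<omega> a]]] in \<open>auto simp: power2_eq_square elim: AE_mp\<close>)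
  ultimately show "(\<integral>x. (norm (grad_comb \<omega> a F x))\<^sup>2 \<partial>lborel) + (\<integral>x. potential \<omega> x * (comb \<omega> a F (inv_stereo x))\<^sup>2 \<partial>lborel)
      = (\<Sum>k\<in>F. eig_val \<omega> k * (a k)\<^sup>2)"
    using Q_form_comb_eq[OF \<omega> e(1) F, of a] by simp
  have sq: "square_integrable (comb \<omega> a F)" by (rule comb_square_integrable[OF F])
  have "(\<integral>x. conf x * (comb \<omega> a F (inv_stereo x))\<^sup>2 \<partial>lborel) = (\<integral>p. (comb \<omega> a F p)\<^sup>2 \<partial>dV)"
    using sq by (intro integral_dV(2)[symmetric]) (auto simp: square_integrable_def)
  also have "\<dots> = (norm ?S)\<^sup>2"
    unfolding power2_norm_eq_inner inner_class_of[OF sq sq] by (simp add: power2_eq_square)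
  also have "\<dots> = (\<Sum>k\<in>F. (a k)\<^sup>2)" unfolding class_of_comb[OF F] by (rule norm_sum[OF F 0])
  finally show "(\<integral>x. conf x * (comb \<omega> a F (inv_stereo x))\<^sup>2 \<partial>lborel) = (\<Sum>k\<in>F. (a k)\<^sup>2)" .
qed

lemma comb_diff: "N \<le> M \<Longrightarrow> comb \<omega> a {..<M} p - comb \<omega> a {..<N} p = comb \<omega> a {N..<M} p"
  and grad_comb_diff: "N \<le> M \<Longrightarrow> grad_comb \<omega> a {..<M} x - grad_comb \<omega> a {..<N} x = grad_comb \<omega> a {N..<M} x"
proof -
  assume "N \<le> M"
  then have u: "{..<M} = {..<N} \<union> {N..<M}" by auto
  show "comb \<omega> a {..<M} p - comb \<omega> a {..<N} p = comb \<omega> a {N..<M} p"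
    unfolding comb_def u by (subst sum.union_disjoint) auto
  show "grad_comb \<omega> a {..<M} x - grad_comb \<omega> a {..<N} x = grad_comb \<omega> a {N..<M} x"
    unfolding grad_comb_def u by (subst sum.union_disjoint) auto
qed

text \<open>Cauchy-Schwarz with the indicator of K divided by sqrt w, which is square integrable
  because 1/w is continuous on the compact set K.\<close>

lemma weighted_L2_imp_L1_on_compact:
  fixes f :: "nat \<Rightarrow> plane \<Rightarrow> 'b::euclidean_space"
  assumes K: "compact K" and w: "continuous_on UNIV w" "\<And>x. w x > 0"
    and m: "\<And>i. f i \<in> borel_measurable borel" and int: "\<And>i. integrable lborel (\<lambda>x. w x * (norm (f i x))\<^sup>2)"
    and lim: "(\<lambda>i. \<integral>x. w x * (norm (f i x))\<^sup>2 \<partial>lborel) \<longlonglongrightarrow> 0"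
  shows "(\<lambda>i. \<integral>x. indicator K x * norm (f i x) \<partial>lborel) \<longlonglongrightarrow> 0"
proof (rule Lim_null_comparison)
  have [measurable]: "w \<in> borel_measurable borel" by (intro borel_measurable_continuous_onI w)
  have Kb[measurable]: "K \<in> sets borel" using K by (rule borel_compact)
  define g where "g x = indicator K x / sqrt (w x)" for x
  have w0: "w x \<noteq> 0" "w x \<ge> 0" for x using w(2)[of x] by auto
  have gm: "g \<in> borel_measurable borel" unfolding g_def by measurable
  have gi: "integrable lborel (\<lambda>x. (g x)\<^sup>2)"
  proof -
    have "continuous_on K (\<lambda>x. 1 / w x)"
      using w0 by (intro continuous_intros continuous_on_subset[OF w(1)]) auto
    then have "set_integrable lborel K (\<lambda>x. 1 / w x)" unfolding set_integrable_def by (rule borel_integrable_compact[OF K])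
    moreover have "indicator K x *\<^sub>R (1 / w x) = (g x)\<^sup>2" for x
      using w0 by (simp add: g_def power_divide indicator_def)
    ultimately show ?thesis by (simp add: set_integrable_def)
  qed
  define h where "h i x = sqrt (w x) * norm (f i x)" for i x
  have hm: "h i \<in> borel_measurable borel" for i unfolding h_def using m[of i] by measurable
  have h2: "(h i x)\<^sup>2 = w x * (norm (f i x))\<^sup>2" for i x
    using w0 by (simp add: h_def power_mult_distrib)
  have "\<bar>\<integral>x. indicator K x * norm (f i x) \<partial>lborel\<bar> \<le> sqrt (\<integral>x. (g x)\<^sup>2 \<partial>lborel) * sqrt (\<integral>x. w x * (norm (f i x))\<^sup>2 \<partial>lborel)" for i
  proof -
    have "indicator K x * norm (f i x) = g x * h i x" for x
      using w0[of x] by (simp add: g_def h_def)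
    then show ?thesis
      using Cauchy_Schwarz_integral[of g lborel "h i"] gm hm gi int by (simp add: h2)
  qed
  then show "\<forall>\<^sub>F i in sequentially. norm (\<integral>x. indicator K x * norm (f i x) \<partial>lborel)
      \<le> sqrt (\<integral>x. (g x)\<^sup>2 \<partial>lborel) * sqrt (\<integral>x. w x * (norm (f i x))\<^sup>2 \<partial>lborel)"
    by simp
  have "(\<lambda>i. sqrt (\<integral>x. (g x)\<^sup>2 \<partial>lborel) * sqrt (\<integral>x. w x * (norm (f i x))\<^sup>2 \<partial>lborel)) \<longlonglongrightarrow> sqrt (\<integral>x. (g x)\<^sup>2 \<partial>lborel) * sqrt 0"
    by (intro tendsto_intros lim)
  then show "(\<lambda>i. sqrt (\<integral>x. (g x)\<^sup>2 \<partial>lborel) * sqrt (\<integral>x. w x * (norm (f i x))\<^sup>2 \<partial>lborel)) \<longlonglongrightarrow> 0" by simp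
qed

lemma form_closed:
  assumes \<omega>: "\<omega> \<ge> 0" and sm: "summable (\<lambda>k. eig_val \<omega> k * (g \<bullet> eig_vec \<omega> k)\<^sup>2)"
  defines "S \<equiv> \<lambda>N. class_of (comb \<omega> (\<lambda>k. g \<bullet> eig_vec \<omega> k) {..<N})"
  shows "g \<in> E_form \<omega>"
    and "f \<in> E_form \<omega> \<Longrightarrow> (\<lambda>N. Q_form \<omega> f (S N)) \<longlonglongrightarrow> Q_form \<omega> f g"
  \<comment> \<open>The partial sums are Cauchy in the energy norm on the first chart, and weak gradients pass to the limit;
    conformal invariance transports the limit gradient to the second chart.\<close>
proof -
  interpret orthonormal_system "eig_vec \<omega>" by (rule orthonormal_eig_vec[OF \<omega>])
  define a where "a k = g \<bullet> eig_vec \<omega> k" for k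
  have a0: "eig_vec \<omega> k = 0 \<Longrightarrow> a k = 0" for k by (simp add: a_def)
  have S: "S N = class_of (comb \<omega> a {..<N})" for N by (simp add: S_def a_def[abs_def])
  define u where "u N x = comb \<omega> a {..<N} (inv_stereo x)" for N x
  define G where "G N = grad_comb \<omega> a {..<N}" for N
  define v where "v x = fun_of g (inv_stereo x)" for x
  have um[measurable]: "u N \<in> borel_measurable borel" for N unfolding u_def by (rule comb_chart_measurable)
  have Gm[measurable]: "G N \<in> borel_measurable borel" for N unfolding G_def by (rule grad_comb_measurable)
  have vm[measurable]: "v \<in> borel_measurable borel" unfolding v_def by (rule measurable_chart(1)[OF fun_of_measurable])
  \<comment> \<open>Gradient, potential part and L2 part are stacked into one vector-valued function
    whose squared norm is the density of energy plus L2 norm; completeness is then invoked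
    once.\<close>
  define f where "f N x = ((G N x, sqrt (potential \<omega> x) * u N x), sqrt (conf x) * u N x)" for N x
  have nsq: "(norm (p :: (plane \<times> real) \<times> real))\<^sup>2 = (norm (fst (fst p)))\<^sup>2 + (snd (fst p))\<^sup>2 + (snd p)\<^sup>2" for p
    by (simp add: norm_prod_def)
  have fsub: "(norm (f i x - f j x))\<^sup>2
      = (norm (G i x - G j x))\<^sup>2 + potential \<omega> x * (u i x - u j x)\<^sup>2 + conf x * (u i x - u j x)\<^sup>2" for i j x
    unfolding nsq f_def by (simp add: power_mult_distrib right_diff_distrib[symmetric])
  have fm: "f N \<in> borel_measurable lborel" for N
  proof -
    have "f N \<in> lborel \<rightarrow>\<^sub>M (borel \<Otimes>\<^sub>M borel) \<Otimes>\<^sub>M borel" unfolding f_def[abs_def] by measurable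
    then show ?thesis by (simp add: borel_prod)
  qed
  have energy: "integrable lborel (\<lambda>x. (norm (f i x - f j x))\<^sup>2)
      \<and> (\<integral>x. (norm (f i x - f j x))\<^sup>2 \<partial>lborel) = (\<Sum>k=j..<i. (eig_val \<omega> k + 1) * (a k)\<^sup>2)" if "j \<le> i" for i j
  proof -
    have G: "G i x - G j x = grad_comb \<omega> a {j..<i} x" for x unfolding G_def by (rule grad_comb_diff[OF that])
    have u: "u i x - u j x = comb \<omega> a {j..<i} (inv_stereo x)" for x unfolding u_def by (rule comb_diff[OF that])
    note ci = comb_integrable[OF \<omega>, of "{j..<i}" a, OF finite_atLeastLessThan]
    show ?thesis unfolding fsub G u
      using ci comb_energy[OF \<omega> _ a0, of "{j..<i}"]
      by (simp add: distrib_right sum.distrib)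
  qed
  have sq: "integrable lborel (\<lambda>x. (norm (f i x - f j x))\<^sup>2)" for i j
    using energy[of i j] energy[of j i] by (cases "j \<le> i") (auto simp: norm_minus_commute[of "f i _"])
  have sums: "summable (\<lambda>k. (eig_val \<omega> k + 1) * (a k)\<^sup>2)"
    using summable_add[OF sm summable_coeffs[of g]] by (simp add: a_def distrib_right)
  have cauchy: "\<exists>N. \<forall>i\<ge>N. \<forall>j\<ge>N. (\<integral>x. (norm (f i x - f j x))\<^sup>2 \<partial>lborel) \<le> e" if e: "e > 0" for e
  proof -
    obtain N where N: "\<And>m n. m \<ge> N \<Longrightarrow> \<bar>\<Sum>k=m..<n. (eig_val \<omega> k + 1) * (a k)\<^sup>2\<bar> < e"
      using sums[unfolded summable_Cauchy, rule_format, OF e] by auto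
    have le: "(\<integral>x. (norm (f i x - f j x))\<^sup>2 \<partial>lborel) \<le> e" if "i \<ge> N" "j \<ge> N" "j \<le> i" for i j
      using energy[OF that(3)] N[OF that(2), of i] by simp
    have "(\<integral>x. (norm (f i x - f j x))\<^sup>2 \<partial>lborel) \<le> e" if "i \<ge> N" "j \<ge> N" for i j
    proof (cases "j \<le> i")
      case False
      have c: "norm (f i x - f j x) = norm (f j x - f i x)" for x by (rule norm_minus_commute)
      show ?thesis unfolding c using le[of j i] that False by simp
    qed (use le that in simp)
    then show ?thesis by blast
  qed
  obtain W r where W: "W \<in> borel_measurable lborel" "strict_mono (r :: nat \<Rightarrow> nat)"
    "AE x in lborel. (\<lambda>k. f (r k) x) \<longlonglongrightarrow> W x"
    "\<And>i. integrable lborel (\<lambda>x. (norm (f i x - W x))\<^sup>2)"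
    "(\<lambda>i. \<integral>x. (norm (f i x - W x))\<^sup>2 \<partial>lborel) \<longlonglongrightarrow> 0"
    using L2_complete[of f lborel, OF fm sq cauchy] by blast
  define H where "H x = fst (fst (W x))" for x
  have Wm: "W \<in> borel \<rightarrow>\<^sub>M (borel \<Otimes>\<^sub>M borel) \<Otimes>\<^sub>M borel" using W(1) by (simp add: borel_prod)
  have Hm[measurable]: "H \<in> borel_measurable borel" unfolding H_def using Wm by measurable
  have W2m[measurable]: "(\<lambda>x. snd (fst (W x))) \<in> borel_measurable borel" using Wm by measurable
  have W3m[measurable]: "(\<lambda>x. snd (W x)) \<in> borel_measurable borel" using Wm by measurable
  have fW: "(norm (f i x - W x))\<^sup>2 = (norm (G i x - H x))\<^sup>2 + (sqrt (potential \<omega> x) * u i x - snd (fst (W x)))\<^sup>2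
      + (sqrt (conf x) * u i x - snd (W x))\<^sup>2" for i x
    unfolding nsq by (simp add: f_def H_def)
  have dist: "integrable lborel (\<lambda>x. conf x * (u N x - v x)\<^sup>2)"
    "(\<integral>x. conf x * (u N x - v x)\<^sup>2 \<partial>lborel) = (norm (S N - g))\<^sup>2"
    "integrable lborel (\<lambda>x. conf x * (comb \<omega> a {..<N} (inv_stereo' x) - fun_of g (inv_stereo' x))\<^sup>2)"
    "(\<integral>x. conf x * (comb \<omega> a {..<N} (inv_stereo' x) - fun_of g (inv_stereo' x))\<^sup>2 \<partial>lborel) = (norm (S N - g))\<^sup>2" for N
  proof -
    have sN: "square_integrable (comb \<omega> a {..<N})" by (rule comb_square_integrable) simp
    have sd: "square_integrable (\<lambda>p. comb \<omega> a {..<N} p - fun_of g p)"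
      by (rule square_integrable_diff[OF sN fun_of_square_integrable])
    have m: "(\<lambda>p. (comb \<omega> a {..<N} p - fun_of g p)\<^sup>2) \<in> borel_measurable dV"
      using sd by (auto simp: square_integrable_def)
    have n: "(norm (S N - g))\<^sup>2 = (\<integral>p. (comb \<omega> a {..<N} p - fun_of g p)\<^sup>2 \<partial>dV)"
      using norm_diff_class_of[OF sN fun_of_square_integrable, of g] by (simp add: S)
    show "integrable lborel (\<lambda>x. conf x * (u N x - v x)\<^sup>2)"
      "(\<integral>x. conf x * (u N x - v x)\<^sup>2 \<partial>lborel) = (norm (S N - g))\<^sup>2"
      "integrable lborel (\<lambda>x. conf x * (comb \<omega> a {..<N} (inv_stereo' x) - fun_of g (inv_stereo' x))\<^sup>2)"
      "(\<integral>x. conf x * (comb \<omega> a {..<N} (inv_stereo' x) - fun_of g (inv_stereo' x))\<^sup>2 \<partial>lborel) = (norm (S N - g))\<^sup>2"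
      using sd integral_dV[OF m] unfolding n by (auto simp: square_integrable_def u_def v_def)
  qed
  have Slim: "(\<lambda>N. (norm (S N - g))\<^sup>2) \<longlonglongrightarrow> 0"
  proof -
    have "S N = (\<Sum>k<N. (g \<bullet> eig_vec \<omega> k) *\<^sub>R eig_vec \<omega> k)" for N unfolding S by (simp add: class_of_comb a_def)
    then have "S = (\<lambda>N. \<Sum>k<N. (g \<bullet> eig_vec \<omega> k) *\<^sub>R eig_vec \<omega> k)" by (rule ext)
    then have "S \<longlonglongrightarrow> g" using expansion[of g] by (simp only:)
    then have "(\<lambda>N. norm (S N - g)) \<longlonglongrightarrow> 0" by (intro tendsto_norm_zero LIM_zero)
    then have "(\<lambda>N. (norm (S N - g))\<^sup>2) \<longlonglongrightarrow> 0\<^sup>2" by (rule tendsto_power)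
    then show ?thesis by simp
  qed
  \<comment> \<open>The partial sums also converge to g in H, which identifies the last component of
    the limit.\<close>
  have W3: "AE x in lborel. snd (W x) = sqrt (conf x) * v x"
  proof -
    have bd: "(snd (W x) - sqrt (conf x) * v x)\<^sup>2 \<le> 2 * (norm (f N x - W x))\<^sup>2 + 2 * (conf x * (u N x - v x)\<^sup>2)" for N x
    proof -
      have "(norm ((snd (W x) - sqrt (conf x) * u N x) + (sqrt (conf x) * u N x - sqrt (conf x) * v x)))\<^sup>2
        \<le> 2 * (norm (snd (W x) - sqrt (conf x) * u N x))\<^sup>2 + 2 * (norm (sqrt (conf x) * u N x - sqrt (conf x) * v x))\<^sup>2"
        by (rule norm_add_square_le)
      moreover have "(sqrt (conf x) * u N x - sqrt (conf x) * v x)\<^sup>2 = conf x * (u N x - v x)\<^sup>2"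
        by (simp add: right_diff_distrib[symmetric] power_mult_distrib)
      moreover have "(snd (W x) - sqrt (conf x) * u N x)\<^sup>2 \<le> (norm (f N x - W x))\<^sup>2"
        unfolding fW by (simp add: power2_commute[of "snd (W x)"])
      ultimately show ?thesis by simp
    qed
    have int: "integrable lborel (\<lambda>x. (snd (W x) - sqrt (conf x) * v x)\<^sup>2)"
      by (rule Bochner_Integration.integrable_bound[of _ "\<lambda>x. 2 * (norm (f 0 x - W x))\<^sup>2 + 2 * (conf x * (u 0 x - v x)\<^sup>2)"])
        (use W(4) dist(1) bd[of _ 0] in \<open>auto intro!: AE_I2 intro: order_trans[OF _ abs_ge_self]\<close>)
    have "(\<integral>x. (snd (W x) - sqrt (conf x) * v x)\<^sup>2 \<partial>lborel)
        \<le> 2 * (\<integral>x. (norm (f N x - W x))\<^sup>2 \<partial>lborel) + 2 * (norm (S N - g))\<^sup>2" for N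
    proof -
      have "(\<integral>x. (snd (W x) - sqrt (conf x) * v x)\<^sup>2 \<partial>lborel)
        \<le> (\<integral>x. 2 * (norm (f N x - W x))\<^sup>2 + 2 * (conf x * (u N x - v x)\<^sup>2) \<partial>lborel)"
        using W(4) dist(1) by (intro integral_mono int bd Bochner_Integration.integrable_add integrable_mult_right)
      then show ?thesis using W(4) dist(1,2) by simp
    qed
    moreover have "(\<lambda>N. 2 * (\<integral>x. (norm (f N x - W x))\<^sup>2 \<partial>lborel) + 2 * (norm (S N - g))\<^sup>2) \<longlonglongrightarrow> 2 * 0 + 2 * 0"
      by (intro tendsto_intros W(5) Slim)
    ultimately have "(\<integral>x. (snd (W x) - sqrt (conf x) * v x)\<^sup>2 \<partial>lborel) \<le> 0"
      by (intro LIMSEQ_le_const[of _ 0]) auto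
    then have "(\<integral>x. (snd (W x) - sqrt (conf x) * v x)\<^sup>2 \<partial>lborel) = 0"
      by (intro antisym integral_nonneg_AE) auto
    then have "AE x in lborel. (snd (W x) - sqrt (conf x) * v x)\<^sup>2 = 0"
      using integral_nonneg_eq_0_iff_AE[OF int] by simp
    then show ?thesis by eventually_elim simp
  qed
  \<comment> \<open>Dividing the last component by the positive sqrt conf gives pointwise
    convergence of u along the subsequence, and this fixes the potential component.\<close>
  have W2: "AE x in lborel. snd (fst (W x)) = sqrt (potential \<omega> x) * v x"
    using W3 W(3)
  proof eventually_elim
    case (elim x)
    have "(\<lambda>k. snd (f (r k) x)) \<longlonglongrightarrow> snd (W x)" by (rule tendsto_snd[OF elim(2)])
    then have "(\<lambda>k. (sqrt (conf x) * u (r k) x) / sqrt (conf x)) \<longlonglongrightarrow> (sqrt (conf x) * v x) / sqrt (conf x)"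
      by (intro tendsto_divide tendsto_const) (auto simp: f_def elim(1))
    then have "(\<lambda>k. u (r k) x) \<longlonglongrightarrow> v x" by simp
    then have "(\<lambda>k. sqrt (potential \<omega> x) * u (r k) x) \<longlonglongrightarrow> sqrt (potential \<omega> x) * v x" by (rule tendsto_mult_left)
    moreover have "(\<lambda>k. snd (fst (f (r k) x))) \<longlonglongrightarrow> snd (fst (W x))" by (rule tendsto_snd[OF tendsto_fst[OF elim(2)]])
    ultimately show ?case by (simp add: f_def) (rule LIMSEQ_unique)
  qed
  have Hi: "integrable lborel (\<lambda>x. (norm (G N x - H x))\<^sup>2)" for N
    by (rule Bochner_Integration.integrable_bound[OF W(4)[of N]]) (auto simp: fW)
  have pi: "integrable lborel (\<lambda>x. potential \<omega> x * (u N x - v x)\<^sup>2)"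
    and pbd: "AE x in lborel. potential \<omega> x * (u N x - v x)\<^sup>2 \<le> (norm (f N x - W x))\<^sup>2" for N
  proof -
    show bd: "AE x in lborel. potential \<omega> x * (u N x - v x)\<^sup>2 \<le> (norm (f N x - W x))\<^sup>2"
      using W2
    proof eventually_elim
      case (elim x)
      have "(sqrt (potential \<omega> x) * u N x - sqrt (potential \<omega> x) * v x)\<^sup>2 = potential \<omega> x * (u N x - v x)\<^sup>2"
        by (simp add: right_diff_distrib[symmetric] power_mult_distrib)
      then show ?case unfolding fW elim by simp
    qed
    show "integrable lborel (\<lambda>x. potential \<omega> x * (u N x - v x)\<^sup>2)"
      by (rule Bochner_Integration.integrable_bound[OF W(4)[of N]]) (use bd in auto)
  qed
  have Glim: "(\<lambda>N. \<integral>x. (norm (G N x - H x))\<^sup>2 \<partial>lborel) \<longlonglongrightarrow> 0"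
  proof (rule tendsto_sandwich[OF _ _ tendsto_const W(5)])
    show "\<forall>\<^sub>F N in sequentially. (\<integral>x. (norm (G N x - H x))\<^sup>2 \<partial>lborel) \<le> (\<integral>x. (norm (f N x - W x))\<^sup>2 \<partial>lborel)"
      by (intro always_eventually allI integral_mono Hi W(4)) (simp add: fW)
  qed (auto intro!: always_eventually)
  have plim: "(\<lambda>N. \<integral>x. potential \<omega> x * (u N x - v x)\<^sup>2 \<partial>lborel) \<longlonglongrightarrow> 0"
  proof (rule tendsto_sandwich[OF _ _ tendsto_const W(5)])
    show "\<forall>\<^sub>F N in sequentially. (\<integral>x. potential \<omega> x * (u N x - v x)\<^sup>2 \<partial>lborel) \<le> (\<integral>x. (norm (f N x - W x))\<^sup>2 \<partial>lborel)"
      by (intro always_eventually allI integral_mono_AE pi W(4) pbd)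
  qed (auto intro!: always_eventually)
  \<comment> \<open>The empty partial sum N = 0 turns bounds on differences into bounds on the limit
    itself.\<close>
  have H2: "integrable lborel (\<lambda>x. (norm (H x))\<^sup>2)" using Hi[of 0] by (simp add: G_def grad_comb_def)
  have v2: "integrable lborel (\<lambda>x. potential \<omega> x * (v x)\<^sup>2)" using pi[of 0] by (simp add: u_def comb_def)
  have sg: "integrable dV (\<lambda>p. (fun_of g p)\<^sup>2)" "(\<lambda>p. (fun_of g p)\<^sup>2) \<in> borel_measurable dV"
    using fun_of_square_integrable[of g] by (auto simp: square_integrable_def)
  have loc: "locally_integrable h" if m: "h \<in> borel_measurable borel" and c: "integrable lborel (\<lambda>x. conf x * (h x)\<^sup>2)" for h :: "plane \<Rightarrow> real"
  proof (rule locally_integrable_square[OF m])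
    fix K :: "plane set" assume K: "compact K"
    have "continuous_on K (\<lambda>x. 1 / conf x)" by (intro continuous_intros continuous_conf) auto
    then have "bounded ((\<lambda>x. 1 / conf x) ` K)" by (intro compact_imp_bounded compact_continuous_image K)
    then obtain B where "\<forall>y\<in>(\<lambda>x. 1 / conf x) ` K. norm y \<le> B" unfolding bounded_iff by blast
    then have B: "1 / conf x \<le> B" if "x \<in> K" for x using that by fastforce
    show "set_integrable lborel K (\<lambda>x. (norm (h x))\<^sup>2)"
      unfolding set_integrable_def
    proof (rule Bochner_Integration.integrable_bound)
      show "integrable lborel (\<lambda>x. B * (conf x * (h x)\<^sup>2))" using c by simp
      show "(\<lambda>x. indicator K x *\<^sub>R (norm (h x))\<^sup>2) \<in> borel_measurable lborel"
        using m borel_compact[OF K] by simp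
      show "AE x in lborel. norm (indicator K x *\<^sub>R (norm (h x))\<^sup>2) \<le> norm (B * (conf x * (h x)\<^sup>2))"
      proof (rule AE_I2)
        fix x
        show "norm (indicator K x *\<^sub>R (norm (h x))\<^sup>2) \<le> norm (B * (conf x * (h x)\<^sup>2))"
        proof (cases "x \<in> K")
          case True
          have "1 \<le> B * conf x" using B[OF True] by (simp add: field_simps)
          then have "1 * (h x)\<^sup>2 \<le> (B * conf x) * (h x)\<^sup>2" by (rule mult_right_mono) simp
          then show ?thesis using True by (simp add: mult.assoc)
        qed simp
      qed
    qed
  qed
  have w1: "has_weak_gradient v H"
  proof (rule has_weak_gradient_limit[of u G])
    show "has_weak_gradient (u N) (G N)" for N
      unfolding u_def G_def using comb_chart1[OF \<omega>, of "{..<N}" a] by simp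
    show "locally_integrable v"
      using sg integral_dV(1)[OF sg(2)] by (intro loc) (auto simp: v_def)
    show "locally_integrable H" by (rule locally_integrable_square_integrable[OF Hm H2])
    fix K :: "plane set" assume K: "compact K"
    show "(\<lambda>N. \<integral>x. indicator K x * \<bar>u N x - v x\<bar> \<partial>lborel) \<longlonglongrightarrow> 0"
      using weighted_L2_imp_L1_on_compact[OF K continuous_conf conf_pos(1), of "\<lambda>N x. u N x - v x"] dist(1,2) Slim by simp
    show "(\<lambda>N. \<integral>x. indicator K x * norm (G N x - H x) \<partial>lborel) \<longlonglongrightarrow> 0"
      using weighted_L2_imp_L1_on_compact[OF K continuous_on_const, of 1 "\<lambda>N x. G N x - H x"] Hi Glim by simp
  qed
  let ?pull = "\<lambda>F x. inversion' x (F (inversion x))"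
  have w2: "has_weak_gradient (\<lambda>x. fun_of g (inv_stereo' x)) (?pull H)"
  proof (rule has_weak_gradient_limit[of "\<lambda>N x. comb \<omega> a {..<N} (inv_stereo' x)" "\<lambda>N. ?pull (G N)"])
    note vm' = measurable_chart(2)[OF fun_of_measurable[of g]]
    show "has_weak_gradient (\<lambda>x. comb \<omega> a {..<N} (inv_stereo' x)) (?pull (G N))" for N
      unfolding G_def using comb_chart2[OF \<omega>, of "{..<N}" a] by simp
    show "locally_integrable (\<lambda>x. fun_of g (inv_stereo' x))"
      using sg integral_dV(3)[OF sg(2)] by (intro loc vm') auto
    show "locally_integrable (?pull H)"
      by (intro locally_integrable_square_integrable inversion'_measurable pullback_energy(1) Hm H2)
    fix K :: "plane set" assume K: "compact K"
    have cm: "(\<lambda>x. comb \<omega> a {..<N} (inv_stereo' x)) \<in> borel_measurable borel" for N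
      using comb_square_integrable[of "{..<N}" \<omega> a] by (intro measurable_chart) (auto simp: square_integrable_def)
    show "(\<lambda>N. \<integral>x. indicator K x * \<bar>comb \<omega> a {..<N} (inv_stereo' x) - fun_of g (inv_stereo' x)\<bar> \<partial>lborel) \<longlonglongrightarrow> 0"
      using weighted_L2_imp_L1_on_compact[OF K continuous_conf conf_pos(1), of "\<lambda>N x. comb \<omega> a {..<N} (inv_stereo' x) - fun_of g (inv_stereo' x)"]
        dist(3,4) Slim cm vm' by simp
    have pull: "?pull (G N) x - ?pull H x = ?pull (\<lambda>x. G N x - H x) x" for N x
      by (simp add: linear_diff[OF inversion'_linear])
    have pm: "(\<lambda>x. G N x - H x) \<in> borel_measurable borel" for N by measurable
    note pe = pullback_energy[OF pm Hi]
    show "(\<lambda>N. \<integral>x. indicator K x * norm (?pull (G N) x - ?pull H x) \<partial>lborel) \<longlonglongrightarrow> 0"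
      unfolding pull
      using weighted_L2_imp_L1_on_compact[OF K continuous_on_const, of 1 "\<lambda>N. ?pull (\<lambda>x. G N x - H x)"]
        inversion'_measurable[OF pm] pe Glim by simp
  qed
  note E = E_formI[OF fun_of_square_integrable w1[unfolded v_def] w2 H2 v2[unfolded v_def]]
  show gE: "g \<in> E_form \<omega>" using E(1) by simp
  have dg: "AE x in lborel. weak_differential (fun_of g) x = H x" using E(2) by simp
  show "(\<lambda>N. Q_form \<omega> h (S N)) \<longlonglongrightarrow> Q_form \<omega> h g" if h: "h \<in> E_form \<omega>" for h
  proof -
    let ?D = "weak_differential (fun_of h)" and ?U = "\<lambda>x. fun_of h (inv_stereo x)"
    note hE = E_formD[OF h]
    have Um[measurable]: "?U \<in> borel_measurable borel" by (rule measurable_chart(1)[OF fun_of_measurable])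
    note [measurable] = hE(2) E_formD(2)[OF gE]
    have Qg: "Q_form \<omega> h g = (\<integral>x. ?D x \<bullet> H x \<partial>lborel) + (\<integral>x. potential \<omega> x * (?U x * v x) \<partial>lborel)"
    proof -
      have "(\<integral>x. ?D x \<bullet> weak_differential (fun_of g) x \<partial>lborel) = (\<integral>x. ?D x \<bullet> H x \<partial>lborel)"
        by (rule integral_cong_AE) (use dg in \<open>auto elim: AE_mp\<close>)
      then show ?thesis by (simp add: Q_form_eq[OF h gE] v_def)
    qed
    have G2: "integrable lborel (\<lambda>x. (norm (G N x))\<^sup>2)" "integrable lborel (\<lambda>x. potential \<omega> x * (u N x)\<^sup>2)" for N
      unfolding G_def u_def using comb_integrable[OF \<omega>, of "{..<N}" a] by simp_all
    \<comment> \<open>Cauchy-Schwarz for the gradient and the potential part separately, against the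
      explicit limit gradient H.\<close>
    have bound: "\<bar>Q_form \<omega> h (S N) - Q_form \<omega> h g\<bar>
       \<le> sqrt (\<integral>x. (norm (?D x))\<^sup>2 \<partial>lborel) * sqrt (\<integral>x. (norm (G N x - H x))\<^sup>2 \<partial>lborel)
         + sqrt (\<integral>x. potential \<omega> x * (?U x)\<^sup>2 \<partial>lborel) * sqrt (\<integral>x. potential \<omega> x * (u N x - v x)\<^sup>2 \<partial>lborel)" for N
    proof -
      have i: "integrable lborel (\<lambda>x. ?D x \<bullet> G N x)" "integrable lborel (\<lambda>x. ?D x \<bullet> H x)"
        "integrable lborel (\<lambda>x. potential \<omega> x * (?U x * u N x))" "integrable lborel (\<lambda>x. potential \<omega> x * (?U x * v x))"
        using hE G2 H2 v2 by (auto intro!: inner_mult_integrable weighted_mult_integrable)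
      have QN: "Q_form \<omega> h (S N) = (\<integral>x. ?D x \<bullet> G N x \<partial>lborel) + (\<integral>x. potential \<omega> x * (?U x * u N x) \<partial>lborel)"
        unfolding S G_def u_def by (rule Q_form_comb_eq[OF \<omega> h]) simp
      have eq: "Q_form \<omega> h (S N) - Q_form \<omega> h g
        = (\<integral>x. ?D x \<bullet> (G N x - H x) \<partial>lborel) + (\<integral>x. potential \<omega> x * (?U x * (u N x - v x)) \<partial>lborel)"
        unfolding QN Qg using i by (simp add: inner_diff_right right_diff_distrib)
      have "\<bar>\<integral>x. ?D x \<bullet> (G N x - H x) \<partial>lborel\<bar> \<le> (\<integral>x. norm (?D x) * norm (G N x - H x) \<partial>lborel)"
        using hE Hi[of N] by (intro order_trans[OF integral_abs_bound integral_mono] integrable_abs inner_mult_integrable square_mult_integrable)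
          (auto simp: Cauchy_Schwarz_ineq2)
      also have "\<dots> \<le> sqrt (\<integral>x. (norm (?D x))\<^sup>2 \<partial>lborel) * sqrt (\<integral>x. (norm (G N x - H x))\<^sup>2 \<partial>lborel)"
        using hE Hi[of N] by (intro order_trans[OF abs_ge_self Cauchy_Schwarz_integral]) auto
      finally have b1: "\<bar>\<integral>x. ?D x \<bullet> (G N x - H x) \<partial>lborel\<bar>
          \<le> sqrt (\<integral>x. (norm (?D x))\<^sup>2 \<partial>lborel) * sqrt (\<integral>x. (norm (G N x - H x))\<^sup>2 \<partial>lborel)" .
      have sp: "potential \<omega> x * (p * q) = (sqrt (potential \<omega> x) * p) * (sqrt (potential \<omega> x) * q)"
        "(sqrt (potential \<omega> x) * p)\<^sup>2 = potential \<omega> x * p\<^sup>2" for x p q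
      proof -
        have "sqrt (potential \<omega> x) * sqrt (potential \<omega> x) = potential \<omega> x" by simp
        then show "potential \<omega> x * (p * q) = (sqrt (potential \<omega> x) * p) * (sqrt (potential \<omega> x) * q)"
          by (metis mult.assoc mult.left_commute)
        show "(sqrt (potential \<omega> x) * p)\<^sup>2 = potential \<omega> x * p\<^sup>2" by (simp add: power_mult_distrib)
      qed
      have b2: "\<bar>\<integral>x. potential \<omega> x * (?U x * (u N x - v x)) \<partial>lborel\<bar>
          \<le> sqrt (\<integral>x. potential \<omega> x * (?U x)\<^sup>2 \<partial>lborel) * sqrt (\<integral>x. potential \<omega> x * (u N x - v x)\<^sup>2 \<partial>lborel)"
        using Cauchy_Schwarz_integral[of "\<lambda>x. sqrt (potential \<omega> x) * ?U x" lborel "\<lambda>x. sqrt (potential \<omega> x) * (u N x - v x)"]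
          hE(4) pi[of N] unfolding sp(2) sp(1)[symmetric] by simp
      show ?thesis unfolding eq using b1 b2 by linarith
    qed
    have "(\<lambda>N. sqrt (\<integral>x. (norm (?D x))\<^sup>2 \<partial>lborel) * sqrt (\<integral>x. (norm (G N x - H x))\<^sup>2 \<partial>lborel)
         + sqrt (\<integral>x. potential \<omega> x * (?U x)\<^sup>2 \<partial>lborel) * sqrt (\<integral>x. potential \<omega> x * (u N x - v x)\<^sup>2 \<partial>lborel))
       \<longlonglongrightarrow> sqrt (\<integral>x. (norm (?D x))\<^sup>2 \<partial>lborel) * sqrt 0 + sqrt (\<integral>x. potential \<omega> x * (?U x)\<^sup>2 \<partial>lborel) * sqrt 0"
      by (intro tendsto_intros Glim plim)
    then have lim0: "(\<lambda>N. sqrt (\<integral>x. (norm (?D x))\<^sup>2 \<partial>lborel) * sqrt (\<integral>x. (norm (G N x - H x))\<^sup>2 \<partial>lborel)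
         + sqrt (\<integral>x. potential \<omega> x * (?U x)\<^sup>2 \<partial>lborel) * sqrt (\<integral>x. potential \<omega> x * (u N x - v x)\<^sup>2 \<partial>lborel)) \<longlonglongrightarrow> 0"
      by simp
    have "(\<lambda>N. Q_form \<omega> h (S N) - Q_form \<omega> h g) \<longlonglongrightarrow> 0"
      by (rule Lim_null_comparison[OF always_eventually lim0]) (use bound in auto)
    then show ?thesis by (simp add: LIM_zero_iff)
  qed
qed

section \<open>Diagonalization\<close>

lemma finite_lam_le: "finite {(m, n). lam \<omega> m n \<le> C}"
proof -
  obtain B :: nat where B: "C + \<omega>\<^sup>2 < real B" using reals_Archimedean2 by blast
  have sub: "{(m, n). lam \<omega> m n \<le> C} \<subseteq> {..B} \<times> {..B}"
  proof clarify
    fix m n assume "lam \<omega> m n \<le> C"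
    then have "real m + real n < real B" using lam_lower[of m n \<omega>] B by linarith
    then show "m \<in> {..B} \<and> n \<in> {..B}" by simp
  qed
  show ?thesis by (rule finite_subset[OF sub]) simp
qed

text \<open>The description in \<open>L_op\<close> has a unique solution, since E contains the
  eigenvectors and these determine a vector by its inner products.\<close>

lemma L_op_eqI:
  assumes \<omega>: "\<omega> \<ge> 0" and h: "\<And>f. f \<in> E_form \<omega> \<Longrightarrow> Q_form \<omega> f g = f \<bullet> h"
  shows "L_op \<omega> g = h"
  unfolding L_op_def
proof (rule the_equality)
  show "\<forall>f\<in>E_form \<omega>. Q_form \<omega> f g = f \<bullet> h" using h by blast
  fix h' assume h': "\<forall>f\<in>E_form \<omega>. Q_form \<omega> f g = f \<bullet> h'"
  interpret orthonormal_system "eig_vec \<omega>" by (rule orthonormal_eig_vec[OF \<omega>])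
  show "h' = h"
    by (rule eqI) (metis h h' eig_vec_E_form[OF \<omega>] inner_commute)
qed

text \<open>With c_k the coordinates of g, |lambda_k c_k^2| <= (lambda_k c_k)^2 + c_k^2, so g has
  finite energy and closedness puts it into E; the identity with h passes to the limit from the
  partial sums.\<close>

lemma L_op_maximal:
  assumes \<omega>: "\<omega> \<ge> 0" and eq: "\<And>i. h \<bullet> eig_vec \<omega> i = eig_val \<omega> i * (g \<bullet> eig_vec \<omega> i)"
  shows "g \<in> L_dom \<omega> \<and> L_op \<omega> g = h"
proof -
  interpret orthonormal_system "eig_vec \<omega>" by (rule orthonormal_eig_vec[OF \<omega>])
  have sm: "summable (\<lambda>k. eig_val \<omega> k * (g \<bullet> eig_vec \<omega> k)\<^sup>2)"
  proof (rule summable_comparison_test'[OF summable_add[OF summable_coeffs[of h] summable_coeffs[of g]], of 0])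
    fix k
    have "eig_val \<omega> k * (g \<bullet> eig_vec \<omega> k)\<^sup>2 = (h \<bullet> eig_vec \<omega> k) * (g \<bullet> eig_vec \<omega> k)"
      by (simp add: eq power2_eq_square)
    moreover have "\<bar>x * y\<bar> \<le> x\<^sup>2 + y\<^sup>2" for x y :: real
    proof -
      have "2 * (\<bar>x\<bar> * \<bar>y\<bar>) \<le> x\<^sup>2 + y\<^sup>2"
        using sum_squares_bound[of "\<bar>x\<bar>" "\<bar>y\<bar>"] by (simp add: mult.assoc)
      moreover have "0 \<le> \<bar>x\<bar> * \<bar>y\<bar>" by simp
      ultimately show ?thesis unfolding abs_mult by linarith
    qed
    ultimately show "norm (eig_val \<omega> k * (g \<bullet> eig_vec \<omega> k)\<^sup>2) \<le> (h \<bullet> eig_vec \<omega> k)\<^sup>2 + (g \<bullet> eig_vec \<omega> k)\<^sup>2"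
      by simp
  qed
  note gE = form_closed(1)[OF \<omega> sm]
  have Q: "Q_form \<omega> f g = f \<bullet> h" if f: "f \<in> E_form \<omega>" for f
  proof (rule LIMSEQ_unique[OF form_closed(2)[OF \<omega> sm f]])
    have "Q_form \<omega> f (class_of (comb \<omega> (\<lambda>k. g \<bullet> eig_vec \<omega> k) {..<N}))
        = f \<bullet> (\<Sum>k<N. (h \<bullet> eig_vec \<omega> k) *\<^sub>R eig_vec \<omega> k)" for N
      unfolding Q_form_comb[OF \<omega> f finite_lessThan] inner_sum_right
      by (rule sum.cong) (simp_all add: eq)
    moreover have "(\<lambda>N. f \<bullet> (\<Sum>k<N. (h \<bullet> eig_vec \<omega> k) *\<^sub>R eig_vec \<omega> k)) \<longlonglongrightarrow> f \<bullet> h"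
      by (intro tendsto_inner tendsto_const expansion)
    ultimately show "(\<lambda>N. Q_form \<omega> f (class_of (comb \<omega> (\<lambda>k. g \<bullet> eig_vec \<omega> k) {..<N}))) \<longlonglongrightarrow> f \<bullet> h"
      by simp
  qed
  have "continuous_on (E_form \<omega>) (\<lambda>f. Q_form \<omega> f g) \<longleftrightarrow> continuous_on (E_form \<omega>) (\<lambda>f. f \<bullet> h)"
    by (rule continuous_on_cong) (auto simp: Q)
  moreover have "continuous_on (E_form \<omega>) (\<lambda>f. f \<bullet> h)" by (intro continuous_intros)
  ultimately have "g \<in> L_dom \<omega>" using gE by (simp add: L_dom_def)
  then show ?thesis using L_op_eqI[OF \<omega> Q] by blast
qed

text \<open>A Riesz representation by hand: continuity at 0 bounds the functional on finite
  combinations of eigenvectors, hence the sum of the squares of its coefficients, and the vector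
  with these coefficients represents it on all of E by density.\<close>

lemma L_op_coord:
  assumes \<omega>: "\<omega> \<ge> 0" and g: "g \<in> L_dom \<omega>"
  shows "L_op \<omega> g \<bullet> eig_vec \<omega> i = eig_val \<omega> i * (g \<bullet> eig_vec \<omega> i)"
proof -
  interpret orthonormal_system "eig_vec \<omega>" by (rule orthonormal_eig_vec[OF \<omega>])
  have gE: "g \<in> E_form \<omega>" and cont: "continuous_on (E_form \<omega>) (\<lambda>f. Q_form \<omega> f g)"
    using g by (auto simp: L_dom_def)
  define a where "a k = eig_val \<omega> k * (g \<bullet> eig_vec \<omega> k)" for k
  have a0: "eig_vec \<omega> k = 0 \<Longrightarrow> a k = 0" for k by (simp add: a_def)
  let ?c = "\<lambda>b N. class_of (comb \<omega> b {..<N})"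
  have cE: "?c b N \<in> E_form \<omega>" for b N by (rule comb_E_form(1)[OF \<omega>]) simp
  have Qc: "Q_form \<omega> (?c b N) g = (\<Sum>k<N. b k * a k)" for b N
    unfolding Q_form_commute[of \<omega> "?c b N"] Q_form_comb[OF \<omega> gE finite_lessThan] a_def ..
  have c0: "?c b 0 = 0" for b by (simp add: class_of_comb)
  have "0 \<in> E_form \<omega>" using cE[of a 0] unfolding c0 .
  moreover have Q0: "Q_form \<omega> 0 g = 0" using Qc[of a 0] unfolding c0 by simp
  ultimately obtain d where d: "d > 0" "\<And>f. f \<in> E_form \<omega> \<Longrightarrow> norm f < d \<Longrightarrow> \<bar>Q_form \<omega> f g\<bar> < 1"
    using cont[unfolded continuous_on_iff, rule_format, of 0 1] by (auto simp: dist_norm)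
  have bound: "(\<Sum>k<N. (a k)\<^sup>2) \<le> 4 / d\<^sup>2" for N
  proof (cases "(\<Sum>k<N. (a k)\<^sup>2) = 0")
    case False
    define S where "S = (\<Sum>k<N. (a k)\<^sup>2)"
    have S: "S > 0" using False sum_nonneg[of "{..<N}" "\<lambda>k. (a k)\<^sup>2"] by (simp add: S_def)
    obtain q where q: "q > 0" "S = q\<^sup>2" using S by (intro that[of "sqrt S"]) auto
    \<comment> \<open>This scales the extremal combination to norm d/2, inside the ball on which the
      functional stays below 1; there its value is d q/2, which gives the bound 4/d^2.\<close>
    define t where "t = d / (2 * q)"
    have t: "t > 0" using d(1) q(1) by (simp add: t_def)
    have "(norm (?c (\<lambda>k. t * a k) N))\<^sup>2 = (\<Sum>k<N. (t * a k)\<^sup>2)"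
      unfolding class_of_comb[OF finite_lessThan] by (rule norm_sum) (auto simp: a0)
    also have "\<dots> = t\<^sup>2 * S" by (simp add: S_def power_mult_distrib sum_distrib_left)
    also have "\<dots> = (d / 2)\<^sup>2" using q by (simp add: t_def power_divide power_mult_distrib)
    finally have "norm (?c (\<lambda>k. t * a k) N) = d / 2" using d(1) by (simp add: power2_eq_iff_nonneg)
    then have "\<bar>Q_form \<omega> (?c (\<lambda>k. t * a k) N) g\<bar> < 1" using d(1) by (intro d(2) cE) simp
    moreover have "Q_form \<omega> (?c (\<lambda>k. t * a k) N) g = t * S"
      unfolding Qc S_def by (simp add: sum_distrib_left power2_eq_square mult.assoc)
    moreover have "t * S = d * q / 2" using q by (simp add: t_def power2_eq_square)
    ultimately have "d * q < 2" by simp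
    then have "q < 2 / d" using d(1) by (simp add: field_simps)
    then have "q\<^sup>2 \<le> (2 / d)\<^sup>2" using q by (intro power_mono) auto
    then show ?thesis using q by (simp add: S_def[symmetric] power_divide)
  qed simp
  have as: "summable (\<lambda>k. (a k)\<^sup>2)"
  proof (rule bounded_imp_summable)
    show "(\<Sum>k\<le>N. (a k)\<^sup>2) \<le> 4 / d\<^sup>2" for N using bound[of "Suc N"] by (simp only: lessThan_Suc_atMost)
  qed simp
  define h where "h = (\<Sum>k. a k *\<^sub>R eig_vec \<omega> k)"
  have he: "h \<bullet> eig_vec \<omega> k = a k" for k unfolding h_def by (rule synthesis(2)[OF as a0])
  have "Q_form \<omega> f g = f \<bullet> h" if f: "f \<in> E_form \<omega>" for f
  proof (rule LIMSEQ_unique)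
    let ?b = "\<lambda>k. f \<bullet> eig_vec \<omega> k"
    \<comment> \<open>Convergence in the norm of H suffices here, because membership of g in the
      domain means continuity in that norm.\<close>
    have "(\<lambda>N. ?c ?b N) \<longlonglongrightarrow> f" using expansion[of f] by (simp add: class_of_comb)
    then show "(\<lambda>N. Q_form \<omega> (?c ?b N) g) \<longlonglongrightarrow> Q_form \<omega> f g"
      using cont[unfolded continuous_on_sequentially] f cE[of ?b] by (auto simp: comp_def)
    have "(\<lambda>N. f \<bullet> (\<Sum>k<N. a k *\<^sub>R eig_vec \<omega> k)) \<longlonglongrightarrow> f \<bullet> h"
      unfolding h_def by (intro tendsto_inner tendsto_const summable_LIMSEQ synthesis(1)[OF as a0])
    then show "(\<lambda>N. Q_form \<omega> (?c ?b N) g) \<longlonglongrightarrow> f \<bullet> h"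
      unfolding Qc by (simp add: inner_sum_right mult.commute)
  qed
  then have "L_op \<omega> g = h" by (rule L_op_eqI[OF \<omega>])
  then show ?thesis by (simp add: he a_def)
qed

lemma diagonal_L_op:
  assumes \<omega>: "\<omega> \<ge> 0"
  shows "diagonal_operator (eig_vec \<omega>) (eig_val \<omega>) (L_dom \<omega>) (L_op \<omega>)"
proof -
  interpret orthonormal_system "eig_vec \<omega>" by (rule orthonormal_eig_vec[OF \<omega>])
  show ?thesis
  proof
    fix C
    have "{i. eig_val \<omega> i \<le> C} \<subseteq> (\<lambda>((m, n), s). ix m n s) ` ({(m, n). lam \<omega> m n \<le> C} \<times> UNIV)"
    proof
      fix i assume "i \<in> {i. eig_val \<omega> i \<le> C}"
      then show "i \<in> (\<lambda>((m, n), s). ix m n s) ` ({(m, n). lam \<omega> m n \<le> C} \<times> UNIV)"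
        by (intro image_eqI[of _ _ "((ix_m i, ix_n i), ix_s i)"]) (auto simp: eig_val_def)
    qed
    then show "finite {i. eig_val \<omega> i \<le> C}"
      by (rule finite_subset) (intro finite_imageI finite_cartesian_product finite_lam_le finite)
  next
    fix g i assume "g \<in> L_dom \<omega>"
    then show "L_op \<omega> g \<bullet> eig_vec \<omega> i = eig_val \<omega> i * (g \<bullet> eig_vec \<omega> i)" by (rule L_op_coord[OF \<omega>])
  next
    fix g h assume "\<And>i. h \<bullet> eig_vec \<omega> i = eig_val \<omega> i * (g \<bullet> eig_vec \<omega> i)"
    then show "g \<in> L_dom \<omega> \<and> L_op \<omega> g = h" by (rule L_op_maximal[OF \<omega>])
  qed
qed

lemma lam_0_0: "\<omega> \<ge> 0 \<Longrightarrow> lam \<omega> 0 0 = \<omega>"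
  by (simp add: lam_def power2_eq_square real_sqrt_mult algebra_simps)

text \<open>The value \<omega> belongs to the base \<omega> + 1/2 of the square. Since s >= 2
  \<omega>, the base exceeds it as soon as m or n is positive.\<close>

lemma lam_gt:
  assumes \<omega>: "\<omega> \<ge> 0" and mn: "m > 0 \<or> n > 0"
  shows "lam \<omega> m n > \<omega>"
proof -
  let ?y = "real m + (real n + 1 + sexp \<omega> n) / 2"
  have "\<omega> + 1 / 2 < ?y" 
  proof -
    have "real m \<ge> 1 \<or> real n \<ge> 1" using mn by auto
    moreover have "real m \<ge> 0" "real n \<ge> 0" by auto
    ultimately show ?thesis using sexp_facts(4)[OF \<omega>, of n] by (simp add: field_simps) linarith
  qed
  then have "(\<omega> + 1 / 2)\<^sup>2 < ?y\<^sup>2" using \<omega> by (intro power_strict_mono) auto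
  then show ?thesis unfolding lam_def sexp_def[symmetric] by (simp add: power2_eq_square algebra_simps)
qed

lemma span_sgn: "span (sgn ` B) = span (B :: 'a::real_normed_vector set)"
proof -
  have "sgn b \<in> span B" if "b \<in> B" for b
    unfolding sgn_div_norm using that by (intro span_scale span_base)
  moreover have "b \<in> span (sgn ` B)" if "b \<in> B" for b
  proof -
    have "norm b *\<^sub>R sgn b \<in> span (sgn ` B)" using that by (intro span_scale span_base imageI)
    moreover have "norm b *\<^sub>R sgn b = b" by (cases "b = 0") (simp_all add: sgn_div_norm)
    ultimately show ?thesis by simp
  qed
  ultimately show ?thesis unfolding span_eq by auto
qed

text \<open>The cosine and sine eigenfunctions are nonnegative multiples of the normalized vectors,
  and normalizing does not change a span, also when the sine vector is 0.\<close>

lemma eigenfunctions_eq_span: "eigenfunctions \<omega> m n = span (eig_vec \<omega> ` {ix m n False, ix m n True})"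
proof -
  let ?r = "\<lambda>s. psi_vec \<omega> n (phase s) (hyper_poly \<omega> m n)"
  have "class_of (eigenfunction \<omega> m n a b) = a *\<^sub>R ?r False + b *\<^sub>R ?r True" for a b
  proof -
    have "eigenfunction \<omega> m n a b = psi_fun \<omega> n (Complex a (- b)) (hyper_poly \<omega> m n)"
      by (rule ext) (rule psi_fun_hyper_poly)
    then show ?thesis using psi_vec_Complex[of \<omega> n a b "hyper_poly \<omega> m n"] by (simp add: psi_vec_def phase_def)
  qed
  then have "eigenfunctions \<omega> m n = {a *\<^sub>R ?r False + b *\<^sub>R ?r True | a b. True}"
    by (simp add: eigenfunctions_def)
  also have "\<dots> = span {?r False, ?r True}"
  proof (intro equalityI subsetI)
    fix x assume "x \<in> {a *\<^sub>R ?r False + b *\<^sub>R ?r True | a b. True}"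
    then obtain a b where x: "x = a *\<^sub>R ?r False + b *\<^sub>R ?r True" by blast
    show "x \<in> span {?r False, ?r True}" unfolding x by (intro span_add span_scale span_base insertI1 insertI2)
  next
    fix x assume "x \<in> span {?r False, ?r True}"
    then obtain k where "x - k *\<^sub>R ?r False \<in> span {?r True}" unfolding span_insert by blast
    then obtain l where "x - k *\<^sub>R ?r False = l *\<^sub>R ?r True" unfolding span_singleton by blast
    then have "x = k *\<^sub>R ?r False + l *\<^sub>R ?r True" by (simp add: algebra_simps)
    then show "x \<in> {a *\<^sub>R ?r False + b *\<^sub>R ?r True | a b. True}" by blast
  qed
  also have "\<dots> = span (sgn ` {?r False, ?r True})" by (rule span_sgn[symmetric])
  also have "sgn ` {?r False, ?r True} = eig_vec \<omega> ` {ix m n False, ix m n True}"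
    by (simp add: eig_vec_sgn)
  finally show ?thesis .
qed

lemma card_nonzero_eig_vec: "card {i \<in> {ix m n False, ix m n True}. eig_vec \<omega> i \<noteq> 0} = pair_mult n"
proof -
  have ne: "ix m n False \<noteq> ix m n True" by (metis ix_simps(3))
  have "{i \<in> {ix m n False, ix m n True}. eig_vec \<omega> i \<noteq> 0} = (if n = 0 then {ix m n False} else {ix m n False, ix m n True})"
    by (auto simp: eig_vec_eq_0)
  then show ?thesis using ne by (simp add: pair_mult_def)
qed

lemma pair_mult_sum: "(\<Sum>n\<le>N. pair_mult n) = 2 * N + 1"
  by (induction N) (simp_all add: pair_mult_def)

text \<open>For \<omega> = 0 one has s = n, so the eigenvalue depends on m + n only; this is the
  degeneracy of spherical harmonics.\<close>

lemma lam_zero: "lam 0 m n = real (m + n) * (real (m + n) + 1)"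
  by (simp add: lam_def power2_eq_square algebra_simps)

lemma lam_zero_eq_iff: "lam 0 m n = real N * (real N + 1) \<longleftrightarrow> m + n = N"
proof -
  have "real j * (real j + 1) < real k * (real k + 1)" if "j < k" for j k
    using that by (intro mult_strict_mono) auto
  then show ?thesis unfolding lam_zero by (metis less_irrefl linorder_neqE_nat)
qed

theorem theorem3p1:
  fixes \<omega> :: real
  assumes "\<omega> \<ge> 0"
  shows
    \<comment> \<open>(a)\<close>
    "(square_integrable (\<lambda>p. (1 + (rad p)\<^sup>2) powr (- \<omega>)) \<and>
      ground_state (L_dom \<omega>) (L_op \<omega>) \<omega> (class_of (\<lambda>p. (1 + (rad p)\<^sup>2) powr (- \<omega>)))) \<and>
    \<comment> \<open>(b)\<close>
     (spectrum (L_dom \<omega>) (L_op \<omega>) = {lam \<omega> m n | m n. True} \<and>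
      (\<forall>m n. eigenvalue (L_dom \<omega>) (L_op \<omega>) (lam \<omega> m n)) \<and>
      (\<forall>\<mu>. finite {(m, n). lam \<omega> m n = \<mu>} \<and>
         dim (eigenspace (L_dom \<omega>) (L_op \<omega>) \<mu>) =
           (\<Sum>(m, n) \<in> {(m, n). lam \<omega> m n = \<mu>}. pair_mult n)) \<and>
      (\<forall>m n a b. square_integrable (eigenfunction \<omega> m n a b)) \<and>
      (\<forall>m n. dim (eigenfunctions \<omega> m n) = pair_mult n) \<and>
      (\<forall>\<mu>. eigenspace (L_dom \<omega>) (L_op \<omega>) \<mu> =
         span (\<Union>(m, n) \<in> {(m, n). lam \<omega> m n = \<mu>}. eigenfunctions \<omega> m n)) \<and>
      (\<forall>m n. \<exists>P :: real poly. degree P = 2 * m \<and>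
         (\<forall>r. poly P (- r) = poly P r) \<and> (\<forall>r. hyp_factor \<omega> m n r = poly P r))) \<and>
    \<comment> \<open>(c)\<close>
     (\<omega> = 0 \<longrightarrow>
      spectrum (L_dom \<omega>) (L_op \<omega>) = {real N * (real N + 1) | N. True} \<and>
      (\<forall>N. dim (eigenspace (L_dom \<omega>) (L_op \<omega>) (real N * (real N + 1))) = 2 * N + 1))"
proof -
  interpret diagonal_operator "eig_vec \<omega>" "eig_val \<omega>" "L_dom \<omega>" "L_op \<omega>"
    by (rule diagonal_L_op[OF assms])
  have nz: "eig_vec \<omega> (ix m n False) \<noteq> 0" for m n by (simp add: eig_vec_eq_0)
  have val: "eig_val \<omega> (ix m n s) = lam \<omega> m n" for m n s by (simp add: eig_val_def)
  have spec: "spectrum (L_dom \<omega>) (L_op \<omega>) = {lam \<omega> m n | m n. True}"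
    unfolding spectrum_eq
  proof (intro equalityI subsetI)
    fix x assume "x \<in> {eig_val \<omega> i | i. eig_vec \<omega> i \<noteq> 0}"
    then obtain i where "x = lam \<omega> (ix_m i) (ix_n i)" unfolding eig_val_def by blast
    then show "x \<in> {lam \<omega> m n | m n. True}" by blast
  next
    fix x assume "x \<in> {lam \<omega> m n | m n. True}"
    then obtain m n where "x = eig_val \<omega> (ix m n False)" unfolding val by blast
    then show "x \<in> {eig_val \<omega> i | i. eig_vec \<omega> i \<noteq> 0}" using nz[of m n] by blast
  qed
  have ev: "eigenvalue (L_dom \<omega>) (L_op \<omega>) (lam \<omega> m n)" for m n
    unfolding eigenvalue_iff by (rule exI[of _ "ix m n False"]) (simp add: val nz)
  have fin: "finite {(m, n). lam \<omega> m n = \<mu>}" for \<mu>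
    by (rule finite_subset[OF _ finite_lam_le[of \<omega> \<mu>]]) auto
  have dims: "dim (eigenspace (L_dom \<omega>) (L_op \<omega>) \<mu>) = (\<Sum>(m, n) \<in> {(m, n). lam \<omega> m n = \<mu>}. pair_mult n)" for \<mu>
  proof -
    let ?A = "\<lambda>(m, n). {i \<in> {ix m n False, ix m n True}. eig_vec \<omega> i \<noteq> 0}"
    \<comment> \<open>The level is a disjoint union over the pairs (m, n), so coincidences between
      eigenvalues of different pairs add up in the multiplicity.\<close>
    have "{i. eig_val \<omega> i = \<mu> \<and> eig_vec \<omega> i \<noteq> 0} = (\<Union>x\<in>{(m, n). lam \<omega> m n = \<mu>}. ?A x)"
    proof (intro equalityI subsetI)
      fix i assume i: "i \<in> {i. eig_val \<omega> i = \<mu> \<and> eig_vec \<omega> i \<noteq> 0}"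
      have "i = ix (ix_m i) (ix_n i) False \<or> i = ix (ix_m i) (ix_n i) True"
        using ix_collapse[of i] by (cases "ix_s i") simp_all
      then show "i \<in> (\<Union>x\<in>{(m, n). lam \<omega> m n = \<mu>}. ?A x)"
        using i by (intro UN_I[of "(ix_m i, ix_n i)"]) (auto simp: eig_val_def)
    qed (auto simp: val)
    then have "dim (eigenspace (L_dom \<omega>) (L_op \<omega>) \<mu>) = card (\<Union>x\<in>{(m, n). lam \<omega> m n = \<mu>}. ?A x)"
      by (simp only: dim_eigenspace)
    also have "\<dots> = (\<Sum>x\<in>{(m, n). lam \<omega> m n = \<mu>}. card (?A x))"
    proof (rule card_UN_disjoint[OF fin])
      show "\<forall>x\<in>{(m, n). lam \<omega> m n = \<mu>}. \<forall>y\<in>{(m, n). lam \<omega> m n = \<mu>}. x \<noteq> y \<longrightarrow> ?A x \<inter> ?A y = {}"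
      proof (intro ballI impI)
        fix x y :: "nat \<times> nat" assume ne: "x \<noteq> y"
        have A: "(ix_m i, ix_n i) = z" if "i \<in> ?A z" for i z using that by (cases z) auto
        show "?A x \<inter> ?A y = {}"
        proof (rule equals0I)
          fix i assume "i \<in> ?A x \<inter> ?A y"
          from A[OF IntD1[OF this]] A[OF IntD2[OF this]] show False using ne by simp
        qed
      qed
    qed auto
    also have "\<dots> = (\<Sum>(m, n) \<in> {(m, n). lam \<omega> m n = \<mu>}. pair_mult n)"
      by (rule sum.cong) (auto simp: card_nonzero_eig_vec simp del: insert_iff)
    finally show ?thesis .
  qed
  have sq: "square_integrable (eigenfunction \<omega> m n a b)" for m n a b
  proof -
    have "eigenfunction \<omega> m n a b = psi_fun \<omega> n (Complex a (- b)) (hyper_poly \<omega> m n)"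
      by (rule ext) (rule psi_fun_hyper_poly)
    then show ?thesis by (simp add: psi_fun_square_integrable)
  qed
  have dimf: "dim (eigenfunctions \<omega> m n) = pair_mult n" for m n
    unfolding eigenfunctions_eq_span by (subst dim_span_subset) (simp_all only: finite.intros card_nonzero_eig_vec)
  have espan: "eigenspace (L_dom \<omega>) (L_op \<omega>) \<mu> = span (\<Union>(m, n) \<in> {(m, n). lam \<omega> m n = \<mu>}. eigenfunctions \<omega> m n)" for \<mu>
    unfolding eigenspace_eq span_eq
  proof (intro conjI subsetI)
    fix x assume "x \<in> eig_vec \<omega> ` {i. eig_val \<omega> i = \<mu>}"
    then obtain i where i: "x = eig_vec \<omega> i" "eig_val \<omega> i = \<mu>" by blast
    have "i = ix (ix_m i) (ix_n i) False \<or> i = ix (ix_m i) (ix_n i) True"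
      using ix_collapse[of i] by (cases "ix_s i") simp_all
    then have "x \<in> eigenfunctions \<omega> (ix_m i) (ix_n i)"
      unfolding eigenfunctions_eq_span i(1) by (intro span_base imageI) auto
    then show "x \<in> span (\<Union>(m, n) \<in> {(m, n). lam \<omega> m n = \<mu>}. eigenfunctions \<omega> m n)"
      using i(2) by (intro span_base UN_I[of "(ix_m i, ix_n i)"]) (auto simp: eig_val_def)
  next
    fix x assume "x \<in> (\<Union>(m, n) \<in> {(m, n). lam \<omega> m n = \<mu>}. eigenfunctions \<omega> m n)"
    then obtain m n where mn: "lam \<omega> m n = \<mu>" "x \<in> eigenfunctions \<omega> m n" by auto
    have "eig_vec \<omega> ` {ix m n False, ix m n True} \<subseteq> eig_vec \<omega> ` {i. eig_val \<omega> i = \<mu>}"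
      using mn(1) by (intro image_mono) (auto simp: val)
    then show "x \<in> span (eig_vec \<omega> ` {i. eig_val \<omega> i = \<mu>})"
      using mn(2) span_mono unfolding eigenfunctions_eq_span by blast
  qed
  \<comment> \<open>For m = n = 0 the polynomial is 1, the angular factor is constant, and the
    exponent a equals \<omega>.\<close>
  have gs: "(\<lambda>p. (1 + (rad p)\<^sup>2) powr (- \<omega>)) = psi_fun \<omega> 0 1 (hyper_poly \<omega> 0 0)"
  proof
    fix p
    have "aexp \<omega> 0 = \<omega>" using assms by (simp add: aexp_def sexp_def real_sqrt_mult)
    then show "(1 + (rad p)\<^sup>2) powr (- \<omega>) = psi_fun \<omega> 0 1 (hyper_poly \<omega> 0 0) p"
      by (simp add: psi_fun_def psi_def hpoly_def radial_def hyper_poly_def tpoly_def tcoord_powr rad_def)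
  qed
  have ground: "ground_state (L_dom \<omega>) (L_op \<omega>) \<omega> (class_of (\<lambda>p. (1 + (rad p)\<^sup>2) powr (- \<omega>)))"
    unfolding ground_state_def
  proof (intro conjI allI impI)
    show "eigenvalue (L_dom \<omega>) (L_op \<omega>) \<omega>" using ev[of 0 0] lam_0_0[OF assms] by simp
    show "\<omega> \<le> \<nu>" if ev: "eigenvalue (L_dom \<omega>) (L_op \<omega>) \<nu>" for \<nu>
    proof -
      obtain i where i: "lam \<omega> (ix_m i) (ix_n i) = \<nu>" using ev unfolding eigenvalue_iff eig_val_def by blast
      show ?thesis
      proof (cases "ix_m i > 0 \<or> ix_n i > 0")
        case True
        then show ?thesis using lam_gt[OF assms True] i by simp
      next
        case False
        then show ?thesis using lam_0_0[OF assms] i by simp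
      qed
    qed
    \<comment> \<open>Only the pair (0, 0) attains the lowest value, and its sine vector is 0, so
      the ground state is simple.\<close>
    have "{(m, n). lam \<omega> m n = \<omega>} = {(0, 0)}"
    proof (intro equalityI subsetI)
      fix x assume "x \<in> {(m, n). lam \<omega> m n = \<omega>}"
      then obtain m n where x: "x = (m, n)" "lam \<omega> m n = \<omega>" by auto
      then have "\<not> (m > 0 \<or> n > 0)" using lam_gt[OF assms, of m n] by (metis less_irrefl)
      then show "x \<in> {(0, 0)}" using x by simp
    qed (simp add: lam_0_0[OF assms])
    then have "eigenspace (L_dom \<omega>) (L_op \<omega>) \<omega> = span (eigenfunctions \<omega> 0 0)" unfolding espan by simp
    also have "\<dots> = span (eig_vec \<omega> ` {ix 0 0 False, ix 0 0 True})"
      unfolding eigenfunctions_eq_span span_span ..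
    also have "eig_vec \<omega> ` {ix 0 0 False, ix 0 0 True} = {sgn (psi_vec \<omega> 0 1 (hyper_poly \<omega> 0 0)), 0}"
    proof -
      have "eig_vec \<omega> (ix 0 0 True) = 0" by (simp add: eig_vec_eq_0)
      moreover have "eig_vec \<omega> (ix 0 0 False) = sgn (psi_vec \<omega> 0 1 (hyper_poly \<omega> 0 0))"
        by (simp add: eig_vec_sgn phase_def)
      ultimately show ?thesis by simp
    qed
    also have "span {sgn (psi_vec \<omega> 0 1 (hyper_poly \<omega> 0 0)), 0} = span (sgn ` {psi_vec \<omega> 0 1 (hyper_poly \<omega> 0 0)})"
      by (simp add: insert_commute[of _ 0] span_insert_0)
    also have "\<dots> = span {class_of (\<lambda>p. (1 + (rad p)\<^sup>2) powr (- \<omega>))}"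
      unfolding span_sgn gs psi_vec_def ..
    finally show "eigenspace (L_dom \<omega>) (L_op \<omega>) \<omega> = span {class_of (\<lambda>p. (1 + (rad p)\<^sup>2) powr (- \<omega>))}" .
  qed
  have c: "spectrum (L_dom \<omega>) (L_op \<omega>) = {real N * (real N + 1) | N. True} \<and>
      (\<forall>N. dim (eigenspace (L_dom \<omega>) (L_op \<omega>) (real N * (real N + 1))) = 2 * N + 1)" if \<omega>: "\<omega> = 0"
  proof (intro conjI allI)
    show "spectrum (L_dom \<omega>) (L_op \<omega>) = {real N * (real N + 1) | N. True}"
      unfolding spec unfolding \<omega> lam_zero
    proof (intro equalityI subsetI)
      fix x assume "x \<in> {real N * (real N + 1) | N. True}"
      then obtain N where "x = real (N + 0) * (real (N + 0) + 1)" by auto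
      then show "x \<in> {real (m + n) * (real (m + n) + 1) | m n. True}" by blast
    qed blast
    fix N
    \<comment> \<open>The pairs with m + n = N are counted by n = 0, ..., N; the value n = 0
      contributes 1 and each of the others 2.\<close>
    have "{(m, n). lam \<omega> m n = real N * (real N + 1)} = (\<lambda>n. (N - n, n)) ` {..N}"
      unfolding \<omega> lam_zero_eq_iff by (auto simp: image_iff)
    then have "dim (eigenspace (L_dom \<omega>) (L_op \<omega>) (real N * (real N + 1))) = (\<Sum>(m, n)\<in>(\<lambda>n. (N - n, n)) ` {..N}. pair_mult n)"
      by (simp only: dims)
    also have "\<dots> = (\<Sum>n\<le>N. pair_mult n)"
      by (subst sum.reindex) (auto intro: inj_onI)
    finally show "dim (eigenspace (L_dom \<omega>) (L_op \<omega>) (real N * (real N + 1))) = 2 * N + 1"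
      by (simp only: pair_mult_sum)
  qed
  have "square_integrable (\<lambda>p. (1 + (rad p)\<^sup>2) powr (- \<omega>))"
    unfolding gs by (rule psi_fun_square_integrable)
  then show ?thesis
    by (intro conjI allI impI ground spec ev fin dims sq dimf espan hyp_factor_even_poly c[THEN conjunct1]
        c[THEN conjunct2, rule_format])
qed

end
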